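(* Let $\mathcal{P}$ be a rectangular set of probability measures on the filtered space $(\Omega,\mathcal{G},\{\mathcal{G}_n\})$ described in the context. Let $(X_i)_{i\ge 1}$ be a sequence of real random variables such that $X_i$ is $\mathcal{G}_i$-measurable and $X_i\in\mathcal{H}$ for each $i$. Suppose there are constants $\underline{\mu}\le\overline{\mu}$ and $\sigma>0$ such that for all $i\ge1$ $$\operatorname*{ess\,sup}_{Q\in\mathcal{P}}E_Q[X_i|\mathcal{G}_{i-1}]=\overline{\mu},\qquad \operatorname*{ess\,inf}_{Q\in\mathcal{P}}E_Q[X_i|\mathcal{G}_{i-1}]=\underline{\mu},$$ $$E_Q\left[(X_i-E_Q[X_i|\mathcal{G}_{i-1}])^2\,|\,\mathcal{G}_{i-1}\right]=\sigma^2\quad\text{for all }Q\in\mathcal{P},$$ and suppose the Lindeberg condition holds: $$\lim_{n\to\infty}\frac1n\sum_{i=1}^n\sup_{Q\in\mathcal{P}}E_Q\left[|X_i|^2I_{\{|X_i|>\sqrt n\,\epsilon\}}\right]=0\quad\forall\epsilon>0.$$ Then for every $\varphi\in C([-\infty,\infty])$, $$\lim_{n\to\infty}\sup_{Q\in\mathcal{P}}E_Q\left[\varphi\left(\frac1n\sum_{i=1}^nX_i+\frac1{\sqrt n}\sum_{i=1}^n\frac1\sigma\left(X_i-E_Q[X_i|\mathcal{G}_{i-1}]\right)\right)\right]=\mathbb{E}_{[\underline{\mu},\overline{\mu}]}[\varphi(B_1)],$$ or equivalently, for every $\varphi\in C([-\infty,\infty])$, $$\lim_{n\to\infty}\inf_{Q\in\mathcal{P}}E_Q\left[\varphi\left(\frac1n\sum_{i=1}^nX_i+\frac1{\sqrt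 n}\sum_{i=1}^n\frac1\sigma\left(X_i-E_Q[X_i|\mathcal{G}_{i-1}]\right)\right)\right]=\mathcal{E}_{[\underline{\mu},\overline{\mu}]}[\varphi(B_1)].$$
   Context: Setting. $\Omega=\prod_{i=1}^\infty\Omega_i$. For each $n$, $\mathcal{G}_n$ is a $\sigma$-algebra on $\prod_{i=1}^n\Omega_i$, identified in the obvious way with a $\sigma$-algebra on $\Omega$; $\mathcal{G}_n$ is increasing in $n$, $\mathcal{G}_0$ is trivial, and $\mathcal{G}=\sigma(\cup_{n\ge1}\mathcal{G}_n)$. $\mathcal{P}$ is a set of probability measures on $(\Omega,\mathcal{G})$ that are mutually equivalent on each $\mathcal{G}_n$; for each $P\in\mathcal{P}$ and each $n$ a regular conditional probability $P(\cdot|\mathcal{G}_n)$ exists. $\mathcal{H}$ is the set of random variables $X$ on $(\Omega,\mathcal{G})$ with $\sup_{Q\in\mathcal{P}}E_Q[|X|]<\infty$. Rectangularity. Write $\omega^{(n)}=(\omega_1,\dots,\omega_n)$, $\omega_{(n+1)}=(\omega_{n+1},\omega_{n+2},\dots)$, $\mathcal{P}_{0,n}=\{P|_{\mathcal{G}_n}:P\in\mathcal{P}\}$ and $\mathcal{G}_{(n+1)}=\{A\subset\prod_{i\ge n+1}\Omega_i:\prod_{i=1}^n\Omega_i\times A\in\mathcal{G}\}$. A probability kernel is a map $\lambda:\prod_{i=1}^n\Omega_i\times\mathcal{G}_{(n+1)}\to[0,1]$ that is a probability measure in its second argument and $\mathcal{G}_n$-measurable in its first. It is a $\mathcal{P}$-kernel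 if for every $\omega^{(n)}$ there is $Q\in\mathcal{P}$ with $\lambda(\omega^{(n)},A)=Q(\prod_{i=1}^n\Omega_i\times A|\mathcal{G}_n)(\omega^{(n)})$ for all $A\in\mathcal{G}_{(n+1)}$. $\mathcal{P}$ is rectangular if for all $n$, all $p_n\in\mathcal{P}_{0,n}$ and all $\mathcal{P}$-kernels $\lambda$, the measure $P(A)=\int\int I_A(\omega^{(n)},\omega_{(n+1)})\,\lambda(\omega^{(n)},d\omega_{(n+1)})\,p_n(d\omega^{(n)})$, $A\in\mathcal{G}$, belongs to $\mathcal{P}$. $C([-\infty,\infty])$ is the class of bounded continuous functions on $\mathbb{R}$ with finite limits at $\pm\infty$. BSDE expectations. $(B_t)$ is a standard Brownian motion on a probability space $(\Omega^*,\mathcal{F}^*,P^* )$ with natural filtration $\{\mathcal{F}_t\}$. $\mathbb{E}_{[\underline\mu,\overline\mu]}[\varphi(B_1)]:=Y_0$, where $(Y_t,Z_t)$ is the unique (adapted, square-integrable) solution of the backward stochastic differential equation $Y_t=\varphi(B_1)+\int_t^1\max_{\underline\mu\le\mu\le\overline\mu}(\mu Z_s)\,ds-\int_t^1Z_s\,dB_s$, $0\le t\le1$. $\mathcal{E}_{[\underline\mu,\overline\mu]}[\varphi(B_1)]:=y_0$, where $(y_t,z_t)$ is the solution of $y_t=\varphi(B_1)+\int_t^1\min_{\underline\mu\le\mu\le\overline\mu}(\mu z_s)\,ds-\int_t^1z_s\,dB_s$, $0\le t\le1$.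
   Formalization: Added assumption: for each n and each A in 𝒢, I_A(ω^(n), ω_(n+1)) is jointly measurable for 𝒢_n ⊗ 𝒢_(n+1), so that the double integral defining rectangularity makes sense; it holds for product σ-algebras. The Brownian filtration is augmented by null sets. *)

theory Defs
  imports "HOL-Probability.Probability"
begin

section \<open>The filtered product space\<close>

text \<open>
  The factors are sets \<open>S i\<close> (\<open>i \<ge> 1\<close>) in one ambient type, and the points of the product of the
  \<open>S i\<close>, \<open>i \<in> I\<close>, are the extensional functions in \<open>PiE I S\<close>. The measure structures
  \<open>G n\<close> on \<open>PiE {1..n} S\<close> are used only through their carriers and sigma-algebras; the values
  of \<open>emeasure (G n)\<close> play no role. As \<open>PiE {1..0} S\<close> is a singleton, \<open>G 0\<close> is trivial.
\<close>

definition path_space :: "(nat \<Rightarrow> 'a set) \<Rightarrow> (nat \<Rightarrow> 'a) set" where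
  "path_space S = PiE {1..} S"

text \<open>\<open>G n\<close>, identified with a sigma-algebra on the infinite product.\<close>

definition filt :: "(nat \<Rightarrow> 'a set) \<Rightarrow> (nat \<Rightarrow> (nat \<Rightarrow> 'a) measure) \<Rightarrow> nat \<Rightarrow> (nat \<Rightarrow> 'a) measure" where
  "filt S G n = vimage_algebra (path_space S) (\<lambda>\<omega>. restrict \<omega> {1..n}) (G n)"

definition filt_top :: "(nat \<Rightarrow> 'a set) \<Rightarrow> (nat \<Rightarrow> (nat \<Rightarrow> 'a) measure) \<Rightarrow> (nat \<Rightarrow> 'a) measure" where
  "filt_top S G = sigma (path_space S) (\<Union>n\<in>{1..}. sets (filt S G n))"

definition tail_cylinder :: "(nat \<Rightarrow> 'a set) \<Rightarrow> nat \<Rightarrow> (nat \<Rightarrow> 'a) set \<Rightarrow> (nat \<Rightarrow> 'a) set" where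
  "tail_cylinder S n A = {\<omega> \<in> path_space S. restrict \<omega> {Suc n..} \<in> A}"

text \<open>The generating family below is already a sigma-algebra.\<close>

definition tail_alg :: "(nat \<Rightarrow> 'a set) \<Rightarrow> (nat \<Rightarrow> (nat \<Rightarrow> 'a) measure) \<Rightarrow> nat \<Rightarrow> (nat \<Rightarrow> 'a) measure" where
  "tail_alg S G n = sigma (PiE {Suc n..} S)
     {A. A \<subseteq> PiE {Suc n..} S \<and> tail_cylinder S n A \<in> sets (filt_top S G)}"

text \<open>
  The last conjunct says that, for every event \<open>A\<close>, the indicator of \<open>A\<close> is jointly measurable as
  a function of the first \<open>n\<close> and the remaining coordinates. This is what makes the iterated
  integrals in the definition of rectangularity meaningful.
\<close>

definition filtered_product_space :: "(nat \<Rightarrow> 'a set) \<Rightarrow> (nat \<Rightarrow> (nat \<Rightarrow> 'a) measure) \<Rightarrow> bool" where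
  "filtered_product_space S G \<longleftrightarrow>
     (\<forall>n. space (G n) = PiE {1..n} S) \<and>
     (\<forall>n. sets (filt S G n) \<subseteq> sets (filt S G (Suc n))) \<and>
     (\<forall>n. merge {1..n} {Suc n..} \<in> G n \<Otimes>\<^sub>M tail_alg S G n \<rightarrow>\<^sub>M filt_top S G)"

section \<open>Sets of probability measures\<close>

definition regular_cond_prob ::
  "(nat \<Rightarrow> 'a set) \<Rightarrow> (nat \<Rightarrow> (nat \<Rightarrow> 'a) measure) \<Rightarrow> (nat \<Rightarrow> 'a) measure \<Rightarrow> nat
    \<Rightarrow> ((nat \<Rightarrow> 'a) \<Rightarrow> (nat \<Rightarrow> 'a) measure) \<Rightarrow> bool" where
  "regular_cond_prob S G Q n K \<longleftrightarrow>
     K \<in> G n \<rightarrow>\<^sub>M prob_algebra (filt_top S G) \<and>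
     (\<forall>A\<in>sets (filt_top S G). AE \<omega> in Q.
        measure (K (restrict \<omega> {1..n})) A = real_cond_exp Q (filt S G n) (indicator A) \<omega>)"

text \<open>
  Kernels drawn from the set of measures are prescribed pointwise, so they refer to fixed versions
  of the regular conditional probabilities: \<open>K Q n\<close> is the chosen version for \<open>Q\<close> given \<open>G n\<close>.
\<close>

definition measure_family ::
  "(nat \<Rightarrow> 'a set) \<Rightarrow> (nat \<Rightarrow> (nat \<Rightarrow> 'a) measure) \<Rightarrow> (nat \<Rightarrow> 'a) measure set
    \<Rightarrow> ((nat \<Rightarrow> 'a) measure \<Rightarrow> nat \<Rightarrow> (nat \<Rightarrow> 'a) \<Rightarrow> (nat \<Rightarrow> 'a) measure) \<Rightarrow> bool" where
  "measure_family S G \<P> K \<longleftrightarrow>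
     \<P> \<noteq> {} \<and>
     (\<forall>Q\<in>\<P>. prob_space Q \<and> space Q = path_space S \<and> sets Q = sets (filt_top S G)) \<and>
     (\<forall>P\<in>\<P>. \<forall>Q\<in>\<P>. \<forall>n. \<forall>A\<in>sets (filt S G n). emeasure P A = 0 \<longleftrightarrow> emeasure Q A = 0) \<and>
     (\<forall>Q\<in>\<P>. \<forall>n. regular_cond_prob S G Q n (K Q n))"

definition marginals ::
  "(nat \<Rightarrow> (nat \<Rightarrow> 'a) measure) \<Rightarrow> (nat \<Rightarrow> 'a) measure set \<Rightarrow> nat \<Rightarrow> (nat \<Rightarrow> 'a) measure set" where
  "marginals G \<P> n = (\<lambda>P. distr P (G n) (\<lambda>\<omega>. restrict \<omega> {1..n})) ` \<P>"

definition P_kernel ::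
  "(nat \<Rightarrow> 'a set) \<Rightarrow> (nat \<Rightarrow> (nat \<Rightarrow> 'a) measure) \<Rightarrow> (nat \<Rightarrow> 'a) measure set
    \<Rightarrow> ((nat \<Rightarrow> 'a) measure \<Rightarrow> nat \<Rightarrow> (nat \<Rightarrow> 'a) \<Rightarrow> (nat \<Rightarrow> 'a) measure)
    \<Rightarrow> nat \<Rightarrow> ((nat \<Rightarrow> 'a) \<Rightarrow> (nat \<Rightarrow> 'a) measure) \<Rightarrow> bool" where
  "P_kernel S G \<P> K n L \<longleftrightarrow>
     L \<in> G n \<rightarrow>\<^sub>M prob_algebra (tail_alg S G n) \<and>
     (\<forall>\<omega>\<in>PiE {1..n} S. \<exists>Q\<in>\<P>. \<forall>A\<in>sets (tail_alg S G n).
        emeasure (L \<omega>) A = emeasure (K Q n \<omega>) (tail_cylinder S n A))"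

definition rectangular ::
  "(nat \<Rightarrow> 'a set) \<Rightarrow> (nat \<Rightarrow> (nat \<Rightarrow> 'a) measure) \<Rightarrow> (nat \<Rightarrow> 'a) measure set
    \<Rightarrow> ((nat \<Rightarrow> 'a) measure \<Rightarrow> nat \<Rightarrow> (nat \<Rightarrow> 'a) \<Rightarrow> (nat \<Rightarrow> 'a) measure) \<Rightarrow> bool" where
  "rectangular S G \<P> K \<longleftrightarrow>
     (\<forall>n. \<forall>p\<in>marginals G \<P> n. \<forall>L. P_kernel S G \<P> K n L \<longrightarrow>
        (\<exists>P\<in>\<P>. \<forall>A\<in>sets (filt_top S G).
           emeasure P A =
             (\<integral>\<^sup>+\<omega>. (\<integral>\<^sup>+\<omega>'. indicator A (merge {1..n} {Suc n..} (\<omega>, \<omega>')) \<partial>L \<omega>) \<partial>p)))"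

definition class_H :: "'a measure \<Rightarrow> 'a measure set \<Rightarrow> ('a \<Rightarrow> real) set" where
  "class_H M \<P> = {X \<in> borel_measurable M. (SUP Q\<in>\<P>. \<integral>\<^sup>+\<omega>. ennreal \<bar>X \<omega>\<bar> \<partial>Q) < \<infinity>}"

definition is_ess_sup :: "'a measure \<Rightarrow> 'i set \<Rightarrow> ('i \<Rightarrow> 'a \<Rightarrow> ereal) \<Rightarrow> ('a \<Rightarrow> ereal) \<Rightarrow> bool" where
  "is_ess_sup M I f Z \<longleftrightarrow>
     Z \<in> borel_measurable M \<and> (\<forall>i\<in>I. AE \<omega> in M. f i \<omega> \<le> Z \<omega>) \<and>
     (\<forall>Z'\<in>borel_measurable M. (\<forall>i\<in>I. AE \<omega> in M. f i \<omega> \<le> Z' \<omega>) \<longrightarrow> (AE \<omega> in M. Z \<omega> \<le> Z' \<omega>))"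

definition is_ess_inf :: "'a measure \<Rightarrow> 'i set \<Rightarrow> ('i \<Rightarrow> 'a \<Rightarrow> ereal) \<Rightarrow> ('a \<Rightarrow> ereal) \<Rightarrow> bool" where
  "is_ess_inf M I f Z \<longleftrightarrow>
     Z \<in> borel_measurable M \<and> (\<forall>i\<in>I. AE \<omega> in M. Z \<omega> \<le> f i \<omega>) \<and>
     (\<forall>Z'\<in>borel_measurable M. (\<forall>i\<in>I. AE \<omega> in M. Z' \<omega> \<le> f i \<omega>) \<longrightarrow> (AE \<omega> in M. Z' \<omega> \<le> Z \<omega>))"

definition C_extended :: "(real \<Rightarrow> real) set" where
  "C_extended = {\<phi>. continuous_on UNIV \<phi> \<and> bounded (range \<phi>) \<and>
     (\<exists>l. (\<phi> \<longlongrightarrow> l) at_top) \<and> (\<exists>l. (\<phi> \<longlongrightarrow> l) at_bot)}"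

section \<open>Brownian motion and the Ito integral\<close>

definition brownian_motion :: "'b measure \<Rightarrow> (real \<Rightarrow> 'b \<Rightarrow> real) \<Rightarrow> bool" where
  "brownian_motion W B \<longleftrightarrow>
     prob_space W \<and>
     (\<forall>t\<ge>0. B t \<in> borel_measurable W) \<and>
     (AE \<omega> in W. B 0 \<omega> = 0) \<and>
     (\<forall>s t. 0 \<le> s \<and> s < t \<longrightarrow>
        distributed W lborel (\<lambda>\<omega>. B t \<omega> - B s \<omega>) (\<lambda>x. ennreal (normal_density 0 (sqrt (t - s)) x))) \<and>
     (\<forall>(n::nat) \<tau>. 0 \<le> \<tau> 0 \<and> mono \<tau> \<longrightarrow>
        prob_space.indep_vars W (\<lambda>_. borel) (\<lambda>k \<omega>. B (\<tau> (Suc k)) \<omega> - B (\<tau> k) \<omega>) {..<n}) \<and>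
     (AE \<omega> in W. continuous_on {0..} (\<lambda>t. B t \<omega>))"

text \<open>The natural filtration, augmented by the null sets as is customary for BSDEs.\<close>

definition brownian_filtration :: "'b measure \<Rightarrow> (real \<Rightarrow> 'b \<Rightarrow> real) \<Rightarrow> real \<Rightarrow> 'b measure" where
  "brownian_filtration W B t = sigma (space W)
     ({B s -` A \<inter> space W | s A. s \<in> {0..t} \<and> A \<in> sets borel} \<union> null_sets W)"

definition simple_integrand ::
  "'b measure \<Rightarrow> (real \<Rightarrow> 'b \<Rightarrow> real) \<Rightarrow> real \<Rightarrow> real \<Rightarrow> nat \<Rightarrow> (nat \<Rightarrow> real) \<Rightarrow> (nat \<Rightarrow> 'b \<Rightarrow> real) \<Rightarrow> bool" where
  "simple_integrand W B a b n \<tau> \<xi> \<longleftrightarrow>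
     \<tau> 0 = a \<and> \<tau> n = b \<and> (\<forall>k<n. \<tau> k \<le> \<tau> (Suc k)) \<and>
     (\<forall>k<n. \<xi> k \<in> borel_measurable (brownian_filtration W B (\<tau> k)) \<and> bounded (\<xi> k ` space W))"

definition simple_process :: "nat \<Rightarrow> (nat \<Rightarrow> real) \<Rightarrow> (nat \<Rightarrow> 'b \<Rightarrow> real) \<Rightarrow> real \<Rightarrow> 'b \<Rightarrow> real" where
  "simple_process n \<tau> \<xi> s \<omega> = (\<Sum>k<n. \<xi> k \<omega> * indicator {\<tau> k<..\<tau> (Suc k)} s)"

definition simple_integral ::
  "(real \<Rightarrow> 'b \<Rightarrow> real) \<Rightarrow> nat \<Rightarrow> (nat \<Rightarrow> real) \<Rightarrow> (nat \<Rightarrow> 'b \<Rightarrow> real) \<Rightarrow> 'b \<Rightarrow> real" where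
  "simple_integral B n \<tau> \<xi> \<omega> = (\<Sum>k<n. \<xi> k \<omega> * (B (\<tau> (Suc k)) \<omega> - B (\<tau> k) \<omega>))"

text \<open>
  \<open>I\<close> is a version of the Ito integral of \<open>Z\<close> against \<open>B\<close> over \<open>[a, b]\<close>: the mean-square limit of
  the integrals of simple processes converging to \<open>Z\<close> in mean square.
\<close>

definition has_ito_integral ::
  "'b measure \<Rightarrow> (real \<Rightarrow> 'b \<Rightarrow> real) \<Rightarrow> (real \<Rightarrow> 'b \<Rightarrow> real) \<Rightarrow> real \<Rightarrow> real \<Rightarrow> ('b \<Rightarrow> real) \<Rightarrow> bool" where
  "has_ito_integral W B Z a b I \<longleftrightarrow>
     I \<in> borel_measurable W \<and>
     (\<exists>n \<tau> \<xi>. (\<forall>m::nat. simple_integrand W B a b (n m) (\<tau> m) (\<xi> m)) \<and>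
        (\<lambda>m. \<integral>\<^sup>+\<omega>. (\<integral>\<^sup>+s\<in>{a..b}. ennreal ((Z s \<omega> - simple_process (n m) (\<tau> m) (\<xi> m) s \<omega>)\<^sup>2) \<partial>lborel) \<partial>W)
           \<longlonglongrightarrow> 0 \<and>
        (\<lambda>m. \<integral>\<^sup>+\<omega>. ennreal ((I \<omega> - simple_integral B (n m) (\<tau> m) (\<xi> m) \<omega>)\<^sup>2) \<partial>W) \<longlonglongrightarrow> 0)"

section \<open>Backward stochastic differential equations\<close>

definition adapted_square_integrable ::
  "'b measure \<Rightarrow> (real \<Rightarrow> 'b \<Rightarrow> real) \<Rightarrow> (real \<Rightarrow> 'b \<Rightarrow> real) \<Rightarrow> bool" where
  "adapted_square_integrable W B Z \<longleftrightarrow>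
     (\<forall>t\<in>{0..1}. Z t \<in> borel_measurable (brownian_filtration W B t)) \<and>
     (\<lambda>(t, \<omega>). Z t \<omega>) \<in> borel_measurable (restrict_space borel {0..1} \<Otimes>\<^sub>M W) \<and>
     (\<integral>\<^sup>+\<omega>. (\<integral>\<^sup>+t\<in>{0..1}. ennreal ((Z t \<omega>)\<^sup>2) \<partial>lborel) \<partial>W) < \<infinity>"

text \<open>Terminal time 1, driver \<open>g (Z s)\<close>, terminal value \<open>\<xi>\<close>.\<close>

definition bsde_solution ::
  "'b measure \<Rightarrow> (real \<Rightarrow> 'b \<Rightarrow> real) \<Rightarrow> (real \<Rightarrow> real) \<Rightarrow> ('b \<Rightarrow> real)
    \<Rightarrow> (real \<Rightarrow> 'b \<Rightarrow> real) \<Rightarrow> (real \<Rightarrow> 'b \<Rightarrow> real) \<Rightarrow> bool" where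
  "bsde_solution W B g \<xi> Y Z \<longleftrightarrow>
     adapted_square_integrable W B Y \<and> adapted_square_integrable W B Z \<and>
     (\<forall>t\<in>{0..1}. \<exists>I. has_ito_integral W B Z t 1 I \<and>
        (AE \<omega> in W. Y t \<omega> = \<xi> \<omega> + (LINT s:{t..1}|lborel. g (Z s \<omega>)) - I \<omega>))"

text \<open>\<open>Y 0\<close> is measurable for a trivial sigma-algebra, hence almost surely equal to a constant.\<close>

definition bsde_value ::
  "'b measure \<Rightarrow> (real \<Rightarrow> 'b \<Rightarrow> real) \<Rightarrow> (real \<Rightarrow> real) \<Rightarrow> ('b \<Rightarrow> real) \<Rightarrow> real" where
  "bsde_value W B g \<xi> = (THE y. \<exists>Y Z. bsde_solution W B g \<xi> Y Z \<and> (AE \<omega> in W. Y 0 \<omega> = y))"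

definition upper_bsde_expectation ::
  "'b measure \<Rightarrow> (real \<Rightarrow> 'b \<Rightarrow> real) \<Rightarrow> real \<Rightarrow> real \<Rightarrow> (real \<Rightarrow> real) \<Rightarrow> real" where
  "upper_bsde_expectation W B \<mu>l \<mu>u \<phi> =
     bsde_value W B (\<lambda>z. SUP \<mu>\<in>{\<mu>l..\<mu>u}. \<mu> * z) (\<lambda>\<omega>. \<phi> (B 1 \<omega>))"

definition lower_bsde_expectation ::
  "'b measure \<Rightarrow> (real \<Rightarrow> 'b \<Rightarrow> real) \<Rightarrow> real \<Rightarrow> real \<Rightarrow> (real \<Rightarrow> real) \<Rightarrow> real" where
  "lower_bsde_expectation W B \<mu>l \<mu>u \<phi> =
     bsde_value W B (\<lambda>z. INF \<mu>\<in>{\<mu>l..\<mu>u}. \<mu> * z) (\<lambda>\<omega>. \<phi> (B 1 \<omega>))"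

section \<open>The normalised sums\<close>

definition clt_statistic ::
  "(nat \<Rightarrow> 'a measure) \<Rightarrow> (nat \<Rightarrow> 'a \<Rightarrow> real) \<Rightarrow> real \<Rightarrow> 'a measure \<Rightarrow> nat \<Rightarrow> 'a \<Rightarrow> real" where
  "clt_statistic F X \<sigma> Q n \<omega> =
     1 / real n * (\<Sum>i=1..n. X i \<omega>) +
     1 / sqrt (real n) * (\<Sum>i=1..n. 1 / \<sigma> * (X i \<omega> - real_cond_exp Q (F (i - 1)) (X i) \<omega>))"

end

(* The limit is u(0,0) for the solution u of u_t + u_xx / 2 + g(u_x) = 0, u(1,.) = phi, where
   g(z) = max(mul z, muu z). Instead of the exact solution we use smooth eps-approximate solutions,
   built by splitting heat flow and driver; the Lipschitz bound on u_x that controls the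
   error is uniform in the step size by a Gronwall argument with kernel r^(-1/2).

   For a measure Q with conditional means m_i of X_i, a Taylor expansion of u(i/n, S_i) along the
   normalised partial sums shows E_Q phi(S_n) = u(0,0) + (1/n) sum_i E_Q [m_i u_x - g(u_x)] + O(eps),
   the Lindeberg condition controlling the remainder uniformly in Q. The summands are never
   positive, and rectangularity allows one to choose Q step by step so that m_i is nearly muu where
   u_x >= 0 and nearly mul elsewhere, which makes them nearly 0.

   Along Brownian motion, (u(t,B_t), u_x(t,B_t)) solves the BSDE up to an error that vanishes with
   eps. An L2 stability estimate on short time intervals makes these pairs a Cauchy family; the
   limit solves the BSDE and starts from lim u(0,0), and solutions are unique. The infimum is
   reduced to the supremum by passing to -phi and (-Y, -Z). *)

theory Submission
  imports Defs
begin

section \<open>Gaussian averages\<close>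

text \<open>The order in which constants are chosen shapes the argument. The regularity constant
  \<open>C\<close> of an approximate solution may explode as \<open>\<epsilon>\<close> tends to 0;
  this is harmless because \<open>\<epsilon>\<close> is frozen before \<open>n\<close>, or the
  number of grid points, goes to infinity. Only one bound must survive a small splitting step
  \<open>h\<close>: the Lipschitz constant of the first space derivative, because it multiplies
  \<open>sqrt h\<close> in the consistency error. Dividing by \<open>\<sigma>\<close> gives the
  fluctuation part of each increment conditional variance 1/n under every measure. To leading order
  the measures differ in the drift only, which is why the equation is semilinear with driver
  \<open>g\<close>. The right-hand side is a definite description, so a solution must be constructed
  and shown unique. Both rest on one energy argument over intervals so short that the driver term is
  absorbed. For two approximate solutions the resulting estimate no longer contains their constants
  \<open>C\<close> once the grid is refined away; solutions for different \<open>\<epsilon>\<close>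
  become comparable although their regularity is unrelated.\<close>

definition gauss :: "real measure" where
  "gauss = density lborel (\<lambda>z. ennreal (std_normal_density z))"

lemma sets_gauss [measurable_cong, simp]: "sets gauss = sets borel"
  and space_gauss [simp]: "space gauss = UNIV"
  by (simp_all add: gauss_def)

interpretation gauss: prob_space gauss
  unfolding gauss_def by (rule prob_space_normal_density) simp

lemma integrable_gauss_iff:
  "f \<in> borel_measurable borel \<Longrightarrow>
    integrable gauss f \<longleftrightarrow> integrable lborel (\<lambda>z. std_normal_density z * f z)" for f :: "real \<Rightarrow> real"
  unfolding gauss_def by (subst integrable_density) auto

lemma integral_gauss:
  "f \<in> borel_measurable borel \<Longrightarrow> (\<integral>z. f z \<partial>gauss) = (\<integral>z. std_normal_density z * f z \<partial>lborel)"
  for f :: "real \<Rightarrow> real"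
  unfolding gauss_def by (subst integral_density) auto

lemma integrable_gauss_power [simp]: "integrable gauss (\<lambda>z. z ^ k)"
  and integrable_gauss_abs_power [simp]: "integrable gauss (\<lambda>z. \<bar>z\<bar> ^ k)"
  by (simp_all add: integrable_gauss_iff integrable_std_normal_moment integrable_std_normal_moment_abs)

lemma integrable_gauss_id [simp]: "integrable gauss (\<lambda>z. z)"
  and integrable_gauss_abs [simp]: "integrable gauss (\<lambda>z. \<bar>z\<bar>)"
  using integrable_gauss_power[of 1] integrable_gauss_abs_power[of 1] by simp_all

lemma gauss_mean [simp]: "(\<integral>z. z \<partial>gauss) = 0"
  using integral_std_normal_moment_odd[of 0] by (simp add: integral_gauss)

lemma gauss_second_moment [simp]: "(\<integral>z. z\<^sup>2 \<partial>gauss) = 1"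
  using integral_std_normal_moment_even[of 1] by (simp add: integral_gauss)

lemma gauss_fourth_moment: "(\<integral>z. z ^ 4 \<partial>gauss) = 3"
  using integral_std_normal_moment_even[of 2] by (simp add: integral_gauss fact_numeral)

lemma gauss_sixth_moment: "(\<integral>z. z ^ 6 \<partial>gauss) = 15"
  using integral_std_normal_moment_even[of 3] by (simp add: integral_gauss fact_numeral)

lemma gauss_abs_moment_le: "(\<integral>z. \<bar>z\<bar> \<partial>gauss) \<le> 1"
proof -
  have "(\<integral>z. \<bar>z\<bar> \<partial>gauss) \<le> (\<integral>z. 1/2 * z\<^sup>2 + 1/2 \<partial>gauss)"
  proof (rule integral_mono)
    fix z :: real
    show "\<bar>z\<bar> \<le> 1/2 * z\<^sup>2 + 1/2" using sum_squares_bound[of "\<bar>z\<bar>" 1] by simp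
  qed auto
  also have "\<dots> = 1" by (subst Bochner_Integration.integral_add) (auto simp: gauss.prob_space[simplified])
  finally show ?thesis .
qed

lemma gauss_abs_third_moment_le: "(\<integral>z. \<bar>z\<bar> ^ 3 \<partial>gauss) \<le> 2"
proof -
  have "(\<integral>z. \<bar>z\<bar> ^ 3 \<partial>gauss) \<le> (\<integral>z. 1/2 * z ^ 4 + 1/2 * z\<^sup>2 \<partial>gauss)"
  proof (rule integral_mono)
    fix z :: real
    have "2 * \<bar>z\<bar>\<^sup>2 * \<bar>z\<bar> * 1 \<le> (\<bar>z\<bar>\<^sup>2)\<^sup>2 + \<bar>z\<bar>\<^sup>2"
      using sum_squares_bound[of "\<bar>z\<bar>\<^sup>2" "\<bar>z\<bar>"] by simp
    then show "\<bar>z\<bar> ^ 3 \<le> 1/2 * z ^ 4 + 1/2 * z\<^sup>2"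
      by (simp add: power3_eq_cube power4_eq_xxxx power2_eq_square)
  qed auto
  also have "\<dots> = 2" by (subst Bochner_Integration.integral_add) (auto simp: gauss_fourth_moment)
  finally show ?thesis .
qed

text \<open>Completing the square: a translation of the variable becomes the density exp(w \<eta> -
  \<eta>^2/2), which is Cameron-Martin in one dimension. Increments of Gaussian averages can thus be
  studied without any smoothness of \<open>f\<close>.\<close>

lemma gauss_shift:
  fixes f :: "real \<Rightarrow> real"
  assumes [measurable]: "f \<in> borel_measurable borel"
  shows "(\<integral>w. f (w + \<eta>) \<partial>gauss) = (\<integral>w. f w * exp (w * \<eta> - \<eta>\<^sup>2 / 2) \<partial>gauss)"
    and "integrable gauss (\<lambda>w. f (w + \<eta>)) \<longleftrightarrow> integrable gauss (\<lambda>w. f w * exp (w * \<eta> - \<eta>\<^sup>2 / 2))"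
proof -
  have eq: "std_normal_density (w - \<eta>) * f w = std_normal_density w * (f w * exp (w * \<eta> - \<eta>\<^sup>2 / 2))" for w
  proof -
    have "- (w - \<eta>)\<^sup>2 / 2 = - w\<^sup>2 / 2 + (w * \<eta> - \<eta>\<^sup>2 / 2)"
      by (simp add: power2_eq_square field_simps)
    then have "exp (- (w - \<eta>)\<^sup>2 / 2) = exp (- w\<^sup>2 / 2) * exp (w * \<eta> - \<eta>\<^sup>2 / 2)"
      by (simp only: exp_add)
    then show ?thesis by (simp add: std_normal_density_def)
  qed
  have "(\<integral>w. f (w + \<eta>) \<partial>gauss) = (\<integral>w. std_normal_density w * f (w + \<eta>) \<partial>lborel)"
    by (subst integral_gauss) auto
  also have "\<dots> = (\<integral>w. std_normal_density (w - \<eta>) * f w \<partial>lborel)"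
    by (subst lborel_integral_real_affine[where c=1 and t="-\<eta>"]) (auto simp: add.commute)
  finally show "(\<integral>w. f (w + \<eta>) \<partial>gauss) = (\<integral>w. f w * exp (w * \<eta> - \<eta>\<^sup>2 / 2) \<partial>gauss)"
    unfolding eq by (subst integral_gauss) auto
  have "integrable gauss (\<lambda>w. f (w + \<eta>)) \<longleftrightarrow> integrable lborel (\<lambda>w. std_normal_density w * f (w + \<eta>))"
    by (subst integrable_gauss_iff) auto
  also have "\<dots> \<longleftrightarrow> integrable lborel (\<lambda>w. std_normal_density (w - \<eta>) * f w)"
    using lborel_integrable_real_affine_iff[where c=1 and t="-\<eta>" and f="\<lambda>w. std_normal_density w * f (w + \<eta>)"]
    by (simp add: add.commute)
  finally show "integrable gauss (\<lambda>w. f (w + \<eta>)) \<longleftrightarrow> integrable gauss (\<lambda>w. f w * exp (w * \<eta> - \<eta>\<^sup>2 / 2))"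
    unfolding eq by (subst integrable_gauss_iff) auto
qed

text \<open>The density of \<open>gauss_shift\<close> is the generating function of the Hermite
  polynomials; removing the orders 0 and 1 leaves the squared norm exp(\<eta>^2) - 1 - \<eta>^2,
  which is at most \<eta>^4 for |\<eta>| \<le> 1. The mean absolute value is then of order
  \<eta>^2.\<close>

lemma gauss_exponential_remainder:
  assumes "\<bar>\<eta>\<bar> \<le> 1"
  shows "integrable gauss (\<lambda>w. exp (w * \<eta> - \<eta>\<^sup>2 / 2) - 1 - \<eta> * w)" (is "integrable _ ?a")
    and "(\<integral>w. \<bar>exp (w * \<eta> - \<eta>\<^sup>2 / 2) - 1 - \<eta> * w\<bar> \<partial>gauss) \<le> \<eta>\<^sup>2"
proof -
  define E where "E = (\<lambda>w::real. exp (w * \<eta> - \<eta>\<^sup>2 / 2))"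
  have [measurable]: "E \<in> borel_measurable borel" by (simp add: E_def)
  have E1: "integrable gauss E" "(\<integral>w. E w \<partial>gauss) = 1"
    using gauss_shift[of "\<lambda>_. 1" \<eta>] gauss.prob_space by (simp_all add: E_def)
  have EE: "E w * E w = exp (\<eta>\<^sup>2) * exp (w * (2*\<eta>) - (2*\<eta>)\<^sup>2 / 2)" for w
    unfolding E_def by (simp add: mult_exp_exp power2_eq_square algebra_simps)
  have E2: "integrable gauss (\<lambda>w. E w * E w)" "(\<integral>w. E w * E w \<partial>gauss) = exp (\<eta>\<^sup>2)"
    unfolding EE using gauss_shift[of "\<lambda>_. 1" "2*\<eta>"] gauss.prob_space by simp_all
  have Ew: "integrable gauss (\<lambda>w. w * E w)" "(\<integral>w. w * E w \<partial>gauss) = \<eta>"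
    using gauss_shift[of "\<lambda>w. w" \<eta>] gauss.prob_space by (simp_all add: E_def)
  show ia: "integrable gauss ?a" using E1 by (simp add: E_def)
  have sq: "(?a w)\<^sup>2 = E w * E w + 1 + \<eta>\<^sup>2 * w\<^sup>2 - 2 * E w - 2 * \<eta> * (w * E w) + 2 * \<eta> * w" for w
    unfolding E_def[symmetric] by (simp add: power2_eq_square E_def algebra_simps)
  have isq: "integrable gauss (\<lambda>w. (?a w)\<^sup>2)" unfolding sq using E1 E2 Ew by simp
  have "(\<integral>w. (?a w)\<^sup>2 \<partial>gauss) = exp (\<eta>\<^sup>2) - 1 - \<eta>\<^sup>2"
    unfolding sq using E1 E2 Ew gauss.prob_space by (simp add: power2_eq_square[of \<eta>, symmetric] mult.assoc)
  also have "\<dots> \<le> (\<eta>\<^sup>2)\<^sup>2"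
    using exp_bound[of "\<eta>\<^sup>2"] assms by (simp add: abs_square_le_1)
  finally have le: "(\<integral>w. (?a w)\<^sup>2 \<partial>gauss) \<le> (\<eta>\<^sup>2)\<^sup>2" .
  show "(\<integral>w. \<bar>?a w\<bar> \<partial>gauss) \<le> \<eta>\<^sup>2"
  proof (cases "\<eta> = 0")
    case False
    \<comment> \<open>Young's inequality with weight \<eta>^2 takes the place of Cauchy-Schwarz;
      both resulting terms are at most \<eta>^2/2.\<close>
    have "(\<integral>w. \<bar>?a w\<bar> \<partial>gauss) \<le> (\<integral>w. \<eta>\<^sup>2 / 2 + (1 / (2 * \<eta>\<^sup>2)) * (?a w)\<^sup>2 \<partial>gauss)"
    proof (rule integral_mono)
      fix w
      have young: "b \<le> e / 2 + (1 / (2 * e)) * b\<^sup>2" if "e > 0" for b e :: real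
        using sum_squares_bound[of e b] that by (simp add: field_simps power2_eq_square)
      show "\<bar>?a w\<bar> \<le> \<eta>\<^sup>2 / 2 + (1 / (2 * \<eta>\<^sup>2)) * (?a w)\<^sup>2"
        using young[of "\<eta>\<^sup>2" "\<bar>?a w\<bar>"] False by simp
    qed (use ia isq in auto)
    also have "\<dots> = \<eta>\<^sup>2 / 2 + (1 / (2 * \<eta>\<^sup>2)) * (\<integral>w. (?a w)\<^sup>2 \<partial>gauss)"
      using isq gauss.prob_space by simp
    also have "\<dots> \<le> \<eta>\<^sup>2 / 2 + (1 / (2 * \<eta>\<^sup>2)) * (\<eta>\<^sup>2)\<^sup>2"
      by (intro add_left_mono mult_left_mono le) simp
    also have "\<dots> = \<eta>\<^sup>2" using False by (simp add: power2_eq_square)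
    finally show ?thesis .
  qed simp
qed

lemma distr_gauss_scale:
  assumes "0 < c"
  shows "distr gauss borel (\<lambda>z. sqrt c * z) = density lborel (\<lambda>x. ennreal (normal_density 0 (sqrt c) x))"
proof -
  have "distributed gauss lborel (\<lambda>z. z) (\<lambda>x. ennreal (std_normal_density x))"
    unfolding distributed_def gauss_def by (auto simp: distr_id2 intro!: measure_eqI)
  from gauss.normal_density_affine[OF this, of "sqrt c" 0] assms
  show ?thesis by (auto simp: distributed_def cong: distr_cong)
qed

text \<open>Sums of independent centred normals: the semigroup law of \<open>heat\<close> on the
  level of distributions. The two projections on the product space realise the independence.\<close>

lemma gauss_distr_sum:
  assumes "0 < r" "0 < s"
  shows "distr (gauss \<Otimes>\<^sub>M gauss) borel (\<lambda>(z, w). sqrt r * z + sqrt s * w) = distr gauss borel (\<lambda>z. sqrt (r + s) * z)"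
proof -
  interpret P: pair_prob_space gauss gauss ..
  have gauss_fst: "distr (gauss \<Otimes>\<^sub>M gauss) borel fst = gauss"
    using gauss.distr_pair_fst[of gauss] by (simp cong: distr_cong)
  have gauss_snd: "distr (gauss \<Otimes>\<^sub>M gauss) borel snd = gauss"
    by (subst P.distr_pair_swap, subst distr_distr) (auto simp: comp_def case_prod_unfold gauss_fst)
  note aff = distr_gauss_scale
  have ind: "P.indep_var borel (\<lambda>x. sqrt r * fst x) borel (\<lambda>x. sqrt s * snd x)"
  proof (subst P.indep_var_distribution_eq, intro conjI)
    have 1: "distr (gauss \<Otimes>\<^sub>M gauss) borel (\<lambda>x. sqrt r * fst x) = distr gauss borel (\<lambda>z. sqrt r * z)"
      using distr_distr[of "\<lambda>z. sqrt r * z" borel borel fst "gauss \<Otimes>\<^sub>M gauss"]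
      by (simp add: comp_def gauss_fst)
    have 2: "distr (gauss \<Otimes>\<^sub>M gauss) borel (\<lambda>x. sqrt s * snd x) = distr gauss borel (\<lambda>z. sqrt s * z)"
    proof -
      show ?thesis
      using distr_distr[of "\<lambda>z. sqrt s * z" borel borel snd "gauss \<Otimes>\<^sub>M gauss"] gauss_snd
      by (simp add: comp_def)
    qed
    have "distr gauss borel (\<lambda>z. sqrt r * z) \<Otimes>\<^sub>M distr gauss borel (\<lambda>z. sqrt s * z) =
       distr (gauss \<Otimes>\<^sub>M gauss) (borel \<Otimes>\<^sub>M borel) (\<lambda>(x, y). (sqrt r * x, sqrt s * y))"
      by (rule pair_measure_distr) (auto intro!: prob_space_imp_sigma_finite gauss.prob_space_distr)
    then show "distr (gauss \<Otimes>\<^sub>M gauss) borel (\<lambda>x. sqrt r * fst x) \<Otimes>\<^sub>M distr (gauss \<Otimes>\<^sub>M gauss) borel (\<lambda>x. sqrt s * snd x) =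
      distr (gauss \<Otimes>\<^sub>M gauss) (borel \<Otimes>\<^sub>M borel) (\<lambda>x. (sqrt r * fst x, sqrt s * snd x))"
      unfolding 1 2 by (simp add: case_prod_unfold)
  qed auto
  have D1: "distributed (gauss \<Otimes>\<^sub>M gauss) lborel (\<lambda>x. sqrt r * fst x) (normal_density 0 (sqrt r))"
    unfolding distributed_def
  proof (intro conjI)
    show "distr (gauss \<Otimes>\<^sub>M gauss) lborel (\<lambda>x. sqrt r * fst x) = density lborel (\<lambda>x. ennreal (normal_density 0 (sqrt r) x))"
      using distr_distr[of "\<lambda>z. sqrt r * z" borel borel fst "gauss \<Otimes>\<^sub>M gauss"] aff[OF assms(1)]
      by (simp add: comp_def gauss_fst cong: distr_cong)
  qed auto
  have D2: "distributed (gauss \<Otimes>\<^sub>M gauss) lborel (\<lambda>x. sqrt s * snd x) (normal_density 0 (sqrt s))"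
    unfolding distributed_def
  proof (intro conjI)
    show "distr (gauss \<Otimes>\<^sub>M gauss) lborel (\<lambda>x. sqrt s * snd x) = density lborel (\<lambda>x. ennreal (normal_density 0 (sqrt s) x))"
      using distr_distr[of "\<lambda>z. sqrt s * z" borel borel snd "gauss \<Otimes>\<^sub>M gauss"] aff[OF assms(2)] gauss_snd
      by (simp add: comp_def cong: distr_cong)
  qed auto
  from P.add_indep_normal[OF ind _ _ D1 D2] assms
  have "distr (gauss \<Otimes>\<^sub>M gauss) lborel (\<lambda>x. sqrt r * fst x + sqrt s * snd x) =
     density lborel (\<lambda>x. ennreal (normal_density 0 (sqrt (r + s)) x))"
    by (simp add: distributed_def)
  also have "\<dots> = distr gauss borel (\<lambda>z. sqrt (r + s) * z)"
    using aff[of "r + s"] assms by simp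
  finally show ?thesis by (simp add: case_prod_unfold cong: distr_cong)
qed

section \<open>The heat semigroup\<close>

text \<open>The noise \<open>sqrt r * z\<close> has variance \<open>r\<close>, so the generator of
  this semigroup is half the second derivative.\<close>

definition heat :: "real \<Rightarrow> (real \<Rightarrow> real) \<Rightarrow> real \<Rightarrow> real" where
  "heat r f x = (\<integral>z. f (x + sqrt r * z) \<partial>gauss)"

text \<open>The derivative of \<open>heat r f\<close>, with the derivative moved from \<open>f\<close> to the Gaussian density, so that it exists for bounded measurable \<open>f\<close>.\<close>

definition dheat :: "real \<Rightarrow> (real \<Rightarrow> real) \<Rightarrow> real \<Rightarrow> real" where
  "dheat r f x = (\<integral>z. f (x + sqrt r * z) * z \<partial>gauss) / sqrt r"

definition bfun :: "real \<Rightarrow> (real \<Rightarrow> real) \<Rightarrow> bool" where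
  "bfun C f \<longleftrightarrow> f \<in> borel_measurable borel \<and> (\<forall>x. \<bar>f x\<bar> \<le> C)"

definition lip :: "real \<Rightarrow> (real \<Rightarrow> real) \<Rightarrow> bool" where
  "lip K f \<longleftrightarrow> (\<forall>x y. \<bar>f x - f y\<bar> \<le> K * \<bar>x - y\<bar>)"

text \<open>A quantitative form of \<open>f1 = f'\<close> with Lipschitz \<open>f1\<close>; unlike derivatives it is stable under averaging.\<close>

definition quad :: "real \<Rightarrow> (real \<Rightarrow> real) \<Rightarrow> (real \<Rightarrow> real) \<Rightarrow> bool" where
  "quad C f f1 \<longleftrightarrow> (\<forall>x h. \<bar>f (x + h) - f x - h * f1 x\<bar> \<le> C * h\<^sup>2)"

section \<open>Rules for bounded, Lipschitz and quadratically approximable functions\<close>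

lemma bfunD: "bfun C f \<Longrightarrow> f \<in> borel_measurable borel" "bfun C f \<Longrightarrow> \<bar>f x\<bar> \<le> C" "bfun C f \<Longrightarrow> 0 \<le> C"
  unfolding bfun_def using abs_ge_zero order_trans by blast+

lemma lipD: "lip K f \<Longrightarrow> \<bar>f x - f y\<bar> \<le> K * \<bar>x - y\<bar>"
  by (simp add: lip_def)

lemma lip_nonneg: "lip K f \<Longrightarrow> 0 \<le> K"
  using lipD[of K f 0 1] by simp

lemma lip_mono: "lip K f \<Longrightarrow> K \<le> K' \<Longrightarrow> lip K' f"
  unfolding lip_def by (meson abs_ge_zero mult_right_mono order_trans)

lemma lip_continuous: "lip K f \<Longrightarrow> continuous_on UNIV f"
  by (rule lipschitz_on_continuous_on[of K], rule lipschitz_onI)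
     (auto simp: lip_nonneg dist_real_def lipD)

lemma lip_measurable: "lip K f \<Longrightarrow> f \<in> borel_measurable borel"
  by (intro borel_measurable_continuous_onI lip_continuous)

lemma bfun_mono: "bfun C f \<Longrightarrow> C \<le> C' \<Longrightarrow> bfun C' f"
  unfolding bfun_def by (meson order_trans)

lemma quadD: "quad C f f1 \<Longrightarrow> \<bar>f (x + h) - f x - h * f1 x\<bar> \<le> C * h\<^sup>2"
  by (simp add: quad_def)

lemma quad_mono: "quad C f f1 \<Longrightarrow> C \<le> C' \<Longrightarrow> quad C' f f1"
  unfolding quad_def by (meson mult_right_mono order_trans zero_le_power2)

lemma quad_nonneg: "quad C f f1 \<Longrightarrow> 0 \<le> C"
  using quadD[of C f f1 0 1] by simp

lemma quad_DERIV:
  assumes "quad C f f1"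
  shows "(f has_real_derivative f1 x) (at x within S)"
proof -
  have "((\<lambda>h. (f (x + h) - f x) / h) \<longlongrightarrow> f1 x) (at 0)"
  proof (rule LIM_I)
    fix e :: real assume e: "e > 0"
    have C: "0 \<le> C" by (rule quad_nonneg[OF assms])
    show "\<exists>s>0. \<forall>h. h \<noteq> 0 \<and> norm (h - 0) < s \<longrightarrow> norm ((f (x + h) - f x) / h - f1 x) < e"
    proof (intro exI[of _ "e / (C + 1)"] conjI allI impI)
      show "0 < e / (C + 1)" using e C by simp
      fix h :: real assume h: "h \<noteq> 0 \<and> norm (h - 0) < e / (C + 1)"
      have "\<bar>(f (x + h) - f x) / h - f1 x\<bar> = \<bar>f (x + h) - f x - h * f1 x\<bar> / \<bar>h\<bar>"
        using h by (subst abs_divide[symmetric]) (simp add: field_simps)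
      also have "\<dots> \<le> C * h\<^sup>2 / \<bar>h\<bar>"
        by (intro divide_right_mono quadD[OF assms]) simp
      also have "\<dots> = C * \<bar>h\<bar>" using h by (simp add: power2_eq_square field_simps abs_if)
      also have "\<dots> \<le> (C + 1) * \<bar>h\<bar>" by (simp add: mult_right_mono)
      also have "\<dots> < e" using h C by (simp add: field_simps)
      finally show "norm ((f (x + h) - f x) / h - f1 x) < e" by simp
    qed
  qed
  then have "(f has_real_derivative f1 x) (at x)" by (simp add: DERIV_def)
  then show ?thesis by (rule has_field_derivative_at_within)
qed

text \<open>Both candidates are the derivative of \<open>f\<close>. Commutation of
  \<open>heat\<close> and \<open>dheat\<close> follows from this by comparing two expansions of the
  same function.\<close>

lemma quad_unique:
  assumes "quad C f f1" "quad C' f f2" shows "f1 = f2"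
  using DERIV_unique[OF quad_DERIV[OF assms(1), of _ UNIV] quad_DERIV[OF assms(2), of _ UNIV]] by auto

lemma bounded_derivative_lip:
  assumes "quad C f f1" "\<And>x. \<bar>f1 x\<bar> \<le> K"
  shows "lip K f"
  unfolding lip_def
proof (intro allI)
  fix x y
  show "\<bar>f x - f y\<bar> \<le> K * \<bar>x - y\<bar>"
    using field_differentiable_bound[of UNIV f f1 K x y] quad_DERIV[OF assms(1)] assms(2) by auto
qed

section \<open>Averaging of bounded and Lipschitz functions\<close>

lemma heat_0 [simp]: "heat 0 f = f"
  using gauss.prob_space by (auto simp: heat_def)

lemma heat_integrable:
  assumes "bfun C f" shows "integrable gauss (\<lambda>z. f (x + c * z))"
proof (rule gauss.integrable_const_bound)
  note [measurable] = bfunD(1)[OF assms]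
  show "(\<lambda>z. f (x + c * z)) \<in> borel_measurable gauss" by measurable
  show "AE z in gauss. norm (f (x + c * z)) \<le> C" using bfunD(2)[OF assms] by simp
qed

lemma heat_integrable_mult:
  assumes "bfun C f" "integrable gauss g" shows "integrable gauss (\<lambda>z. f (x + c * z) * g z)"
proof (rule Bochner_Integration.integrable_bound)
  note [measurable] = bfunD(1)[OF assms(1)] borel_measurable_integrable[OF assms(2)]
  show "(\<lambda>z. f (x + c * z) * g z) \<in> borel_measurable gauss" by measurable
  show "integrable gauss (\<lambda>z. C * g z)" using assms(2) by simp
  show "AE z in gauss. norm (f (x + c * z) * g z) \<le> norm (C * g z)"
    using bfunD(2,3)[OF assms(1)] by (auto simp: abs_mult intro!: mult_right_mono)
qed

lemma integral_gauss_abs_le: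
  fixes f g :: "real \<Rightarrow> real"
  assumes "integrable gauss f" "integrable gauss g" "\<And>z. \<bar>f z\<bar> \<le> g z"
  shows "\<bar>\<integral>z. f z \<partial>gauss\<bar> \<le> (\<integral>z. g z \<partial>gauss)"
proof -
  have "\<bar>\<integral>z. f z \<partial>gauss\<bar> \<le> (\<integral>z. \<bar>f z\<bar> \<partial>gauss)"
    using integral_norm_bound[of gauss f] by simp
  also have "\<dots> \<le> (\<integral>z. g z \<partial>gauss)" using assms by (intro integral_mono) auto
  finally show ?thesis .
qed

lemma bfun_heat:
  assumes "bfun C f" shows "bfun C (heat r f)"
  unfolding bfun_def
proof (intro conjI allI)
  note [measurable] = bfunD(1)[OF assms]
  show "heat r f \<in> borel_measurable borel" unfolding heat_def by measurable
  fix x show "\<bar>heat r f x\<bar> \<le> C"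
    unfolding heat_def
    using integral_gauss_abs_le[OF heat_integrable[OF assms], of "\<lambda>_. C" x "sqrt r"] bfunD(2)[OF assms] gauss.prob_space
    by simp
qed

lemma heat_diff_le:
  assumes "bfun C f" "bfun C' g" "\<And>z. \<bar>f (x + sqrt r * z) - g (y + sqrt r * z)\<bar> \<le> K"
  shows "\<bar>heat r f x - heat r g y\<bar> \<le> K"
proof -
  have "heat r f x - heat r g y = (\<integral>z. f (x + sqrt r * z) - g (y + sqrt r * z) \<partial>gauss)"
    unfolding heat_def using heat_integrable[OF assms(1)] heat_integrable[OF assms(2)] by simp
  also have "\<bar>\<dots>\<bar> \<le> (\<integral>z. K \<partial>gauss)"
    using heat_integrable[OF assms(1)] heat_integrable[OF assms(2)] assms(3)
    by (intro integral_gauss_abs_le) auto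
  finally show ?thesis using gauss.prob_space by simp
qed

lemma lip_heat: "bfun C f \<Longrightarrow> lip K f \<Longrightarrow> lip K (heat r f)"
  unfolding lip_def
proof (intro allI)
  fix x y assume f: "bfun C f" "\<forall>x y. \<bar>f x - f y\<bar> \<le> K * \<bar>x - y\<bar>"
  show "\<bar>heat r f x - heat r f y\<bar> \<le> K * \<bar>x - y\<bar>"
  proof (rule heat_diff_le[OF f(1) f(1)])
    fix z show "\<bar>f (x + sqrt r * z) - f (y + sqrt r * z)\<bar> \<le> K * \<bar>x - y\<bar>"
      using f(2)[rule_format, of "x + sqrt r * z" "y + sqrt r * z"] by simp
  qed
qed

lemma heat_near:
  assumes "bfun C f" "lip K f" "0 \<le> r"
  shows "\<bar>heat r f x - f x\<bar> \<le> K * sqrt r"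
proof -
  have "heat r f x - f x = (\<integral>z. f (x + sqrt r * z) - f x \<partial>gauss)"
    unfolding heat_def using heat_integrable[OF assms(1)] gauss.prob_space by simp
  also have "\<bar>\<dots>\<bar> \<le> (\<integral>z. (K * sqrt r) * \<bar>z\<bar> \<partial>gauss)"
    using heat_integrable[OF assms(1)] lipD[OF assms(2), of "x + sqrt r * _" x] assms(3)
    by (intro integral_gauss_abs_le) (auto simp: abs_mult mult.assoc)
  also have "\<dots> \<le> K * sqrt r"
    using mult_left_mono[OF gauss_abs_moment_le, of "K * sqrt r"] lip_nonneg[OF assms(2)] assms(3) by simp
  finally show ?thesis .
qed

lemma heat_add: "bfun C f \<Longrightarrow> bfun C' g \<Longrightarrow> heat r (\<lambda>x. f x + g x) = (\<lambda>x. heat r f x + heat r g x)"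
  by (auto simp: heat_def fun_eq_iff heat_integrable)

lemma heat_cmult: "heat r (\<lambda>x. c * f x) = (\<lambda>x. c * heat r f x)"
  by (auto simp: heat_def)

lemma bfun_add: "bfun C f \<Longrightarrow> bfun C' g \<Longrightarrow> bfun (C + C') (\<lambda>x. f x + g x)"
  unfolding bfun_def by (auto intro!: order_trans[OF abs_triangle_ineq] add_mono)

lemma bfun_cmult: "bfun C f \<Longrightarrow> bfun (\<bar>c\<bar> * C) (\<lambda>x. c * f x)"
  unfolding bfun_def by (auto simp: abs_mult intro!: mult_left_mono)

lemma bfun_sum: "(\<And>i. i \<in> I \<Longrightarrow> bfun (C i) (f i)) \<Longrightarrow> bfun (\<Sum>i\<in>I. C i) (\<lambda>x. \<Sum>i\<in>I. f i x)"
  unfolding bfun_def by (intro conjI allI borel_measurable_sum order_trans[OF sum_abs] sum_mono) auto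

lemma heat_sum: "(\<And>i. i \<in> I \<Longrightarrow> bfun (C i) (f i)) \<Longrightarrow>
    heat r (\<lambda>x. \<Sum>i\<in>I. f i x) = (\<lambda>x. \<Sum>i\<in>I. heat r (f i) x)"
  unfolding heat_def fun_eq_iff
  by (intro allI Bochner_Integration.integral_sum) (rule heat_integrable)

lemma lip_add: "lip C f \<Longrightarrow> lip C' g \<Longrightarrow> lip (C + C') (\<lambda>x. f x + g x)"
  unfolding lip_def
proof (intro allI)
  fix x y assume *: "\<forall>x y. \<bar>f x - f y\<bar> \<le> C * \<bar>x - y\<bar>" "\<forall>x y. \<bar>g x - g y\<bar> \<le> C' * \<bar>x - y\<bar>"
  have "\<bar>f x + g x - (f y + g y)\<bar> \<le> \<bar>f x - f y\<bar> + \<bar>g x - g y\<bar>" by arith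
  then show "\<bar>f x + g x - (f y + g y)\<bar> \<le> (C + C') * \<bar>x - y\<bar>"
    using *[rule_format, of x y] by (simp add: distrib_right)
qed

lemma lip_cmult: "lip C f \<Longrightarrow> lip (\<bar>c\<bar> * C) (\<lambda>x. c * f x)"
  unfolding lip_def by (auto simp: abs_mult right_diff_distrib[symmetric] mult.assoc intro!: mult_left_mono)

lemma lip_zero: "lip 0 (\<lambda>x. 0)" by (simp add: lip_def)

lemma lip_sum: "finite I \<Longrightarrow> (\<And>i. i \<in> I \<Longrightarrow> lip (C i) (f i)) \<Longrightarrow> lip (\<Sum>i\<in>I. C i) (\<lambda>x. \<Sum>i\<in>I. f i x)"
  by (induction I rule: finite_induct) (auto intro: lip_add lip_zero)

lemma quad_add: "quad C f f1 \<Longrightarrow> quad C' g g1 \<Longrightarrow> quad (C + C') (\<lambda>x. f x + g x) (\<lambda>x. f1 x + g1 x)"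
  unfolding quad_def
proof (intro allI)
  fix x h :: real assume *: "\<forall>x h. \<bar>f (x + h) - f x - h * f1 x\<bar> \<le> C * h\<^sup>2" "\<forall>x h. \<bar>g (x + h) - g x - h * g1 x\<bar> \<le> C' * h\<^sup>2"
  have "\<bar>f (x + h) + g (x + h) - (f x + g x) - h * (f1 x + g1 x)\<bar> \<le>
      \<bar>f (x + h) - f x - h * f1 x\<bar> + \<bar>g (x + h) - g x - h * g1 x\<bar>" by (simp add: algebra_simps)
  then show "\<bar>f (x + h) + g (x + h) - (f x + g x) - h * (f1 x + g1 x)\<bar> \<le> (C + C') * h\<^sup>2"
    using *[rule_format, of x h] by (simp add: distrib_right)
qed

lemma quad_cmult: "quad C f f1 \<Longrightarrow> quad (\<bar>c\<bar> * C) (\<lambda>x. c * f x) (\<lambda>x. c * f1 x)"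
  unfolding quad_def
proof (intro allI)
  fix x h :: real assume *: "\<forall>x h. \<bar>f (x + h) - f x - h * f1 x\<bar> \<le> C * h\<^sup>2"
  have "c * f (x + h) - c * f x - h * (c * f1 x) = c * (f (x + h) - f x - h * f1 x)" by (simp add: algebra_simps)
  then show "\<bar>c * f (x + h) - c * f x - h * (c * f1 x)\<bar> \<le> \<bar>c\<bar> * C * h\<^sup>2"
    using *[rule_format, of x h] by (simp add: abs_mult mult.assoc mult_left_mono)
qed

lemma heat_heat:
  assumes f: "bfun C f" and "0 \<le> r" "0 \<le> s"
  shows "heat r (heat s f) = heat (r + s) f"
proof (cases "r = 0 \<or> s = 0")
  case False
  then have rs: "0 < r" "0 < s" using assms by auto
  note [measurable] = bfunD(1)[OF f]
  interpret P: pair_prob_space gauss gauss ..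
  show ?thesis
  proof
    fix x
    have int: "integrable (gauss \<Otimes>\<^sub>M gauss) (\<lambda>(z, w). f (x + (sqrt r * z + sqrt s * w)))"
      using bfunD(2)[OF f] by (intro P.integrable_const_bound[of _ C]) auto
    have "heat r (heat s f) x = (\<integral>z. \<integral>w. f (x + (sqrt r * z + sqrt s * w)) \<partial>gauss \<partial>gauss)"
      by (simp add: heat_def add.assoc)
    also have "\<dots> = (\<integral>p. f (x + (\<lambda>(z, w). sqrt r * z + sqrt s * w) p) \<partial>(gauss \<Otimes>\<^sub>M gauss))"
      using P.integral_fst'[OF int] by (simp add: case_prod_unfold)
    also have "\<dots> = (\<integral>y. f (x + y) \<partial>distr (gauss \<Otimes>\<^sub>M gauss) borel (\<lambda>(z, w). sqrt r * z + sqrt s * w))"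
      by (subst integral_distr) auto
    also have "\<dots> = (\<integral>y. f (x + y) \<partial>distr gauss borel (\<lambda>z. sqrt (r + s) * z))"
      by (simp add: gauss_distr_sum rs)
    also have "\<dots> = heat (r + s) f x"
      by (subst integral_distr) (auto simp: heat_def)
    finally show "heat r (heat s f) x = heat (r + s) f x" .
  qed
qed auto

lemma quad_heat:
  assumes "bfun C f" "bfun C1 f1" "quad K f f1"
  shows "quad K (heat r f) (heat r f1)"
  unfolding quad_def
proof (intro allI)
  fix x h :: real
  have i: "integrable gauss (\<lambda>z. f (x + sqrt r * z + h))"
    using heat_integrable[OF assms(1), of "x + h" "sqrt r"] by (simp add: ac_simps)
  note i = i heat_integrable[OF assms(1)] heat_integrable[OF assms(2)]
  have "heat r f (x + h) = (\<integral>z. f (x + sqrt r * z + h) \<partial>gauss)" by (simp add: heat_def ac_simps)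
  then have "\<bar>heat r f (x + h) - heat r f x - h * heat r f1 x\<bar> =
     \<bar>\<integral>z. f (x + sqrt r * z + h) - f (x + sqrt r * z) - h * f1 (x + sqrt r * z) \<partial>gauss\<bar>"
    using i by (simp add: heat_def)
  also have "\<dots> \<le> (\<integral>z. K * h\<^sup>2 \<partial>gauss)"
    using i by (intro integral_gauss_abs_le quadD[OF assms(3)]) auto
  finally show "\<bar>heat r f (x + h) - heat r f x - h * heat r f1 x\<bar> \<le> K * h\<^sup>2"
    using gauss.prob_space by simp
qed

section \<open>Smoothing estimates for the differentiated kernel\<close>

lemma bfun_dheat:
  assumes "bfun C f" "0 < r" shows "bfun (C / sqrt r) (dheat r f)"
  unfolding bfun_def
proof (intro conjI allI)
  note [measurable] = bfunD(1)[OF assms(1)]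
  show "dheat r f \<in> borel_measurable borel" unfolding dheat_def by measurable
  fix x
  have "\<bar>\<integral>z. f (x + sqrt r * z) * z \<partial>gauss\<bar> \<le> (\<integral>z. C * \<bar>z\<bar> \<partial>gauss)"
    using bfunD[OF assms(1)] heat_integrable_mult[OF assms(1) integrable_gauss_id]
    by (intro integral_gauss_abs_le) (auto simp: abs_mult intro!: mult_right_mono)
  also have "\<dots> \<le> C" using mult_left_mono[OF gauss_abs_moment_le, of C] bfunD(3)[OF assms(1)] by simp
  finally show "\<bar>dheat r f x\<bar> \<le> C / sqrt r" using assms(2) by (simp add: dheat_def divide_right_mono)
qed

text \<open>One derivative costs the factor r^(-1/2). It is integrable at 0, and this is the kernel
  of the Gronwall argument for \<open>lip_v1\<close>.\<close>

lemma lip_dheat: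
  assumes "bfun C f" "lip K f" "0 < r" shows "lip (K / sqrt r) (dheat r f)"
  unfolding lip_def
proof (intro allI)
  fix x y
  note i = heat_integrable_mult[OF assms(1) integrable_gauss_id]
  have "dheat r f x - dheat r f y = (\<integral>z. (f (x + sqrt r * z) - f (y + sqrt r * z)) * z \<partial>gauss) / sqrt r"
    using i[of x "sqrt r"] i[of y "sqrt r"] by (simp add: dheat_def diff_divide_distrib left_diff_distrib)
  also have "\<bar>\<dots>\<bar> \<le> (\<integral>z. K * \<bar>x - y\<bar> * \<bar>z\<bar> \<partial>gauss) / sqrt r"
    unfolding abs_divide abs_of_pos[OF real_sqrt_gt_zero[OF assms(3)]]
  proof (intro divide_right_mono integral_gauss_abs_le)
    fix z
    show "\<bar>(f (x + sqrt r * z) - f (y + sqrt r * z)) * z\<bar> \<le> K * \<bar>x - y\<bar> * \<bar>z\<bar>"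
      unfolding abs_mult using lipD[OF assms(2), of "x + sqrt r * z" "y + sqrt r * z"]
      by (intro mult_right_mono) auto
  qed (use i assms(3) in \<open>auto simp: left_diff_distrib\<close>)
  also have "\<dots> \<le> (K * \<bar>x - y\<bar>) / sqrt r"
    using mult_left_mono[OF gauss_abs_moment_le, of "K * \<bar>x - y\<bar>"] lip_nonneg[OF assms(2)] assms(3)
    by (intro divide_right_mono) auto
  finally show "\<bar>dheat r f x - dheat r f y\<bar> \<le> K / sqrt r * \<bar>x - y\<bar>" by simp
qed

text \<open>Since \<open>z\<close> is centred, \<open>f x * z\<close> may be subtracted under the
  integral; the Lipschitz bound then supplies a factor \<open>sqrt r\<close> that cancels the
  denominator. For Lipschitz \<open>f\<close> the bound does not degenerate as \<open>r\<close>
  tends to 0.\<close>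

lemma dheat_le_lip:
  assumes "bfun C f" "lip K f" "0 < r" shows "bfun K (dheat r f)"
  unfolding bfun_def
proof (intro conjI allI)
  show "dheat r f \<in> borel_measurable borel" using bfun_dheat[OF assms(1,3)] by (rule bfunD)
  fix x
  note i = heat_integrable_mult[OF assms(1) integrable_gauss_id]
  have "(\<integral>z. f (x + sqrt r * z) * z \<partial>gauss) = (\<integral>z. f (x + sqrt r * z) * z - f x * z \<partial>gauss)"
    using i[of x "sqrt r"] by simp
  also have "\<bar>\<dots>\<bar> \<le> (\<integral>z. K * sqrt r * z\<^sup>2 \<partial>gauss)"
  proof (intro integral_gauss_abs_le)
    fix z
    have "\<bar>f (x + sqrt r * z) * z - f x * z\<bar> = \<bar>f (x + sqrt r * z) - f x\<bar> * \<bar>z\<bar>"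
      by (simp add: abs_mult[symmetric] left_diff_distrib)
    also have "\<dots> \<le> (K * \<bar>x + sqrt r * z - x\<bar>) * \<bar>z\<bar>"
      by (intro mult_right_mono lipD[OF assms(2)]) simp
    also have "\<dots> = K * sqrt r * z\<^sup>2" using assms(3) by (simp add: abs_mult power2_eq_square abs_mult_self_eq mult.assoc)
    finally show "\<bar>f (x + sqrt r * z) * z - f x * z\<bar> \<le> K * sqrt r * z\<^sup>2" .
  qed (use i in auto)
  also have "\<dots> = K * sqrt r" by simp
  finally show "\<bar>dheat r f x\<bar> \<le> K" using assms(3) by (simp add: dheat_def field_simps)
qed

text \<open>In the unit \<open>\<eta> = h / sqrt r\<close> the increment becomes a change of
  density. For |\<eta>| \<le> 1 the expansion of that density applies; for |\<eta>| > 1 each of the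
  three terms is trivially at most C \<eta>^2, which is where the factor 3 comes from.\<close>

lemma quad_dheat:
  assumes f: "bfun C f" and r: "0 < r" shows "quad (3 * C / r) (heat r f) (dheat r f)"
  unfolding quad_def
proof (intro allI)
  fix x h :: real
  note [measurable] = bfunD(1)[OF f]
  define \<eta> where "\<eta> = h / sqrt r"
  have h: "h = sqrt r * \<eta>" using r by (simp add: \<eta>_def)
  have \<eta>2: "\<eta>\<^sup>2 = h\<^sup>2 / r" using r by (simp add: \<eta>_def power_divide)
  note i = heat_integrable[OF f] heat_integrable_mult[OF f integrable_gauss_id]
  have D: "h * dheat r f x = \<eta> * (\<integral>z. f (x + sqrt r * z) * z \<partial>gauss)"
    using r by (simp add: dheat_def h)
  show "\<bar>heat r f (x + h) - heat r f x - h * dheat r f x\<bar> \<le> 3 * C / r * h\<^sup>2"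
  proof (cases "\<bar>\<eta>\<bar> \<le> 1")
    case True
    have "heat r f (x + h) = (\<integral>z. f (x + sqrt r * (z + \<eta>)) \<partial>gauss)"
      by (simp add: heat_def h algebra_simps)
    also have "\<dots> = (\<integral>z. f (x + sqrt r * z) * exp (z * \<eta> - \<eta>\<^sup>2 / 2) \<partial>gauss)"
      by (rule gauss_shift(1)[of "\<lambda>z. f (x + sqrt r * z)"]) measurable
    finally have e: "heat r f (x + h) = (\<integral>z. f (x + sqrt r * z) * exp (z * \<eta> - \<eta>\<^sup>2 / 2) \<partial>gauss)" .
    have ie: "integrable gauss (\<lambda>z. f (x + sqrt r * z) * exp (z * \<eta> - \<eta>\<^sup>2 / 2))"
      using gauss_shift(2)[of "\<lambda>z. 1" \<eta>] by (intro heat_integrable_mult[OF f]) simp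
    have "\<bar>heat r f (x + h) - heat r f x - h * dheat r f x\<bar> =
      \<bar>\<integral>z. f (x + sqrt r * z) * (exp (z * \<eta> - \<eta>\<^sup>2 / 2) - 1 - \<eta> * z) \<partial>gauss\<bar>"
      unfolding e D using i[of x "sqrt r"] ie
      by (simp add: heat_def right_diff_distrib mult.left_commute[of _ \<eta>])
    also have "\<dots> \<le> (\<integral>z. C * \<bar>exp (z * \<eta> - \<eta>\<^sup>2 / 2) - 1 - \<eta> * z\<bar> \<partial>gauss)"
      using bfunD[OF f] gauss_exponential_remainder(1)[OF True]
      by (intro integral_gauss_abs_le heat_integrable_mult[OF f]) (auto simp: abs_mult intro!: mult_right_mono)
    also have "\<dots> \<le> C * \<eta>\<^sup>2"
      using mult_left_mono[OF gauss_exponential_remainder(2)[OF True] bfunD(3)[OF f]] by simp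
    also have "\<dots> \<le> 3 * C / r * h\<^sup>2" using bfunD(3)[OF f] r by (simp add: \<eta>2 divide_right_mono)
    finally show ?thesis .
  next
    case False
    have C: "0 \<le> C" by (rule bfunD(3)[OF f])
    have "1 * \<bar>\<eta>\<bar> \<le> \<bar>\<eta>\<bar> * \<bar>\<eta>\<bar>" using False by (intro mult_right_mono) auto
    then have \<eta>: "\<bar>\<eta>\<bar> \<le> \<eta>\<^sup>2" "1 \<le> \<eta>\<^sup>2" using False by (auto simp: power2_eq_square abs_mult_self_eq)
    have "\<bar>h * dheat r f x\<bar> \<le> \<bar>h\<bar> * (C / sqrt r)"
      unfolding abs_mult by (intro mult_left_mono bfunD(2)[OF bfun_dheat[OF f r]]) simp
    also have "\<dots> = C * \<bar>\<eta>\<bar>" using r by (simp add: \<eta>_def)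
    also have "\<dots> \<le> C * \<eta>\<^sup>2" using \<eta> C by (intro mult_left_mono)
    finally have "\<bar>heat r f (x + h) - heat r f x - h * dheat r f x\<bar> \<le> C + C + C * \<eta>\<^sup>2"
      using bfunD(2)[OF bfun_heat[OF f], of r "x + h"] bfunD(2)[OF bfun_heat[OF f], of r x] by linarith
    also have "\<dots> \<le> C * \<eta>\<^sup>2 + C * \<eta>\<^sup>2 + C * \<eta>\<^sup>2"
      using mult_left_mono[OF \<eta>(2) C] by simp
    also have "\<dots> = 3 * C / r * h\<^sup>2" by (simp add: \<eta>2)
    finally show ?thesis .
  qed
qed

text \<open>Both sides are the derivative of \<open>heat (r + s) f\<close>, so uniqueness of
  derivatives replaces a computation with integrals.\<close>

lemma heat_dheat:
  assumes f: "bfun C f" and "0 \<le> r" "0 < s"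
  shows "heat r (dheat s f) = dheat (r + s) f"
proof -
  have "quad (3 * C / s) (heat r (heat s f)) (heat r (dheat s f))"
    by (rule quad_heat[OF bfun_heat[OF f] bfun_dheat[OF f] quad_dheat[OF f]]) (use assms in auto)
  moreover have "quad (3 * C / (r + s)) (heat (r + s) f) (dheat (r + s) f)"
    using assms by (intro quad_dheat[OF f]) auto
  ultimately show ?thesis using heat_heat[OF f assms(2), of s] assms(3) by (auto intro: quad_unique)
qed

text \<open>One constant for all six bounds avoids bookkeeping; what counts later is that the same
  constant serves all times of an approximate solution.\<close>

definition smooth2 :: "real \<Rightarrow> (real \<Rightarrow> real) \<Rightarrow> (real \<Rightarrow> real) \<Rightarrow> (real \<Rightarrow> real) \<Rightarrow> bool" where
  "smooth2 C f f1 f2 \<longleftrightarrow> bfun C f \<and> bfun C f1 \<and> bfun C f2 \<and> lip C f2 \<and> quad C f f1 \<and> quad C f1 f2"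

lemma smooth2_mono: "smooth2 C f f1 f2 \<Longrightarrow> C \<le> C' \<Longrightarrow> smooth2 C' f f1 f2"
  unfolding smooth2_def by (auto intro: bfun_mono lip_mono quad_mono)

lemma smooth2_add: "smooth2 C f f1 f2 \<Longrightarrow> smooth2 C' g g1 g2 \<Longrightarrow>
    smooth2 (C + C') (\<lambda>x. f x + g x) (\<lambda>x. f1 x + g1 x) (\<lambda>x. f2 x + g2 x)"
  unfolding smooth2_def by (auto intro: bfun_add lip_add quad_add)

lemma smooth2_cmult: "smooth2 C f f1 f2 \<Longrightarrow>
    smooth2 (\<bar>c\<bar> * C) (\<lambda>x. c * f x) (\<lambda>x. c * f1 x) (\<lambda>x. c * f2 x)"
  unfolding smooth2_def by (auto intro: bfun_cmult lip_cmult quad_cmult)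

lemma smooth2_heat: "smooth2 C f f1 f2 \<Longrightarrow> smooth2 C (heat r f) (heat r f1) (heat r f2)"
  unfolding smooth2_def by (auto intro: bfun_heat lip_heat quad_heat)

lemma smooth2_lip: "smooth2 C f f1 f2 \<Longrightarrow> lip C f" "smooth2 C f f1 f2 \<Longrightarrow> lip C f1"
  unfolding smooth2_def by (auto intro!: bounded_derivative_lip dest: bfunD(2))

text \<open>The time \<open>r\<close> is split into halves, and each half pays for one derivative.
  The constant \<open>C'\<close> is left uncontrolled; the second claim records the one bound that
  is needed with explicit dependence on \<open>K\<close> and \<open>r\<close>.\<close>

lemma smooth2_mollify:
  assumes f: "bfun C f" "lip K f" and r: "0 < r"
  shows "\<exists>C'. smooth2 C' (heat r f) (dheat r f) (dheat (r/2) (dheat (r/2) f))"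
    and "bfun (K / sqrt (r/2)) (dheat (r/2) (dheat (r/2) f))"
proof -
  let ?q = "dheat (r/2) f"
  have r2: "0 < r/2" using r by simp
  have q: "bfun K ?q" "lip (K / sqrt (r/2)) ?q"
    using dheat_le_lip[OF f r2] lip_dheat[OF f r2] .
  show q2: "bfun (K / sqrt (r/2)) (dheat (r/2) ?q)" by (rule dheat_le_lip[OF q r2])
  have q3: "lip (K / sqrt (r/2) / sqrt (r/2)) (dheat (r/2) ?q)" by (rule lip_dheat[OF q r2])
  have "heat (r/2) ?q = dheat r f" using heat_dheat[OF f(1) _ r2, of "r/2"] r by simp
  then have q4: "quad (3 * K / (r/2)) (dheat r f) (dheat (r/2) ?q)" using quad_dheat[OF q(1) r2] by simp
  define C' where "C' = max C (max K (max (K / sqrt (r/2)) (max (K / sqrt (r/2) / sqrt (r/2)) (max (3 * K / (r/2)) (3 * C / r)))))"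
  have "smooth2 C' (heat r f) (dheat r f) (dheat (r/2) (dheat (r/2) f))"
    unfolding smooth2_def
  proof (intro conjI)
    show "bfun C' (heat r f)" by (rule bfun_mono[OF bfun_heat[OF f(1)]]) (unfold C'_def le_max_iff_disj, blast intro: order_refl)
    show "bfun C' (dheat r f)" by (rule bfun_mono[OF dheat_le_lip[OF f r]]) (unfold C'_def le_max_iff_disj, blast intro: order_refl)
    show "bfun C' (dheat (r/2) ?q)" by (rule bfun_mono[OF q2]) (unfold C'_def le_max_iff_disj, blast intro: order_refl)
    show "lip C' (dheat (r/2) ?q)" by (rule lip_mono[OF q3]) (unfold C'_def le_max_iff_disj, blast intro: order_refl)
    show "quad C' (heat r f) (dheat r f)" by (rule quad_mono[OF quad_dheat[OF f(1) r]]) (unfold C'_def le_max_iff_disj, blast intro: order_refl)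
    show "quad C' (dheat r f) (dheat (r/2) ?q)" by (rule quad_mono[OF q4]) (unfold C'_def le_max_iff_disj, blast intro: order_refl)
  qed
  then show "\<exists>C'. smooth2 C' (heat r f) (dheat r f) (dheat (r/2) (dheat (r/2) f))" by blast
qed

text \<open>As a function of the step, the remainder has derivative
  \<open>f1 (x + t) - f1 x - t * f2 x\<close>, which \<open>quad\<close> bounds by
  \<open>C * h\<^sup>2\<close>; the mean value inequality supplies the third power.\<close>

lemma smooth2_taylor:
  assumes "smooth2 C f f1 f2"
  shows "\<bar>f (x + h) - f x - h * f1 x - h\<^sup>2 / 2 * f2 x\<bar> \<le> C * \<bar>h\<bar> ^ 3"
proof -
  have q: "quad C f f1" "quad C f1 f2" using assms by (auto simp: smooth2_def)
  define p where "p = (\<lambda>t. f (x + t) - t * f1 x - t\<^sup>2 / 2 * f2 x)"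
  have d: "(p has_real_derivative f1 (x + t) - f1 x - t * f2 x) (at t within S)" for t S
  proof -
    have 1: "((\<lambda>t. x + t) has_real_derivative 1) (at t within S)" by (auto intro!: derivative_eq_intros)
    have "((\<lambda>t. f (x + t)) has_real_derivative f1 (x + t) * 1) (at t within S)"
      by (rule DERIV_chain2[where f=f and g="\<lambda>t. x + t", OF quad_DERIV[OF q(1)] 1])
    then show ?thesis unfolding p_def by (auto intro!: derivative_eq_intros)
  qed
  have "norm (p h - p 0) \<le> (C * h\<^sup>2) * norm (h - 0)"
  proof (rule field_differentiable_bound[of "{-\<bar>h\<bar>..\<bar>h\<bar>}", OF _ d])
    fix t assume "t \<in> {-\<bar>h\<bar>..\<bar>h\<bar>}"
    then have "t\<^sup>2 \<le> h\<^sup>2" by (intro abs_le_square_iff[THEN iffD1]) auto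
    then show "norm (f1 (x + t) - f1 x - t * f2 x) \<le> C * h\<^sup>2"
      using quadD[OF q(2), of x t] mult_left_mono[of "t\<^sup>2" "h\<^sup>2" C] quad_nonneg[OF q(2)] by auto
  qed auto
  also have "p h - p 0 = f (x + h) - f x - h * f1 x - h\<^sup>2 / 2 * f2 x" by (simp add: p_def)
  also have "C * h\<^sup>2 * norm (h - 0) = C * \<bar>h\<bar> ^ 3" by (simp add: power3_eq_cube power2_eq_square abs_mult_self_eq flip: abs_mult)
  finally show ?thesis by simp
qed

text \<open>The odd term integrates to 0 and \<open>z\<^sup>2\<close> to 1, so the generator appears
  as f2/2; the error is the cubic Taylor remainder together with the bound 2 on the third absolute
  moment.\<close>

lemma heat_taylor:
  assumes "smooth2 C f f1 f2" "0 \<le> \<tau>"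
  shows "\<bar>heat \<tau> f x - f x - \<tau> / 2 * f2 x\<bar> \<le> 2 * C * \<tau> * sqrt \<tau>"
proof -
  have f: "bfun C f" using assms by (simp add: smooth2_def)
  have s: "(sqrt \<tau> * z)\<^sup>2 = \<tau> * z\<^sup>2" for z using assms(2) by (simp add: power_mult_distrib)
  have "\<bar>heat \<tau> f x - f x - \<tau> / 2 * f2 x\<bar> =
    \<bar>\<integral>z. f (x + sqrt \<tau> * z) - f x - (sqrt \<tau> * z) * f1 x - (sqrt \<tau> * z)\<^sup>2 / 2 * f2 x \<partial>gauss\<bar>"
    unfolding heat_def s using heat_integrable[OF f, of x "sqrt \<tau>"] gauss.prob_space by simp
  also have "\<dots> \<le> (\<integral>z. (C * sqrt \<tau> ^ 3) * \<bar>z\<bar> ^ 3 \<partial>gauss)"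
  proof (rule integral_gauss_abs_le)
    show "integrable gauss (\<lambda>z. f (x + sqrt \<tau> * z) - f x - (sqrt \<tau> * z) * f1 x - (sqrt \<tau> * z)\<^sup>2 / 2 * f2 x)"
      unfolding s using heat_integrable[OF f, of x "sqrt \<tau>"] by simp
    fix z show "\<bar>f (x + sqrt \<tau> * z) - f x - sqrt \<tau> * z * f1 x - (sqrt \<tau> * z)\<^sup>2 / 2 * f2 x\<bar> \<le> C * sqrt \<tau> ^ 3 * \<bar>z\<bar> ^ 3"
      using smooth2_taylor[OF assms(1), of x "sqrt \<tau> * z"] assms(2)
      by (simp add: abs_mult power_mult_distrib mult.assoc)
  qed simp
  also have "\<dots> \<le> (C * sqrt \<tau> ^ 3) * 2"
    using mult_left_mono[OF gauss_abs_third_moment_le, of "C * sqrt \<tau> ^ 3"] bfunD(3)[OF f] assms(2) by simp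
  also have "\<dots> = 2 * C * \<tau> * sqrt \<tau>" using assms(2) by (simp add: power3_eq_cube)
  finally show ?thesis .
qed

section \<open>The splitting scheme\<close>

text \<open>A Riemann sum for the integral of exp(-\<beta> r) r^(-1/2) over [0, j h]. Up to
  \<open>\<eta>\<close> the exponential is dropped and r^(-1/2) integrated; beyond
  \<open>\<eta>\<close> the root is bounded by its value there and the exponential integrated. The
  right-hand side is written so that each summand is dominated by its increment, which gives the
  induction.\<close>

lemma singular_sum_le:
  fixes h \<beta> \<eta> :: real and j :: nat
  assumes "0 < h" "0 < \<beta>" "0 < \<eta>"
  shows "(\<Sum>l=1..j. h * exp (- \<beta> * (real l * h)) / sqrt (real l * h)) \<le>
    2 * min (sqrt (j * h)) (sqrt \<eta>) + (1 - exp (- \<beta> * (j * h))) / (\<beta> * sqrt \<eta>)"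
proof (induction j)
  case (Suc j)
  let ?a = "real j * h" and ?b = "real (Suc j) * h"
  have b: "?b = ?a + h" "0 \<le> ?a" "0 < ?b" using assms by (auto simp: algebra_simps add_pos_nonneg)
  have "h * exp (- \<beta> * ?b) / sqrt ?b \<le>
     2 * (min (sqrt ?b) (sqrt \<eta>) - min (sqrt ?a) (sqrt \<eta>)) + (exp (- \<beta> * ?a) - exp (- \<beta> * ?b)) / (\<beta> * sqrt \<eta>)"
  proof (cases "?b \<le> \<eta>")
    case True
    have le: "sqrt ?a \<le> sqrt ?b" using b assms by simp
    \<comment> \<open>The discrete form of dr / sqrt r = 2 d(sqrt r).\<close>
    have "h = (sqrt ?b - sqrt ?a) * (sqrt ?b + sqrt ?a)"
      using b by (simp add: square_diff_square_factored[symmetric] mult.commute[of "sqrt _ - _"])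
    also have "\<dots> \<le> (sqrt ?b - sqrt ?a) * (2 * sqrt ?b)" using le by (intro mult_left_mono) auto
    finally have "h / sqrt ?b \<le> 2 * (sqrt ?b - sqrt ?a)" using b by (simp add: field_simps)
    moreover have "h * exp (- \<beta> * ?b) / sqrt ?b \<le> h / sqrt ?b"
      using assms b by (intro divide_right_mono) (auto simp: mult_le_cancel_left1)
    moreover have "sqrt ?a \<le> sqrt \<eta>" "sqrt ?b \<le> sqrt \<eta>" using True b assms by auto
    moreover have "0 \<le> (exp (- \<beta> * ?a) - exp (- \<beta> * ?b)) / (\<beta> * sqrt \<eta>)"
      using assms b by (intro divide_nonneg_nonneg) auto
    ultimately show ?thesis by (simp add: min_def)
  next
    case False
    have "\<beta> * h \<le> exp (\<beta> * h) - 1" using exp_ge_add_one_self[of "\<beta> * h"] by linarith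
    then have "exp (- \<beta> * ?b) * (\<beta> * h) \<le> exp (- \<beta> * ?b) * (exp (\<beta> * h) - 1)" by (intro mult_left_mono) auto
    also have "\<dots> = exp (- \<beta> * ?a) - exp (- \<beta> * ?b)"
      by (simp add: right_diff_distrib mult_exp_exp b(1)) (simp add: algebra_simps)
    finally have *: "exp (- \<beta> * ?b) * (\<beta> * h) \<le> exp (- \<beta> * ?a) - exp (- \<beta> * ?b)" .
    have "h * exp (- \<beta> * ?b) / sqrt ?b \<le> h * exp (- \<beta> * ?b) / sqrt \<eta>"
      using assms b False by (intro divide_left_mono) auto
    also have "\<dots> = exp (- \<beta> * ?b) * (\<beta> * h) / (\<beta> * sqrt \<eta>)" using assms by simp
    also have "\<dots> \<le> (exp (- \<beta> * ?a) - exp (- \<beta> * ?b)) / (\<beta> * sqrt \<eta>)"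
      using * assms by (intro divide_right_mono) auto
    finally have "h * exp (- \<beta> * ?b) / sqrt ?b \<le> (exp (- \<beta> * ?a) - exp (- \<beta> * ?b)) / (\<beta> * sqrt \<eta>)" .
    moreover have "min (sqrt ?a) (sqrt \<eta>) \<le> min (sqrt ?b) (sqrt \<eta>)"
      using b assms by (intro min.mono) auto
    moreover have "A \<le> E \<Longrightarrow> m \<le> m' \<Longrightarrow> A \<le> 2 * (m' - m) + E" for A E m m' :: real by simp
    ultimately show ?thesis by blast
  qed
  then show ?case using Suc by (simp add: diff_divide_distrib)
qed (use assms in simp)

text \<open>With \<beta> = 32 L^2 and the cut at 1/(64 L^2) either part contributes at most 1/(4 L).
  The total 1/(2 L) is what lets the sources account for only one half of the bound sought in
  \<open>lip_v1\<close>.\<close>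

lemma singular_sum_small:
  fixes h L :: real and j :: nat
  assumes "0 < h" "0 < L"
  shows "(\<Sum>l=1..j. h * exp (- (32 * L\<^sup>2) * (real l * h)) / sqrt (real l * h)) \<le> 1 / (2 * L)"
proof -
  let ?\<eta> = "(1 / (8 * L))\<^sup>2"
  have s: "sqrt ?\<eta> = 1 / (8 * L)" using assms by simp
  have "(\<Sum>l=1..j. h * exp (- (32 * L\<^sup>2) * (real l * h)) / sqrt (real l * h)) \<le>
    2 * min (sqrt (j * h)) (sqrt ?\<eta>) + (1 - exp (- (32 * L\<^sup>2) * (j * h))) / ((32 * L\<^sup>2) * sqrt ?\<eta>)"
    using assms by (intro singular_sum_le) auto
  also have "\<dots> \<le> 2 * (1 / (8 * L)) + 1 / ((32 * L\<^sup>2) * (1 / (8 * L)))"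
    unfolding s using assms by (intro add_mono divide_right_mono) auto
  also have "\<dots> = 1 / (2 * L)" using assms by (simp add: field_simps power2_eq_square)
  finally show ?thesis .
qed

text \<open>Backward in time, on a piece of length \<open>h\<close> the approximate solution starting from \<open>w\<close> is
  \<open>r \<mapsto> P\<^sub>r w + r P\<^sub>h (g \<circ> w')\<close>, where \<open>P\<close> is the heat semigroup. Regularising the source by the fixed time \<open>h\<close>
  keeps everything smooth; \<open>flow1\<close> and \<open>flow2\<close> are the two space derivatives.\<close>

definition flow0 where "flow0 g h r w w1 = (\<lambda>x. heat r w x + r * heat h (\<lambda>y. g (w1 y)) x)"
definition flow1 where "flow1 g h r w1 = (\<lambda>x. heat r w1 x + r * dheat h (\<lambda>y. g (w1 y)) x)"
definition flow2 where "flow2 g h r w1 w2 =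
  (\<lambda>x. heat r w2 x + r * dheat (h/2) (dheat (h/2) (\<lambda>y. g (w1 y))) x)"

text \<open>Pieces are counted from the terminal time. The recursion for \<open>v1\<close> comes
  before that for \<open>v0\<close> because it is closed: the driver sees only the first
  derivative.\<close>

locale splitting =
  fixes g \<phi> \<phi>1 \<phi>2 :: "real \<Rightarrow> real" and L h C0 :: real
  assumes g: "lip L g" and L: "0 < L" and h: "0 < h" and \<phi>: "smooth2 C0 \<phi> \<phi>1 \<phi>2"
begin

primrec v1 :: "nat \<Rightarrow> real \<Rightarrow> real" where
  "v1 0 = \<phi>1" | "v1 (Suc j) = flow1 g h h (v1 j)"
primrec v0 :: "nat \<Rightarrow> real \<Rightarrow> real" where
  "v0 0 = \<phi>" | "v0 (Suc j) = flow0 g h h (v0 j) (v1 j)"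
primrec v2 :: "nat \<Rightarrow> real \<Rightarrow> real" where
  "v2 0 = \<phi>2" | "v2 (Suc j) = flow2 g h h (v1 j) (v2 j)"

abbreviation "src j \<equiv> (\<lambda>y. g (v1 j y))"

lemma src_lip: "lip K (v1 j) \<Longrightarrow> lip (L * K) (src j)"
  unfolding lip_def
proof (intro allI)
  fix x y assume *: "\<forall>x y. \<bar>v1 j x - v1 j y\<bar> \<le> K * \<bar>x - y\<bar>"
  have "\<bar>g (v1 j x) - g (v1 j y)\<bar> \<le> L * \<bar>v1 j x - v1 j y\<bar>" by (rule lipD[OF g])
  also have "\<dots> \<le> L * (K * \<bar>x - y\<bar>)" using * L by (intro mult_left_mono) auto
  finally show "\<bar>g (v1 j x) - g (v1 j y)\<bar> \<le> L * K * \<bar>x - y\<bar>" by simp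
qed

lemma src_bfun: "bfun C (v1 j) \<Longrightarrow> bfun (\<bar>g 0\<bar> + L * C) (src j)"
  unfolding bfun_def
proof (intro conjI allI)
  assume *: "v1 j \<in> borel_measurable borel \<and> (\<forall>x. \<bar>v1 j x\<bar> \<le> C)"
  then show "src j \<in> borel_measurable borel" using lip_measurable[OF g] by (auto intro: measurable_compose)
  fix x
  have "\<bar>g (v1 j x) - g 0\<bar> \<le> L * \<bar>v1 j x - 0\<bar>" by (rule lipD[OF g])
  also have "\<dots> \<le> L * C" using * L by (intro mult_left_mono) auto
  finally show "\<bar>g (v1 j x)\<bar> \<le> \<bar>g 0\<bar> + L * C" by linarith
qed

text \<open>The constant may grow without control in \<open>j\<close> and in 1/h; only uniformity
  over the local time \<open>r\<close> is claimed. Control that is uniform in \<open>h\<close> is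
  the subject of \<open>lip_v1\<close>.\<close>

lemma smooth_piece:
  assumes "smooth2 C (v0 j) (v1 j) (v2 j)"
  shows "\<exists>C'. \<forall>r\<in>{0..h}. smooth2 C' (flow0 g h r (v0 j) (v1 j)) (flow1 g h r (v1 j)) (flow2 g h r (v1 j) (v2 j))"
proof -
  have b: "bfun (\<bar>g 0\<bar> + L * C) (src j)" "lip (L * C) (src j)"
    using assms src_bfun src_lip smooth2_lip(2)[OF assms] by (auto simp: smooth2_def)
  obtain C1 where C1: "smooth2 C1 (heat h (src j)) (dheat h (src j)) (dheat (h/2) (dheat (h/2) (src j)))"
    using smooth2_mollify(1)[OF b h] by auto
  have C1': "0 \<le> C1" using C1 by (auto simp: smooth2_def dest: bfunD(3))
  show ?thesis
  proof (intro exI[of _ "C + h * C1"] ballI)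
    fix r assume r: "r \<in> {0..h}"
    have "smooth2 (C + \<bar>r\<bar> * C1) (flow0 g h r (v0 j) (v1 j)) (flow1 g h r (v1 j)) (flow2 g h r (v1 j) (v2 j))"
      unfolding flow0_def flow1_def flow2_def
      by (rule smooth2_add[OF smooth2_heat[OF assms] smooth2_cmult[OF C1]])
    then show "smooth2 (C + h * C1) (flow0 g h r (v0 j) (v1 j)) (flow1 g h r (v1 j)) (flow2 g h r (v1 j) (v2 j))"
      by (rule smooth2_mono) (use r C1' in \<open>auto intro: mult_right_mono\<close>)
  qed
qed

lemma smooth_v: "\<exists>C. smooth2 C (v0 j) (v1 j) (v2 j)"
proof (induction j)
  case (Suc j)
  then obtain C where "smooth2 C (v0 j) (v1 j) (v2 j)" by auto
  from smooth_piece[OF this] h show ?case by auto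
qed (use \<phi> in auto)

lemma bfun_v1: "\<exists>C. bfun C (v1 j)" and bfun_src: "\<exists>C. bfun C (src j)"
  using smooth_v[of j] src_bfun by (auto simp: smooth2_def)

text \<open>Unrolling the recursion is what makes the Lipschitz bound on \<open>v1\<close> independent of \<open>h\<close>: the kernel \<open>1 / sqrt r\<close>
  of \<open>dheat\<close> is integrable, so a singular Gronwall argument applies.\<close>

lemma duhamel: "v1 j = (\<lambda>x. heat (j * h) \<phi>1 x + (\<Sum>i<j. h * dheat (real (j - i) * h) (src i) x))"
proof (induction j)
  case (Suc j)
  obtain Cs where Cs: "\<And>i. bfun (Cs i) (src i)" using bfun_src by metis
  have \<phi>1: "bfun C0 \<phi>1" using \<phi> by (simp add: smooth2_def)
  have bd: "bfun (\<bar>h\<bar> * (Cs i / sqrt (real (j - i) * h))) (\<lambda>x. h * dheat (real (j - i) * h) (src i) x)" if "i < j" for i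
    using that h by (intro bfun_cmult bfun_dheat Cs) auto
  have "heat h (v1 j) = (\<lambda>x. heat h (heat (j * h) \<phi>1) x + heat h (\<lambda>x. \<Sum>i<j. h * dheat (real (j - i) * h) (src i) x) x)"
    by (subst Suc, rule heat_add[OF bfun_heat[OF \<phi>1] bfun_sum[OF bd]]) simp
  also have "heat h (heat (j * h) \<phi>1) = heat (Suc j * h) \<phi>1"
    using heat_heat[OF \<phi>1, of h "j * h"] h by (simp add: algebra_simps)
  also have "heat h (\<lambda>x. \<Sum>i<j. h * dheat (real (j - i) * h) (src i) x) =
      (\<lambda>x. \<Sum>i<j. h * heat h (dheat (real (j - i) * h) (src i)) x)"
    by (subst heat_sum[OF bd]) (auto simp: heat_cmult)
  \<comment> \<open>One more averaging step prolongs each kernel by \<open>h\<close>; the new source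
    joins as the term \<open>i = j\<close>.\<close>
  also have "\<dots> = (\<lambda>x. \<Sum>i<j. h * dheat (real (Suc j - i) * h) (src i) x)"
  proof (intro ext sum.cong refl)
    fix x i assume "i \<in> {..<j}"
    then have "heat h (dheat (real (j - i) * h) (src i)) = dheat (h + real (j - i) * h) (src i)"
      using h by (intro heat_dheat[OF Cs]) auto
    also have "h + real (j - i) * h = real (Suc j - i) * h" using \<open>i \<in> {..<j}\<close> by (simp add: of_nat_diff algebra_simps)
    finally show "h * heat h (dheat (real (j - i) * h) (src i)) x = h * dheat (real (Suc j - i) * h) (src i) x" by simp
  qed
  finally show ?case by (auto simp: flow1_def)
qed auto

text \<open>Strong induction with exponential weights. After the exponential at time
  \<open>j * h\<close> is factored out, the Duhamel sum is the one bounded in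
  \<open>singular_sum_small\<close>, so the sources contribute at most \<open>C0\<close> times the
  exponential and the initial term another \<open>C0\<close>: hence the factor 2.\<close>

lemma lip_v1: "lip (2 * C0 * exp (32 * L\<^sup>2 * (j * h))) (v1 j)"
proof (induction j rule: less_induct)
  case (less j)
  let ?\<beta> = "32 * L\<^sup>2"
  obtain Cs where Cs: "\<And>i. bfun (Cs i) (src i)" using bfun_src by metis
  have \<phi>1: "bfun C0 \<phi>1" "lip C0 \<phi>1" using \<phi> smooth2_lip(2)[OF \<phi>] by (auto simp: smooth2_def)
  have C0: "0 \<le> C0" using \<phi>1 by (auto dest: bfunD)
  let ?K = "C0 + (\<Sum>i<j. \<bar>h\<bar> * (L * (2 * C0 * exp (?\<beta> * (i * h))) / sqrt (real (j - i) * h)))"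
  have "lip ?K (v1 j)"
    apply (subst duhamel)
    by (intro lip_add lip_heat[OF \<phi>1] lip_sum lip_cmult lip_dheat[OF Cs] src_lip less) (use h in auto)
  moreover have "?K \<le> 2 * C0 * exp (?\<beta> * (j * h))"
  proof -
    have "(\<Sum>i<j. \<bar>h\<bar> * (L * (2 * C0 * exp (?\<beta> * (i * h))) / sqrt (real (j - i) * h))) =
       (\<Sum>l=1..j. \<bar>h\<bar> * (L * (2 * C0 * exp (?\<beta> * ((j - l) * h))) / sqrt (real l * h)))"
      by (rule sum.reindex_bij_witness[where i="\<lambda>l. j - l" and j="\<lambda>i. j - i"]) auto
    also have "\<dots> = (\<Sum>l=1..j. (2 * C0 * L * exp (?\<beta> * (j * h))) * (h * exp (- ?\<beta> * (l * h)) / sqrt (l * h)))"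
    proof (rule sum.cong[OF refl])
      fix l assume "l \<in> {1..j}"
      then have "exp (?\<beta> * (real (j - l) * h)) = exp (?\<beta> * (j * h)) * exp (- ?\<beta> * (l * h))"
        by (simp add: mult_exp_exp of_nat_diff) (simp add: algebra_simps)
      then show "\<bar>h\<bar> * (L * (2 * C0 * exp (?\<beta> * ((j - l) * h))) / sqrt (real l * h)) =
         (2 * C0 * L * exp (?\<beta> * (j * h))) * (h * exp (- ?\<beta> * (l * h)) / sqrt (l * h))" using h by simp
    qed
    also have "\<dots> = (2 * C0 * L * exp (?\<beta> * (j * h))) * (\<Sum>l=1..j. h * exp (- ?\<beta> * (l * h)) / sqrt (l * h))"
      by (simp only: sum_distrib_left)
    also have "\<dots> \<le> (2 * C0 * L * exp (?\<beta> * (j * h))) * (1 / (2 * L))"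
      using singular_sum_small[OF h L, of j] C0 L by (intro mult_left_mono) auto
    also have "\<dots> = C0 * exp (?\<beta> * (j * h))" using L by simp
    finally have "?K \<le> C0 * 1 + C0 * exp (?\<beta> * (j * h))" by simp
    also have "C0 * 1 \<le> C0 * exp (?\<beta> * (j * h))" using C0 h L by (intro mult_left_mono) auto
    finally show ?thesis by simp
  qed
  ultimately show ?case by (rule lip_mono)
qed

section \<open>Errors inside one piece\<close>

abbreviation "w0 j r \<equiv> flow0 g h r (v0 j) (v1 j)"
abbreviation "w1 j r \<equiv> flow1 g h r (v1 j)"
abbreviation "w2 j r \<equiv> flow2 g h r (v1 j) (v2 j)"
abbreviation "ham j r x \<equiv> w2 j r x / 2 + g (w1 j r x)"

text \<open>Three replacements are paid for: the smoothed source instead of the source, the slope at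
  local time \<open>r\<close> instead of the one at the node inside \<open>g\<close>, and the second
  derivative of the source term. Each costs \<open>sqrt h\<close> times a multiple of the Lipschitz
  bound \<open>A\<close>. The uncontrolled \<open>C\<close> enters only with
  \<open>\<tau> * sqrt \<tau>\<close> and is defeated later by short time steps.\<close>

lemma consistency_piece:
  assumes A: "lip A (v1 j)" and C: "smooth2 C (v0 j) (v1 j) (v2 j)"
    and r: "0 \<le> r" "0 \<le> \<tau>" "r + \<tau> \<le> h" and h1: "h \<le> 1"
  shows "\<bar>w0 j (r + \<tau>) x - w0 j r x - \<tau> * ham j r x\<bar> \<le> \<tau> * (sqrt h * (A * (3 * L + L\<^sup>2))) + 2 * C * \<tau> * sqrt \<tau>"
proof -
  have v: "bfun C (v0 j)" "bfun C (v1 j)" "bfun C (v2 j)" using C by (auto simp: smooth2_def)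
  obtain Cs where s: "bfun Cs (src j)" "lip (L * A) (src j)" using bfun_src src_lip[OF A] by blast
  have A0: "0 \<le> A" by (rule lip_nonneg[OF A])
  have rs: "r \<le> sqrt h * sqrt h" "sqrt r \<le> sqrt h" using r h by auto
  \<comment> \<open>The second derivative of the mollified source is of size 1/sqrt h; its prefactor
    \<open>r \<le> h\<close> brings this back to \<open>sqrt h\<close>.\<close>
  have h2: "r * (1 / sqrt (h/2)) \<le> 2 * sqrt h"
  proof -
    have "r * (1 / sqrt (h/2)) = r * sqrt 2 / sqrt h" by (simp add: real_sqrt_divide)
    also have "\<dots> \<le> (sqrt h * sqrt h) * 2 / sqrt h"
      using rs h r real_sqrt_le_mono[of 2 4] by (intro divide_right_mono mult_mono) auto
    also have "\<dots> = 2 * (h / sqrt h)" using h by simp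
    also have "\<dots> = 2 * sqrt h" using h by (simp add: real_div_sqrt)
    finally show ?thesis .
  qed
  have hh: "h \<le> sqrt h" using h h1 real_sqrt_le_mono[of h 1] mult_right_mono[of "sqrt h" 1 "sqrt h"] by simp
  have 1: "\<bar>r * dheat (h/2) (dheat (h/2) (src j)) x\<bar> \<le> 2 * sqrt h * (L * A)"
  proof -
    have "\<bar>r * dheat (h/2) (dheat (h/2) (src j)) x\<bar> \<le> r * (L * A / sqrt (h/2))"
      unfolding abs_mult using r bfunD(2)[OF smooth2_mollify(2)[OF s h], of x] by (intro mult_mono) auto
    also have "\<dots> = (r * (1 / sqrt (h/2))) * (L * A)" by simp
    also have "\<dots> \<le> 2 * sqrt h * (L * A)" using A0 L h2 by (intro mult_right_mono) auto
    finally show ?thesis .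
  qed
  have 2: "\<bar>w1 j r x - v1 j x\<bar> \<le> sqrt h * A + sqrt h * (L * A)"
  proof -
    have "\<bar>heat r (v1 j) x - v1 j x\<bar> \<le> A * sqrt r" by (rule heat_near[OF v(2) A r(1)])
    also have "\<dots> \<le> A * sqrt h" using A0 rs by (intro mult_left_mono)
    finally have a: "\<bar>heat r (v1 j) x - v1 j x\<bar> \<le> A * sqrt h" .
    have "\<bar>r * dheat h (src j) x\<bar> \<le> sqrt h * (L * A)"
      unfolding abs_mult using r hh bfunD(2)[OF dheat_le_lip[OF s h], of x] by (intro mult_mono) auto
    then show ?thesis using a unfolding flow1_def by (simp add: mult.commute)
  qed
  have 3: "\<bar>heat h (src j) x - src j x\<bar> \<le> sqrt h * (L * A)"
    using heat_near[OF s, of h x] h by (simp add: mult.commute)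
  have 4: "\<bar>g (w1 j r x) - g (v1 j x)\<bar> \<le> L * (sqrt h * A + sqrt h * (L * A))"
    using lipD[OF g, of "w1 j r x" "v1 j x"] mult_left_mono[OF 2, of L] L by linarith
  have 5: "\<bar>heat r (v2 j) x / 2 + heat h (src j) x - ham j r x\<bar> \<le> sqrt h * (A * (3 * L + L\<^sup>2))"
  proof -
    have "heat r (v2 j) x / 2 + heat h (src j) x - ham j r x =
      - (r * dheat (h/2) (dheat (h/2) (src j)) x / 2) + (heat h (src j) x - src j x) - (g (w1 j r x) - g (v1 j x))"
      by (simp add: flow2_def add_divide_distrib)
    also have "\<bar>\<dots>\<bar> \<le> sqrt h * (L * A) + sqrt h * (L * A) + L * (sqrt h * A + sqrt h * (L * A))"
      using 1 3 4 by linarith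
    also have "\<dots> = sqrt h * (A * (3 * L + L\<^sup>2))" by (simp add: algebra_simps power2_eq_square)
    finally show ?thesis .
  qed
  have hr: "heat (r + \<tau>) (v0 j) = heat \<tau> (heat r (v0 j))"
    using heat_heat[OF v(1) r(2) r(1)] by (simp add: add.commute)
  have 6: "\<bar>heat (r + \<tau>) (v0 j) x - heat r (v0 j) x - \<tau> / 2 * heat r (v2 j) x\<bar> \<le> 2 * C * \<tau> * sqrt \<tau>"
    unfolding hr by (rule heat_taylor[OF smooth2_heat[OF C] r(2)])
  have "w0 j (r + \<tau>) x - w0 j r x - \<tau> * ham j r x =
     (heat (r + \<tau>) (v0 j) x - heat r (v0 j) x - \<tau> / 2 * heat r (v2 j) x)
     + \<tau> * (heat r (v2 j) x / 2 + heat h (src j) x - ham j r x)"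
    unfolding flow0_def by (simp add: algebra_simps)
  moreover have "\<bar>\<tau> * (heat r (v2 j) x / 2 + heat h (src j) x - ham j r x)\<bar> \<le> \<tau> * (sqrt h * (A * (3 * L + L\<^sup>2)))"
    unfolding abs_mult using 5 r by (intro mult_mono) auto
  ultimately show ?thesis using 6 by linarith
qed

text \<open>Serves the Hoelder bound on the slope in \<open>approx_sol\<close> and the crossing of a
  node, where the Hamiltonian at the start of a step is compared with the one at the node. The
  constant may depend on \<open>h\<close>.\<close>

lemma time_continuity_piece:
  assumes C: "smooth2 C (v0 j) (v1 j) (v2 j)" and h1: "h \<le> 1"
  shows "\<exists>M. \<forall>r \<tau> x. 0 \<le> r \<longrightarrow> 0 \<le> \<tau> \<longrightarrow> r + \<tau> \<le> h \<longrightarrow>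
    \<bar>w1 j (r + \<tau>) x - w1 j r x\<bar> \<le> M * sqrt \<tau> \<and> \<bar>ham j (r + \<tau>) x - ham j r x\<bar> \<le> M * sqrt \<tau>"
proof -
  have v: "bfun C (v1 j)" "bfun C (v2 j)" "lip C (v1 j)" "lip C (v2 j)"
    using C smooth2_lip(2)[OF C] by (auto simp: smooth2_def)
  have s: "bfun (\<bar>g 0\<bar> + L * C) (src j)" "lip (L * C) (src j)" using src_bfun v src_lip by auto
  obtain C1 where C1: "smooth2 C1 (heat h (src j)) (dheat h (src j)) (dheat (h/2) (dheat (h/2) (src j)))"
    using smooth2_mollify(1)[OF s h] by auto
  have d: "\<bar>dheat h (src j) x\<bar> \<le> C1" "\<bar>dheat (h/2) (dheat (h/2) (src j)) x\<bar> \<le> C1" "0 \<le> C1" for x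
    using C1 unfolding smooth2_def by (auto dest: bfunD)
  show ?thesis
  proof (intro exI[of _ "(C + C1) + (C + C1) * L"] allI impI)
    fix r \<tau> x :: real assume r: "0 \<le> r" "0 \<le> \<tau>" "r + \<tau> \<le> h"
    have t: "\<tau> \<le> sqrt \<tau>" using r h1 real_sqrt_le_mono[of \<tau> 1] mult_right_mono[of "sqrt \<tau>" 1 "sqrt \<tau>"] by simp
    have near: "\<bar>(heat (r + \<tau>) f x + (r + \<tau>) * q) - (heat r f x + r * q)\<bar> \<le> (C + C1) * sqrt \<tau>"
      if "bfun C f" "lip C f" "\<bar>q\<bar> \<le> C1" for f q
    proof -
      have "heat (r + \<tau>) f = heat \<tau> (heat r f)"
        using heat_heat[OF that(1) r(2) r(1)] by (simp add: add.commute)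
      then have "\<bar>heat (r + \<tau>) f x - heat r f x\<bar> \<le> C * sqrt \<tau>"
        using heat_near[OF bfun_heat[OF that(1)] lip_heat[OF that(1,2)] r(2)] by simp
      moreover have "\<bar>\<tau> * q\<bar> \<le> C1 * sqrt \<tau>"
        unfolding abs_mult using t that(3) r d(3) by (subst mult.commute, intro mult_mono) auto
      ultimately show ?thesis by (simp add: algebra_simps)
    qed
    have 1: "\<bar>w1 j (r + \<tau>) x - w1 j r x\<bar> \<le> (C + C1) * sqrt \<tau>"
      unfolding flow1_def by (rule near[OF v(1,3) d(1)])
    have 2: "\<bar>w2 j (r + \<tau>) x - w2 j r x\<bar> \<le> (C + C1) * sqrt \<tau>"
      unfolding flow2_def by (rule near[OF v(2,4) d(2)])
    have 3: "\<bar>g (w1 j (r + \<tau>) x) - g (w1 j r x)\<bar> \<le> (C + C1) * L * sqrt \<tau>"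
      using order_trans[OF lipD[OF g] mult_left_mono[OF 1, of L]] L by (simp add: ac_simps)
    have C0: "0 \<le> C" "0 \<le> (C + C1) * L * sqrt \<tau>" "0 \<le> (C + C1) * sqrt \<tau>" using v d(3) L r by (auto dest: bfunD)
    have "\<bar>ham j (r + \<tau>) x - ham j r x\<bar> \<le> (C + C1) * sqrt \<tau> + (C + C1) * L * sqrt \<tau>"
      using 2 3 C0 by (simp add: abs_le_iff)
    then show "\<bar>w1 j (r + \<tau>) x - w1 j r x\<bar> \<le> ((C + C1) + (C + C1) * L) * sqrt \<tau> \<and>
      \<bar>ham j (r + \<tau>) x - ham j r x\<bar> \<le> ((C + C1) + (C + C1) * L) * sqrt \<tau>"
      using 1 C0 by (auto simp: distrib_right)
  qed
qed

end

section \<open>Approximate solutions of the parabolic equation\<close>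

text \<open>Smooth \<open>\<epsilon>\<close>-approximate solutions of \<open>\<partial>\<^sub>t u + u'' / 2 + g u' = 0\<close>, \<open>u 1 = \<phi>\<close>.\<close>

definition approx_sol where
  "approx_sol g \<epsilon> \<phi> C d u u1 u2 \<longleftrightarrow> 0 < d \<and>
     (\<forall>t\<in>{0..1}. smooth2 C (u t) (u1 t) (u2 t)) \<and> (\<forall>x. \<bar>u 1 x - \<phi> x\<bar> \<le> \<epsilon>) \<and>
     (\<forall>s\<in>{0..1}. \<forall>t\<in>{0..1}. s \<le> t \<longrightarrow> t - s \<le> d \<longrightarrow>
        (\<forall>x. \<bar>u s x - u t x - (t - s) * (u2 t x / 2 + g (u1 t x))\<bar> \<le> \<epsilon> * (t - s) \<and>
             \<bar>u1 s x - u1 t x\<bar> \<le> C * sqrt (t - s)))"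
  for g :: "real \<Rightarrow> real" and u u1 u2 :: "real \<Rightarrow> real \<Rightarrow> real"

lemma finite_uniform_bound:
  fixes P :: "nat \<Rightarrow> real \<Rightarrow> bool"
  assumes "\<And>j. \<exists>C. P j C" "\<And>j C C'. P j C \<Longrightarrow> C \<le> C' \<Longrightarrow> P j C'"
  shows "\<exists>C\<ge>0. \<forall>j\<le>J. P j C"
proof -
  obtain Cs where Cs: "\<And>j. P j (Cs j)" using assms(1) by metis
  have "Cs j \<le> (\<Sum>i\<le>J. \<bar>Cs i\<bar>)" if "j \<le> J" for j
    using member_le_sum[of j "{..J}" "\<lambda>i. \<bar>Cs i\<bar>"] that by auto
  then show ?thesis using assms(2)[OF Cs] by (intro exI[of _ "\<Sum>i\<le>J. \<bar>Cs i\<bar>"]) (auto intro: sum_nonneg)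
qed

section \<open>Gluing the pieces into one approximate solution\<close>

context splitting begin

text \<open>The argument \<open>T\<close> is the time left until 1, and \<open>rest T\<close> the
  local time inside the piece reached.\<close>

definition piece :: "real \<Rightarrow> nat" where "piece T = nat \<lfloor>T / h\<rfloor>"
definition rest :: "real \<Rightarrow> real" where "rest T = T - real (piece T) * h"

lemma piece:
  assumes "0 \<le> T" shows "T = real (piece T) * h + rest T" "0 \<le> rest T" "rest T \<le> h" "rest T < h"
proof -
  have e: "real (piece T) = of_int \<lfloor>T / h\<rfloor>" using assms h by (simp add: piece_def)
  have "of_int \<lfloor>T / h\<rfloor> * h \<le> T" using h by (simp add: pos_le_divide_eq[symmetric])
  moreover have "T < (of_int \<lfloor>T / h\<rfloor> + 1) * h" using h by (simp add: pos_divide_less_eq[symmetric])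
  ultimately show "T = real (piece T) * h + rest T" "0 \<le> rest T" "rest T \<le> h" "rest T < h"
    by (auto simp: rest_def e algebra_simps)
qed

lemma piece_le: "0 \<le> T \<Longrightarrow> T \<le> 1 \<Longrightarrow> real (piece T) * h \<le> 1"
  using piece(1,2)[of T] by linarith

text \<open>Because the step is shorter than \<open>h\<close>, it meets at most one node; these are
  the two cases of \<open>approximate_solution\<close>.\<close>

lemma consecutive_pieces:
  assumes "0 \<le> T" "0 \<le> \<tau>" "\<tau> < h"
  shows "piece (T + \<tau>) = piece T \<and> rest (T + \<tau>) = rest T + \<tau> \<or>
     piece (T + \<tau>) = Suc (piece T) \<and> (h - rest T) + rest (T + \<tau>) = \<tau>"
proof -
  note p = piece[OF assms(1)] and q = piece[of "T + \<tau>"]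
  have "real (piece (T + \<tau>)) * h < (real (piece T) + 2) * h" "real (piece T) * h < (real (piece (T + \<tau>)) + 1) * h"
    using p q assms by (auto simp: algebra_simps)
  then have "real (piece (T + \<tau>)) < real (piece T) + 2" "real (piece T) < real (piece (T + \<tau>)) + 1"
    using h mult_less_cancel_right_pos by blast+
  then have "piece (T + \<tau>) = piece T \<or> piece (T + \<tau>) = Suc (piece T)" by linarith
  then show ?thesis
  proof
    assume *: "piece (T + \<tau>) = piece T"
    then have "rest (T + \<tau>) = rest T + \<tau>" by (simp add: rest_def)
    then show ?thesis using * by auto
  next
    assume *: "piece (T + \<tau>) = Suc (piece T)"
    then have "(h - rest T) + rest (T + \<tau>) = \<tau>" by (simp add: rest_def algebra_simps)
    then show ?thesis using * by auto
  qed
qed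

lemma node:
  "w0 (Suc j) 0 = w0 j h" "w1 (Suc j) 0 = w1 j h" "w2 (Suc j) 0 = w2 j h"
  by (simp_all add: flow0_def[of _ _ 0] flow1_def[of _ _ 0] flow2_def[of _ _ 0])

text \<open>The error has a part of order \<open>sqrt h\<close>, made at most
  \<open>\<epsilon>\<close> by \<open>small\<close>, and a part of order \<open>C * sqrt d\<close>,
  made at most \<open>\<epsilon>\<close> by choosing the admissible step \<open>d\<close> after
  \<open>h\<close> and hence after \<open>C\<close>. This is why \<open>approx_sol\<close> carries
  its own \<open>d\<close>.\<close>

lemma approximate_solution:
  assumes h1: "h \<le> 1" and \<epsilon>: "\<epsilon> > 0" and small: "sqrt h * (2 * C0 * exp (32 * L\<^sup>2) * (3 * L + L\<^sup>2)) \<le> \<epsilon>"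
  shows "\<exists>C d u u1 u2. approx_sol g (2 * \<epsilon>) \<phi> C d u u1 u2"
proof -
  define J where "J = nat \<lceil>1 / h\<rceil>"
  have J: "j \<le> J" if "real j * h \<le> 1" for j
    using that h by (simp add: J_def le_nat_iff pos_le_divide_eq[symmetric]) linarith
  let ?P1 = "\<lambda>j C. smooth2 C (v0 j) (v1 j) (v2 j)"
  let ?P2 = "\<lambda>j C. \<forall>r\<in>{0..h}. smooth2 C (w0 j r) (w1 j r) (w2 j r)"
  let ?P3 = "\<lambda>j M. \<forall>r \<tau> x. 0 \<le> r \<longrightarrow> 0 \<le> \<tau> \<longrightarrow> r + \<tau> \<le> h \<longrightarrow>
    \<bar>w1 j (r + \<tau>) x - w1 j r x\<bar> \<le> M * sqrt \<tau> \<and> \<bar>ham j (r + \<tau>) x - ham j r x\<bar> \<le> M * sqrt \<tau>"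
  have "\<exists>C\<ge>0. \<forall>j\<le>J. ?P1 j C \<and> ?P2 j C \<and> ?P3 j C"
  proof (rule finite_uniform_bound)
    fix j
    obtain Ca where a: "?P1 j Ca" using smooth_v by blast
    obtain Cb where b: "?P2 j Cb" using smooth_piece[OF a] by blast
    obtain Cc where c: "?P3 j Cc" using time_continuity_piece[OF a h1] by blast
    let ?C = "max Ca (max Cb Cc)"
    have "?P1 j ?C" by (rule smooth2_mono[OF a]) simp
    moreover have "?P2 j ?C" using smooth2_mono[of Cb _ _ _ ?C] b by fastforce
    moreover have "?P3 j ?C"
    proof -
      have "Cc * sqrt \<tau> \<le> ?C * sqrt \<tau>" if "0 \<le> \<tau>" for \<tau> using that by (intro mult_right_mono) auto
      then show ?thesis using c by (meson order_trans)
    qed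
    ultimately show "\<exists>C. ?P1 j C \<and> ?P2 j C \<and> ?P3 j C" by blast
  next
    fix j C C' assume *: "?P1 j C \<and> ?P2 j C \<and> ?P3 j C" "C \<le> C'"
    have "C * sqrt \<tau> \<le> C' * sqrt \<tau>" if "0 \<le> \<tau>" for \<tau> using that * by (intro mult_right_mono) auto
    then have "?P3 j C'" using conjunct2[OF conjunct2[OF *(1)]] by (meson order_trans)
    moreover have "?P1 j C'" by (rule smooth2_mono[OF _ *(2)]) (use *(1) in blast)
    moreover have "?P2 j C'"
    proof
      fix r assume "r \<in> {0..h}"
      then show "smooth2 C' (w0 j r) (w1 j r) (w2 j r)" using *(1) by (intro smooth2_mono[OF _ *(2)]) blast
    qed
    ultimately show "?P1 j C' \<and> ?P2 j C' \<and> ?P3 j C'" by (intro conjI)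
  qed
  then obtain C where C0: "C \<ge> 0" and "\<forall>j\<le>J. ?P1 j C \<and> ?P2 j C \<and> ?P3 j C" by (elim exE conjE)
  note CC = this(2)[THEN spec, THEN mp, OF J]
  note C = CC[THEN conjunct1] CC[THEN conjunct2, THEN conjunct1] CC[THEN conjunct2, THEN conjunct2]
  have cons: "\<bar>w0 j (r + \<tau>) x - w0 j r x - \<tau> * ham j r x\<bar> \<le> \<tau> * \<epsilon> + 2 * C * \<tau> * sqrt \<tau>"
    if j: "real j * h \<le> 1" and r: "0 \<le> r" "0 \<le> \<tau>" "r + \<tau> \<le> h" for j r \<tau> x
  proof -
    have C0p: "0 \<le> C0" using \<phi> by (auto simp: smooth2_def dest: bfunD(3))
    have "lip (2 * C0 * exp (32 * L\<^sup>2)) (v1 j)"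
      by (rule lip_mono[OF lip_v1]) (use j C0p in \<open>auto intro!: mult_left_mono mult_left_le\<close>)
    from consistency_piece[OF this C(1)[OF j] r h1, of x] mult_left_mono[OF small r(2)]
    show ?thesis by linarith
  qed
  \<comment> \<open>\<open>h / 2\<close> makes a step cross at most one node. The second entry
    absorbs \<open>3 * C * sqrt d\<close>: 2 C comes from the Taylor errors and C from replacing the
    Hamiltonian at a node by the one at the start of the step.\<close>
  define d where "d = min (h / 2) ((\<epsilon> / (3 * C + 1))\<^sup>2)"
  have d: "0 < d" "d < h" using \<epsilon> h C0 by (auto simp: d_def)
  have ds: "3 * C * sqrt d \<le> \<epsilon>"
  proof -
    have "sqrt d \<le> \<epsilon> / (3 * C + 1)" using \<epsilon> C0 by (intro real_le_lsqrt) (auto simp: d_def)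
    then have "(3 * C + 1) * sqrt d \<le> \<epsilon>" using C0 by (simp add: pos_le_divide_eq mult.commute)
    moreover have "3 * C * sqrt d \<le> (3 * C + 1) * sqrt d" using d by (intro mult_right_mono) auto
    ultimately show ?thesis by linarith
  qed
  define U0 where "U0 T = w0 (piece T) (rest T)" for T
  define U1 where "U1 T = w1 (piece T) (rest T)" for T
  define U2 where "U2 T = w2 (piece T) (rest T)" for T
  have main: "\<bar>U0 (T + \<tau>) x - U0 T x - \<tau> * (U2 T x / 2 + g (U1 T x))\<bar> \<le> \<tau> * \<epsilon> + 3 * C * \<tau> * sqrt \<tau> \<and>
     \<bar>U1 (T + \<tau>) x - U1 T x\<bar> \<le> 2 * C * sqrt \<tau>"
    if T: "0 \<le> T" "0 \<le> \<tau>" "T + \<tau> \<le> 1" "\<tau> < h" for T \<tau> x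
    using consecutive_pieces[OF T(1,2,4)]
  proof
    let ?j = "piece T"
    have j: "real ?j * h \<le> 1" using piece_le[of T] T by auto
    assume *: "piece (T + \<tau>) = piece T \<and> rest (T + \<tau>) = rest T + \<tau>"
    have r: "0 \<le> rest T" "rest T + \<tau> \<le> h" using piece[of T] piece[of "T + \<tau>"] T * by auto
    have "C * \<tau> * sqrt \<tau> \<ge> 0" "C * sqrt \<tau> \<ge> 0" using C0 T by auto
    then show ?thesis
      unfolding U0_def U1_def U2_def using * cons[OF j r(1) T(2) r(2), of x] C(3)[OF j, rule_format, OF r(1) T(2) r(2), of x] by auto
  next
    let ?j = "piece T" and ?a = "h - rest T" and ?b = "rest (T + \<tau>)"
    assume *: "piece (T + \<tau>) = Suc (piece T) \<and> (h - rest T) + rest (T + \<tau>) = \<tau>"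
    have j: "real ?j * h \<le> 1" and sj: "real (Suc ?j) * h \<le> 1" using piece_le[of T] piece_le[of "T + \<tau>"] T * by auto
    have r: "0 \<le> rest T" "0 \<le> ?a" "rest T + ?a \<le> h" "0 \<le> ?b" "0 + ?b \<le> h" using piece[of T] piece[of "T + \<tau>"] T by auto
    have 1: "\<bar>w0 ?j h x - w0 ?j (rest T) x - ?a * ham ?j (rest T) x\<bar> \<le> ?a * \<epsilon> + 2 * C * ?a * sqrt ?a"
      using cons[OF j r(1,2,3), of x] by simp
    have 2: "\<bar>w0 (Suc ?j) ?b x - w0 ?j h x - ?b * ham ?j h x\<bar> \<le> ?b * \<epsilon> + 2 * C * ?b * sqrt ?b"
      using cons[OF sj order_refl r(4,5), of x] unfolding node by simp
    have 3: "\<bar>w1 ?j h x - w1 ?j (rest T) x\<bar> \<le> C * sqrt ?a" "\<bar>ham ?j h x - ham ?j (rest T) x\<bar> \<le> C * sqrt ?a"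
      using C(3)[OF j, rule_format, OF r(1,2,3), of x] by auto
    have 4: "\<bar>w1 (Suc ?j) ?b x - w1 ?j h x\<bar> \<le> C * sqrt ?b"
      using C(3)[OF sj, rule_format, OF order_refl r(4,5), of x] unfolding node by simp
    have "?a \<le> \<tau>" "?b \<le> \<tau>" using * r by linarith+
    then have sq: "sqrt ?a \<le> sqrt \<tau>" "sqrt ?b \<le> sqrt \<tau>" by auto
    have "C * ?a * sqrt ?a \<le> C * ?a * sqrt \<tau>" "C * ?b * sqrt ?b \<le> C * ?b * sqrt \<tau>"
       "?b * (C * sqrt ?a) \<le> ?b * (C * sqrt \<tau>)" "?b * (C * sqrt \<tau>) \<le> \<tau> * (C * sqrt \<tau>)"
       "C * sqrt ?a \<le> C * sqrt \<tau>" "C * sqrt ?b \<le> C * sqrt \<tau>"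
      using C0 r sq \<open>?b \<le> \<tau>\<close> T by (auto intro!: mult_left_mono mult_right_mono)
    note m = this
    have 5: "\<bar>?b * (ham ?j h x - ham ?j (rest T) x)\<bar> \<le> ?b * (C * sqrt ?a)"
      unfolding abs_mult using 3 r by (intro mult_mono) auto
    have tt: "?a * \<epsilon> + ?b * \<epsilon> = \<tau> * \<epsilon>" "C * ?a * sqrt \<tau> + C * ?b * sqrt \<tau> = C * \<tau> * sqrt \<tau>"
      "?a * ham ?j (rest T) x + ?b * ham ?j (rest T) x = \<tau> * ham ?j (rest T) x"
      using * by (auto simp: distrib_right[symmetric] distrib_left[symmetric])
    \<comment> \<open>The increment is split at the node; its second half is expanded there, and the
      Hamiltonian of that half is moved back to the start of the step.\<close>
    have "w0 (Suc ?j) ?b x - w0 ?j (rest T) x - \<tau> * ham ?j (rest T) x =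
       (w0 ?j h x - w0 ?j (rest T) x - ?a * ham ?j (rest T) x) + (w0 (Suc ?j) ?b x - w0 ?j h x - ?b * ham ?j h x)
       + ?b * (ham ?j h x - ham ?j (rest T) x)"
      unfolding right_diff_distrib using tt(3) by linarith
    then have "\<bar>w0 (Suc ?j) ?b x - w0 ?j (rest T) x - \<tau> * ham ?j (rest T) x\<bar> \<le>
      (?a * \<epsilon> + 2 * C * ?a * sqrt ?a) + (?b * \<epsilon> + 2 * C * ?b * sqrt ?b) + ?b * (C * sqrt ?a)"
      using 1 2 5 by linarith
    also have "\<dots> \<le> \<tau> * \<epsilon> + 3 * C * \<tau> * sqrt \<tau>"
    proof -
      have "?b * (C * sqrt ?a) \<le> C * \<tau> * sqrt \<tau>" using m by (simp add: mult.commute mult.left_commute)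
      then show ?thesis using m tt by linarith
    qed
    finally have "\<bar>w0 (Suc ?j) ?b x - w0 ?j (rest T) x - \<tau> * ham ?j (rest T) x\<bar> \<le> \<tau> * \<epsilon> + 3 * C * \<tau> * sqrt \<tau>" .
    moreover have "\<bar>w1 (Suc ?j) ?b x - w1 ?j (rest T) x\<bar> \<le> 2 * C * sqrt \<tau>" using 3 4 m by linarith
    ultimately show ?thesis unfolding U0_def U1_def U2_def using * by simp
  qed
  \<comment> \<open>Time is reversed here. The constant is doubled because a step over a node picks
    up the time modulus of the slope twice.\<close>
  have "approx_sol g (2 * \<epsilon>) \<phi> (2 * C) d (\<lambda>t. U0 (1 - t)) (\<lambda>t. U1 (1 - t)) (\<lambda>t. U2 (1 - t))"
    unfolding approx_sol_def
  proof (intro conjI ballI allI impI)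
    show "0 < d" by fact
    fix t :: real assume t: "t \<in> {0..1}"
    have "smooth2 C (U0 (1 - t)) (U1 (1 - t)) (U2 (1 - t))"
      unfolding U0_def U1_def U2_def
      using C(2)[OF piece_le[of "1 - t"]] piece[of "1 - t"] t by auto
    then show "smooth2 (2 * C) (U0 (1 - t)) (U1 (1 - t)) (U2 (1 - t))" by (rule smooth2_mono) (use C0 in simp)
  next
    fix x
    have "piece 0 = 0" "rest 0 = 0" by (simp_all add: piece_def rest_def)
    then show "\<bar>U0 (1 - 1) x - \<phi> x\<bar> \<le> 2 * \<epsilon>" using \<epsilon> by (simp add: U0_def flow0_def)
  next
    fix s t x :: real assume st: "s \<in> {0..1}" "t \<in> {0..1}" "s \<le> t" "t - s \<le> d"
    have m: "\<bar>U0 (1 - s) x - U0 (1 - t) x - (t - s) * (U2 (1 - t) x / 2 + g (U1 (1 - t) x))\<bar> \<le> (t - s) * \<epsilon> + 3 * C * (t - s) * sqrt (t - s)"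
      "\<bar>U1 (1 - s) x - U1 (1 - t) x\<bar> \<le> 2 * C * sqrt (t - s)"
      using main[of "1 - t" "t - s" x] st d by auto
    have "3 * C * sqrt (t - s) \<le> 3 * C * sqrt d" using C0 st by (intro mult_left_mono) auto
    then have "(t - s) * (3 * C * sqrt (t - s)) \<le> (t - s) * \<epsilon>" using ds st by (intro mult_left_mono) auto
    then show "\<bar>U0 (1 - s) x - U0 (1 - t) x - (t - s) * (U2 (1 - t) x / 2 + g (U1 (1 - t) x))\<bar> \<le> 2 * \<epsilon> * (t - s)"
      using m(1) by (simp add: algebra_simps)
    show "\<bar>U1 (1 - s) x - U1 (1 - t) x\<bar> \<le> 2 * C * sqrt (t - s)" by (rule m(2))
  qed
  then show ?thesis by blast
qed

end

text \<open>The limits at both infinities control the ends, compactness the middle. The middle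
  interval overlaps the ends by 1, so two points closer than 1 share one of the three
  regions.\<close>

lemma C_extended_uniformly_continuous:
  assumes "\<phi> \<in> C_extended" "0 < e"
  obtains d where "0 < d" "\<And>x y. \<bar>x - y\<bar> < d \<Longrightarrow> \<bar>\<phi> x - \<phi> y\<bar> < e"
proof -
  obtain l m where lim: "(\<phi> \<longlongrightarrow> l) at_top" "(\<phi> \<longlongrightarrow> m) at_bot" and cont: "continuous_on UNIV \<phi>"
    using assms(1) by (auto simp: C_extended_def)
  have e2: "0 < e / 2" using assms by simp
  obtain a where a: "\<And>x. a \<le> x \<Longrightarrow> \<bar>\<phi> x - l\<bar> < e / 2"
    using tendstoD[OF lim(1) e2] by (auto simp: eventually_at_top_linorder dist_real_def)
  obtain b where b: "\<And>x. x \<le> b \<Longrightarrow> \<bar>\<phi> x - m\<bar> < e / 2"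
    using tendstoD[OF lim(2) e2] by (auto simp: eventually_at_bot_linorder dist_real_def)
  have "uniformly_continuous_on {b - 1..a + 1} \<phi>"
    by (rule compact_uniformly_continuous[OF continuous_on_subset[OF cont]]) auto
  then obtain d where d: "0 < d" "\<And>x y. x \<in> {b - 1..a + 1} \<Longrightarrow> y \<in> {b - 1..a + 1} \<Longrightarrow> \<bar>x - y\<bar> < d \<Longrightarrow> \<bar>\<phi> x - \<phi> y\<bar> < e"
    using assms(2) unfolding uniformly_continuous_on_def dist_real_def by (metis abs_minus_commute)
  show thesis
  proof (rule that[of "min d 1"])
    fix x y :: real assume xy: "\<bar>x - y\<bar> < min d 1"
    then consider "a \<le> x \<and> a \<le> y" | "x \<le> b \<and> y \<le> b" | "x \<in> {b - 1..a + 1} \<and> y \<in> {b - 1..a + 1}"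
      by (auto simp: not_le) linarith
    then show "\<bar>\<phi> x - \<phi> y\<bar> < e"
    proof cases
      case 1 then show ?thesis using a[of x] a[of y] by linarith
    next
      case 2 then show ?thesis using b[of x] b[of y] by linarith
    next
      case 3 then show ?thesis using d(2)[of x y] xy by auto
    qed
  qed (use d in simp)
qed

lemma C_extended_bfun:
  assumes "\<phi> \<in> C_extended" shows "\<exists>C. bfun C \<phi>"
proof -
  obtain C where "\<And>x. \<bar>\<phi> x\<bar> \<le> C" using assms by (auto simp: C_extended_def bounded_iff)
  moreover have "\<phi> \<in> borel_measurable borel"
    using assms by (auto simp: C_extended_def intro: borel_measurable_continuous_onI)
  ultimately show ?thesis by (auto simp: bfun_def)
qed

text \<open>Uniform continuity handles displacements below \<open>d\<close>; for the others the
  bound 2 C is multiplied by \<open>r * z\<^sup>2 / d\<^sup>2\<close>, which is at least 1 there, in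
  the manner of Chebyshev. The time \<open>r\<close> is chosen so that this part integrates to at
  most e/2.\<close>

lemma C_extended_heat_near:
  assumes "\<phi> \<in> C_extended" "0 < e"
  obtains r where "0 < r" "\<And>x. \<bar>heat r \<phi> x - \<phi> x\<bar> \<le> e"
proof -
  have e2: "0 < e / 2" using assms by simp
  obtain d where d: "0 < d" "\<And>x y. \<bar>x - y\<bar> < d \<Longrightarrow> \<bar>\<phi> x - \<phi> y\<bar> < e / 2"
    using C_extended_uniformly_continuous[OF assms(1) e2] by blast
  obtain C where C: "bfun C \<phi>" using C_extended_bfun[OF assms(1)] by blast
  have C0: "0 \<le> C" by (rule bfunD(3)[OF C])
  define r where "r = d\<^sup>2 * e / (4 * C + 1)"
  have r: "0 < r" using d assms C0 by (simp add: r_def add_nonneg_pos)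
  have rC: "2 * C * r / d\<^sup>2 \<le> e / 2"
  proof -
    have "2 * C * r / d\<^sup>2 = e / 2 * (4 * C / (4 * C + 1))" using d by (simp add: r_def)
    also have "\<dots> \<le> e / 2 * 1" using C0 assms by (intro mult_left_mono) auto
    finally show ?thesis by simp
  qed
  show thesis
  proof (rule that[OF r])
    fix x
    have i: "integrable gauss (\<lambda>z. \<phi> (x + sqrt r * z))" by (rule heat_integrable[OF C])
    have "\<bar>heat r \<phi> x - \<phi> x\<bar> = \<bar>\<integral>z. \<phi> (x + sqrt r * z) - \<phi> x \<partial>gauss\<bar>"
      using i gauss.prob_space by (simp add: heat_def)
    also have "\<dots> \<le> (\<integral>z. e / 2 + (2 * C * r / d\<^sup>2) * z\<^sup>2 \<partial>gauss)"
    proof (rule integral_gauss_abs_le)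
      fix z
      show "\<bar>\<phi> (x + sqrt r * z) - \<phi> x\<bar> \<le> e / 2 + (2 * C * r / d\<^sup>2) * z\<^sup>2"
      proof (cases "\<bar>sqrt r * z\<bar> < d")
        case True
        then have "\<bar>\<phi> (x + sqrt r * z) - \<phi> x\<bar> < e / 2" by (intro d(2)) simp
        moreover have "0 \<le> (2 * C * r / d\<^sup>2) * z\<^sup>2" using C0 r by simp
        ultimately show ?thesis by linarith
      next
        case False
        then have "d\<^sup>2 \<le> (sqrt r * z)\<^sup>2" using d(1) by (intro abs_le_square_iff[THEN iffD1]) auto
        then have "1 \<le> r * z\<^sup>2 / d\<^sup>2" using r d by (simp add: power_mult_distrib)
        then have "2 * C * 1 \<le> 2 * C * (r * z\<^sup>2 / d\<^sup>2)" using C0 by (intro mult_left_mono) auto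
        moreover have "\<bar>\<phi> (x + sqrt r * z) - \<phi> x\<bar> \<le> 2 * C"
          using bfunD(2)[OF C, of "x + sqrt r * z"] bfunD(2)[OF C, of x] by linarith
        ultimately show ?thesis using assms by simp
      qed
    qed (use i in auto)
    also have "\<dots> = e / 2 + 2 * C * r / d\<^sup>2" using gauss.prob_space by simp
    also have "\<dots> \<le> e" using rC by simp
    finally show "\<bar>heat r \<phi> x - \<phi> x\<bar> \<le> e" .
  qed
qed

text \<open>The terminal function is replaced by \<open>heat r \<phi>\<close> at cost \<epsilon>/2,
  and the scheme spends the other half. Of the two half-time mollifications one produces a Lipschitz
  function, the other gives this function two controlled derivatives.\<close>

theorem approx_sol_exists:
  assumes \<phi>: "\<phi> \<in> C_extended" and g: "lip L g" and \<epsilon>: "0 < \<epsilon>"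
  shows "\<exists>C d u u1 u2. approx_sol g \<epsilon> \<phi> C d u u1 u2"
proof -
  have e2: "0 < \<epsilon> / 2" "0 < \<epsilon> / 4" using \<epsilon> by auto
  obtain r where r: "0 < r" "\<And>x. \<bar>heat r \<phi> x - \<phi> x\<bar> \<le> \<epsilon> / 2"
    using C_extended_heat_near[OF \<phi> e2(1)] by blast
  have r2: "0 < r / 2" using r by simp
  obtain C where C: "bfun C \<phi>" using C_extended_bfun[OF \<phi>] by blast
  have l: "lip (C / sqrt (r/2)) (heat (r/2) \<phi>)"
    using bounded_derivative_lip[OF quad_dheat[OF C r2]] bfunD(2)[OF bfun_dheat[OF C r2]] by blast
  obtain C0 \<phi>1 \<phi>2 where "smooth2 C0 (heat (r/2) (heat (r/2) \<phi>)) \<phi>1 \<phi>2"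
    using smooth2_mollify(1)[OF bfun_heat[OF C] l r2] by blast
  then have s: "smooth2 C0 (heat r \<phi>) \<phi>1 \<phi>2" using heat_heat[OF C, of "r/2" "r/2"] r by simp
  have C0: "0 \<le> C0" using s by (auto simp: smooth2_def dest: bfunD(3))
  \<comment> \<open>The scheme asks for a strictly positive Lipschitz constant.\<close>
  define L' where "L' = max L 1"
  have L': "0 < L'" "lip L' g" using g by (auto simp: L'_def intro: lip_mono)
  define K where "K = 2 * C0 * exp (32 * L'\<^sup>2) * (3 * L' + L'\<^sup>2)"
  have K: "0 \<le> K" using C0 L' by (simp add: K_def)
  \<comment> \<open>\<open>K\<close> depends on the mollified terminal function and on
    \<open>L'\<close> but not on \<open>h\<close>; this is what \<open>lip_v1\<close>
    achieves.\<close>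
  define h where "h = min 1 ((\<epsilon> / 4 / (K + 1))\<^sup>2)"
  have hpos: "0 < h" "h \<le> 1" using \<epsilon> K by (auto simp: h_def)
  have "sqrt h \<le> \<epsilon> / 4 / (K + 1)" using \<epsilon> K by (intro real_le_lsqrt) (auto simp: h_def)
  then have "sqrt h * (K + 1) \<le> \<epsilon> / 4" using K by (simp add: pos_le_divide_eq algebra_simps)
  then have hK: "sqrt h * K \<le> \<epsilon> / 4" using hpos by (simp add: distrib_left) (smt (verit) real_sqrt_ge_zero)
  interpret splitting g "heat r \<phi>" \<phi>1 \<phi>2 L' h C0 by unfold_locales (use L' hpos s in auto)
  obtain Ca d u u1 u2 where "approx_sol g (2 * (\<epsilon> / 4)) (heat r \<phi>) Ca d u u1 u2"
    using approximate_solution[OF hpos(2) e2(2) hK[unfolded K_def]] by blast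
  note a = this[unfolded approx_sol_def]
  have "approx_sol g \<epsilon> \<phi> Ca d u u1 u2"
    unfolding approx_sol_def
  proof (intro conjI ballI allI impI)
    show "0 < d" using a by blast
    fix t :: real assume "t \<in> {0..1}" then show "smooth2 Ca (u t) (u1 t) (u2 t)" using a by blast
  next
    fix x
    have "\<bar>u 1 x - heat r \<phi> x\<bar> \<le> 2 * (\<epsilon> / 4)" using a by blast
    then show "\<bar>u 1 x - \<phi> x\<bar> \<le> \<epsilon>" using r(2)[of x] by linarith
  next
    fix s t x :: real assume st: "s \<in> {0..1}" "t \<in> {0..1}" "s \<le> t" "t - s \<le> d"
    have "\<bar>u s x - u t x - (t - s) * (u2 t x / 2 + g (u1 t x))\<bar> \<le> 2 * (\<epsilon> / 4) * (t - s)"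
      using a st by blast
    also have "\<dots> \<le> \<epsilon> * (t - s)" using st \<epsilon> by (intro mult_right_mono) auto
    finally show "\<bar>u s x - u t x - (t - s) * (u2 t x / 2 + g (u1 t x))\<bar> \<le> \<epsilon> * (t - s)" .
    show "\<bar>u1 s x - u1 t x\<bar> \<le> Ca * sqrt (t - s)" using a st by blast
  qed
  then show ?thesis by blast
qed

section \<open>Pasting measures\<close>

locale rectangular_family =
  fixes S :: "nat \<Rightarrow> 'a set" and G :: "nat \<Rightarrow> (nat \<Rightarrow> 'a) measure"
    and \<P> :: "(nat \<Rightarrow> 'a) measure set"
    and K :: "(nat \<Rightarrow> 'a) measure \<Rightarrow> nat \<Rightarrow> (nat \<Rightarrow> 'a) \<Rightarrow> (nat \<Rightarrow> 'a) measure"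
  assumes fps: "filtered_product_space S G"
    and family: "measure_family S G \<P> K"
    and rect: "rectangular S G \<P> K"
begin

section \<open>The filtration and its description through initial segments\<close>

abbreviation "F \<equiv> filt S G"
abbreviation "FT \<equiv> filt_top S G"
abbreviation "TA \<equiv> tail_alg S G"
abbreviation "head n \<equiv> (\<lambda>w. restrict w {1..n})"
abbreviation "tail n \<equiv> (\<lambda>w. restrict w {Suc n..})"
abbreviation "glue n \<equiv> merge {1..n} {Suc n..}"

lemma space_G: "space (G n) = PiE {1..n} S"
  using fps by (simp add: filtered_product_space_def)

lemma space_F [simp]: "space (F n) = path_space S"
  by (simp add: filt_def)

lemma F_sets_path: "A \<in> sets (F n) \<Longrightarrow> A \<subseteq> path_space S"
  using sets.sets_into_space[of A "F n"] by simp

lemma space_FT [simp]: "space FT = path_space S"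
  unfolding filt_top_def by (rule space_measure_of) (auto dest: F_sets_path)

lemma F_mono: "m \<le> n \<Longrightarrow> sets (F m) \<subseteq> sets (F n)"
proof (rule lift_Suc_mono_le[of "\<lambda>n. sets (F n)"])
  show "sets (F k) \<subseteq> sets (F (Suc k))" for k using fps by (simp add: filtered_product_space_def)
qed

lemma F_le_FT: "sets (F n) \<subseteq> sets FT"
proof -
  have "sets (F (Suc n)) \<subseteq> sets FT"
    unfolding filt_top_def by (subst sets_measure_of) (auto dest: F_sets_path)
  then show ?thesis using F_mono[of n "Suc n"] by auto
qed

lemma \<P>_nonempty: "\<P> \<noteq> {}" and
  prob_\<P>: "Q \<in> \<P> \<Longrightarrow> prob_space Q" and space_\<P>: "Q \<in> \<P> \<Longrightarrow> space Q = path_space S"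
  and sets_\<P>: "Q \<in> \<P> \<Longrightarrow> sets Q = sets FT"
  and equiv_\<P>: "P \<in> \<P> \<Longrightarrow> Q \<in> \<P> \<Longrightarrow> A \<in> sets (F n) \<Longrightarrow> emeasure P A = 0 \<longleftrightarrow> emeasure Q A = 0"
  and rcp: "Q \<in> \<P> \<Longrightarrow> regular_cond_prob S G Q n (K Q n)"
  using family unfolding measure_family_def by blast+

lemma path_space_nonempty: "path_space S \<noteq> {}"
  using \<P>_nonempty prob_\<P> space_\<P> prob_space.not_empty by (metis all_not_in_conv)

lemma subalg_\<P>: "Q \<in> \<P> \<Longrightarrow> subalgebra Q (F n)"
  using F_le_FT by (simp add: subalgebra_def space_\<P> sets_\<P>)

lemma sigma_finite_subalg: "Q \<in> \<P> \<Longrightarrow> sigma_finite_subalgebra Q (F n)"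
  by (intro finite_measure_subalgebra_is_sigma_finite)
     (auto simp: finite_measure_subalgebra_def finite_measure_subalgebra_axioms_def subalg_\<P> prob_space.finite_measure prob_\<P>)

lemma measurable_F_FT: "f \<in> F n \<rightarrow>\<^sub>M N \<Longrightarrow> f \<in> FT \<rightarrow>\<^sub>M N"
  by (rule measurable_from_subalg[of FT "F n", rotated]) (simp_all add: subalgebra_def F_le_FT)

lemma measurable_F_mono: "f \<in> F m \<rightarrow>\<^sub>M N \<Longrightarrow> m \<le> n \<Longrightarrow> f \<in> F n \<rightarrow>\<^sub>M N"
  by (rule measurable_from_subalg[of "F n" "F m", rotated]) (simp_all add: subalgebra_def F_mono)

lemma measurable_\<P>: "Q \<in> \<P> \<Longrightarrow> measurable Q N = measurable FT N"
  by (rule measurable_cong_sets) (simp_all add: sets_\<P>)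

text \<open>Equivalence of the measures is available on each \<open>F n\<close> separately, which is
  why the set of good points must lie in some \<open>F n\<close>.\<close>

lemma AE_equiv:
  assumes "P \<in> \<P>" "Q \<in> \<P>" "AE w in P. R w" "{w \<in> path_space S. R w} \<in> sets (F n)"
  shows "AE w in Q. R w"
proof -
  let ?N = "{w \<in> path_space S. \<not> R w}"
  have "?N = space (F n) - {w \<in> path_space S. R w}" by auto
  then have N: "?N \<in> sets (F n)" using assms(4) by (metis sets.compl_sets)
  then have "?N \<in> sets P" "?N \<in> sets Q" using F_le_FT sets_\<P> assms by auto
  then show ?thesis
    using assms equiv_\<P>[OF assms(1,2) N] AE_iff_measurable[of ?N P R] AE_iff_measurable[of ?N Q R]
    by (simp add: space_\<P>)
qed

lemma head_measurable: "head n \<in> F n \<rightarrow>\<^sub>M G n"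
  unfolding filt_def
  by (rule measurable_vimage_algebra1) (auto simp: space_G path_space_def PiE_iff)

lemma head_measurable_FT: "head n \<in> FT \<rightarrow>\<^sub>M G n"
  by (rule measurable_F_FT[OF head_measurable])

lemma F_set_head:
  assumes "A \<in> sets (F n)" obtains A' where "A' \<in> sets (G n)" "A = {w \<in> path_space S. head n w \<in> A'}"
proof -
  have "head n \<in> path_space S \<rightarrow> space (G n)" by (auto simp: space_G path_space_def PiE_iff)
  then have "sets (F n) = {head n -` A \<inter> path_space S |A. A \<in> sets (G n)}"
    unfolding filt_def by (rule sets_vimage_algebra2)
  then show thesis using assms that by (auto simp: vimage_def Int_def conj_commute)
qed

lemma space_TA: "space (TA n) = PiE {Suc n..} S"
  unfolding tail_alg_def by (rule space_measure_of) auto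

lemma tail_measurable: "tail n \<in> FT \<rightarrow>\<^sub>M TA n"
  unfolding tail_alg_def
proof (rule measurable_measure_of)
  show "tail n \<in> space FT \<rightarrow> PiE {Suc n..} S" by (auto simp: path_space_def PiE_iff)
  fix A assume "A \<in> {A. A \<subseteq> PiE {Suc n..} S \<and> tail_cylinder S n A \<in> sets FT}"
  moreover have "tail n -` A \<inter> space FT = tail_cylinder S n A" by (auto simp: tail_cylinder_def)
  ultimately show "tail n -` A \<inter> space FT \<in> sets FT" by simp
qed auto

lemma tail_cylinder_sets: "A \<in> sets (TA n) \<Longrightarrow> tail_cylinder S n A \<in> sets FT"
  using measurable_sets[OF tail_measurable, of A n]
  by (auto simp: tail_cylinder_def vimage_def Int_def conj_commute)

lemma glue_measurable: "glue n \<in> G n \<Otimes>\<^sub>M TA n \<rightarrow>\<^sub>M FT"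
  using fps by (simp add: filtered_product_space_def)

lemma glue_head_tail: "w \<in> path_space S \<Longrightarrow> glue n (head n w, tail n w) = w"
  by (auto simp: path_space_def PiE_def extensional_def merge_def fun_eq_iff)

lemma head_glue: "y \<in> PiE {1..n} S \<Longrightarrow> head n (glue n (y, y')) = y"
  by (subst restrict_merge) (auto simp: PiE_def extensional_restrict)

lemma glue_path: "y \<in> PiE {1..n} S \<Longrightarrow> y' \<in> PiE {Suc n..} S \<Longrightarrow> glue n (y, y') \<in> path_space S"
  by (auto simp: path_space_def PiE_iff merge_def extensional_def)

section \<open>Kernels, gluing and disintegration\<close>

lemma K_measurable: "Q \<in> \<P> \<Longrightarrow> K Q n \<in> G n \<rightarrow>\<^sub>M prob_algebra FT"
  using rcp by (simp add: regular_cond_prob_def)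

text \<open>The format that \<open>P_kernel\<close> demands: a law on the remaining coordinates
  only.\<close>

definition tailK where "tailK Q n y = distr (K Q n y) (TA n) (tail n)"

lemma tailK_measurable: "Q \<in> \<P> \<Longrightarrow> tailK Q n \<in> G n \<rightarrow>\<^sub>M prob_algebra (TA n)"
  unfolding tailK_def
  by (rule measurable_compose[OF K_measurable measurable_distr_prob_space[OF tail_measurable]])

lemma emeasure_tailK:
  assumes "Q \<in> \<P>" "y \<in> PiE {1..n} S" "A \<in> sets (TA n)"
  shows "emeasure (tailK Q n y) A = emeasure (K Q n y) (tail_cylinder S n A)"
proof -
  have "K Q n y \<in> space (prob_algebra FT)"
    using measurable_space[OF K_measurable[OF assms(1)]] assms by (simp add: space_G)
  then have s: "sets (K Q n y) = sets FT" by (simp add: space_prob_algebra)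
  then have "tail n \<in> K Q n y \<rightarrow>\<^sub>M TA n" using tail_measurable by (simp cong: measurable_cong_sets)
  moreover have "tail n -` A \<inter> space (K Q n y) = tail_cylinder S n A"
    using sets_eq_imp_space_eq[OF s] by (auto simp: tail_cylinder_def)
  ultimately show ?thesis using assms by (simp add: tailK_def emeasure_distr)
qed

text \<open>The semidirect product of \<open>p\<close> and \<open>L\<close>, transported to the path
  space.\<close>

definition paste where
  "paste n p L = p \<bind> (\<lambda>y. distr (L y) FT (\<lambda>y'. glue n (y, y')))"

lemma paste_kernel:
  assumes "L \<in> G n \<rightarrow>\<^sub>M prob_algebra (TA n)"
  shows "(\<lambda>y. distr (L y) FT (\<lambda>y'. glue n (y, y'))) \<in> G n \<rightarrow>\<^sub>M subprob_algebra FT"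
  using glue_measurable by (intro measurable_distr2[where M="TA n"] measurable_prob_algebraD[OF assms]) simp

lemma L_sets:
  assumes "L \<in> G n \<rightarrow>\<^sub>M prob_algebra (TA n)" "y \<in> PiE {1..n} S"
  shows "sets (L y) = sets (TA n)" "space (L y) = PiE {Suc n..} S" "prob_space (L y)"
    "(\<lambda>y'. glue n (y, y')) \<in> L y \<rightarrow>\<^sub>M FT"
proof -
  have "L y \<in> space (prob_algebra (TA n))"
    using measurable_space[OF assms(1)] assms by (simp add: space_G)
  then show s: "sets (L y) = sets (TA n)" "prob_space (L y)" by (auto simp: space_prob_algebra)
  then show "space (L y) = PiE {Suc n..} S" using sets_eq_imp_space_eq[OF s(1)] by (simp add: space_TA)
  have "(\<lambda>y'. glue n (y, y')) \<in> TA n \<rightarrow>\<^sub>M FT"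
    by (rule measurable_compose_Pair1[OF _ glue_measurable]) (use assms in \<open>simp add: space_G\<close>)
  then show "(\<lambda>y'. glue n (y, y')) \<in> L y \<rightarrow>\<^sub>M FT" using s by (simp cong: measurable_cong_sets)
qed

lemma nn_integral_paste:
  assumes L: "L \<in> G n \<rightarrow>\<^sub>M prob_algebra (TA n)" and p: "sets p = sets (G n)" and f: "f \<in> borel_measurable FT"
  shows "(\<integral>\<^sup>+w. f w \<partial>paste n p L) = (\<integral>\<^sup>+y. (\<integral>\<^sup>+y'. f (glue n (y, y')) \<partial>L y) \<partial>p)"
  unfolding paste_def
proof (subst nn_integral_bind[OF f])
  show "(\<lambda>y. distr (L y) FT (\<lambda>y'. glue n (y, y'))) \<in> p \<rightarrow>\<^sub>M subprob_algebra FT"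
    using paste_kernel[OF L] p by (simp cong: measurable_cong_sets)
  show "(\<integral>\<^sup>+y. (\<integral>\<^sup>+w. f w \<partial>distr (L y) FT (\<lambda>y'. glue n (y, y'))) \<partial>p) = (\<integral>\<^sup>+y. (\<integral>\<^sup>+y'. f (glue n (y, y')) \<partial>L y) \<partial>p)"
  proof (rule nn_integral_cong)
    fix y assume "y \<in> space p"
    then have y: "y \<in> PiE {1..n} S" using sets_eq_imp_space_eq[OF p] by (simp add: space_G)
    show "(\<integral>\<^sup>+w. f w \<partial>distr (L y) FT (\<lambda>y'. glue n (y, y'))) = (\<integral>\<^sup>+y'. f (glue n (y, y')) \<partial>L y)"
      using f by (intro nn_integral_distr L_sets(4)[OF L y]) simp
  qed
qed

lemma kernel_integral_measurable:
  assumes L: "L \<in> G n \<rightarrow>\<^sub>M prob_algebra (TA n)" and f: "f \<in> borel_measurable FT"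
  shows "(\<lambda>y. \<integral>\<^sup>+y'. f (glue n (y, y')) \<partial>L y) \<in> borel_measurable (G n)"
proof (rule nn_integral_measurable_subprob_algebra2[OF _ measurable_prob_algebraD[OF L]])
  show "(\<lambda>(y, y'). f (glue n (y, y'))) \<in> borel_measurable (G n \<Otimes>\<^sub>M TA n)"
    using measurable_compose[OF glue_measurable f] by simp
qed

lemma sets_paste:
  assumes "space p \<noteq> {}" shows "sets (paste n p L) = sets FT"
  unfolding paste_def using assms by (subst sets_bind[of _ _ FT]) auto

lemma marg: "Q \<in> \<P> \<Longrightarrow> distr Q (G n) (head n) \<in> marginals G \<P> n"
  by (auto simp: marginals_def)

lemma nn_integral_marg:
  assumes "Q \<in> \<P>" "f \<in> borel_measurable (G n)"
  shows "(\<integral>\<^sup>+y. f y \<partial>distr Q (G n) (head n)) = (\<integral>\<^sup>+w. f (head n w) \<partial>Q)"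
  using head_measurable_FT assms by (intro nn_integral_distr) (auto simp: measurable_\<P>)

text \<open>Rectangularity speaks of events. Identifying the measure it provides with
  \<open>paste\<close> extends the formula to all nonnegative measurable functions.\<close>

lemma rectangular_paste:
  assumes Q: "Q \<in> \<P>" and L: "P_kernel S G \<P> K n L"
  shows "\<exists>P\<in>\<P>. \<forall>f\<in>borel_measurable FT.
    (\<integral>\<^sup>+w. f w \<partial>P) = (\<integral>\<^sup>+w. (\<integral>\<^sup>+y'. f (glue n (head n w, y')) \<partial>L (head n w)) \<partial>Q)"
proof -
  let ?p = "distr Q (G n) (head n)"
  have Lm: "L \<in> G n \<rightarrow>\<^sub>M prob_algebra (TA n)" using L by (simp add: P_kernel_def)
  obtain P where P: "P \<in> \<P>" and eq: "\<And>A. A \<in> sets FT \<Longrightarrow>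
    emeasure P A = (\<integral>\<^sup>+y. (\<integral>\<^sup>+y'. indicator A (glue n (y, y')) \<partial>L y) \<partial>?p)"
    using rect marg[OF Q, of n] L unfolding rectangular_def by meson
  have ne: "space ?p \<noteq> {}" using path_space_nonempty by (auto simp: space_G path_space_def PiE_eq_empty_iff)
  have "P = paste n ?p L"
  proof (rule measure_eqI)
    show "sets P = sets (paste n ?p L)" using sets_paste[OF ne] sets_\<P>[OF P] by simp
    fix A assume "A \<in> sets P"
    then have A: "A \<in> sets FT" using sets_\<P>[OF P] by simp
    have "emeasure (paste n ?p L) A = (\<integral>\<^sup>+w. indicator A w \<partial>paste n ?p L)"
      using A sets_paste[OF ne] by simp
    also have "\<dots> = emeasure P A" using A by (subst nn_integral_paste[OF Lm]) (auto simp: eq)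
    finally show "emeasure P A = emeasure (paste n ?p L) A" by simp
  qed
  note PP = this
  show ?thesis
  proof (intro bexI[OF _ P] ballI)
    fix f :: "(nat \<Rightarrow> 'a) \<Rightarrow> ennreal" assume f: "f \<in> borel_measurable FT"
    have "(\<integral>\<^sup>+w. f w \<partial>P) = (\<integral>\<^sup>+y. (\<integral>\<^sup>+y'. f (glue n (y, y')) \<partial>L y) \<partial>?p)"
      unfolding PP by (rule nn_integral_paste[OF Lm _ f]) simp
    then show "(\<integral>\<^sup>+w. f w \<partial>P) = (\<integral>\<^sup>+w. (\<integral>\<^sup>+y'. f (glue n (head n w, y')) \<partial>L (head n w)) \<partial>Q)"
      by (simp only: nn_integral_marg[OF Q kernel_integral_measurable[OF Lm f]])
  qed
qed

text \<open>A regular conditional probability is tied to \<open>Q\<close> event by event. Comparing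
  the joint law of head and tail with the composed kernel on measurable rectangles, a generator
  stable under intersection, upgrades this to an integral formula; gluing recovers the path.\<close>

lemma disintegration:
  assumes Q: "Q \<in> \<P>" and f: "f \<in> borel_measurable FT"
  shows "(\<integral>\<^sup>+w. f w \<partial>Q) = (\<integral>\<^sup>+w. (\<integral>\<^sup>+y'. f (glue n (head n w, y')) \<partial>tailK Q n (head n w)) \<partial>Q)"
proof -
  interpret Q: prob_space Q by (rule prob_\<P>[OF Q])
  interpret SQ: sigma_finite_subalgebra Q "F n" by (rule sigma_finite_subalg[OF Q])
  let ?p = "distr Q (G n) (head n)" and ?L = "tailK Q n" and ?N = "G n \<Otimes>\<^sub>M TA n"
  note L = tailK_measurable[OF Q, of n]
  have hQ: "head n \<in> Q \<rightarrow>\<^sub>M G n" and tQ: "tail n \<in> Q \<rightarrow>\<^sub>M TA n"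
    using head_measurable_FT tail_measurable by (auto simp: measurable_\<P>[OF Q])
  have pr: "prob_space ?p" by (rule Q.prob_space_distr[OF hQ])
  have ht: "(\<lambda>w. (head n w, tail n w)) \<in> Q \<rightarrow>\<^sub>M ?N" using hQ tQ by measurable
  let ?M1 = "distr Q ?N (\<lambda>w. (head n w, tail n w))"
  let ?M2 = "?p \<bind> (\<lambda>y. distr (?L y) ?N (Pair y))"
  have kern: "(\<lambda>y. distr (?L y) ?N (Pair y)) \<in> G n \<rightarrow>\<^sub>M prob_algebra ?N"
    by (rule measurable_distr_prob_space2[OF L]) simp
  have kern': "(\<lambda>y. distr (?L y) ?N (Pair y)) \<in> ?p \<rightarrow>\<^sub>M subprob_algebra ?N"
    using measurable_prob_algebraD[OF kern] by simp
  have ne: "space ?p \<noteq> {}" using prob_space.not_empty[OF pr] .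
  have sets2: "sets ?M2 = sets ?N" using ne by (intro sets_bind) auto
  have "?M1 = ?M2"
  proof (rule measure_eqI_generator_eq[OF Int_stable_pair_measure_generator[of "G n" "TA n"]])
    show "{a \<times> b |a b. a \<in> sets (G n) \<and> b \<in> sets (TA n)} \<subseteq> Pow (space ?N)"
      using sets.sets_into_space by (auto simp: space_pair_measure)
    show "sets ?M1 = sigma_sets (space ?N) {a \<times> b |a b. a \<in> sets (G n) \<and> b \<in> sets (TA n)}"
      by (simp add: sets_pair_measure space_pair_measure)
    show "sets ?M2 = sigma_sets (space ?N) {a \<times> b |a b. a \<in> sets (G n) \<and> b \<in> sets (TA n)}"
      unfolding sets2 by (simp add: sets_pair_measure space_pair_measure)
    show "range (\<lambda>_::nat. space ?N) \<subseteq> {a \<times> b |a b. a \<in> sets (G n) \<and> b \<in> sets (TA n)}"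
      by (auto simp: space_pair_measure)
    show "(\<Union>i::nat. space ?N) = space ?N" by simp
    show "emeasure ?M1 (space ?N) \<noteq> \<infinity>" for i :: nat
      unfolding infinity_ennreal_def
      by (rule finite_measure.emeasure_finite[OF prob_space.finite_measure[OF Q.prob_space_distr[OF ht]]])
    fix X assume "X \<in> {a \<times> b |a b. a \<in> sets (G n) \<and> b \<in> sets (TA n)}"
    then obtain a b where X: "X = a \<times> b" and a: "a \<in> sets (G n)" and b: "b \<in> sets (TA n)" by auto
    define A where "A = head n -` a \<inter> path_space S"
    have A: "A \<in> sets (F n)" using measurable_sets[OF head_measurable a] by (simp add: A_def)
    have A': "A \<in> sets Q" using A F_le_FT sets_\<P>[OF Q] by auto
    define Bc where "Bc = tail_cylinder S n b"
    have B: "Bc \<in> sets FT" unfolding Bc_def by (rule tail_cylinder_sets[OF b])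
    have B': "Bc \<in> sets Q" using B sets_\<P>[OF Q] by simp
    have "emeasure ?M2 X = (\<integral>\<^sup>+y. emeasure (distr (?L y) ?N (Pair y)) X \<partial>?p)"
      using a b by (intro emeasure_bind[OF ne kern']) (simp add: X)
    also have "\<dots> = (\<integral>\<^sup>+y. indicator a y * emeasure (K Q n y) Bc \<partial>?p)"
    proof (rule nn_integral_cong)
      fix y assume "y \<in> space ?p"
      then have y: "y \<in> PiE {1..n} S" by (simp add: space_G)
      have "Pair y \<in> ?L y \<rightarrow>\<^sub>M ?N" using measurable_Pair1'[of y "G n" "TA n"] L_sets(1)[OF L y] y
        by (simp add: space_G cong: measurable_cong_sets)
      then have "emeasure (distr (?L y) ?N (Pair y)) X = emeasure (?L y) (Pair y -` X \<inter> space (?L y))"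
        using a b by (intro emeasure_distr) (auto simp: X)
      also have "Pair y -` X \<inter> space (?L y) = (if y \<in> a then b else {})"
        using sets.sets_into_space[OF b] L_sets(2)[OF L y] by (auto simp: X space_TA)
      also have "emeasure (?L y) \<dots> = indicator a y * emeasure (K Q n y) Bc"
        using emeasure_tailK[OF Q y b] by (simp add: Bc_def)
      finally show "emeasure (distr (?L y) ?N (Pair y)) X = indicator a y * emeasure (K Q n y) Bc" .
    qed
    also have "\<dots> = (\<integral>\<^sup>+w. indicator a (head n w) * emeasure (K Q n (head n w)) Bc \<partial>Q)"
    proof (rule nn_integral_marg[OF Q])
      have "(\<lambda>y. emeasure (K Q n y) Bc) \<in> borel_measurable (G n)"
        by (rule measurable_compose[OF measurable_prob_algebraD[OF K_measurable[OF Q]] measurable_emeasure_subprob_algebra[OF B]])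
      then show "(\<lambda>y. indicator a y * emeasure (K Q n y) Bc) \<in> borel_measurable (G n)" using a by measurable
    qed
    \<comment> \<open>The defining property of the version \<open>K Q n\<close> is used here, for
      the single event \<open>Bc\<close>; the head enters only through the \<open>F n\<close>-event
      \<open>A\<close>.\<close>
    also have "\<dots> = (\<integral>\<^sup>+w. ennreal (indicator A w * real_cond_exp Q (F n) (indicator Bc) w) \<partial>Q)"
    proof (rule nn_integral_cong_AE)
      have "AE w in Q. measure (K Q n (head n w)) Bc = real_cond_exp Q (F n) (indicator Bc) w"
        using rcp[OF Q, of n] B by (auto simp: regular_cond_prob_def)
      then show "AE w in Q. indicator a (head n w) * emeasure (K Q n (head n w)) Bc =
         ennreal (indicator A w * real_cond_exp Q (F n) (indicator Bc) w)"
      proof (rule AE_mp, intro AE_I2 impI)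
        fix w assume w: "w \<in> space Q" and e: "measure (K Q n (head n w)) Bc = real_cond_exp Q (F n) (indicator Bc) w"
        have "w \<in> path_space S" using w space_\<P>[OF Q] by simp
        then have hw: "head n w \<in> PiE {1..n} S" by (auto simp: path_space_def PiE_iff)
        then have "K Q n (head n w) \<in> space (prob_algebra FT)"
          using measurable_space[OF K_measurable[OF Q]] by (simp add: space_G)
        then interpret k: prob_space "K Q n (head n w)" by (simp add: space_prob_algebra)
        show "indicator a (head n w) * emeasure (K Q n (head n w)) Bc =
         ennreal (indicator A w * real_cond_exp Q (F n) (indicator Bc) w)"
          using \<open>w \<in> path_space S\<close> k.emeasure_eq_measure[of Bc] by (auto simp: e[symmetric] A_def indicator_def)
      qed
    qed
    also have "\<dots> = ennreal (\<integral>w. indicator A w * real_cond_exp Q (F n) (indicator Bc) w \<partial>Q)"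
    proof (rule nn_integral_eq_integral)
      show "integrable Q (\<lambda>w. indicator A w * real_cond_exp Q (F n) (indicator Bc) w)"
        using A A' B' by (intro SQ.real_cond_exp_intg(1) Q.integrable_const_bound[of _ 1]) (auto simp: indicator_def)
      have "AE w in Q. 0 \<le> real_cond_exp Q (F n) (indicator Bc) w"
        using B' by (intro SQ.real_cond_exp_pos) auto
      then show "AE w in Q. 0 \<le> indicator A w * real_cond_exp Q (F n) (indicator Bc) w" by eventually_elim auto
    qed
    also have "(\<integral>w. indicator A w * real_cond_exp Q (F n) (indicator Bc) w \<partial>Q) = (\<integral>w. indicator A w * indicator Bc w \<partial>Q)"
      using A A' B' by (intro SQ.real_cond_exp_intg(2) Q.integrable_const_bound[of _ 1]) (auto simp: indicator_def)
    also have "\<dots> = measure Q (A \<inter> Bc)"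
      using A' B' by (simp add: indicator_inter_arith[symmetric] Int_absorb2 sets.sets_into_space)
    also have "ennreal \<dots> = emeasure ?M1 X"
    proof -
      have "emeasure ?M1 X = emeasure Q ((\<lambda>w. (head n w, tail n w)) -` X \<inter> space Q)"
        using a b by (intro emeasure_distr[OF ht]) (simp add: X)
      also have "(\<lambda>w. (head n w, tail n w)) -` X \<inter> space Q = A \<inter> Bc"
        by (auto simp: X A_def Bc_def tail_cylinder_def space_\<P>[OF Q])
      finally show ?thesis by (simp only: Q.emeasure_eq_measure)
    qed
    finally show "emeasure ?M1 X = emeasure ?M2 X" by (rule sym)
  qed
  note M12 = this
  have fg: "(\<lambda>z. f (glue n z)) \<in> borel_measurable ?N" by (rule measurable_compose[OF glue_measurable f])
  have "(\<integral>\<^sup>+w. f w \<partial>Q) = (\<integral>\<^sup>+w. f (glue n (head n w, tail n w)) \<partial>Q)"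
    by (intro nn_integral_cong) (simp only: glue_head_tail space_\<P>[OF Q])
  also have "\<dots> = (\<integral>\<^sup>+z. f (glue n z) \<partial>?M1)" using fg by (intro nn_integral_distr[OF ht, symmetric]) simp
  also have "\<dots> = (\<integral>\<^sup>+y. \<integral>\<^sup>+z. f (glue n z) \<partial>distr (?L y) ?N (Pair y) \<partial>?p)"
    unfolding M12 by (rule nn_integral_bind[OF fg kern'])
  also have "\<dots> = (\<integral>\<^sup>+y. \<integral>\<^sup>+y'. f (glue n (y, y')) \<partial>?L y \<partial>?p)"
  proof (rule nn_integral_cong)
    fix y assume "y \<in> space ?p"
    then have y: "y \<in> PiE {1..n} S" by (simp add: space_G)
    have "Pair y \<in> ?L y \<rightarrow>\<^sub>M ?N" using measurable_Pair1'[of y "G n" "TA n"] L_sets(1)[OF L y] y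
      by (simp add: space_G cong: measurable_cong_sets)
    then show "(\<integral>\<^sup>+z. f (glue n z) \<partial>distr (?L y) ?N (Pair y)) = (\<integral>\<^sup>+y'. f (glue n (y, y')) \<partial>?L y)"
      using fg by (intro nn_integral_distr) auto
  qed
  also have "\<dots> = (\<integral>\<^sup>+w. (\<integral>\<^sup>+y'. f (glue n (head n w, y')) \<partial>?L (head n w)) \<partial>Q)"
    by (rule nn_integral_marg[OF Q kernel_integral_measurable[OF L f]])
  finally show ?thesis .
qed

end

section \<open>Steering the conditional means\<close>

text \<open>The exhaustion argument behind essential suprema.\<close>

lemma countable_cover_attains_sup:
  fixes A :: "'i \<Rightarrow> 'a set"
  assumes "finite_measure M" "I \<noteq> {}" and A: "\<And>i. i \<in> I \<Longrightarrow> A i \<in> sets M"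
  shows "\<exists>J :: nat \<Rightarrow> 'i. range J \<subseteq> I \<and> (\<forall>i\<in>I. emeasure M (A i - (\<Union>n. A (J n))) = 0)"
proof -
  interpret finite_measure M by fact
  let ?U = "\<lambda>J::nat \<Rightarrow> 'i. (\<Union>n. A (J n))"
  let ?\<J> = "{J. range J \<subseteq> I}"
  define s where "s = (SUP J\<in>?\<J>. emeasure M (?U J))"
  have U: "?U J \<in> sets M" if "J \<in> ?\<J>" for J using that A by auto
  have ne: "?\<J> \<noteq> {}" using assms(2) by (auto intro!: exI[of _ "\<lambda>_. SOME i. i \<in> I"] simp: some_in_eq)
  obtain f :: "nat \<Rightarrow> ennreal" where f: "range f \<subseteq> (\<lambda>J. emeasure M (?U J)) ` ?\<J>" "s = (SUP n. f n)"
    using ennreal_Sup_countable_SUP[of "(\<lambda>J. emeasure M (?U J)) ` ?\<J>"] ne unfolding s_def by (auto simp: image_image)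
  have "\<exists>J. J \<in> ?\<J> \<and> f n = emeasure M (?U J)" for n using f(1) by (auto simp: subset_eq)
  then obtain JJ where JJ: "\<And>n. JJ n \<in> ?\<J>" "\<And>n. f n = emeasure M (?U (JJ n))" by metis
  \<comment> \<open>A single sequence enumerating the members of all the nearly maximising
    sequences.\<close>
  define J where "J = (\<lambda>k. case prod_decode k of (n, m) \<Rightarrow> JJ n m)"
  have "JJ n m \<in> I" for n m using JJ(1)[of n] by auto
  then have J: "J \<in> ?\<J>" by (auto simp: J_def split: prod.splits)
  have sub: "?U (JJ n) \<subseteq> ?U J" for n
  proof
    fix x assume "x \<in> ?U (JJ n)"
    then obtain m where "x \<in> A (JJ n m)" by auto
    then have "x \<in> A (J (prod_encode (n, m)))" by (simp add: J_def)
    then show "x \<in> ?U J" by blast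
  qed
  have "s \<le> emeasure M (?U J)" unfolding f(2) JJ(2) by (intro SUP_least emeasure_mono sub U[OF J])
  show ?thesis
  proof (intro exI[of _ J] conjI ballI)
    show "range J \<subseteq> I" using J by simp
    fix i assume i: "i \<in> I"
    \<comment> \<open>Prepending \<open>i\<close> gives another admissible sequence; its union
      cannot exceed the supremum, so what \<open>A i\<close> adds is null.\<close>
    define J' where "J' = (\<lambda>k. case k of 0 \<Rightarrow> i | Suc k \<Rightarrow> J k)"
    have J': "J' \<in> ?\<J>" using range_subsetD[of J I] J i by (auto simp: J'_def split: nat.splits)
    have UJ': "?U J' = ?U J \<union> (A i - ?U J)"
      unfolding J'_def by (auto split: nat.splits)
    have "emeasure M (?U J) + emeasure M (A i - ?U J) = emeasure M (?U J')"
      unfolding UJ' using U[OF J] A[OF i] by (intro plus_emeasure) auto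
    also have "\<dots> \<le> s" unfolding s_def by (rule SUP_upper[OF J'])
    also have "\<dots> \<le> emeasure M (?U J)" by fact
    finally have "emeasure M (?U J) + emeasure M (A i - ?U J) \<le> emeasure M (?U J) + 0" by simp
    then show "emeasure M (A i - ?U J) = 0"
      using emeasure_finite[of "?U J"] unfolding ennreal_add_left_cancel_le by simp
  qed
qed

text \<open>Were the union \<open>U\<close> of the near-optimality events not of full measure, the
  function equal to \<open>c\<close> on \<open>U\<close> and to \<open>c - e\<close> elsewhere would
  be an upper bound that is smaller than the essential supremum.\<close>

lemma ess_sup_countable_selection:
  fixes h :: "'i \<Rightarrow> 'a \<Rightarrow> real" and c e :: real
  assumes M: "finite_measure M" and I: "I \<noteq> {}" and h: "\<And>i. i \<in> I \<Longrightarrow> h i \<in> borel_measurable M"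
    and sup: "is_ess_sup M I (\<lambda>i w. ereal (h i w)) (\<lambda>_. ereal c)" and e: "0 < e"
  shows "\<exists>J :: nat \<Rightarrow> 'i. range J \<subseteq> I \<and> (AE w in M. \<exists>n. h (J n) w > c - e)"
proof -
  let ?A = "\<lambda>i. {w \<in> space M. h i w > c - e}"
  have A: "?A i \<in> sets M" if "i \<in> I" for i using h[OF that] by measurable
  obtain J :: "nat \<Rightarrow> 'i" where J: "range J \<subseteq> I" "\<And>i. i \<in> I \<Longrightarrow> emeasure M (?A i - (\<Union>n. ?A (J n))) = 0"
    using countable_cover_attains_sup[where A="?A", OF M I A] by auto
  define U where "U = (\<Union>n. ?A (J n))"
  have U: "U \<in> sets M" unfolding U_def using A J(1) by blast
  define Z where "Z = (\<lambda>w. if w \<in> U then ereal c else ereal (c - e))"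
  have Z: "Z \<in> borel_measurable M" unfolding Z_def using U by measurable
  have "AE w in M. ereal (h i w) \<le> Z w" if i: "i \<in> I" for i
  proof -
    have "AE w in M. ereal (h i w) \<le> ereal c" using sup i by (auto simp: is_ess_sup_def)
    moreover have "AE w in M. w \<notin> ?A i - U"
      using J(2)[OF i] U A[OF i] by (intro AE_not_in) (auto simp: null_sets_def U_def)
    ultimately show ?thesis using AE_space by eventually_elim (auto simp: Z_def not_less)
  qed
  then have "AE w in M. ereal c \<le> Z w" using sup Z by (simp add: is_ess_sup_def)
  then have "AE w in M. \<exists>n. h (J n) w > c - e"
    by eventually_elim (use e in \<open>auto simp: Z_def U_def split: if_splits\<close>)
  then show ?thesis using J(1) by blast
qed

lemma ess_inf_countable_selection:
  fixes h :: "'i \<Rightarrow> 'a \<Rightarrow> real" and c e :: real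
  assumes M: "finite_measure M" and I: "I \<noteq> {}" and h: "\<And>i. i \<in> I \<Longrightarrow> h i \<in> borel_measurable M"
    and inf: "is_ess_inf M I (\<lambda>i w. ereal (h i w)) (\<lambda>_. ereal c)" and e: "0 < e"
  shows "\<exists>J :: nat \<Rightarrow> 'i. range J \<subseteq> I \<and> (AE w in M. \<exists>n. h (J n) w < c + e)"
proof -
  have "is_ess_sup M I (\<lambda>i w. ereal (- h i w)) (\<lambda>_. ereal (- c))"
    unfolding is_ess_sup_def
  proof (intro conjI ballI impI)
    fix i assume "i \<in> I"
    then have "AE w in M. ereal c \<le> ereal (h i w)" using inf by (auto simp: is_ess_inf_def)
    then show "AE w in M. ereal (- h i w) \<le> ereal (- c)" by eventually_elim simp
  next
    fix Z :: "'a \<Rightarrow> ereal" assume Z: "Z \<in> borel_measurable M" "\<forall>i\<in>I. AE w in M. ereal (- h i w) \<le> Z w"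
    have "AE w in M. - Z w \<le> ereal (h i w)" if "i \<in> I" for i
      using Z(2)[rule_format, OF that] by eventually_elim (metis ereal_minus_le_minus ereal_uminus_uminus uminus_ereal.simps(1))
    moreover have "(\<lambda>w. - Z w) \<in> borel_measurable M" using Z(1) by measurable
    moreover have "Z' \<in> borel_measurable M \<Longrightarrow> \<forall>i\<in>I. AE w in M. Z' w \<le> ereal (h i w) \<Longrightarrow> AE w in M. Z' w \<le> ereal c" for Z'
      using inf by (simp add: is_ess_inf_def)
    ultimately have "AE w in M. - Z w \<le> ereal c" by simp
    then show "AE w in M. ereal (- c) \<le> Z w" by eventually_elim (metis ereal_minus_le_minus ereal_uminus_uminus uminus_ereal.simps(1))
  qed simp
  from ess_sup_countable_selection[OF M I _ this e] h
  obtain J :: "nat \<Rightarrow> 'i" where "range J \<subseteq> I" "AE w in M. \<exists>n. - h (J n) w > - c - e" by (auto simp: borel_measurable_uminus)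
  moreover have "- h (J n) w > - c - e \<longleftrightarrow> h (J n) w < c + e" for n w by linarith
  ultimately show ?thesis by auto
qed

section \<open>Conditional expectations under pasted measures\<close>

context rectangular_family begin

text \<open>An event of \<open>F n\<close> is decided by the head, which gluing leaves unchanged;
  its indicator is constant for the inner integral.\<close>

lemma kernel_glue_F:
  assumes Q: "Q \<in> \<P>" and w: "w \<in> path_space S" and f: "f \<in> borel_measurable FT" and A: "A \<in> sets (F n)"
  shows "(\<integral>\<^sup>+y'. f (glue n (head n w, y')) * indicator A (glue n (head n w, y')) \<partial>tailK Q n (head n w)) =
     (\<integral>\<^sup>+y'. f (glue n (head n w, y')) \<partial>tailK Q n (head n w)) * indicator A w"
proof -
  obtain A' where A': "A' \<in> sets (G n)" "A = {w \<in> path_space S. head n w \<in> A'}" by (rule F_set_head[OF A])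
  have y: "head n w \<in> PiE {1..n} S" using w by (auto simp: path_space_def PiE_iff)
  note L = L_sets[OF tailK_measurable[OF Q] y]
  have "(\<integral>\<^sup>+y'. f (glue n (head n w, y')) * indicator A (glue n (head n w, y')) \<partial>tailK Q n (head n w)) =
     (\<integral>\<^sup>+y'. f (glue n (head n w, y')) * indicator A w \<partial>tailK Q n (head n w))"
  proof (rule nn_integral_cong)
    fix y' assume "y' \<in> space (tailK Q n (head n w))"
    then have y': "y' \<in> PiE {Suc n..} S" using L(2) by simp
    have "glue n (head n w, y') \<in> A \<longleftrightarrow> w \<in> A"
      using glue_path[OF y y'] head_glue[OF y, of y'] w by (auto simp: A'(2))
    then show "f (glue n (head n w, y')) * indicator A (glue n (head n w, y')) = f (glue n (head n w, y')) * indicator A w"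
      by (simp add: indicator_def)
  qed
  also have "\<dots> = (\<integral>\<^sup>+y'. f (glue n (head n w, y')) \<partial>tailK Q n (head n w)) * indicator A w"
    by (rule nn_integral_multc) (rule measurable_compose[OF L(4) f])
  finally show ?thesis .
qed

text \<open>Turns conditional expectations, which are defined up to null sets, into kernel integrals
  that can be switched history by history.\<close>

lemma nn_cond_exp_kernel:
  assumes Q: "Q \<in> \<P>" and f: "f \<in> borel_measurable FT"
  shows "AE w in Q. (\<integral>\<^sup>+y'. f (glue n (head n w, y')) \<partial>tailK Q n (head n w)) = nn_cond_exp Q (F n) f w"
proof (rule sigma_finite_subalgebra.nn_cond_exp_charact[OF sigma_finite_subalg[OF Q]])
  fix A assume A: "A \<in> sets (F n)"
  have "(\<lambda>w. f w * indicator A w) \<in> borel_measurable FT" using f subsetD[OF F_le_FT A] by measurable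
  from disintegration[where n=n, OF Q this]
  show "(\<integral>\<^sup>+w\<in>A. f w \<partial>Q) = (\<integral>\<^sup>+w\<in>A. (\<integral>\<^sup>+y'. f (glue n (head n w, y')) \<partial>tailK Q n (head n w)) \<partial>Q)"
    by (subst (asm) nn_integral_cong[OF kernel_glue_F[OF Q _ f A]]) (simp_all only: space_\<P>[OF Q])
next
  show "f \<in> borel_measurable Q" using f by (simp add: measurable_\<P>[OF Q])
  show "(\<lambda>w. \<integral>\<^sup>+y'. f (glue n (head n w, y')) \<partial>tailK Q n (head n w)) \<in> borel_measurable (F n)"
    by (rule measurable_compose[OF head_measurable kernel_integral_measurable[OF tailK_measurable[OF Q] f]])
qed

text \<open>\<open>P_kernel\<close> is a condition at each single history, so a kernel may switch
  between countably many measures through a measurable index. The law on \<open>F n\<close> is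
  inherited from \<open>Q0\<close>, and what happens after time \<open>n\<close> from the measure
  that the history selects.\<close>

lemma pasting:
  assumes Q0: "Q0 \<in> \<P>" and Qs: "\<And>j::nat. Qs j \<in> \<P>" and ix: "ix \<in> G n \<rightarrow>\<^sub>M count_space UNIV"
  obtains P where "P \<in> \<P>" "\<And>A. A \<in> sets (F n) \<Longrightarrow> emeasure P A = emeasure Q0 A"
    "\<And>f. f \<in> borel_measurable FT \<Longrightarrow>
       AE w in P. nn_cond_exp P (F n) f w = nn_cond_exp (Qs (ix (head n w))) (F n) f w"
proof -
  let ?L = "\<lambda>y. tailK (Qs (ix y)) n y"
  have L: "?L \<in> G n \<rightarrow>\<^sub>M prob_algebra (TA n)"
    by (rule measurable_compose_countable[OF tailK_measurable[OF Qs] ix])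
  have "P_kernel S G \<P> K n ?L"
    unfolding P_kernel_def using L emeasure_tailK[OF Qs] Qs by (auto intro!: bexI[of _ "Qs (ix _)"])
  from rectangular_paste[OF Q0 this]
  obtain P where P: "P \<in> \<P>" and int: "\<And>f. f \<in> borel_measurable FT \<Longrightarrow>
    (\<integral>\<^sup>+w. f w \<partial>P) = (\<integral>\<^sup>+w. (\<integral>\<^sup>+y'. f (glue n (head n w, y')) \<partial>?L (head n w)) \<partial>Q0)" by blast
  have int_A: "(\<integral>\<^sup>+w\<in>A. f w \<partial>P) = (\<integral>\<^sup>+w\<in>A. (\<integral>\<^sup>+y'. f (glue n (head n w, y')) \<partial>?L (head n w)) \<partial>Q0)"
    if f: "f \<in> borel_measurable FT" and A: "A \<in> sets (F n)" for f A
  proof -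
    have "(\<lambda>w. f w * indicator A w) \<in> borel_measurable FT" using f subsetD[OF F_le_FT A] by measurable
    from int[OF this] show ?thesis
      by (subst (asm) nn_integral_cong[OF kernel_glue_F[OF Qs _ f A]]) (simp_all only: space_\<P>[OF Q0])
  qed
  have eq: "emeasure P A = emeasure Q0 A" if A: "A \<in> sets (F n)" for A
  proof -
    have "emeasure P A = (\<integral>\<^sup>+w\<in>A. 1 \<partial>P)" using A F_le_FT sets_\<P>[OF P] by (subst nn_integral_indicator[symmetric]) auto
    also have "\<dots> = (\<integral>\<^sup>+w\<in>A. (\<integral>\<^sup>+y'. 1 \<partial>?L (head n w)) \<partial>Q0)" using int_A[OF _ A, of "\<lambda>_. 1"] by simp
    also have "\<dots> = (\<integral>\<^sup>+w\<in>A. 1 \<partial>Q0)"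
    proof (rule nn_integral_cong)
      fix w assume "w \<in> space Q0"
      then have "head n w \<in> PiE {1..n} S" using space_\<P>[OF Q0] by (auto simp: path_space_def PiE_iff)
      from L_sets(3)[OF L this] show "(\<integral>\<^sup>+y'. 1 \<partial>?L (head n w)) * indicator A w = 1 * indicator A w"
        by (simp add: prob_space.emeasure_space_1)
    qed
    also have "\<dots> = emeasure Q0 A" using A F_le_FT sets_\<P>[OF Q0] by (subst nn_integral_indicator[symmetric]) auto
    finally show ?thesis .
  qed
  \<comment> \<open>Conditional expectations given \<open>F n\<close> are tested with
    \<open>F n\<close>-measurable integrands, for which \<open>P\<close> and \<open>Q0\<close> are
    interchangeable.\<close>
  have restr: "restr_to_subalg P (F n) = restr_to_subalg Q0 (F n)"
  proof (rule measure_eqI)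
    show "sets (restr_to_subalg P (F n)) = sets (restr_to_subalg Q0 (F n))"
      by (simp add: sets_restr_to_subalg[OF subalg_\<P>] P Q0)
    fix A assume "A \<in> sets (restr_to_subalg P (F n))"
    then have "A \<in> sets (F n)" by (simp add: sets_restr_to_subalg[OF subalg_\<P>] P)
    then show "emeasure (restr_to_subalg P (F n)) A = emeasure (restr_to_subalg Q0 (F n)) A"
      using eq by (simp add: emeasure_restr_to_subalg[OF subalg_\<P>] P Q0)
  qed
  have "AE w in P. nn_cond_exp P (F n) f w = nn_cond_exp (Qs (ix (head n w))) (F n) f w" if f: "f \<in> borel_measurable FT" for f
  proof -
    have m: "(\<lambda>w. \<integral>\<^sup>+y'. f (glue n (head n w, y')) \<partial>?L (head n w)) \<in> borel_measurable (F n)"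
      by (rule measurable_compose[OF head_measurable kernel_integral_measurable[OF L f]])
    have 1: "AE w in P. (\<integral>\<^sup>+y'. f (glue n (head n w, y')) \<partial>?L (head n w)) = nn_cond_exp P (F n) f w"
    proof (rule sigma_finite_subalgebra.nn_cond_exp_charact[OF sigma_finite_subalg[OF P]])
      show "f \<in> borel_measurable P" using f by (simp add: measurable_\<P>[OF P])
      fix A assume A: "A \<in> sets (F n)"
      have mA: "(\<lambda>w. (\<integral>\<^sup>+y'. f (glue n (head n w, y')) \<partial>?L (head n w)) * indicator A w) \<in> borel_measurable (F n)"
        using m A by measurable
      show "(\<integral>\<^sup>+w\<in>A. f w \<partial>P) = (\<integral>\<^sup>+w\<in>A. (\<integral>\<^sup>+y'. f (glue n (head n w, y')) \<partial>?L (head n w)) \<partial>P)"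
        unfolding int_A[OF f A]
        using nn_integral_subalgebra2[OF subalg_\<P>[OF P] mA] nn_integral_subalgebra2[OF subalg_\<P>[OF Q0] mA]
        by (simp add: restr)
    qed (rule m)
    \<comment> \<open>The kernel formula holds almost surely under \<open>Qs j\<close>. Both sides
      are \<open>F n\<close>-measurable, so equivalence carries it to \<open>P\<close>; countability
      of the index then handles all \<open>j\<close> at once.\<close>
    have "AE w in P. (\<integral>\<^sup>+y'. f (glue n (head n w, y')) \<partial>tailK (Qs j) n (head n w)) = nn_cond_exp (Qs j) (F n) f w" for j
    proof (rule AE_equiv[OF Qs P nn_cond_exp_kernel[OF Qs f]])
      have [measurable]: "(\<lambda>w. \<integral>\<^sup>+y'. f (glue n (head n w, y')) \<partial>tailK (Qs j) n (head n w)) \<in> borel_measurable (F n)"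
        by (rule measurable_compose[OF head_measurable kernel_integral_measurable[OF tailK_measurable[OF Qs] f]])
      have "{w \<in> space (F n). (\<integral>\<^sup>+y'. f (glue n (head n w, y')) \<partial>tailK (Qs j) n (head n w)) = nn_cond_exp (Qs j) (F n) f w} \<in> sets (F n)"
        by measurable
      then show "{w \<in> path_space S. (\<integral>\<^sup>+y'. f (glue n (head n w, y')) \<partial>tailK (Qs j) n (head n w)) = nn_cond_exp (Qs j) (F n) f w} \<in> sets (F n)"
        by simp
    qed
    then have "AE w in P. \<forall>j. (\<integral>\<^sup>+y'. f (glue n (head n w, y')) \<partial>tailK (Qs j) n (head n w)) = nn_cond_exp (Qs j) (F n) f w"
      by (simp add: AE_all_countable)
    with 1 show ?thesis by eventually_elim simp
  qed
  with P eq show thesis by (rule that)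
qed

lemma pasting_real:
  assumes "Q0 \<in> \<P>" "\<And>j::nat. Qs j \<in> \<P>" "ix \<in> G n \<rightarrow>\<^sub>M count_space UNIV"
  obtains P where "P \<in> \<P>" "\<And>A. A \<in> sets (F n) \<Longrightarrow> emeasure P A = emeasure Q0 A"
    "\<And>f. f \<in> borel_measurable FT \<Longrightarrow>
       AE w in P. real_cond_exp P (F n) f w = real_cond_exp (Qs (ix (head n w))) (F n) f w"
proof -
  obtain P where P: "P \<in> \<P>" "\<And>A. A \<in> sets (F n) \<Longrightarrow> emeasure P A = emeasure Q0 A"
    "\<And>f. f \<in> borel_measurable FT \<Longrightarrow>
       AE w in P. nn_cond_exp P (F n) f w = nn_cond_exp (Qs (ix (head n w))) (F n) f w"
    by (rule pasting[where Qs=Qs and ix=ix, OF assms]) (rule that; assumption)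
  show thesis
  proof (rule that[OF P(1,2)])
    fix f :: "(nat \<Rightarrow> 'a) \<Rightarrow> real" assume [measurable]: "f \<in> borel_measurable FT"
    have "AE w in P. nn_cond_exp P (F n) (\<lambda>x. ennreal (f x)) w = nn_cond_exp (Qs (ix (head n w))) (F n) (\<lambda>x. ennreal (f x)) w"
      by (rule P(3)) measurable
    moreover have "AE w in P. nn_cond_exp P (F n) (\<lambda>x. ennreal (- f x)) w = nn_cond_exp (Qs (ix (head n w))) (F n) (\<lambda>x. ennreal (- f x)) w"
      by (rule P(3)) measurable
    ultimately show "AE w in P. real_cond_exp P (F n) f w = real_cond_exp (Qs (ix (head n w))) (F n) f w"
      by eventually_elim (simp add: real_cond_exp_def)
  qed
qed

text \<open>Rectangularity enters here: on the cells of a countable \<open>F n\<close>-partition the kernels of nearly optimal measures are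
  pasted together, while the law up to time \<open>n\<close> is kept.\<close>

lemma steering:
  assumes Q0: "Q0 \<in> \<P>" and B: "B \<in> sets (F n)" and Y: "Y \<in> borel_measurable FT" and e: "0 < e"
    and upper: "\<And>P. P \<in> \<P> \<Longrightarrow> is_ess_sup (restr_to_subalg P (F n)) \<P> (\<lambda>Q w. ereal (real_cond_exp Q (F n) Y w)) (\<lambda>_. ereal \<mu>u)"
    and lower: "\<And>P. P \<in> \<P> \<Longrightarrow> is_ess_inf (restr_to_subalg P (F n)) \<P> (\<lambda>Q w. ereal (real_cond_exp Q (F n) Y w)) (\<lambda>_. ereal \<mu>l)"
  obtains P where "P \<in> \<P>" "\<And>A. A \<in> sets (F n) \<Longrightarrow> emeasure P A = emeasure Q0 A"
    "AE w in P. if w \<in> B then \<mu>u - e < real_cond_exp P (F n) Y w else real_cond_exp P (F n) Y w < \<mu>l + e"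
proof -
  let ?M = "restr_to_subalg Q0 (F n)"
  note fin = finite_measure_restr_to_subalg[OF subalg_\<P>[OF Q0] prob_space.finite_measure[OF prob_\<P>[OF Q0]]]
  have meas: "real_cond_exp Q (F n) Y \<in> borel_measurable ?M" for Q
    by (rule measurable_in_subalg[OF subalg_\<P>[OF Q0]]) simp
  obtain Ju :: "nat \<Rightarrow> (nat \<Rightarrow> 'a) measure" where Ju: "range Ju \<subseteq> \<P>" "AE w in ?M. \<exists>k. real_cond_exp (Ju k) (F n) Y w > \<mu>u - e"
    using ess_sup_countable_selection[OF fin \<P>_nonempty meas upper[OF Q0] e] by (elim exE conjE)
  obtain Jl :: "nat \<Rightarrow> (nat \<Rightarrow> 'a) measure" where Jl: "range Jl \<subseteq> \<P>" "AE w in ?M. \<exists>k. real_cond_exp (Jl k) (F n) Y w < \<mu>l + e"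
    using ess_inf_countable_selection[OF fin \<P>_nonempty meas lower[OF Q0] e] by (elim exE conjE)
  \<comment> \<open>Even indices for nearly maximal means, odd ones for nearly minimal means: one
    sequence serves both on \<open>B\<close> and off it.\<close>
  define Qs where "Qs j = (if even j then Ju (j div 2) else Jl (j div 2))" for j
  have Qs: "Qs j \<in> \<P>" for j using Ju(1) Jl(1) by (auto simp: Qs_def)
  let ?good = "\<lambda>Q w. if w \<in> B then \<mu>u - e < real_cond_exp Q (F n) Y w else real_cond_exp Q (F n) Y w < \<mu>l + e"
  define A where "A j = {w \<in> path_space S. ?good (Qs j) w}" for j
  have "A j \<in> sets (F n)" for j
  proof -
    have "{w \<in> space (F n). ?good (Qs j) w} \<in> sets (F n)" using B by measurable
    then show ?thesis by (simp add: A_def)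
  qed
  then have ex: "\<exists>A'. A' \<in> sets (G n) \<and> A j = {w \<in> path_space S. head n w \<in> A'}" for j
    using F_set_head[of "A j" n] by metis
  define A' where "A' j = (SOME A'. A' \<in> sets (G n) \<and> A j = {w \<in> path_space S. head n w \<in> A'})" for j
  have A': "A' j \<in> sets (G n)" "A j = {w \<in> path_space S. head n w \<in> A' j}" for j
    using someI_ex[OF ex[of j]] unfolding A'_def by blast+
  \<comment> \<open>The index must be a function of the first \<open>n\<close> coordinates, hence
    the passage from the sets \<open>A j\<close> of paths to sets \<open>A' j\<close> of
    \<open>G n\<close>.\<close>
  define ix where "ix y = (LEAST j. y \<in> A' j)" for y
  have ix: "ix \<in> G n \<rightarrow>\<^sub>M count_space UNIV"
  proof -
    note [measurable] = A'(1)
    show ?thesis unfolding ix_def by measurable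
  qed
  obtain P where P: "P \<in> \<P>" and eq: "\<And>A. A \<in> sets (F n) \<Longrightarrow> emeasure P A = emeasure Q0 A"
    and ce: "\<And>f. f \<in> borel_measurable FT \<Longrightarrow>
       AE w in P. real_cond_exp P (F n) f w = real_cond_exp (Qs (ix (head n w))) (F n) f w"
    by (rule pasting_real[where Qs=Qs and ix=ix, OF Q0 Qs ix]) (rule that; assumption)
  have "AE w in ?M. \<exists>j. ?good (Qs j) w"
    using Ju(2) Jl(2)
  proof eventually_elim
    case (elim w)
    then obtain k l where k: "real_cond_exp (Ju k) (F n) Y w > \<mu>u - e" and l: "real_cond_exp (Jl l) (F n) Y w < \<mu>l + e" by blast
    show ?case
    proof (cases "w \<in> B")
      case True then show ?thesis using k by (intro exI[of _ "2 * k"]) (simp add: Qs_def)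
    next
      case False then show ?thesis using l by (intro exI[of _ "2 * l + 1"]) (simp add: Qs_def)
    qed
  qed
  then have "AE w in Q0. \<exists>j. ?good (Qs j) w" by (rule AE_restr_to_subalg[OF subalg_\<P>[OF Q0]])
  moreover have "{w \<in> path_space S. \<exists>j. ?good (Qs j) w} \<in> sets (F n)"
  proof -
    have "{w \<in> space (F n). \<exists>j. ?good (Qs j) w} \<in> sets (F n)" using B by measurable
    then show ?thesis by simp
  qed
  ultimately have "AE w in P. \<exists>j. ?good (Qs j) w" by (rule AE_equiv[OF Q0 P])
  then have "AE w in P. ?good P w"
    using ce[OF Y] AE_space
  proof eventually_elim
    case (elim w)
    then have w: "w \<in> path_space S" using space_\<P>[OF P] by simp
    obtain j where "?good (Qs j) w" using elim by blast
    then have "head n w \<in> A' j" using w A'(2)[of j] by (auto simp: A_def)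
    then have "head n w \<in> A' (ix (head n w))" unfolding ix_def by (rule LeastI)
    then have "w \<in> A (ix (head n w))" using w A'(2) by simp
    then show ?case using elim by (simp add: A_def)
  qed
  then show thesis using that P eq by blast
qed

end

section \<open>Taylor expansion along the partial sums\<close>

text \<open>Small increments use the cubic Taylor bound, one factor of which is at most
  \<open>\<eta>\<close>. Large ones use the quadratic bound on the first-order remainder plus the
  second-order term, together at most 3/2 C \<delta>^2. This is the split that fits the Lindeberg
  condition.\<close>

lemma smooth2_remainder:
  assumes v: "smooth2 C v v1 v2" and \<eta>: "0 < \<eta>"
  shows "\<bar>v (x + \<delta>) - v x - \<delta> * v1 x - \<delta>\<^sup>2 / 2 * v2 x\<bar> \<le> C * \<eta> * \<delta>\<^sup>2 + 2 * C * (\<delta>\<^sup>2 * indicator {z. \<eta> < \<bar>z\<bar>} \<delta>)"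
proof -
  have C: "0 \<le> C" "\<bar>v2 x\<bar> \<le> C" using v by (auto simp: smooth2_def dest: bfunD)
  show ?thesis
  proof (cases "\<eta> < \<bar>\<delta>\<bar>")
    case True
    have "\<bar>v (x + \<delta>) - v x - \<delta> * v1 x\<bar> \<le> C * \<delta>\<^sup>2" using v by (auto simp: smooth2_def dest: quadD)
    moreover have "\<bar>\<delta>\<^sup>2 / 2 * v2 x\<bar> \<le> \<delta>\<^sup>2 / 2 * C" unfolding abs_mult using C by (intro mult_mono) auto
    moreover have "0 \<le> C * \<eta> * \<delta>\<^sup>2" "0 \<le> C * \<delta>\<^sup>2" using C \<eta> by auto
    ultimately show ?thesis using True by (simp add: algebra_simps)
  next
    case False
    have "\<bar>v (x + \<delta>) - v x - \<delta> * v1 x - \<delta>\<^sup>2 / 2 * v2 x\<bar> \<le> C * \<bar>\<delta>\<bar> ^ 3" by (rule smooth2_taylor[OF v])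
    also have "\<dots> = C * \<bar>\<delta>\<bar> * \<delta>\<^sup>2" by (simp add: power3_eq_cube power2_eq_square)
    also have "\<dots> \<le> C * \<eta> * \<delta>\<^sup>2" using False C by (intro mult_right_mono mult_left_mono) auto
    finally show ?thesis using False by simp
  qed
qed

context prob_space begin

lemma integrable_bounded_mult:
  fixes f h :: "'a \<Rightarrow> real"
  assumes "integrable M h" "f \<in> borel_measurable M" "\<And>x. \<bar>f x\<bar> \<le> C"
  shows "integrable M (\<lambda>x. f x * h x)"
proof (rule Bochner_Integration.integrable_bound)
  show "integrable M (\<lambda>x. C * h x)" using assms by simp
  show "AE x in M. norm (f x * h x) \<le> norm (C * h x)"
  proof (rule AE_I2)
    fix x have "\<bar>f x\<bar> \<le> \<bar>C\<bar>" using assms(3)[of x] by linarith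
    then show "norm (f x * h x) \<le> norm (C * h x)" by (simp add: abs_mult mult_right_mono)
  qed
qed (use assms in measurable)

text \<open>With D = X - m the increment is \<alpha> m + (\<alpha> + \<beta>) D. Against
  \<open>F\<close>-measurable weights D is centred with second moment \<sigma>^2, so the cross terms
  drop out and the drift term of order \<alpha> and the diffusion term survive. The square of the
  drift is of order \<alpha>^2 and goes into the error.\<close>

lemma taylor_step:
  fixes X s :: "'a \<Rightarrow> real"
  assumes sub: "subalgebra M F" and X[measurable]: "X \<in> borel_measurable M" and X2: "integrable M (\<lambda>w. (X w)\<^sup>2)"
    and m: "m = real_cond_exp M F X" and mb: "AE w in M. \<bar>m w\<bar> \<le> B"
    and var: "AE w in M. real_cond_exp M F (\<lambda>w'. (X w' - real_cond_exp M F X w')\<^sup>2) w = \<sigma>\<^sup>2"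
    and s: "s \<in> borel_measurable F" and v: "smooth2 C v v1 v2" and \<eta>: "0 < \<eta>"
    and \<delta>: "\<And>w. \<delta> w = \<alpha> * X w + \<beta> * (X w - m w)"
  shows "\<bar>expectation (\<lambda>w. v (s w + \<delta> w)) - expectation (\<lambda>w. v (s w)) - \<alpha> * expectation (\<lambda>w. v1 (s w) * m w)
      - (\<alpha> + \<beta>)\<^sup>2 * \<sigma>\<^sup>2 / 2 * expectation (\<lambda>w. v2 (s w))\<bar>
    \<le> C * \<alpha>\<^sup>2 * B\<^sup>2 / 2 + C * \<eta> * (\<alpha>\<^sup>2 * B\<^sup>2 + (\<alpha> + \<beta>)\<^sup>2 * \<sigma>\<^sup>2)
      + 2 * C * expectation (\<lambda>w. (\<delta> w)\<^sup>2 * indicator {z. \<eta> < \<bar>z\<bar>} (\<delta> w))"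
proof -
  interpret SF: sigma_finite_subalgebra M F
    by (intro finite_measure_subalgebra_is_sigma_finite)
       (auto simp: finite_measure_subalgebra_def finite_measure_subalgebra_axioms_def sub finite_measure_axioms)
  have bv: "bfun C v" "bfun C v1" "bfun C v2" and C0: "0 \<le> C" using v by (auto simp: smooth2_def dest: bfunD)
  note [measurable] = bfunD(1)[OF bv(1)] bfunD(1)[OF bv(2)] bfunD(1)[OF bv(3)] s
  have [measurable]: "s \<in> borel_measurable M" by (rule measurable_from_subalg[OF sub s])
  have mF[measurable]: "m \<in> borel_measurable F" "m \<in> borel_measurable M" by (auto simp: m)
  define D where "D w = X w - m w" for w
  have D[measurable]: "D \<in> borel_measurable M" by (simp add: D_def[abs_def])
  have iX: "integrable M X" using square_integrable_imp_integrable[OF X X2] .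
  have mm: "integrable M (\<lambda>w. (m w)\<^sup>2)"
    by (rule integrable_const_bound[of _ "B\<^sup>2"])
       (use mb in \<open>auto elim!: eventually_mono simp: abs_le_square_iff[symmetric]\<close>)
  have im: "integrable M m" using iX by (auto simp: m)
  have iD: "integrable M D" using iX im by (simp add: D_def[abs_def])
  have iD2: "integrable M (\<lambda>w. (D w)\<^sup>2)"
  proof (rule Bochner_Integration.integrable_bound)
    show "integrable M (\<lambda>w. 2 * (X w)\<^sup>2 + 2 * (m w)\<^sup>2)" using X2 mm by simp
    show "AE w in M. norm ((D w)\<^sup>2) \<le> norm (2 * (X w)\<^sup>2 + 2 * (m w)\<^sup>2)"
    proof (rule AE_I2)
      fix w
      have "(D w)\<^sup>2 \<le> 2 * (X w)\<^sup>2 + 2 * (m w)\<^sup>2"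
        using zero_le_power2[of "X w + m w"] by (simp add: D_def power2_eq_square algebra_simps)
      then show "norm ((D w)\<^sup>2) \<le> norm (2 * (X w)\<^sup>2 + 2 * (m w)\<^sup>2)" by simp
    qed
  qed simp
  \<comment> \<open>Stated for weights with integrable product rather than for bounded ones, because
    it is also applied to the weights \<open>m\<close> and \<open>v2 (s w) * m w\<close>, which are
    bounded only almost surely.\<close>
  have D0: "expectation (\<lambda>w. f w * D w) = 0" "integrable M (\<lambda>w. f w * D w)"
    if f[measurable]: "f \<in> borel_measurable F" and fi: "integrable M (\<lambda>w. f w * X w)" for f
  proof -
    have "integrable M (\<lambda>w. f w * m w)" "expectation (\<lambda>w. f w * m w) = expectation (\<lambda>w. f w * X w)"
      using SF.real_cond_exp_intg[OF fi f] by (auto simp: m)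
    then show "expectation (\<lambda>w. f w * D w) = 0" "integrable M (\<lambda>w. f w * D w)"
      using fi by (auto simp: D_def right_diff_distrib)
  qed
  have D2: "expectation (\<lambda>w. f w * (D w)\<^sup>2) = \<sigma>\<^sup>2 * expectation f" "integrable M (\<lambda>w. f w * (D w)\<^sup>2)"
    if f[measurable]: "f \<in> borel_measurable F" and fb: "\<And>w. \<bar>f w\<bar> \<le> c" for f c
  proof -
    show i: "integrable M (\<lambda>w. f w * (D w)\<^sup>2)"
      using measurable_from_subalg[OF sub f] fb by (intro integrable_bounded_mult[OF iD2]) auto
    have "expectation (\<lambda>w. f w * (D w)\<^sup>2) = expectation (\<lambda>w. f w * real_cond_exp M F (\<lambda>w. (D w)\<^sup>2) w)"
      by (rule SF.real_cond_exp_intg(2)[OF i f, symmetric]) simp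
    also have "\<dots> = expectation (\<lambda>w. f w * \<sigma>\<^sup>2)"
      by (rule integral_cong_AE) (use var measurable_from_subalg[OF sub f] in \<open>auto simp: D_def[abs_def] m elim!: eventually_mono\<close>)
    finally show "expectation (\<lambda>w. f w * (D w)\<^sup>2) = \<sigma>\<^sup>2 * expectation f" by simp
  qed
  let ?a = "\<alpha> + \<beta>"
  have \<delta>': "\<delta> w = \<alpha> * m w + ?a * D w" for w by (simp add: \<delta> D_def algebra_simps)
  have [measurable]: "\<delta> \<in> borel_measurable M" by (simp add: \<delta>'[abs_def])
  have \<delta>2: "(\<delta> w)\<^sup>2 = \<alpha>\<^sup>2 * (m w)\<^sup>2 + ?a\<^sup>2 * (D w)\<^sup>2 + 2 * \<alpha> * ?a * (m w * D w)" for w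
    by (simp add: \<delta>' power2_eq_square algebra_simps)
  have imX: "integrable M (\<lambda>w. m w * X w)"
  proof (rule Bochner_Integration.integrable_bound)
    show "integrable M (\<lambda>w. (X w)\<^sup>2 + (m w)\<^sup>2)" using X2 mm by simp
    show "AE w in M. norm (m w * X w) \<le> norm ((X w)\<^sup>2 + (m w)\<^sup>2)"
    proof (rule AE_I2)
      fix w
      have "2 * (\<bar>m w\<bar> * \<bar>X w\<bar>) \<le> (m w)\<^sup>2 + (X w)\<^sup>2" using sum_squares_bound[of "\<bar>m w\<bar>" "\<bar>X w\<bar>"] by simp
      moreover have "0 \<le> \<bar>m w\<bar> * \<bar>X w\<bar>" by simp
      ultimately have "\<bar>m w\<bar> * \<bar>X w\<bar> \<le> (m w)\<^sup>2 + (X w)\<^sup>2" by linarith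
      then show "norm (m w * X w) \<le> norm ((X w)\<^sup>2 + (m w)\<^sup>2)" by (simp add: abs_mult)
    qed
  qed simp
  have i\<delta>2: "integrable M (\<lambda>w. (\<delta> w)\<^sup>2)" unfolding \<delta>2 using mm iD2 D0(2)[OF mF(1) imX] by simp
  have mB: "expectation (\<lambda>w. (m w)\<^sup>2) \<le> B\<^sup>2"
    by (rule integral_le_const[OF mm]) (use mb in \<open>auto elim!: eventually_mono simp: abs_le_square_iff[symmetric]\<close>)
  have E\<delta>2: "expectation (\<lambda>w. (\<delta> w)\<^sup>2) \<le> \<alpha>\<^sup>2 * B\<^sup>2 + ?a\<^sup>2 * \<sigma>\<^sup>2"
  proof -
    have "expectation (\<lambda>w. (\<delta> w)\<^sup>2) = \<alpha>\<^sup>2 * expectation (\<lambda>w. (m w)\<^sup>2) + ?a\<^sup>2 * \<sigma>\<^sup>2"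
      unfolding \<delta>2 using mm iD2 D0[OF mF(1) imX] D2(1)[of "\<lambda>_. 1" 1] prob_space by simp
    then show ?thesis using mult_left_mono[OF mB, of "\<alpha>\<^sup>2"] by simp
  qed
  let ?R = "\<lambda>w. v (s w + \<delta> w) - v (s w) - \<delta> w * v1 (s w) - (\<delta> w)\<^sup>2 / 2 * v2 (s w)"
  let ?I = "\<lambda>w. (\<delta> w)\<^sup>2 * indicator {z. \<eta> < \<bar>z\<bar>} (\<delta> w)"
  have iI: "integrable M ?I"
    by (subst mult.commute, rule integrable_bounded_mult[OF i\<delta>2, of _ 1]) (auto simp: indicator_def)
  have iv: "integrable M (\<lambda>w. v (s w + \<delta> w))" "integrable M (\<lambda>w. v (s w))" "integrable M (\<lambda>w. v2 (s w))"
    using bfunD(2)[OF bv(1)] bfunD(2)[OF bv(3)] by (auto intro!: integrable_const_bound[of _ C])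
  have i1: "integrable M (\<lambda>w. v1 (s w) * m w)" "integrable M (\<lambda>w. v1 (s w) * X w)"
    using bfunD(2)[OF bv(2)] im iX by (auto intro!: integrable_bounded_mult[of _ _ C])
  have d1: "expectation (\<lambda>w. v1 (s w) * D w) = 0" "integrable M (\<lambda>w. v1 (s w) * D w)"
    using D0[OF _ i1(2)] by measurable
  have e1: "expectation (\<lambda>w. \<delta> w * v1 (s w)) = \<alpha> * expectation (\<lambda>w. v1 (s w) * m w)" "integrable M (\<lambda>w. \<delta> w * v1 (s w))"
  proof -
    have eq: "\<delta> w * v1 (s w) = \<alpha> * (v1 (s w) * m w) + ?a * (v1 (s w) * D w)" for w by (simp add: \<delta>' algebra_simps)
    show "expectation (\<lambda>w. \<delta> w * v1 (s w)) = \<alpha> * expectation (\<lambda>w. v1 (s w) * m w)" "integrable M (\<lambda>w. \<delta> w * v1 (s w))"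
      unfolding eq using i1(1) d1 by auto
  qed
  have i2: "integrable M (\<lambda>w. v2 (s w) * (m w)\<^sup>2)"
    using bfunD(2)[OF bv(3)] mm by (auto intro!: integrable_bounded_mult[of _ _ C])
  have i3: "integrable M (\<lambda>w. (v2 (s w) * m w) * X w)"
    using bfunD(2)[OF bv(3)] imX by (auto intro!: integrable_bounded_mult[of _ _ C] simp: mult.assoc)
  have d2: "expectation (\<lambda>w. (v2 (s w) * m w) * D w) = 0" "integrable M (\<lambda>w. (v2 (s w) * m w) * D w)"
    using D0[OF _ i3] by measurable
  have d3: "expectation (\<lambda>w. v2 (s w) * (D w)\<^sup>2) = \<sigma>\<^sup>2 * expectation (\<lambda>w. v2 (s w))" "integrable M (\<lambda>w. v2 (s w) * (D w)\<^sup>2)"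
    using bfunD(2)[OF bv(3)] by (auto intro!: D2[of _ C])
  have e2: "expectation (\<lambda>w. (\<delta> w)\<^sup>2 / 2 * v2 (s w)) = \<alpha>\<^sup>2 / 2 * expectation (\<lambda>w. v2 (s w) * (m w)\<^sup>2) + ?a\<^sup>2 * \<sigma>\<^sup>2 / 2 * expectation (\<lambda>w. v2 (s w))"
    "integrable M (\<lambda>w. (\<delta> w)\<^sup>2 / 2 * v2 (s w))"
  proof -
    have eq: "(\<delta> w)\<^sup>2 / 2 * v2 (s w) = \<alpha>\<^sup>2 / 2 * (v2 (s w) * (m w)\<^sup>2) + ?a\<^sup>2 / 2 * (v2 (s w) * (D w)\<^sup>2) + \<alpha> * ?a * ((v2 (s w) * m w) * D w)" for w
      by (simp add: \<delta>2 algebra_simps)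
    show "expectation (\<lambda>w. (\<delta> w)\<^sup>2 / 2 * v2 (s w)) = \<alpha>\<^sup>2 / 2 * expectation (\<lambda>w. v2 (s w) * (m w)\<^sup>2) + ?a\<^sup>2 * \<sigma>\<^sup>2 / 2 * expectation (\<lambda>w. v2 (s w))"
      "integrable M (\<lambda>w. (\<delta> w)\<^sup>2 / 2 * v2 (s w))"
      unfolding eq using i2 d2 d3 by auto
  qed
  have "\<bar>expectation ?R\<bar> \<le> expectation (\<lambda>w. \<bar>?R w\<bar>)" using integral_norm_bound[of M ?R] by simp
  also have "\<dots> \<le> expectation (\<lambda>w. C * \<eta> * (\<delta> w)\<^sup>2 + 2 * C * ?I w)"
    using iv e1 e2 i\<delta>2 iI by (intro integral_mono smooth2_remainder[OF v \<eta>]) auto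
  also have "\<dots> = C * \<eta> * expectation (\<lambda>w. (\<delta> w)\<^sup>2) + 2 * C * expectation ?I"
    using i\<delta>2 iI by simp
  also have "\<dots> \<le> C * \<eta> * (\<alpha>\<^sup>2 * B\<^sup>2 + ?a\<^sup>2 * \<sigma>\<^sup>2) + 2 * C * expectation ?I"
    using E\<delta>2 C0 \<eta> by (intro add_right_mono mult_left_mono) auto
  finally have R: "\<bar>expectation ?R\<bar> \<le> C * \<eta> * (\<alpha>\<^sup>2 * B\<^sup>2 + ?a\<^sup>2 * \<sigma>\<^sup>2) + 2 * C * expectation ?I" .
  have ER: "expectation ?R = expectation (\<lambda>w. v (s w + \<delta> w)) - expectation (\<lambda>w. v (s w)) - \<alpha> * expectation (\<lambda>w. v1 (s w) * m w)
     - (\<alpha>\<^sup>2 / 2 * expectation (\<lambda>w. v2 (s w) * (m w)\<^sup>2) + ?a\<^sup>2 * \<sigma>\<^sup>2 / 2 * expectation (\<lambda>w. v2 (s w)))"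
    using iv e1 e2 by (simp add: add_divide_distrib)
  have "\<bar>\<alpha>\<^sup>2 / 2 * expectation (\<lambda>w. v2 (s w) * (m w)\<^sup>2)\<bar> \<le> \<alpha>\<^sup>2 / 2 * (C * B\<^sup>2)"
  proof -
    have "\<bar>expectation (\<lambda>w. v2 (s w) * (m w)\<^sup>2)\<bar> \<le> expectation (\<lambda>w. \<bar>v2 (s w) * (m w)\<^sup>2\<bar>)"
      using integral_norm_bound[of M "\<lambda>w. v2 (s w) * (m w)\<^sup>2"] by simp
    also have "\<dots> \<le> expectation (\<lambda>w. C * (m w)\<^sup>2)"
      using integrable_abs[OF i2] mm bfunD(2)[OF bv(3)] by (intro integral_mono) (auto simp: abs_mult intro!: mult_right_mono)
    also have "\<dots> \<le> C * B\<^sup>2" using mB C0 by (simp add: mult_left_mono)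
    finally show ?thesis unfolding abs_mult by (intro mult_mono) auto
  qed
  note mid = this
  have comb: "\<bar>v - z\<bar> \<le> e2 + e1 + e3" if "\<bar>v - (y + z)\<bar> \<le> e1 + e3" "\<bar>y\<bar> \<le> e2" for v y z e1 e2 e3 :: real
    using that by linarith
  have eq: "C * \<alpha>\<^sup>2 * B\<^sup>2 / 2 = \<alpha>\<^sup>2 / 2 * (C * B\<^sup>2)" by simp
  show ?thesis unfolding eq using comb[OF R[unfolded ER] mid] by simp
qed

end

context rectangular_family begin

lemma restr_eq:
  assumes "P \<in> \<P>" "Q \<in> \<P>" "\<And>A. A \<in> sets (F n) \<Longrightarrow> emeasure P A = emeasure Q A"
  shows "restr_to_subalg P (F n) = restr_to_subalg Q (F n)"
proof (rule measure_eqI)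
  show "sets (restr_to_subalg P (F n)) = sets (restr_to_subalg Q (F n))"
    by (simp add: sets_restr_to_subalg[OF subalg_\<P>] assms)
  fix A assume "A \<in> sets (restr_to_subalg P (F n))"
  then have "A \<in> sets (F n)" by (simp add: sets_restr_to_subalg[OF subalg_\<P>] assms)
  then show "emeasure (restr_to_subalg P (F n)) A = emeasure (restr_to_subalg Q (F n)) A"
    using assms by (simp add: emeasure_restr_to_subalg[OF subalg_\<P>])
qed

lemma integral_restr_eq:
  fixes f :: "(nat \<Rightarrow> 'a) \<Rightarrow> real"
  assumes "P \<in> \<P>" "Q \<in> \<P>" "\<And>A. A \<in> sets (F n) \<Longrightarrow> emeasure P A = emeasure Q A" and f: "f \<in> borel_measurable (F n)"
  shows "(\<integral>w. f w \<partial>P) = (\<integral>w. f w \<partial>Q)" "integrable Q f \<Longrightarrow> integrable P f"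
  using integral_subalgebra2[OF subalg_\<P>[OF assms(1)] f] integral_subalgebra2[OF subalg_\<P>[OF assms(2)] f]
    integrable_in_subalg[OF subalg_\<P>[OF assms(2)] f] integrable_from_subalg[OF subalg_\<P>[OF assms(1), of n]]
  by (simp_all add: restr_eq[OF assms(1,2,3)])

lemma AE_restr_eq:
  assumes "P \<in> \<P>" "Q \<in> \<P>" "AE w in Q. R w" "{w \<in> path_space S. R w} \<in> sets (F n)"
  shows "AE w in P. R w"
  using AE_equiv[OF assms(2,1,3,4)] .

end

section \<open>Normalised partial sums and their one-step expansion\<close>

locale rectangular_clt = rectangular_family S G \<P> K
  for S :: "nat \<Rightarrow> 'a set" and G :: "nat \<Rightarrow> (nat \<Rightarrow> 'a) measure"
    and \<P> :: "(nat \<Rightarrow> 'a) measure set"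
    and K :: "(nat \<Rightarrow> 'a) measure \<Rightarrow> nat \<Rightarrow> (nat \<Rightarrow> 'a) \<Rightarrow> (nat \<Rightarrow> 'a) measure" +
  fixes X :: "nat \<Rightarrow> (nat \<Rightarrow> 'a) \<Rightarrow> real" and \<mu>l \<mu>u \<sigma> :: real
  assumes adapted: "\<And>i. i \<ge> 1 \<Longrightarrow> X i \<in> borel_measurable (F i)"
    and in_H: "\<And>i. i \<ge> 1 \<Longrightarrow> X i \<in> class_H FT \<P>"
    and bounds: "\<mu>l \<le> \<mu>u" "\<sigma> > 0"
    and upper_mean: "\<And>i P. i \<ge> 1 \<Longrightarrow> P \<in> \<P> \<Longrightarrow>
      is_ess_sup (restr_to_subalg P (F (i - 1))) \<P>
        (\<lambda>Q w. ereal (real_cond_exp Q (F (i - 1)) (X i) w)) (\<lambda>_. ereal \<mu>u)"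
    and lower_mean: "\<And>i P. i \<ge> 1 \<Longrightarrow> P \<in> \<P> \<Longrightarrow>
      is_ess_inf (restr_to_subalg P (F (i - 1))) \<P>
        (\<lambda>Q w. ereal (real_cond_exp Q (F (i - 1)) (X i) w)) (\<lambda>_. ereal \<mu>l)"
    and cond_var: "\<And>i Q. i \<ge> 1 \<Longrightarrow> Q \<in> \<P> \<Longrightarrow>
      AE w in Q. real_cond_exp Q (F (i - 1))
        (\<lambda>w'. (X i w' - real_cond_exp Q (F (i - 1)) (X i) w')\<^sup>2) w = \<sigma>\<^sup>2"
    and lindeberg: "\<And>\<epsilon>::real. \<epsilon> > 0 \<Longrightarrow>
      (\<lambda>n. (\<Sum>i=1..n. SUP Q\<in>\<P>. \<integral>\<^sup>+w\<in>{w. \<bar>X i w\<bar> > sqrt (real n) * \<epsilon>}. ennreal (\<bar>X i w\<bar>\<^sup>2) \<partial>Q)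
        / of_nat n) \<longlonglongrightarrow> 0"
begin

definition m where "m Q i = real_cond_exp Q (F (i - 1)) (X i)"

definition incr where "incr n Q i w = 1 / real n * X i w + 1 / (\<sigma> * sqrt (real n)) * (X i w - m Q i w)"

definition psum where "psum n Q k w = (\<Sum>i=1..k. incr n Q i w)"

lemma clt_statistic_eq: "clt_statistic F X \<sigma> Q n w = psum n Q n w"
  by (simp add: clt_statistic_def psum_def incr_def m_def sum.distrib sum_distrib_left mult.assoc)
     (simp add: field_simps)

lemma X_FT: "i \<ge> 1 \<Longrightarrow> X i \<in> borel_measurable FT"
  by (rule measurable_F_FT[OF adapted])

lemma X_Q: "i \<ge> 1 \<Longrightarrow> Q \<in> \<P> \<Longrightarrow> X i \<in> borel_measurable Q"
  using X_FT by (simp add: measurable_\<P>)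

lemma m_F: "m Q i \<in> borel_measurable (F (i - 1))"
  by (simp add: m_def)

lemma incr_F: "i \<ge> 1 \<Longrightarrow> incr n Q i \<in> borel_measurable (F i)"
  unfolding incr_def[abs_def]
  using adapted[of i] measurable_F_mono[OF m_F, of i i Q] by measurable

lemma psum_F: "psum n Q k \<in> borel_measurable (F k)"
  unfolding psum_def[abs_def]
  by (intro borel_measurable_sum measurable_F_mono[OF incr_F]) auto

lemma psum_Suc: "psum n Q (Suc k) w = psum n Q k w + incr n Q (Suc k) w"
  by (simp add: psum_def)

lemma m_bounds:
  assumes "i \<ge> 1" "Q \<in> \<P>"
  shows "AE w in Q. \<mu>l \<le> m Q i w \<and> m Q i w \<le> \<mu>u"
proof -
  have "AE w in restr_to_subalg Q (F (i - 1)). ereal (m Q i w) \<le> ereal \<mu>u"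
    "AE w in restr_to_subalg Q (F (i - 1)). ereal \<mu>l \<le> ereal (m Q i w)"
    using upper_mean[OF assms] lower_mean[OF assms] assms(2) unfolding is_ess_sup_def is_ess_inf_def m_def by blast+
  then have "AE w in Q. ereal (m Q i w) \<le> ereal \<mu>u" "AE w in Q. ereal \<mu>l \<le> ereal (m Q i w)"
    by (auto intro: AE_restr_to_subalg[OF subalg_\<P>[OF assms(2)]])
  then show ?thesis by eventually_elim simp
qed

lemma m_bounds_Suc: "Q \<in> \<P> \<Longrightarrow> AE w in Q. \<mu>l \<le> m Q (Suc k) w \<and> m Q (Suc k) w \<le> \<mu>u"
  by (rule m_bounds) simp_all

text \<open>Extracted from the Lindeberg condition: for some \<open>n \<ge> i\<close> the quotient
  with threshold \<open>sqrt n\<close> is below 1, hence the large values of \<open>X i\<close> have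
  a finite second moment, and the remaining values are bounded by \<open>sqrt n\<close>.\<close>

lemma X_square_integrable:
  assumes i: "i \<ge> 1" and Q: "Q \<in> \<P>" shows "integrable Q (\<lambda>w. (X i w)\<^sup>2)"
proof -
  interpret Q: prob_space Q by (rule prob_\<P>[OF Q])
  note [measurable] = X_Q[OF i Q]
  let ?L = "\<lambda>n j. SUP Q\<in>\<P>. \<integral>\<^sup>+w\<in>{w. \<bar>X j w\<bar> > sqrt (real n) * 1}. ennreal (\<bar>X j w\<bar>\<^sup>2) \<partial>Q"
  have "eventually (\<lambda>n. (\<Sum>j=1..n. ?L n j) / of_nat n < 1) sequentially"
    using lindeberg[of 1] by (rule order_tendstoD(2)) auto
  then have "eventually (\<lambda>n. (\<Sum>j=1..n. ?L n j) / of_nat n < 1 \<and> i \<le> n) sequentially"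
    using eventually_ge_at_top by (rule eventually_conj)
  then obtain n where n: "(\<Sum>j=1..n. ?L n j) / of_nat n < 1" "i \<le> n" by (auto simp: eventually_sequentially)
  have "(\<Sum>j=1..n. ?L n j) \<noteq> \<infinity>"
  proof
    assume "(\<Sum>j=1..n. ?L n j) = \<infinity>"
    then have "(\<Sum>j=1..n. ?L n j) / of_nat n = \<infinity>" by (simp only: infinity_ennreal_def ennreal_top_divide) simp
    then show False using n(1) by (simp only: infinity_ennreal_def) simp
  qed
  moreover have "?L n i \<le> (\<Sum>j=1..n. ?L n j)" using n(2) i by (intro member_le_sum) auto
  ultimately have "?L n i \<noteq> \<infinity>" unfolding infinity_ennreal_def using neq_top_trans by blast
  then have "?L n i < \<infinity>" by (simp only: infinity_ennreal_def less_top)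
  then have fin: "(\<integral>\<^sup>+w\<in>{w. \<bar>X i w\<bar> > sqrt (real n) * 1}. ennreal (\<bar>X i w\<bar>\<^sup>2) \<partial>Q) < \<infinity>"
    by (rule le_less_trans[OF SUP_upper[OF Q]])
  have "(\<integral>\<^sup>+w. ennreal (norm ((X i w)\<^sup>2)) \<partial>Q) \<le>
    (\<integral>\<^sup>+w. ennreal (\<bar>X i w\<bar>\<^sup>2) * indicator {w. \<bar>X i w\<bar> > sqrt (real n) * 1} w + ennreal (real n) \<partial>Q)"
  proof (rule nn_integral_mono)
    fix w
    show "ennreal (norm ((X i w)\<^sup>2)) \<le> ennreal (\<bar>X i w\<bar>\<^sup>2) * indicator {w. \<bar>X i w\<bar> > sqrt (real n) * 1} w + ennreal (real n)"
    proof (cases "\<bar>X i w\<bar> > sqrt (real n)")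
      case False
      then have "\<bar>X i w\<bar>\<^sup>2 \<le> (sqrt (real n))\<^sup>2" by (intro power_mono) auto
      then show ?thesis using False by (simp add: ennreal_leI)
    qed simp
  qed
  also have "\<dots> = (\<integral>\<^sup>+w\<in>{w. \<bar>X i w\<bar> > sqrt (real n) * 1}. ennreal (\<bar>X i w\<bar>\<^sup>2) \<partial>Q) + ennreal (real n)"
    by (subst nn_integral_add) (auto simp: Q.emeasure_space_1)
  also have "\<dots> < \<infinity>" using fin by (simp add: ennreal_add_less_top)
  finally show ?thesis by (intro integrableI_bounded) auto
qed

text \<open>The sum of suprema dominates the sum for each single measure, whence the same
  \<open>n\<close> works for all of them.\<close>

lemma lindeberg_uniform:
  assumes e: "0 < e" and \<rho>: "0 < \<rho>"
  shows "eventually (\<lambda>n. \<forall>Q\<in>\<P>. (\<Sum>i=1..n. \<integral>w. (X i w)\<^sup>2 * indicator {z. sqrt (real n) * e < \<bar>z\<bar>} (X i w) \<partial>Q) / real n \<le> \<rho>) sequentially"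
proof -
  let ?L = "\<lambda>n j. SUP Q\<in>\<P>. \<integral>\<^sup>+w\<in>{w. \<bar>X j w\<bar> > sqrt (real n) * e}. ennreal (\<bar>X j w\<bar>\<^sup>2) \<partial>Q"
  have "eventually (\<lambda>n. (\<Sum>j=1..n. ?L n j) / of_nat n < ennreal \<rho>) sequentially"
    using lindeberg[OF e] by (rule order_tendstoD(2)) (use \<rho> in auto)
  then show ?thesis
    using eventually_gt_at_top[of 0]
  proof eventually_elim
    case (elim n)
    show ?case
    proof
      fix Q assume Q: "Q \<in> \<P>"
      interpret Q: prob_space Q by (rule prob_\<P>[OF Q])
      let ?f = "\<lambda>i w. (X i w)\<^sup>2 * indicator {z. sqrt (real n) * e < \<bar>z\<bar>} (X i w) :: real"
      have le: "ennreal (\<integral>w. ?f i w \<partial>Q) \<le> ?L n i" if i: "i \<in> {1..n}" for i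
      proof -
        note [measurable] = X_Q[of i Q]
        have "integrable Q (?f i)"
          using X_square_integrable[of i Q] X_Q[of i Q] i Q
          by (subst mult.commute, intro Q.integrable_bounded_mult[of _ _ 1]) (auto simp: indicator_def)
        then have "ennreal (\<integral>w. ?f i w \<partial>Q) = (\<integral>\<^sup>+w. ennreal (?f i w) \<partial>Q)"
          by (intro nn_integral_eq_integral[symmetric]) auto
        also have "\<dots> = (\<integral>\<^sup>+w\<in>{w. \<bar>X i w\<bar> > sqrt (real n) * e}. ennreal (\<bar>X i w\<bar>\<^sup>2) \<partial>Q)"
          by (intro nn_integral_cong) (auto simp: indicator_def)
        also have "\<dots> \<le> ?L n i" by (rule SUP_upper[OF Q])
        finally show ?thesis .
      qed
      have nn: "0 \<le> (\<integral>w. ?f i w \<partial>Q)" for i by (rule integral_nonneg_AE) auto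
      have "ennreal ((\<Sum>i=1..n. \<integral>w. ?f i w \<partial>Q) / real n) = (\<Sum>i=1..n. ennreal (\<integral>w. ?f i w \<partial>Q)) / of_nat n"
        using elim(2) nn by (simp add: divide_ennreal[symmetric] sum_nonneg sum_ennreal ennreal_of_nat_eq_real_of_nat)
      also have "\<dots> \<le> (\<Sum>i=1..n. ?L n i) / of_nat n"
        by (intro divide_right_mono_ennreal sum_mono le)
      also have "\<dots> < ennreal \<rho>" by (rule elim(1))
      finally have "ennreal ((\<Sum>i=1..n. \<integral>w. ?f i w \<partial>Q) / real n) < ennreal \<rho>" .
      moreover have "ennreal a < ennreal \<rho> \<Longrightarrow> a \<le> \<rho>" for a by (meson ennreal_leI leD nle_le)
      ultimately show "(\<Sum>i=1..n. \<integral>w. ?f i w \<partial>Q) / real n \<le> \<rho>" by blast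
    qed
  qed
qed

abbreviation "g z \<equiv> max (\<mu>l * z) (\<mu>u * z)"
abbreviation "B \<equiv> max \<bar>\<mu>l\<bar> \<bar>\<mu>u\<bar>"

text \<open>The loss at step \<open>k\<close>: never positive, and nearly 0 if the conditional mean is nearly the maximiser of the driver.\<close>

definition gap where
  "gap v1 n Q k = (\<integral>w. v1 (psum n Q k w) * m Q (Suc k) w - g (v1 (psum n Q k w)) \<partial>Q)"

text \<open>Conditional means are bounded by \<open>B\<close>, so once \<open>sqrt n\<close> is
  large a big increment forces a big |X i|; then |X i| also exceeds \<open>B\<close>, and the
  increment is at most 2 (1 + 1/\<sigma>) |X i| / sqrt n. This translates the Lindeberg condition
  from \<open>X\<close> to the increments.\<close>

lemma incr_large:
  assumes n: "0 < n" and \<eta>: "0 < \<eta>" and big: "2 * (1 + 1/\<sigma>) * B / \<eta> \<le> sqrt (real n)"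
    and m: "\<bar>m Q i w\<bar> \<le> B"
  shows "(incr n Q i w)\<^sup>2 * indicator {z. \<eta> < \<bar>z\<bar>} (incr n Q i w) \<le>
    (4 * (1 + 1/\<sigma>)\<^sup>2 / real n) * ((X i w)\<^sup>2 * indicator {z. sqrt (real n) * (\<eta> / (2 * (1 + 1/\<sigma>))) < \<bar>z\<bar>} (X i w))"
proof (cases "\<eta> < \<bar>incr n Q i w\<bar>")
  case True
  let ?k = "1 + 1/\<sigma>" and ?r = "sqrt (real n)"
  have k: "1 \<le> ?k" "1/\<sigma> \<le> ?k" "0 < ?k" using bounds by (auto intro: add_pos_pos)
  have r: "1 \<le> ?r" "0 < ?r" "?r * ?r = real n" using n by auto
  have B: "0 \<le> B" by simp
  have "\<bar>incr n Q i w\<bar> \<le> 1 / real n * \<bar>X i w\<bar> + 1 / (\<sigma> * ?r) * (\<bar>X i w\<bar> + B)"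
  proof -
    have "\<bar>1 / (\<sigma> * ?r) * (X i w - m Q i w)\<bar> \<le> 1 / (\<sigma> * ?r) * (\<bar>X i w\<bar> + B)"
      unfolding abs_mult using bounds m by (intro mult_mono) auto
    moreover have "\<bar>1 / real n * X i w\<bar> = 1 / real n * \<bar>X i w\<bar>" by (simp add: abs_mult)
    ultimately show ?thesis unfolding incr_def by linarith
  qed
  also have "\<dots> \<le> 1 / ?r * (\<bar>X i w\<bar> + B) + 1 / (\<sigma> * ?r) * (\<bar>X i w\<bar> + B)"
  proof -
    have "1 / real n \<le> 1 / ?r" using r mult_right_mono[of 1 ?r ?r] by (intro divide_left_mono) auto
    then show ?thesis using B by (intro add_right_mono mult_mono) auto
  qed
  also have "\<dots> = ?k / ?r * (\<bar>X i w\<bar> + B)" by (simp add: add_divide_distrib distrib_right)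
  finally have 1: "\<bar>incr n Q i w\<bar> \<le> ?k / ?r * (\<bar>X i w\<bar> + B)" .
  have "\<eta> < ?k / ?r * (\<bar>X i w\<bar> + B)" using True 1 by linarith
  then have 2: "?r * (\<eta> / ?k) < \<bar>X i w\<bar> + B" using k r by (simp add: field_simps)
  have 3: "B \<le> ?r * (\<eta> / (2 * ?k))"
  proof -
    have "b \<le> ?r * (\<eta> / (2 * \<kappa>))" if "0 < \<kappa>" "2 * \<kappa> * b / \<eta> \<le> ?r" for b \<kappa> :: real
      using that \<eta> by (simp add: field_simps)
    from this[OF k(3) big] show ?thesis .
  qed
  have "?r * (y / \<kappa>) = 2 * (?r * (y / (2 * \<kappa>)))" for y \<kappa> :: real by simp
  note this[of \<eta> ?k]
  moreover have "c < x \<and> b \<le> x" if "a < x + b" "b \<le> c" "a = 2 * c" for a b c x :: real using that by linarith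
  ultimately have 4: "?r * (\<eta> / (2 * ?k)) < \<bar>X i w\<bar>" "B \<le> \<bar>X i w\<bar>" using 2 3 by blast+
  have "\<bar>incr n Q i w\<bar> \<le> ?k / ?r * (2 * \<bar>X i w\<bar>)"
    using 4 k r by (intro order_trans[OF 1] mult_left_mono) auto
  then have "\<bar>incr n Q i w\<bar>\<^sup>2 \<le> (?k / ?r * (2 * \<bar>X i w\<bar>))\<^sup>2" by (intro power_mono) auto
  also have "\<dots> = (4 * ?k\<^sup>2 / real n) * (X i w)\<^sup>2"
    using r by (simp add: power_mult_distrib power_divide)
  finally show ?thesis using True 4 by simp
next
  case False
  then show ?thesis using bounds by (simp add: indicator_def)
qed

text \<open>Space is expanded at the later time, and time is moved back by the equation for
  \<open>u\<close>. The diffusion coefficient (1 + \<sigma>/sqrt n)^2 / n differs from 1/n in lower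
  order only, so the second derivatives cancel up to a small error and drift minus driver, that is
  \<open>gap\<close>, remains.\<close>

lemma one_step:
  assumes Q: "Q \<in> \<P>" and n: "0 < n" and k: "k < n" and d: "1 / real n \<le> d" and ap: "approx_sol g \<epsilon> \<phi> C d u u1 u2"
    and \<eta>: "0 < \<eta>" and big: "2 * (1 + 1/\<sigma>) * B / \<eta> \<le> sqrt (real n)"
  shows "\<bar>(\<integral>w. u (real (Suc k) / real n) (psum n Q (Suc k) w) \<partial>Q) - (\<integral>w. u (real k / real n) (psum n Q k w) \<partial>Q)
      - 1 / real n * gap (u1 (real (Suc k) / real n)) n Q k\<bar>
    \<le> C * B\<^sup>2 / (real n)\<^sup>2 / 2 + C * \<eta> * (B\<^sup>2 / (real n)\<^sup>2 + (1 + \<sigma> / sqrt (real n))\<^sup>2 / real n)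
      + 2 * C * (4 * (1 + 1/\<sigma>)\<^sup>2 / real n * (\<integral>w. (X (Suc k) w)\<^sup>2 * indicator {z. sqrt (real n) * (\<eta> / (2 * (1 + 1/\<sigma>))) < \<bar>z\<bar>} (X (Suc k) w) \<partial>Q))
      + C * ((1 + \<sigma> / sqrt (real n))\<^sup>2 - 1) / real n / 2 + \<epsilon> / real n"
proof -
  interpret Q: prob_space Q by (rule prob_\<P>[OF Q])
  let ?i = "Suc k" and ?t = "real (Suc k) / real n" and ?s = "real k / real n"
  let ?p = "psum n Q k" and ?m = "m Q (Suc k)" and ?\<alpha> = "1 / real n" and ?\<beta> = "1 / (\<sigma> * sqrt (real n))"
  have ts: "?t \<in> {0..1}" "?s \<in> {0..1}" "?s \<le> ?t" "?t - ?s = 1 / real n" using n k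
    by (auto simp: divide_right_mono diff_divide_distrib[symmetric])
  have sm: "smooth2 C (u ?t) (u1 ?t) (u2 ?t)" "smooth2 C (u ?s) (u1 ?s) (u2 ?s)" using ap ts by (auto simp: approx_sol_def)
  have C: "0 \<le> C" using sm by (auto simp: smooth2_def dest: bfunD)
  have bt: "bfun C (u ?t)" "bfun C (u1 ?t)" "bfun C (u2 ?t)" "bfun C (u ?s)" using sm by (auto simp: smooth2_def)
  note [measurable] = bfunD(1)[OF bt(1)] bfunD(1)[OF bt(2)] bfunD(1)[OF bt(3)] bfunD(1)[OF bt(4)]
  have pF: "?p \<in> borel_measurable (F k)" by (rule psum_F)
  have [measurable]: "?p \<in> borel_measurable Q" using measurable_F_FT[OF pF] by (simp add: measurable_\<P>[OF Q])
  have mb0: "AE w in Q. \<bar>?m w\<bar> \<le> B" using m_bounds_Suc[OF Q, of k] by (rule eventually_mono) auto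
  have [measurable]: "?m \<in> borel_measurable Q" by (simp add: m_def)
  have im: "integrable Q ?m" using mb0 by (intro Q.integrable_const_bound) auto
  have x2: "integrable Q (\<lambda>w. (X ?i w)\<^sup>2)" by (rule X_square_integrable[OF _ Q]) simp
  have T: "\<bar>(\<integral>w. u ?t (?p w + incr n Q ?i w) \<partial>Q) - (\<integral>w. u ?t (?p w) \<partial>Q) - ?\<alpha> * (\<integral>w. u1 ?t (?p w) * ?m w \<partial>Q)
      - (?\<alpha> + ?\<beta>)\<^sup>2 * \<sigma>\<^sup>2 / 2 * (\<integral>w. u2 ?t (?p w) \<partial>Q)\<bar>
    \<le> C * ?\<alpha>\<^sup>2 * B\<^sup>2 / 2 + C * \<eta> * (?\<alpha>\<^sup>2 * B\<^sup>2 + (?\<alpha> + ?\<beta>)\<^sup>2 * \<sigma>\<^sup>2)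
      + 2 * C * (\<integral>w. (incr n Q ?i w)\<^sup>2 * indicator {z. \<eta> < \<bar>z\<bar>} (incr n Q ?i w) \<partial>Q)"
  proof (rule Q.taylor_step[OF _ X_Q[OF _ Q] x2 _ mb0 _ pF sm(1) \<eta>])
    show "subalgebra Q (F k)" by (rule subalg_\<P>[OF Q])
    show "?m = real_cond_exp Q (F k) (X ?i)" by (simp add: m_def)
    show "AE w in Q. real_cond_exp Q (F k) (\<lambda>w'. (X ?i w' - real_cond_exp Q (F k) (X ?i) w')\<^sup>2) w = \<sigma>\<^sup>2"
      using cond_var[of ?i, OF _ Q] by simp
    show "incr n Q ?i w = ?\<alpha> * X ?i w + ?\<beta> * (X ?i w - ?m w)" for w by (simp add: incr_def)
  qed simp
  \<comment> \<open>The centred part of \<open>X\<close> enters through both normalisations; its 1/n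
    share merely perturbs the coefficient.\<close>
  have ab: "(?\<alpha> + ?\<beta>)\<^sup>2 * \<sigma>\<^sup>2 = (1 + \<sigma> / sqrt (real n))\<^sup>2 / real n"
  proof -
    have "(?\<alpha> + ?\<beta>) * \<sigma> = (1 + \<sigma> / sqrt (real n)) / sqrt (real n)"
      using bounds n by (simp add: field_simps)
    then have "((?\<alpha> + ?\<beta>) * \<sigma>)\<^sup>2 = ((1 + \<sigma> / sqrt (real n)) / sqrt (real n))\<^sup>2" by simp
    then show ?thesis by (simp add: power_mult_distrib power_divide)
  qed
  have iX: "integrable Q (\<lambda>w. (X ?i w)\<^sup>2 * indicator {z. sqrt (real n) * (\<eta> / (2 * (1 + 1/\<sigma>))) < \<bar>z\<bar>} (X ?i w))"
    using x2 X_Q[of ?i Q] Q by (subst mult.commute, intro Q.integrable_bounded_mult[of _ _ 1]) (auto simp: indicator_def)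
  have large: "(\<integral>w. (incr n Q ?i w)\<^sup>2 * indicator {z. \<eta> < \<bar>z\<bar>} (incr n Q ?i w) \<partial>Q) \<le>
    4 * (1 + 1/\<sigma>)\<^sup>2 / real n * (\<integral>w. (X ?i w)\<^sup>2 * indicator {z. sqrt (real n) * (\<eta> / (2 * (1 + 1/\<sigma>))) < \<bar>z\<bar>} (X ?i w) \<partial>Q)"
    unfolding integral_mult_right_zero[symmetric]
  proof (rule integral_mono_AE')
    show "AE w in Q. (incr n Q ?i w)\<^sup>2 * indicator {z. \<eta> < \<bar>z\<bar>} (incr n Q ?i w) \<le>
      4 * (1 + 1/\<sigma>)\<^sup>2 / real n * ((X ?i w)\<^sup>2 * indicator {z. sqrt (real n) * (\<eta> / (2 * (1 + 1/\<sigma>))) < \<bar>z\<bar>} (X ?i w))"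
      using mb0 by eventually_elim (rule incr_large[OF n \<eta> big])
  qed (use iX in auto)
  have Cabs: "\<bar>\<integral>w. u2 ?t (?p w) \<partial>Q\<bar> \<le> C"
  proof -
    have "(\<lambda>w. u2 ?t (?p w)) \<in> borel_measurable Q" by measurable
    then have i: "integrable Q (\<lambda>w. u2 ?t (?p w))" by (intro Q.integrable_const_bound[of _ C] AE_I2) (simp_all add: bfunD(2)[OF bt(3)] del: of_nat_Suc)
    have "\<bar>\<integral>w. u2 ?t (?p w) \<partial>Q\<bar> \<le> (\<integral>w. \<bar>u2 ?t (?p w)\<bar> \<partial>Q)" using integral_norm_bound[of Q "\<lambda>w. u2 ?t (?p w)"] by simp
    also have "\<dots> \<le> C" using i bfunD(2)[OF bt(3)] by (intro Q.integral_le_const) auto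
    finally show ?thesis .
  qed
  have mm: "(\<lambda>w. u ?s (?p w)) \<in> borel_measurable Q" "(\<lambda>w. u ?t (?p w)) \<in> borel_measurable Q"
    "(\<lambda>w. u2 ?t (?p w)) \<in> borel_measurable Q" "(\<lambda>w. u1 ?t (?p w)) \<in> borel_measurable Q" by measurable
  have i: "integrable Q (\<lambda>w. u ?s (?p w))" "integrable Q (\<lambda>w. u ?t (?p w))" "integrable Q (\<lambda>w. u2 ?t (?p w))"
    "integrable Q (\<lambda>w. u1 ?t (?p w))"
    using Q.integrable_const_bound[OF AE_I2 mm(1), of C] Q.integrable_const_bound[OF AE_I2 mm(2), of C]
      Q.integrable_const_bound[OF AE_I2 mm(3), of C] Q.integrable_const_bound[OF AE_I2 mm(4), of C]
    by (simp_all add: bfunD(2)[OF bt(4)] bfunD(2)[OF bt(1)] bfunD(2)[OF bt(2)] bfunD(2)[OF bt(3)] del: of_nat_Suc)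
  have ig: "integrable Q (\<lambda>w. g (u1 ?t (?p w)))"
    by (intro integrable_max integrable_mult_right i)
  have ium: "integrable Q (\<lambda>w. u1 ?t (?p w) * ?m w)"
    by (rule Q.integrable_bounded_mult[OF im mm(4)]) (rule bfunD(2)[OF bt(2)])
  have cons: "\<bar>(\<integral>w. u ?s (?p w) \<partial>Q) - (\<integral>w. u ?t (?p w) \<partial>Q) - 1 / real n * ((\<integral>w. u2 ?t (?p w) \<partial>Q) / 2 + (\<integral>w. g (u1 ?t (?p w)) \<partial>Q))\<bar> \<le> \<epsilon> / real n"
  proof -
    let ?f = "\<lambda>w. u ?s (?p w) - u ?t (?p w) - 1 / real n * (u2 ?t (?p w) / 2 + g (u1 ?t (?p w)))"
    have td: "?t - ?s \<le> d" unfolding ts(4) by (rule d)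
    note ap' = ap[unfolded approx_sol_def, THEN conjunct2, THEN conjunct2, THEN conjunct2, rule_format, OF ts(2,1,3) td]
    have fb: "\<bar>?f w\<bar> \<le> \<epsilon> / real n" for w
      using conjunct1[OF ap'[unfolded ts(4), of "?p w"]] by simp
    have "\<bar>\<integral>w. ?f w \<partial>Q\<bar> \<le> (\<integral>w. \<bar>?f w\<bar> \<partial>Q)" using integral_norm_bound[of Q ?f] by simp
    also have "\<dots> \<le> \<epsilon> / real n" using i ig fb by (intro Q.integral_le_const) auto
    also have "(\<integral>w. ?f w \<partial>Q) = (\<integral>w. u ?s (?p w) \<partial>Q) - (\<integral>w. u ?t (?p w) \<partial>Q) - 1 / real n * ((\<integral>w. u2 ?t (?p w) \<partial>Q) / 2 + (\<integral>w. g (u1 ?t (?p w)) \<partial>Q))"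
      using i ig by simp
    finally show ?thesis .
  qed
  have gp: "gap (u1 ?t) n Q k = (\<integral>w. u1 ?t (?p w) * ?m w \<partial>Q) - (\<integral>w. g (u1 ?t (?p w)) \<partial>Q)"
    unfolding gap_def using ium ig by simp
  let ?q = "(1 + \<sigma> / sqrt (real n))\<^sup>2"
  have q1: "1 \<le> ?q" using bounds by (intro one_le_power) simp
  let ?E2 = "\<integral>w. u2 ?t (?p w) \<partial>Q"
  have mid: "\<bar>?q / real n / 2 * ?E2 - 1 / real n * (?E2 / 2)\<bar> \<le> C * (?q - 1) / real n / 2"
  proof -
    have "?q / real n / 2 * ?E2 - 1 / real n * (?E2 / 2) = (?q - 1) / real n / 2 * ?E2"
      by (simp add: diff_divide_distrib left_diff_distrib)
    also have "\<bar>\<dots>\<bar> \<le> (?q - 1) / real n / 2 * C" unfolding abs_mult using q1 Cabs by (intro mult_mono) auto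
    finally show ?thesis by (simp add: mult.commute)
  qed
  have T': "\<bar>(\<integral>w. u ?t (psum n Q ?i w) \<partial>Q) - (\<integral>w. u ?t (?p w) \<partial>Q) - 1 / real n * (\<integral>w. u1 ?t (?p w) * ?m w \<partial>Q)
      - ?q / real n / 2 * ?E2\<bar>
    \<le> C * B\<^sup>2 / (real n)\<^sup>2 / 2 + C * \<eta> * (B\<^sup>2 / (real n)\<^sup>2 + ?q / real n)
      + 2 * C * (4 * (1 + 1/\<sigma>)\<^sup>2 / real n * (\<integral>w. (X ?i w)\<^sup>2 * indicator {z. sqrt (real n) * (\<eta> / (2 * (1 + 1/\<sigma>))) < \<bar>z\<bar>} (X ?i w) \<partial>Q))"
    using T[unfolded ab] mult_left_mono[OF large, of "2 * C"] C unfolding psum_Suc power_divide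
    by (simp add: power_divide)
  have comb: "\<bar>a - b - c * (p - q)\<bar> \<le> e1 + e2 + e3"
    if "\<bar>a - v - c * p - z\<bar> \<le> e1" "\<bar>b - v - c * (y / 2 + q)\<bar> \<le> e3" "\<bar>z - c * (y / 2)\<bar> \<le> e2" for a b c p q v z y e1 e2 e3 :: real
    using that by (simp add: algebra_simps abs_le_iff)
  show ?thesis unfolding gp by (rule comb[OF T' cons mid])
qed

end

section \<open>Convergence of the supremum\<close>

context rectangular_clt begin

text \<open>Consecutive expansions share their middle values, and \<open>n\<close> errors of order
  1/n add up. The sum starts at 0, which produces \<open>u 0 0\<close>.\<close>

lemma telescoped:
  assumes Q: "Q \<in> \<P>" and n: "0 < n" and d: "1 / real n \<le> d" and ap: "approx_sol g \<epsilon> \<phi> C d u u1 u2"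
    and \<eta>: "0 < \<eta>" and big: "2 * (1 + 1/\<sigma>) * B / \<eta> \<le> sqrt (real n)"
  shows "\<bar>(\<integral>w. u 1 (psum n Q n w) \<partial>Q) - u 0 0 - 1 / real n * (\<Sum>k<n. gap (u1 (real (Suc k) / real n)) n Q k)\<bar>
    \<le> C * B\<^sup>2 / real n / 2 + C * \<eta> * (B\<^sup>2 / real n + (1 + \<sigma> / sqrt (real n))\<^sup>2)
      + 8 * C * (1 + 1/\<sigma>)\<^sup>2 * ((\<Sum>i=1..n. \<integral>w. (X i w)\<^sup>2 * indicator {z. sqrt (real n) * (\<eta> / (2 * (1 + 1/\<sigma>))) < \<bar>z\<bar>} (X i w) \<partial>Q) / real n)
      + C * ((1 + \<sigma> / sqrt (real n))\<^sup>2 - 1) / 2 + \<epsilon>"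
proof -
  interpret Q: prob_space Q by (rule prob_\<P>[OF Q])
  let ?V = "\<lambda>k. \<integral>w. u (real k / real n) (psum n Q k w) \<partial>Q"
  let ?G = "\<lambda>k. gap (u1 (real (Suc k) / real n)) n Q k"
  let ?I = "\<lambda>i. \<integral>w. (X i w)\<^sup>2 * indicator {z. sqrt (real n) * (\<eta> / (2 * (1 + 1/\<sigma>))) < \<bar>z\<bar>} (X i w) \<partial>Q"
  let ?q = "(1 + \<sigma> / sqrt (real n))\<^sup>2"
  let ?c = "C * B\<^sup>2 / (real n)\<^sup>2 / 2 + C * \<eta> * (B\<^sup>2 / (real n)\<^sup>2 + ?q / real n) + C * (?q - 1) / real n / 2 + \<epsilon> / real n"
  let ?w = "8 * C * (1 + 1/\<sigma>)\<^sup>2 / real n"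
  have st: "\<bar>?V (Suc k) - ?V k - 1 / real n * ?G k\<bar> \<le> ?c + ?w * ?I (Suc k)" if "k < n" for k
  proof -
    have "2 * C * (4 * (1 + 1/\<sigma>)\<^sup>2 / real n * ?I (Suc k)) = ?w * ?I (Suc k)" by simp
    then show ?thesis using one_step[OF Q n that d ap \<eta> big] by linarith
  qed
  have tel: "(\<Sum>k<n. ?V (Suc k) - ?V k) = ?V n - ?V 0" by (rule sum_lessThan_telescope[of "?V"])
  have eq: "?V n - ?V 0 - 1 / real n * (\<Sum>k<n. ?G k) = (\<Sum>k<n. ?V (Suc k) - ?V k - 1 / real n * ?G k)"
    using tel by (simp only: sum_distrib_left sum_subtractf)
  have "\<bar>?V n - ?V 0 - 1 / real n * (\<Sum>k<n. ?G k)\<bar> \<le> (\<Sum>k<n. \<bar>?V (Suc k) - ?V k - 1 / real n * ?G k\<bar>)" unfolding eq by (rule sum_abs)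
  also have "\<dots> \<le> (\<Sum>k<n. ?c + ?w * ?I (Suc k))" by (intro sum_mono st) simp
  also have "\<dots> = real n * ?c + ?w * (\<Sum>k<n. ?I (Suc k))"
    by (simp add: sum.distrib sum_distrib_left)
  also have "(\<Sum>k<n. ?I (Suc k)) = (\<Sum>i=1..n. ?I i)" by (simp add: sum.atLeast1_atMost_eq)
  also have "real n * ?c = C * B\<^sup>2 / real n / 2 + C * \<eta> * (B\<^sup>2 / real n + ?q) + C * (?q - 1) / 2 + \<epsilon>"
    using n by (simp add: distrib_left power2_eq_square[of "real n"] mult.left_commute[of "real n"])
  finally have fin: "\<bar>?V n - ?V 0 - 1 / real n * (\<Sum>k<n. ?G k)\<bar> \<le>
    C * B\<^sup>2 / real n / 2 + C * \<eta> * (B\<^sup>2 / real n + ?q) + C * (?q - 1) / 2 + \<epsilon> + ?w * (\<Sum>i=1..n. ?I i)" .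
  have V: "?V n = (\<integral>w. u 1 (psum n Q n w) \<partial>Q)" "?V 0 = u 0 0" using n Q.prob_space by (auto simp: psum_def)
  have w: "?w * (\<Sum>i=1..n. ?I i) = 8 * C * (1 + 1/\<sigma>)\<^sup>2 * ((\<Sum>i=1..n. ?I i) / real n)" by simp
  show ?thesis using fin unfolding V w by linarith
qed

text \<open>All constants of the approximate solution are fixed before \<open>n\<close>, so each of
  the four discretisation errors falls below \<open>\<epsilon>\<close>; the fifth
  \<open>\<epsilon>\<close> is the defect of the equation. The threshold for \<open>n\<close> does
  not depend on \<open>Q\<close>.\<close>

lemma core_estimate:
  assumes ap: "approx_sol g \<epsilon> \<phi> C d u u1 u2" and \<epsilon>: "0 < \<epsilon>"
  shows "eventually (\<lambda>n. 0 < n \<and> (\<forall>Q\<in>\<P>. \<bar>(\<integral>w. u 1 (psum n Q n w) \<partial>Q) - u 0 0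
    - 1 / real n * (\<Sum>k<n. gap (u1 (real (Suc k) / real n)) n Q k)\<bar> \<le> 5 * \<epsilon>)) sequentially"
proof -
  have d: "0 < d" using ap by (simp add: approx_sol_def)
  have "smooth2 C (u 0) (u1 0) (u2 0)" using ap by (simp add: approx_sol_def)
  then have C: "0 \<le> C" by (auto simp: smooth2_def dest: bfunD)
  define M where "M = B\<^sup>2 + (1 + \<sigma>)\<^sup>2"
  have M: "0 < M" using bounds by (auto simp: M_def intro!: add_nonneg_pos)
  \<comment> \<open>The cut between small and large increments. It makes C \<eta> times the bound
    \<open>M\<close> on the scaled second moments at most \<open>\<epsilon>\<close>, and it is fixed
    before the Lindeberg condition is invoked at level \<open>e\<close>.\<close>
  define \<eta> where "\<eta> = \<epsilon> / ((C + 1) * M)"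
  have \<eta>: "0 < \<eta>" using \<epsilon> C M by (simp add: \<eta>_def)
  have CM: "C * \<eta> * M \<le> \<epsilon>"
  proof -
    have "C * \<eta> * M = \<epsilon> * (C / (C + 1))" using C M by (simp add: \<eta>_def)
    also have "\<dots> \<le> \<epsilon> * 1" using C \<epsilon> by (intro mult_left_mono) auto
    finally show ?thesis by simp
  qed
  define W where "W = 8 * C * (1 + 1/\<sigma>)\<^sup>2"
  have W: "0 \<le> W" using C by (simp add: W_def)
  define e where "e = \<eta> / (2 * (1 + 1/\<sigma>))"
  have e: "0 < e" using \<eta> bounds by (simp add: e_def add_pos_pos)
  have \<rho>: "0 < \<epsilon> / (W + 1)" using \<epsilon> W by simp
  \<comment> \<open>One entry for each demand: mesh below \<open>d\<close>, the range of
    \<open>incr_large\<close>, the squared drift, and the excess of the diffusion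
    coefficient.\<close>
  define N where "N = max (1 / d) (max ((2 * (1 + 1/\<sigma>) * B / \<eta>)\<^sup>2) (max (C * B\<^sup>2 / \<epsilon>) ((C * \<sigma> * (2 + \<sigma>) / \<epsilon>)\<^sup>2)))"
  have "eventually (\<lambda>n. N \<le> real n) sequentially"
    using filterlim_real_sequentially by (auto simp: filterlim_at_top)
  with lindeberg_uniform[OF e \<rho>] show ?thesis
    using eventually_gt_at_top[of 0]
  proof eventually_elim
    case (elim n)
    have n: "0 < n" "1 \<le> real n" using elim by auto
    have Ns: "1 / d \<le> real n" "(2 * (1 + 1/\<sigma>) * B / \<eta>)\<^sup>2 \<le> real n" "C * B\<^sup>2 / \<epsilon> \<le> real n" "(C * \<sigma> * (2 + \<sigma>) / \<epsilon>)\<^sup>2 \<le> real n"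
      using elim(2) unfolding N_def max.bounded_iff by blast+
    have a: "1 / real n \<le> d" using Ns(1) d n by (simp add: field_simps)
    have b: "2 * (1 + 1/\<sigma>) * B / \<eta> \<le> sqrt (real n)" by (rule real_le_rsqrt[OF Ns(2)])
    have r: "1 \<le> sqrt (real n)" using n by simp
    have sr: "\<sigma> / sqrt (real n) \<le> \<sigma>" using r bounds by (simp add: pos_divide_le_eq)
    have q: "(1 + \<sigma> / sqrt (real n))\<^sup>2 \<le> (1 + \<sigma>)\<^sup>2" using sr bounds by (intro power_mono) auto
    have 1: "C * B\<^sup>2 / real n / 2 \<le> \<epsilon>"
    proof -
      have "C * B\<^sup>2 / real n \<le> \<epsilon>" using Ns(3) n \<epsilon> by (simp add: field_simps)
      moreover have "x / 2 \<le> \<epsilon>" if "x \<le> \<epsilon>" for x using that \<epsilon> by simp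
      ultimately show ?thesis by blast
    qed
    have 2: "C * \<eta> * (B\<^sup>2 / real n + (1 + \<sigma> / sqrt (real n))\<^sup>2) \<le> \<epsilon>"
    proof -
      have "B\<^sup>2 / real n \<le> B\<^sup>2" using n by (simp add: divide_le_eq mult_le_cancel_left1)
      then have "C * \<eta> * (B\<^sup>2 / real n + (1 + \<sigma> / sqrt (real n))\<^sup>2) \<le> C * \<eta> * M"
        unfolding M_def using q C \<eta> by (intro mult_left_mono add_mono) auto
      then show ?thesis using CM by linarith
    qed
    have 3: "C * ((1 + \<sigma> / sqrt (real n))\<^sup>2 - 1) / 2 \<le> \<epsilon>"
    proof -
      have c: "C * \<sigma> * (2 + \<sigma>) / \<epsilon> \<le> sqrt (real n)" by (rule real_le_rsqrt[OF Ns(4)])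
      have "(1 + \<sigma> / sqrt (real n))\<^sup>2 - 1 = \<sigma> / sqrt (real n) * (2 + \<sigma> / sqrt (real n))"
        by (simp add: power2_eq_square algebra_simps)
      also have "\<dots> \<le> \<sigma> / sqrt (real n) * (2 + \<sigma>)" using sr bounds by (intro mult_left_mono) auto
      finally have "C * ((1 + \<sigma> / sqrt (real n))\<^sup>2 - 1) \<le> C * (\<sigma> / sqrt (real n) * (2 + \<sigma>))"
        using C by (rule mult_left_mono)
      also have "\<dots> = C * \<sigma> * (2 + \<sigma>) / sqrt (real n)" by simp
      also have "\<dots> \<le> \<epsilon>" using c \<epsilon> r by (simp add: divide_le_eq mult.commute)
      finally have "C * ((1 + \<sigma> / sqrt (real n))\<^sup>2 - 1) \<le> \<epsilon>" .
      moreover have "x / 2 \<le> \<epsilon>" if "x \<le> \<epsilon>" for x using that \<epsilon> by simp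
      ultimately show ?thesis by blast
    qed
    show ?case
    proof (intro conjI ballI)
      fix Q assume Q: "Q \<in> \<P>"
      let ?\<Lambda> = "(\<Sum>i=1..n. \<integral>w. (X i w)\<^sup>2 * indicator {z. sqrt (real n) * e < \<bar>z\<bar>} (X i w) \<partial>Q) / real n"
      have "W * ?\<Lambda> \<le> W * (\<epsilon> / (W + 1))" using elim(1) Q W by (intro mult_left_mono) auto
      also have "\<dots> = \<epsilon> * (W / (W + 1))" by simp
      also have "\<dots> \<le> \<epsilon> * 1" using W \<epsilon> by (intro mult_left_mono) auto
      finally have 4: "W * ?\<Lambda> \<le> \<epsilon>" by simp
      show "\<bar>(\<integral>w. u 1 (psum n Q n w) \<partial>Q) - u 0 0
        - 1 / real n * (\<Sum>k<n. gap (u1 (real (Suc k) / real n)) n Q k)\<bar> \<le> 5 * \<epsilon>"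
        using telescoped[OF Q n(1) a ap \<eta> b, folded e_def W_def] 1 2 3 4 by linarith
    qed (rule n)
  qed
qed

text \<open>Induction on the horizon: a pasting at time \<open>N\<close> leaves the law on
  \<open>F N\<close> alone, so the earlier conditional means and partial sums, although defined
  through the measure, stay the same almost surely and the earlier choices survive.\<close>

lemma steering_sequence:
  fixes b :: "nat \<Rightarrow> real \<Rightarrow> real"
  assumes b: "\<And>k. b k \<in> borel_measurable borel" and e: "0 < e"
  shows "\<exists>Q\<in>\<P>. \<forall>k<N. AE w in Q. if 0 \<le> b k (psum n Q k w) then \<mu>u - e < m Q (Suc k) w else m Q (Suc k) w < \<mu>l + e"
proof (induction N)
  case 0 then show ?case using \<P>_nonempty by auto
next
  case (Suc N)
  let ?good = "\<lambda>Q k w. if 0 \<le> b k (psum n Q k w) then \<mu>u - e < m Q (Suc k) w else m Q (Suc k) w < \<mu>l + e"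
  obtain Q0 where Q0: "Q0 \<in> \<P>" "\<And>k. k < N \<Longrightarrow> AE w in Q0. ?good Q0 k w" using Suc by blast
  define A where "A = {w \<in> path_space S. 0 \<le> b N (psum n Q0 N w)}"
  have A: "A \<in> sets (F N)"
  proof -
    define f where "f = (\<lambda>w. b N (psum n Q0 N w))"
    have [measurable]: "f \<in> borel_measurable (F N)" unfolding f_def by (rule measurable_compose[OF psum_F b])
    have "{w \<in> space (F N). 0 \<le> f w} \<in> sets (F N)" by (rule borel_measurable_le) measurable
    then show ?thesis by (simp add: A_def f_def)
  qed
  obtain P where P: "P \<in> \<P>" and eq: "\<And>A. A \<in> sets (F N) \<Longrightarrow> emeasure P A = emeasure Q0 A"
    and st: "AE w in P. if w \<in> A then \<mu>u - e < real_cond_exp P (F N) (X (Suc N)) w else real_cond_exp P (F N) (X (Suc N)) w < \<mu>l + e"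
    by (rule steering[OF Q0(1) A X_FT[of "Suc N"] e, of \<mu>u \<mu>l])
       (use upper_mean[of "Suc N"] lower_mean[of "Suc N"] in auto)
  interpret P: prob_space P by (rule prob_\<P>[OF P])
  \<comment> \<open>Both \<open>X i\<close> and the test events belong to \<open>F N\<close>, where
    \<open>P\<close> and \<open>Q0\<close> agree, so the old conditional mean passes the
    characterisation under \<open>P\<close>.\<close>
  have m_eq: "AE w in P. m P i w = m Q0 i w" if i: "1 \<le> i" "i \<le> N" for i
    unfolding m_def[of P]
  proof (rule sigma_finite_subalgebra.real_cond_exp_charact[OF sigma_finite_subalg[OF P]])
    interpret SQ: sigma_finite_subalgebra Q0 "F (i - 1)" by (rule sigma_finite_subalg[OF Q0(1)])
    have XN: "X i \<in> borel_measurable (F N)" by (rule measurable_F_mono[OF adapted[OF i(1)] i(2)])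
    have mN: "m Q0 i \<in> borel_measurable (F N)" by (rule measurable_F_mono[OF m_F]) (use i in auto)
    have iX: "integrable Q0 (X i)"
      using finite_measure.square_integrable_imp_integrable[OF prob_space.finite_measure[OF prob_\<P>[OF Q0(1)]] X_Q[OF i(1) Q0(1)] X_square_integrable[OF i(1) Q0(1)]] .
    show "integrable P (X i)" by (rule integral_restr_eq(2)[OF P Q0(1) eq XN iX])
    have im: "integrable Q0 (m Q0 i)" unfolding m_def by (rule SQ.real_cond_exp_int(1)[OF iX])
    show "integrable P (m Q0 i)" by (rule integral_restr_eq(2)[OF P Q0(1) eq mN im])
    show "m Q0 i \<in> borel_measurable (F (i - 1))" by (rule m_F)
    fix A' assume A': "A' \<in> sets (F (i - 1))"
    have A'N: "A' \<in> sets (F N)" using A' F_mono[of "i - 1" N] i by (meson diff_le_self le_trans subsetD)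
    note [measurable] = XN mN A'N
    have "(\<integral>w\<in>A'. X i w \<partial>P) = (\<integral>w\<in>A'. X i w \<partial>Q0)"
      unfolding set_lebesgue_integral_def
      by (rule integral_restr_eq(1)[OF P Q0(1) eq borel_measurable_scaleR[OF borel_measurable_indicator[OF A'N] XN]])
    also have "\<dots> = (\<integral>w\<in>A'. m Q0 i w \<partial>Q0)" unfolding m_def by (rule SQ.real_cond_exp_intA[OF iX A'])
    also have "\<dots> = (\<integral>w\<in>A'. m Q0 i w \<partial>P)"
      unfolding set_lebesgue_integral_def
      by (rule integral_restr_eq(1)[OF P Q0(1) eq borel_measurable_scaleR[OF borel_measurable_indicator[OF A'N] mN], symmetric])
    finally show "(\<integral>w\<in>A'. X i w \<partial>P) = (\<integral>w\<in>A'. m Q0 i w \<partial>P)" .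
  qed
  have p_eq: "AE w in P. psum n P k w = psum n Q0 k w" if "k \<le> N" for k
  proof -
    have "AE w in P. \<forall>i\<in>{1..k}. m P i w = m Q0 i w" using m_eq that by (intro AE_finite_allI) auto
    then show ?thesis by eventually_elim (simp add: psum_def incr_def)
  qed
  have "AE w in P. ?good P k w" if "k < Suc N" for k
  proof (cases "k = N")
    case True
    show ?thesis using st p_eq[of N, OF order_refl] AE_space unfolding True
      by eventually_elim (simp add: A_def m_def space_\<P>[OF P] split: if_splits)
  next
    case False
    then have k: "k < N" using that by simp
    have "AE w in P. ?good Q0 k w"
    proof (rule AE_restr_eq[OF P Q0(1) Q0(2)[OF k]])
      define f where "f = (\<lambda>w. b k (psum n Q0 k w))"
      have [measurable]: "f \<in> borel_measurable (F k)" unfolding f_def by (rule measurable_compose[OF psum_F b])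
      have [measurable]: "m Q0 (Suc k) \<in> borel_measurable (F k)" using m_F[of Q0 "Suc k"] by simp
      have "{w \<in> space (F k). if 0 \<le> f w then \<mu>u - e < m Q0 (Suc k) w else m Q0 (Suc k) w < \<mu>l + e} \<in> sets (F k)" by measurable
      then show "{w \<in> path_space S. ?good Q0 k w} \<in> sets (F k)" unfolding f_def space_F .
    qed
    with p_eq[of k] m_eq[of "Suc k"] k show ?thesis by (auto elim: eventually_elim2 eventually_rev_mp intro: AE_I2)
  qed
  then show ?case using P by blast
qed

lemma gap_nonpos:
  assumes Q: "Q \<in> \<P>" shows "gap v1 n Q k \<le> 0"
proof -
  have "AE w in Q. 0 \<le> - (v1 (psum n Q k w) * m Q (Suc k) w - g (v1 (psum n Q k w)))"
    using m_bounds_Suc[OF Q, of k]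
  proof (rule AE_mp, intro AE_I2 impI)
    fix w assume m: "\<mu>l \<le> m Q (Suc k) w \<and> m Q (Suc k) w \<le> \<mu>u"
    show "0 \<le> - (v1 (psum n Q k w) * m Q (Suc k) w - g (v1 (psum n Q k w)))"
    proof (cases "0 \<le> v1 (psum n Q k w)")
      case True
      then show ?thesis using m mult_left_mono[of "m Q (Suc k) w" \<mu>u "v1 (psum n Q k w)"] by (simp add: mult.commute le_max_iff_disj)
    next
      case False
      then show ?thesis using m mult_left_mono_neg[of \<mu>l "m Q (Suc k) w" "v1 (psum n Q k w)"] by (simp add: mult.commute le_max_iff_disj)
    qed
  qed
  then have "0 \<le> (\<integral>w. - (v1 (psum n Q k w) * m Q (Suc k) w - g (v1 (psum n Q k w))) \<partial>Q)"
    by (rule integral_nonneg_AE)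
  then show ?thesis unfolding gap_def integral_minus by simp
qed

text \<open>Missing the best mean by at most \<open>e\<close> costs at most |v1| e, whichever
  endpoint is the target.\<close>

lemma gap_steered:
  assumes Q: "Q \<in> \<P>" and v: "bfun C v1" and e: "0 < e"
    and st: "AE w in Q. if 0 \<le> v1 (psum n Q k w) then \<mu>u - e < m Q (Suc k) w else m Q (Suc k) w < \<mu>l + e"
  shows "- (C * e) \<le> gap v1 n Q k"
proof -
  interpret Q: prob_space Q by (rule prob_\<P>[OF Q])
  note [measurable] = bfunD(1)[OF v]
  have [measurable]: "psum n Q k \<in> borel_measurable Q" using measurable_F_FT[OF psum_F] by (simp add: measurable_\<P>[OF Q])
  have [measurable]: "m Q (Suc k) \<in> borel_measurable Q" by (simp add: m_def)
  have "AE w in Q. \<bar>m Q (Suc k) w\<bar> \<le> B" using m_bounds_Suc[OF Q, of k] by (rule eventually_mono) auto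
  then have "integrable Q (m Q (Suc k))" by (intro Q.integrable_const_bound) auto
  then have i1: "integrable Q (\<lambda>w. v1 (psum n Q k w) * m Q (Suc k) w)"
    using bfunD(2)[OF v] by (intro Q.integrable_bounded_mult[of _ _ C]) auto
  have i2: "integrable Q (\<lambda>w. g (v1 (psum n Q k w)))"
    using bfunD(2)[OF v] by (intro integrable_max integrable_mult_right Q.integrable_const_bound[of _ C]) auto
  have "AE w in Q. - (C * e) \<le> v1 (psum n Q k w) * m Q (Suc k) w - g (v1 (psum n Q k w))"
    using st
  proof (rule AE_mp, intro AE_I2 impI)
    fix w assume m: "if 0 \<le> v1 (psum n Q k w) then \<mu>u - e < m Q (Suc k) w else m Q (Suc k) w < \<mu>l + e"
    let ?v = "v1 (psum n Q k w)" and ?m = "m Q (Suc k) w"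
    have ve: "\<bar>?v\<bar> * e \<le> C * e" using bfunD(2)[OF v] e by (intro mult_right_mono) auto
    show "- (C * e) \<le> ?v * ?m - g ?v"
    proof (cases "0 \<le> ?v")
      case True
      have "?v * (\<mu>u - e) \<le> ?v * ?m" using m True by (intro mult_left_mono) auto
      moreover have "g ?v = \<mu>u * ?v" using True bounds by (simp add: max_def mult_right_mono)
      ultimately show ?thesis using ve True by (simp add: algebra_simps)
    next
      case False
      have "?v * (\<mu>l + e) \<le> ?v * ?m" using m False by (intro mult_left_mono_neg) auto
      moreover have "g ?v = \<mu>l * ?v" using False bounds mult_right_mono_neg[of \<mu>l \<mu>u ?v] by (simp add: max_def)
      ultimately show ?thesis using ve False by (simp add: algebra_simps)
    qed
  qed
  then show ?thesis unfolding gap_def using i1 i2 by (intro Q.integral_ge_const) auto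
qed

text \<open>The budget is 5 \<epsilon> from \<open>core_estimate\<close>, one for the terminal value
  and one for imperfect steering. The upper bound holds for every measure by the sign of
  \<open>gap\<close>, the lower one for the steered measure.\<close>

theorem sup_near_approximate_solution:
  assumes ap: "approx_sol g \<epsilon> \<phi> C d u u1 u2" and \<epsilon>: "0 < \<epsilon>" and \<phi>: "bfun C\<phi> \<phi>"
  shows "eventually (\<lambda>n. \<bar>(SUP Q\<in>\<P>. \<integral>w. \<phi> (clt_statistic F X \<sigma> Q n w) \<partial>Q) - u 0 0\<bar> \<le> 7 * \<epsilon>) sequentially"
  using core_estimate[OF ap \<epsilon>]
proof eventually_elim
  case (elim n)
  then have n: "0 < n" and est: "\<And>Q. Q \<in> \<P> \<Longrightarrow> \<bar>(\<integral>w. u 1 (psum n Q n w) \<partial>Q) - u 0 0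
    - 1 / real n * (\<Sum>k<n. gap (u1 (real (Suc k) / real n)) n Q k)\<bar> \<le> 5 * \<epsilon>" by auto
  have sm: "smooth2 C (u t) (u1 t) (u2 t)" if "t \<in> {0..1}" for t using ap that by (simp add: approx_sol_def)
  have C: "0 \<le> C" using sm[of 0] by (auto simp: smooth2_def dest: bfunD)
  let ?E = "\<lambda>Q. \<integral>w. \<phi> (clt_statistic F X \<sigma> Q n w) \<partial>Q"
  have near: "\<bar>?E Q - (\<integral>w. u 1 (psum n Q n w) \<partial>Q)\<bar> \<le> \<epsilon>" and Eb: "\<bar>?E Q\<bar> \<le> C\<phi>" if Q: "Q \<in> \<P>" for Q
  proof -
    interpret Q: prob_space Q by (rule prob_\<P>[OF Q])
    have [measurable]: "psum n Q n \<in> borel_measurable Q" using measurable_F_FT[OF psum_F] by (simp add: measurable_\<P>[OF Q])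
    have u: "bfun C (u 1)" using sm[of 1] by (simp add: smooth2_def)
    note [measurable] = bfunD(1)[OF u] bfunD(1)[OF \<phi>]
    have i: "integrable Q (\<lambda>w. \<phi> (psum n Q n w))" "integrable Q (\<lambda>w. u 1 (psum n Q n w))"
      using bfunD(2)[OF u] bfunD(2)[OF \<phi>]
      by (auto intro: Q.integrable_const_bound[of _ C\<phi>] Q.integrable_const_bound[of _ C])
    let ?f = "\<lambda>w. \<phi> (psum n Q n w) - u 1 (psum n Q n w)"
    have "\<bar>\<integral>w. ?f w \<partial>Q\<bar> \<le> (\<integral>w. \<bar>?f w\<bar> \<partial>Q)" using integral_norm_bound[of Q ?f] by simp
    also have "\<dots> \<le> \<epsilon>" using i ap by (intro Q.integral_le_const) (auto simp: approx_sol_def abs_minus_commute)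
    finally show "\<bar>?E Q - (\<integral>w. u 1 (psum n Q n w) \<partial>Q)\<bar> \<le> \<epsilon>" using i by (simp add: clt_statistic_eq)
    have "\<bar>?E Q\<bar> \<le> (\<integral>w. \<bar>\<phi> (psum n Q n w)\<bar> \<partial>Q)" unfolding clt_statistic_eq
      using integral_norm_bound[of Q "\<lambda>w. \<phi> (psum n Q n w)"] by simp
    also have "\<dots> \<le> C\<phi>" using i bfunD(2)[OF \<phi>] by (intro Q.integral_le_const) auto
    finally show "\<bar>?E Q\<bar> \<le> C\<phi>" .
  qed
  have bdd: "bdd_above (?E ` \<P>)" using Eb by (intro bdd_aboveI[of _ C\<phi>]) (auto simp: abs_le_iff)
  have "?E Q \<le> u 0 0 + 6 * \<epsilon>" if Q: "Q \<in> \<P>" for Q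
  proof -
    have "1 / real n * (\<Sum>k<n. gap (u1 (real (Suc k) / real n)) n Q k) \<le> 0"
      by (intro mult_nonneg_nonpos sum_nonpos gap_nonpos[OF Q]) simp
    then show ?thesis using near[OF Q] est[OF Q] by linarith
  qed
  then have up: "(SUP Q\<in>\<P>. ?E Q) \<le> u 0 0 + 6 * \<epsilon>" by (intro cSUP_least \<P>_nonempty)
  \<comment> \<open>The slopes are bounded by \<open>C\<close>, so steering with this accuracy loses
    at most \<open>\<epsilon>\<close> in the average of the gaps.\<close>
  define e where "e = \<epsilon> / (C + 1)"
  have e: "0 < e" using C \<epsilon> by (simp add: e_def)
  have Ce: "C * e \<le> \<epsilon>"
  proof -
    have "C * e = \<epsilon> * (C / (C + 1))" by (simp add: e_def)
    also have "\<dots> \<le> \<epsilon> * 1" using C \<epsilon> by (intro mult_left_mono) auto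
    finally show ?thesis by simp
  qed
  define b where "b k = (if k < n then u1 (real (Suc k) / real n) else (\<lambda>_. 0))" for k
  have b: "bfun C (u1 (real (Suc k) / real n))" if "k < n" for k
    using sm[of "real (Suc k) / real n"] that by (auto simp: smooth2_def)
  have "b k \<in> borel_measurable borel" for k using bfunD(1)[OF b] by (simp add: b_def)
  from steering_sequence[where n=n and N=n and b=b, OF this e] obtain Q where Q: "Q \<in> \<P>"
    and "\<forall>k<n. AE w in Q. if 0 \<le> b k (psum n Q k w) then \<mu>u - e < m Q (Suc k) w else m Q (Suc k) w < \<mu>l + e" by (elim bexE)
  note st = this(2)[THEN spec, THEN mp]
  have "- (C * e) \<le> gap (u1 (real (Suc k) / real n)) n Q k" if k: "k < n" for k
    using st[OF k] k by (intro gap_steered[OF Q b[OF k] e]) (simp add: b_def)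
  then have "(\<Sum>k<n. - (C * e)) \<le> (\<Sum>k<n. gap (u1 (real (Suc k) / real n)) n Q k)" by (intro sum_mono) auto
  then have "1 / real n * (real n * - (C * e)) \<le> 1 / real n * (\<Sum>k<n. gap (u1 (real (Suc k) / real n)) n Q k)"
    by (intro mult_left_mono) simp_all
  then have "- (C * e) \<le> 1 / real n * (\<Sum>k<n. gap (u1 (real (Suc k) / real n)) n Q k)" using n by simp
  then have "u 0 0 - 7 * \<epsilon> \<le> ?E Q" using near[OF Q] est[OF Q] Ce by linarith
  also have "?E Q \<le> (SUP Q\<in>\<P>. ?E Q)" by (rule cSUP_upper[OF Q bdd])
  finally show ?case using up \<epsilon> by linarith
qed

end

section \<open>Brownian increments\<close>

locale brownian =
  fixes W :: "'b measure" and B :: "real \<Rightarrow> 'b \<Rightarrow> real"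
  assumes bm: "brownian_motion W B"

sublocale brownian \<subseteq> prob_space W
  using bm by (simp add: brownian_motion_def)

context brownian begin

abbreviation "Fil \<equiv> brownian_filtration W B"

lemma B_measurable: "0 \<le> t \<Longrightarrow> B t \<in> borel_measurable W"
  and B_0: "AE w in W. B 0 w = 0"
  and B_increment: "0 \<le> s \<Longrightarrow> s < t \<Longrightarrow>
    distributed W lborel (\<lambda>w. B t w - B s w) (\<lambda>x. ennreal (normal_density 0 (sqrt (t - s)) x))"
  and B_indep: "0 \<le> \<tau> 0 \<Longrightarrow> mono \<tau> \<Longrightarrow> indep_vars (\<lambda>_. borel) (\<lambda>k w. B (\<tau> (Suc k)) w - B (\<tau> k) w) {..<n::nat}"
  and B_continuous: "AE w in W. continuous_on {0..} (\<lambda>t. B t w)"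
  using bm unfolding brownian_motion_def by blast+

lemma Fil_gen: "0 \<le> t \<Longrightarrow> {B s -` A \<inter> space W | s A. s \<in> {0..t} \<and> A \<in> sets borel} \<union> null_sets W \<subseteq> sets W"
  using B_measurable by (auto intro: measurable_sets)

lemma Fil_gen_Pow: "{B s -` A \<inter> space W | s A. s \<in> {0..t} \<and> A \<in> sets borel} \<union> null_sets W \<subseteq> Pow (space W)"
  using sets.sets_into_space by auto

lemma space_Fil [simp]: "space (Fil t) = space W"
  unfolding brownian_filtration_def by (rule space_measure_of[OF Fil_gen_Pow])

lemma sets_Fil: "sets (Fil t) = sigma_sets (space W) ({B s -` A \<inter> space W | s A. s \<in> {0..t} \<and> A \<in> sets borel} \<union> null_sets W)"
  unfolding brownian_filtration_def by (rule sets_measure_of[OF Fil_gen_Pow])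

lemma Fil_subset: "0 \<le> t \<Longrightarrow> sets (Fil t) \<subseteq> sets W"
  unfolding sets_Fil by (rule sets.sigma_sets_subset[OF Fil_gen])

lemma Fil_mono: "s \<le> t \<Longrightarrow> sets (Fil s) \<subseteq> sets (Fil t)"
  unfolding sets_Fil
  by (rule sigma_sets_mono', rule Un_mono[OF _ order_refl], clarsimp, intro exI conjI, rule refl) auto

lemma measurable_Fil_W: "f \<in> Fil t \<rightarrow>\<^sub>M N \<Longrightarrow> 0 \<le> t \<Longrightarrow> f \<in> W \<rightarrow>\<^sub>M N"
  by (rule measurable_from_subalg[of W "Fil t", rotated]) (simp_all add: subalgebra_def Fil_subset)

lemma measurable_Fil_mono: "f \<in> Fil s \<rightarrow>\<^sub>M N \<Longrightarrow> s \<le> t \<Longrightarrow> f \<in> Fil t \<rightarrow>\<^sub>M N"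
  by (rule measurable_from_subalg[of "Fil t" "Fil s", rotated]) (simp_all add: subalgebra_def Fil_mono)

lemma null_Fil: "N \<in> null_sets W \<Longrightarrow> N \<in> sets (Fil t)"
  unfolding sets_Fil by (rule sigma_sets.Basic) simp

lemma B_Fil: "0 \<le> s \<Longrightarrow> s \<le> t \<Longrightarrow> B s \<in> borel_measurable (Fil t)"
proof (rule measurableI)
  fix A :: "real set" assume "0 \<le> s" "s \<le> t" "A \<in> sets borel"
  then show "B s -` A \<inter> space (Fil t) \<in> sets (Fil t)"
    unfolding sets_Fil space_Fil by (intro sigma_sets.Basic) auto
qed simp

text \<open>The definition of Brownian motion offers independence of increments along one monotone
  sequence. Listing the finitely many times together with 0 and \<open>s\<close> in order, and
  appending \<open>t\<close>, turns the past values into partial sums of the earlier increments and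
  the new increment into the last one.\<close>

lemma cylinder_indep:
  assumes I: "finite I" "I \<subseteq> {0..s}" and A: "\<And>i. i \<in> I \<Longrightarrow> A i \<in> sets borel" and st: "0 \<le> s" "s < t"
    and C: "C \<in> sets borel"
  shows "prob {w \<in> space W. (\<forall>i\<in>I. B i w \<in> A i) \<and> B t w - B s w \<in> C} =
    prob {w \<in> space W. \<forall>i\<in>I. B i w \<in> A i} * prob {w \<in> space W. B t w - B s w \<in> C}"
proof -
  define J where "J = insert 0 (insert s I)"
  have J: "finite J" "J \<subseteq> {0..s}" "0 \<in> J" "s \<in> J" "J \<noteq> {}" using I st by (auto simp: J_def)
  define p where "p = sorted_list_of_set J"
  have p: "sorted p" "set p = J" "p \<noteq> []" using J by (auto simp: p_def)
  define n where "n = length p"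
  have n: "0 < n" using p by (simp add: n_def)
  \<comment> \<open>Constant equal to \<open>t\<close> from index \<open>n\<close> on, so that the
    sequence is monotone on all natural numbers.\<close>
  define \<tau> where "\<tau> k = (if k < n then p ! k else t)" for k
  have pJ: "p ! k \<in> {0..s}" if "k < n" for k using that J(2) p(2) nth_mem[of k p] by (auto simp: n_def)
  have "mono \<tau>"
  proof (rule monoI)
    fix i j :: nat assume "i \<le> j"
    then show "\<tau> i \<le> \<tau> j"
      using pJ[of i] st p(1) by (auto simp: \<tau>_def n_def intro: sorted_nth_mono)
  qed
  moreover have \<tau>0: "\<tau> 0 = 0"
  proof -
    obtain k where "k < n" "p ! k = 0" using J(3) p(2) by (auto simp: in_set_conv_nth n_def)
    then have "p ! 0 \<le> 0" using p(1) sorted_nth_mono[of p 0 k] by (simp add: n_def)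
    then show ?thesis using pJ[of 0] n by (auto simp: \<tau>_def)
  qed
  ultimately have ind: "indep_vars (\<lambda>_. borel) (\<lambda>k w. B (\<tau> (Suc k)) w - B (\<tau> k) w) {..<n}"
    by (intro B_indep) simp_all
  have last: "\<tau> (n - 1) = s" "\<tau> n = t"
  proof -
    obtain k where k: "k < n" "p ! k = s" using J(4) p(2) by (auto simp: in_set_conv_nth n_def)
    then have "s \<le> p ! (n - 1)" using p(1) sorted_nth_mono[of p k "n - 1"] by (simp add: n_def)
    then show "\<tau> (n - 1) = s" "\<tau> n = t" using pJ[of "n - 1"] n by (auto simp: \<tau>_def)
  qed
  let ?D = "\<lambda>k w. B (\<tau> (Suc k)) w - B (\<tau> k) w"
  let ?X = "\<lambda>w. restrict (\<lambda>k. ?D k w) {..<n-1}" and ?Y = "\<lambda>w. restrict (\<lambda>k. ?D k w) {n-1}"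
  have iv: "indep_var (PiM {..<n-1} (\<lambda>_. borel)) ?X (PiM {n-1} (\<lambda>_. borel)) ?Y"
    using n by (intro indep_var_restrict[OF ind]) auto
  have "\<forall>i\<in>I. \<exists>k<n. p ! k = i" using p(2) by (auto simp: J_def in_set_conv_nth n_def)
  then obtain pos where pos: "\<And>i. i \<in> I \<Longrightarrow> pos i < n" "\<And>i. i \<in> I \<Longrightarrow> p ! pos i = i" by metis
  define S where "S = {x \<in> space (PiM {..<n-1} (\<lambda>_. borel)). \<forall>i\<in>I. (\<Sum>k<pos i. x k) \<in> A i}"
  have S: "S \<in> sets (PiM {..<n-1} (\<lambda>_. borel::real measure))"
  proof -
    have m: "(\<lambda>x. \<Sum>k<pos i. x k) \<in> borel_measurable (PiM {..<n-1} (\<lambda>_. borel::real measure))" if "i \<in> I" for i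
      using pos(1)[OF that] by (intro borel_measurable_sum measurable_component_singleton) auto
    have "{x \<in> space (PiM {..<n-1} (\<lambda>_. borel)). (\<Sum>k<pos i. x k) \<in> A i} \<in> sets (PiM {..<n-1} (\<lambda>_. borel::real measure))" if "i \<in> I" for i
      using measurable_sets[OF m[OF that] A[OF that]] by (simp add: vimage_def Int_def conj_commute)
    then show ?thesis unfolding S_def using I(1) by (intro sets.sets_Collect_finite_All) auto
  qed
  define T where "T = {x \<in> space (PiM {n-1} (\<lambda>_. borel)). x (n-1) \<in> C}"
  have T: "T \<in> sets (PiM {n-1} (\<lambda>_. borel::real measure))"
    using measurable_sets[OF measurable_component_singleton[of "n-1" "{n-1}" "\<lambda>_. borel::real measure"] C]
    by (simp add: T_def vimage_def Int_def conj_commute)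
  have "prob ((?X -` S \<inter> space W) \<inter> (?Y -` T \<inter> space W)) = prob (?X -` S \<inter> space W) * prob (?Y -` T \<inter> space W)"
    using indep_varD[OF iv S T] by (simp add: vimage_def Int_def conj_ac)
  moreover have Y: "?Y -` T \<inter> space W = {w \<in> space W. B t w - B s w \<in> C}"
    using last n by (auto simp: T_def space_PiM)
  \<comment> \<open>Only almost surely, because the sums telescope down to
    \<open>B 0\<close>.\<close>
  moreover have X_eq: "AE w in W. w \<in> ?X -` S \<longleftrightarrow> (\<forall>i\<in>I. B i w \<in> A i)"
    using B_0
  proof eventually_elim
    case (elim w)
    have "(\<Sum>k<pos i. ?X w k) = B i w" if "i \<in> I" for i
    proof -
      have "(\<Sum>k<pos i. ?X w k) = (\<Sum>k<pos i. ?D k w)" using pos(1)[OF that] by (intro sum.cong) auto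
      also have "\<dots> = B (\<tau> (pos i)) w - B (\<tau> 0) w" by (rule sum_lessThan_telescope)
      also have "\<dots> = B i w" using pos[OF that] \<tau>0 elim by (simp add: \<tau>_def)
      finally show ?thesis .
    qed
    moreover have "?X w \<in> space (PiM {..<n-1} (\<lambda>_. borel))" by (simp add: space_PiM)
    ultimately show ?case unfolding S_def vimage_def mem_Collect_eq by (metis (no_types, lifting))
  qed
  moreover have mX: "?X -` S \<inter> space W \<in> sets W" "?Y -` T \<inter> space W \<in> sets W"
    using indep_var_rv1[OF iv] indep_var_rv2[OF iv] S T by (auto intro: measurable_sets)
  moreover have mE: "{w \<in> space W. \<forall>i\<in>I. B i w \<in> A i} \<in> sets W"
  proof (rule sets.sets_Collect_finite_All[OF _ I(1)])
    fix i assume i: "i \<in> I"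
    then have "B i \<in> borel_measurable W" using I(2) by (intro B_measurable) auto
    from measurable_sets[OF this A[OF i]] show "{w \<in> space W. B i w \<in> A i} \<in> sets W"
      by (simp add: vimage_def Int_def conj_commute)
  qed
  moreover have "prob (?X -` S \<inter> space W) = prob {w \<in> space W. \<forall>i\<in>I. B i w \<in> A i}"
    using X_eq AE_space by (intro finite_measure_eq_AE mX mE) (auto elim!: eventually_elim2)
  moreover have "prob ((?X -` S \<inter> space W) \<inter> (?Y -` T \<inter> space W)) =
     prob ({w \<in> space W. \<forall>i\<in>I. B i w \<in> A i} \<inter> (?Y -` T \<inter> space W))"
    using X_eq AE_space by (intro finite_measure_eq_AE sets.Int mX mE) (auto elim!: eventually_elim2)
  moreover have "{w \<in> space W. (\<forall>i\<in>I. B i w \<in> A i) \<and> B t w - B s w \<in> C} =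
    {w \<in> space W. \<forall>i\<in>I. B i w \<in> A i} \<inter> {w \<in> space W. B t w - B s w \<in> C}" by auto
  ultimately show ?thesis by simp
qed

text \<open>Independence is inherited from generators stable under intersection. The cylinders are
  taken up to null sets, so that the augmentation of the filtration is covered by the same
  family.\<close>

lemma increment_indep_Fil:
  assumes st: "0 \<le> s" "s < t"
  shows "indep_set (sets (Fil s)) (sigma_sets (space W) {(\<lambda>w. B t w - B s w) -` C \<inter> space W | C. C \<in> sets borel})"
proof -
  let ?D = "\<lambda>w. B t w - B s w"
  let ?\<D> = "{?D -` C \<inter> space W | C. C \<in> sets borel}"
  define cyl where "cyl I A E \<longleftrightarrow> finite I \<and> I \<subseteq> {0..s} \<and> (\<forall>i\<in>I. A i \<in> sets (borel::real measure)) \<and>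
    (AE w in W. w \<in> E \<longleftrightarrow> (\<forall>i\<in>I. B i w \<in> A i))" for I A E
  define \<G> where "\<G> = {E \<in> sets W. \<exists>I A. cyl I A E}"
  have Dm: "?D \<in> borel_measurable W" using B_measurable[of s] B_measurable[of t] st by auto
  have "indep_set (sigma_sets (space W) \<G>) (sigma_sets (space W) ?\<D>)"
  proof (rule indep_set_sigma_sets)
    show "indep_set \<G> ?\<D>"
      unfolding indep_sets2_eq
    proof (intro conjI ballI)
      show "\<G> \<subseteq> events" by (auto simp: \<G>_def)
      show "?\<D> \<subseteq> events" using measurable_sets[OF Dm] by auto
      fix a b assume a: "a \<in> \<G>" and b: "b \<in> ?\<D>"
      obtain I A where c: "cyl I A a" and aW: "a \<in> sets W" using a by (auto simp: \<G>_def)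
      note c' = c[unfolded cyl_def]
      obtain C where C: "C \<in> sets borel" "b = ?D -` C \<inter> space W" using b by auto
      have bW: "b \<in> sets W" using measurable_sets[OF Dm C(1)] C(2) by simp
      have b_eq: "b = {w \<in> space W. ?D w \<in> C}" using C(2) by auto
      let ?E = "{w \<in> space W. \<forall>i\<in>I. B i w \<in> A i}"
      have E: "?E \<in> sets W"
      proof (rule sets.sets_Collect_finite_All)
        fix i assume i: "i \<in> I"
        then have "i \<in> {0..s}" using c' by blast
        then have "B i \<in> borel_measurable W" "A i \<in> sets borel" using c' i by (auto intro: B_measurable)
        from measurable_sets[OF this] show "{w \<in> space W. B i w \<in> A i} \<in> sets W"
          by (simp add: vimage_def Int_def conj_commute)
      qed (use c' in auto)
      have ae: "AE w in W. w \<in> a \<longleftrightarrow> w \<in> ?E" using conjunct2[OF conjunct2[OF conjunct2[OF c']]] AE_space by eventually_elim auto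
      have "prob (a \<inter> b) = prob (?E \<inter> b)"
        using ae by (intro finite_measure_eq_AE sets.Int aW bW E) (auto elim: eventually_mono)
      also have "?E \<inter> b = {w \<in> space W. (\<forall>i\<in>I. B i w \<in> A i) \<and> ?D w \<in> C}" by (auto simp: b_eq)
      also have "prob \<dots> = prob ?E * prob b"
        unfolding b_eq using c' by (intro cylinder_indep st C(1)) auto
      also have "prob ?E = prob a" using ae by (intro finite_measure_eq_AE aW E) (auto elim: eventually_mono)
      finally show "prob (a \<inter> b) = prob a * prob b" .
    qed
    show "Int_stable ?\<D>"
    proof (rule Int_stableI)
      fix a b assume "a \<in> ?\<D>" "b \<in> ?\<D>"
      then obtain C C' where "C \<in> sets borel" "C' \<in> sets borel" "a = ?D -` C \<inter> space W" "b = ?D -` C' \<inter> space W" by auto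
      then have "a \<inter> b = ?D -` (C \<inter> C') \<inter> space W" "C \<inter> C' \<in> sets borel" by auto
      then show "a \<inter> b \<in> ?\<D>" by blast
    qed
    show "Int_stable \<G>"
    proof (rule Int_stableI)
      fix a b assume "a \<in> \<G>" "b \<in> \<G>"
      then obtain I A J A' where c: "cyl I A a" "cyl J A' b" and s: "a \<in> sets W" "b \<in> sets W" by (auto simp: \<G>_def)
      let ?A = "\<lambda>i. (if i \<in> I then A i else UNIV) \<inter> (if i \<in> J then A' i else UNIV)"
      have "AE w in W. w \<in> a \<longleftrightarrow> (\<forall>i\<in>I. B i w \<in> A i)" "AE w in W. w \<in> b \<longleftrightarrow> (\<forall>i\<in>J. B i w \<in> A' i)"
        using c by (auto simp: cyl_def)
      then have "AE w in W. w \<in> a \<inter> b \<longleftrightarrow> (\<forall>i\<in>I \<union> J. B i w \<in> ?A i)" by eventually_elim auto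
      then have "cyl (I \<union> J) ?A (a \<inter> b)" using c unfolding cyl_def by auto
      then show "a \<inter> b \<in> \<G>" using s by (auto simp: \<G>_def)
    qed
  qed
  moreover have "sets (Fil s) \<subseteq> sigma_sets (space W) \<G>"
    unfolding sets_Fil
  proof (rule sigma_sets_mono', rule subsetI)
    fix E assume "E \<in> {B u -` A \<inter> space W | u A. u \<in> {0..s} \<and> A \<in> sets borel} \<union> null_sets W"
    then show "E \<in> \<G>"
    proof
      assume "E \<in> {B u -` A \<inter> space W | u A. u \<in> {0..s} \<and> A \<in> sets borel}"
      then obtain u A where u: "E = B u -` A \<inter> space W" "u \<in> {0..s}" "A \<in> sets borel" by blast
      then have "cyl {u} (\<lambda>_. A) E" by (auto simp: cyl_def intro!: AE_I2)
      then show ?thesis using u measurable_sets[OF B_measurable[of u] u(3)] by (auto simp: \<G>_def)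
    next
      assume N: "E \<in> null_sets W"
      \<comment> \<open>A null set is almost surely the empty cylinder.\<close>
      then have "cyl {0} (\<lambda>_. {}) E" using st AE_not_in[OF N] by (auto simp: cyl_def)
      then show ?thesis using N by (auto simp: \<G>_def)
    qed
  qed
  ultimately show ?thesis unfolding indep_sets2_eq by blast
qed

text \<open>Independence factorises the expectation. The case \<open>s = t\<close> is separate, as
  the increment is then 0 and has no density.\<close>

lemma increment_expectation:
  fixes \<xi> :: "'b \<Rightarrow> real" and h :: "real \<Rightarrow> real"
  assumes st: "0 \<le> s" "s \<le> t" and \<xi>: "\<xi> \<in> borel_measurable (Fil s)" "integrable W \<xi>"
    and h[measurable]: "h \<in> borel_measurable borel" and hi: "integrable gauss (\<lambda>z. h (sqrt (t - s) * z))"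
  shows "integrable W (\<lambda>w. \<xi> w * h (B t w - B s w))"
    and "expectation (\<lambda>w. \<xi> w * h (B t w - B s w)) = expectation \<xi> * (\<integral>z. h (sqrt (t - s) * z) \<partial>gauss)"
proof -
  have "integrable W (\<lambda>w. \<xi> w * h (B t w - B s w)) \<and>
    expectation (\<lambda>w. \<xi> w * h (B t w - B s w)) = expectation \<xi> * (\<integral>z. h (sqrt (t - s) * z) \<partial>gauss)"
  proof (cases "s = t")
    case True
    then show ?thesis using \<xi>(2) gauss.prob_space by simp
  next
    case False
    then have lt: "s < t" using st by simp
    let ?D = "\<lambda>w. B t w - B s w"
    have [measurable]: "?D \<in> borel_measurable W" using B_measurable[of s] B_measurable[of t] st by auto
    have dD: "distr W borel ?D = distr gauss borel (\<lambda>z. sqrt (t - s) * z)"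
      using B_increment[OF st(1) lt] distr_gauss_scale[of "t - s"] lt
      by (simp add: distributed_def cong: distr_cong)
    have "integrable (distr gauss borel (\<lambda>z. sqrt (t - s) * z)) h" using hi by (simp add: integrable_distr_eq)
    then have i1: "integrable W (\<lambda>w. h (?D w))" unfolding dD[symmetric] by (simp add: integrable_distr_eq)
    have "expectation (\<lambda>w. h (?D w)) = (\<integral>x. h x \<partial>distr W borel ?D)" by (subst integral_distr) auto
    also have "\<dots> = (\<integral>z. h (sqrt (t - s) * z) \<partial>gauss)" unfolding dD by (subst integral_distr) auto
    finally have i2: "expectation (\<lambda>w. h (?D w)) = (\<integral>z. h (sqrt (t - s) * z) \<partial>gauss)" .
    have "indep_var borel \<xi> borel (\<lambda>w. h (?D w))"
      unfolding indep_var_eq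
    proof (intro conjI)
      show "\<xi> \<in> borel_measurable W" by (rule measurable_Fil_W[OF \<xi>(1) st(1)])
      have 1: "sigma_sets (space W) {\<xi> -` A \<inter> space W | A. A \<in> sets borel} \<subseteq> sets (Fil s)"
      proof -
        have "{\<xi> -` A \<inter> space W | A. A \<in> sets borel} \<subseteq> sets (Fil s)" using measurable_sets[OF \<xi>(1)] by auto
        then show ?thesis using sets.sigma_sets_subset[of _ "Fil s"] by simp
      qed
      have 2: "sigma_sets (space W) {(\<lambda>w. h (?D w)) -` A \<inter> space W | A. A \<in> sets borel} \<subseteq>
          sigma_sets (space W) {?D -` C \<inter> space W | C. C \<in> sets borel}"
      proof (rule sigma_sets_mono', rule subsetI)
        fix E assume "E \<in> {(\<lambda>w. h (?D w)) -` A \<inter> space W | A. A \<in> sets borel}"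
        then obtain A where A: "A \<in> sets borel" "E = (\<lambda>w. h (?D w)) -` A \<inter> space W" by auto
        then have "E = ?D -` (h -` A) \<inter> space W" "h -` A \<in> sets borel" using measurable_sets[OF h A(1)] by auto
        then show "E \<in> {?D -` C \<inter> space W | C. C \<in> sets borel}" by blast
      qed
      show "indep_set (sigma_sets (space W) {\<xi> -` A \<inter> space W | A. A \<in> sets borel})
        (sigma_sets (space W) {(\<lambda>w. h (?D w)) -` A \<inter> space W | A. A \<in> sets borel})"
        using increment_indep_Fil[OF st(1) lt] 1 2 unfolding indep_sets2_eq by blast
    qed simp
    from indep_var_integrable[OF this \<xi>(2) i1] indep_var_lebesgue_integral[OF this \<xi>(2) i1] i2
    show ?thesis by simp
  qed
  then show "integrable W (\<lambda>w. \<xi> w * h (B t w - B s w))"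
    "expectation (\<lambda>w. \<xi> w * h (B t w - B s w)) = expectation \<xi> * (\<integral>z. h (sqrt (t - s) * z) \<partial>gauss)" by auto
qed

text \<open>Pythagoras: the new term is orthogonal to everything known at time \<open>s\<close>,
  since \<open>h\<close> has mean 0 under the increment. A general \<open>h\<close> is kept because
  two cases are needed, the increment itself for the stochastic integral and its centred square for
  the Ito correction.\<close>

lemma square_step:
  fixes a \<xi> :: "'b \<Rightarrow> real" and h :: "real \<Rightarrow> real"
  assumes st: "0 \<le> s" "s \<le> t" and a: "a \<in> borel_measurable (Fil s)" "integrable W (\<lambda>w. (a w)\<^sup>2)"
    and \<xi>: "\<xi> \<in> borel_measurable (Fil s)" "\<And>w. w \<in> space W \<Longrightarrow> \<bar>\<xi> w\<bar> \<le> C"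
    and h: "h \<in> borel_measurable borel" and h0: "(\<integral>z. h (sqrt (t - s) * z) \<partial>gauss) = 0"
    and h1: "integrable gauss (\<lambda>z. h (sqrt (t - s) * z))"
    and h2: "integrable gauss (\<lambda>z. (h (sqrt (t - s) * z))\<^sup>2)"
  shows "integrable W (\<lambda>w. (a w + \<xi> w * h (B t w - B s w))\<^sup>2)"
    and "expectation (\<lambda>w. (a w + \<xi> w * h (B t w - B s w))\<^sup>2) =
      expectation (\<lambda>w. (a w)\<^sup>2) + expectation (\<lambda>w. (\<xi> w)\<^sup>2) * (\<integral>z. (h (sqrt (t - s) * z))\<^sup>2 \<partial>gauss)"
proof -
  let ?H = "\<lambda>w. h (B t w - B s w)"
  have aW[measurable]: "a \<in> borel_measurable W" and \<xi>W[measurable]: "\<xi> \<in> borel_measurable W"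
    using measurable_Fil_W[OF a(1) st(1)] measurable_Fil_W[OF \<xi>(1) st(1)] .
  have i\<xi>2: "integrable W (\<lambda>w. (\<xi> w)\<^sup>2)"
  proof (rule integrable_const_bound[of _ "C\<^sup>2"])
    show "AE w in W. norm ((\<xi> w)\<^sup>2) \<le> C\<^sup>2"
    proof (rule AE_I2)
      fix w assume "w \<in> space W"
      then have "\<bar>\<xi> w\<bar>\<^sup>2 \<le> C\<^sup>2" using \<xi>(2) by (intro power_mono) auto
      then show "norm ((\<xi> w)\<^sup>2) \<le> C\<^sup>2" by simp
    qed
  qed simp
  have ia: "integrable W a" by (rule square_integrable_imp_integrable[OF aW a(2)])
  have ia\<xi>: "integrable W (\<lambda>w. a w * \<xi> w)"
  proof (rule Bochner_Integration.integrable_bound)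
    show "integrable W (\<lambda>w. C * a w)" using ia by simp
    show "AE w in W. norm (a w * \<xi> w) \<le> norm (C * a w)"
    proof (rule AE_I2)
      fix w assume "w \<in> space W"
      then have "\<bar>\<xi> w\<bar> \<le> \<bar>C\<bar>" using \<xi>(2)[of w] by linarith
      then show "norm (a w * \<xi> w) \<le> norm (C * a w)" by (simp add: abs_mult mult.commute mult_right_mono)
    qed
  qed simp
  have m1: "(\<lambda>w. a w * \<xi> w) \<in> borel_measurable (Fil s)" "(\<lambda>w. (\<xi> w)\<^sup>2) \<in> borel_measurable (Fil s)"
    using a(1) \<xi>(1) by measurable
  have h2m: "(\<lambda>x. (h x)\<^sup>2) \<in> borel_measurable borel" using h by measurable
  note c = increment_expectation[OF st m1(1) ia\<xi> h h1] and q = increment_expectation[OF st m1(2) i\<xi>2 h2m h2]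
  have eq: "(a w + \<xi> w * ?H w)\<^sup>2 = (a w)\<^sup>2 + 2 * (a w * \<xi> w * ?H w) + (\<xi> w)\<^sup>2 * (?H w)\<^sup>2" for w
    by (simp add: power2_eq_square algebra_simps)
  show "integrable W (\<lambda>w. (a w + \<xi> w * ?H w)\<^sup>2)" unfolding eq using a(2) c(1) q(1) by simp
  show "expectation (\<lambda>w. (a w + \<xi> w * ?H w)\<^sup>2) =
      expectation (\<lambda>w. (a w)\<^sup>2) + expectation (\<lambda>w. (\<xi> w)\<^sup>2) * (\<integral>z. (h (sqrt (t - s) * z))\<^sup>2 \<partial>gauss)"
    unfolding eq using a(2) c q h0 by simp
qed

end

section \<open>Simple integrals\<close>

context brownian begin

lemma increment_Fil: "0 \<le> s \<Longrightarrow> s \<le> t \<Longrightarrow> (\<lambda>w. B t w - B s w) \<in> borel_measurable (Fil t)"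
  by (intro borel_measurable_diff B_Fil) auto

lemma partition_square:
  fixes \<xi> :: "nat \<Rightarrow> 'b \<Rightarrow> real" and h :: "nat \<Rightarrow> real \<Rightarrow> real" and v :: "nat \<Rightarrow> real"
  assumes \<tau>: "0 \<le> \<tau> 0" "\<And>k. k < n \<Longrightarrow> \<tau> k \<le> \<tau> (Suc k)"
    and \<eta>: "\<eta> \<in> borel_measurable (Fil (\<tau> 0))" "integrable W (\<lambda>w. (\<eta> w)\<^sup>2)"
    and \<xi>: "\<And>k. k < n \<Longrightarrow> \<xi> k \<in> borel_measurable (Fil (\<tau> k))" "\<And>k w. k < n \<Longrightarrow> w \<in> space W \<Longrightarrow> \<bar>\<xi> k w\<bar> \<le> C k"
    and h: "\<And>k. k < n \<Longrightarrow> h k \<in> borel_measurable borel" "\<And>k. k < n \<Longrightarrow> (\<integral>z. h k (sqrt (\<tau> (Suc k) - \<tau> k) * z) \<partial>gauss) = 0"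
      "\<And>k. k < n \<Longrightarrow> integrable gauss (\<lambda>z. h k (sqrt (\<tau> (Suc k) - \<tau> k) * z))"
      "\<And>k. k < n \<Longrightarrow> integrable gauss (\<lambda>z. (h k (sqrt (\<tau> (Suc k) - \<tau> k) * z))\<^sup>2)"
      "\<And>k. k < n \<Longrightarrow> (\<integral>z. (h k (sqrt (\<tau> (Suc k) - \<tau> k) * z))\<^sup>2 \<partial>gauss) = v k"
  shows "(\<lambda>w. \<eta> w + (\<Sum>k<n. \<xi> k w * h k (B (\<tau> (Suc k)) w - B (\<tau> k) w))) \<in> borel_measurable (Fil (\<tau> n))"
    and "integrable W (\<lambda>w. (\<eta> w + (\<Sum>k<n. \<xi> k w * h k (B (\<tau> (Suc k)) w - B (\<tau> k) w)))\<^sup>2)"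
    and "expectation (\<lambda>w. (\<eta> w + (\<Sum>k<n. \<xi> k w * h k (B (\<tau> (Suc k)) w - B (\<tau> k) w)))\<^sup>2) =
      expectation (\<lambda>w. (\<eta> w)\<^sup>2) + (\<Sum>k<n. expectation (\<lambda>w. (\<xi> k w)\<^sup>2) * v k)"
proof -
  let ?S = "\<lambda>j w. \<eta> w + (\<Sum>k<j. \<xi> k w * h k (B (\<tau> (Suc k)) w - B (\<tau> k) w))"
  have "j \<le> n \<Longrightarrow> 0 \<le> \<tau> j \<and> ?S j \<in> borel_measurable (Fil (\<tau> j)) \<and> integrable W (\<lambda>w. (?S j w)\<^sup>2) \<and>
    expectation (\<lambda>w. (?S j w)\<^sup>2) = expectation (\<lambda>w. (\<eta> w)\<^sup>2) + (\<Sum>k<j. expectation (\<lambda>w. (\<xi> k w)\<^sup>2) * v k)" for j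
  proof (induction j)
    case 0 then show ?case using \<tau> \<eta> by simp
  next
    case (Suc j)
    then have j: "j < n" and IH: "0 \<le> \<tau> j" "?S j \<in> borel_measurable (Fil (\<tau> j))" "integrable W (\<lambda>w. (?S j w)\<^sup>2)"
      "expectation (\<lambda>w. (?S j w)\<^sup>2) = expectation (\<lambda>w. (\<eta> w)\<^sup>2) + (\<Sum>k<j. expectation (\<lambda>w. (\<xi> k w)\<^sup>2) * v k)" by auto
    have Sj: "?S (Suc j) = (\<lambda>w. ?S j w + \<xi> j w * h j (B (\<tau> (Suc j)) w - B (\<tau> j) w))" by (simp add: fun_eq_iff)
    note step = square_step[OF IH(1) \<tau>(2)[OF j] IH(2,3) \<xi>(1)[OF j] \<xi>(2)[OF j] h(1)[OF j] h(2)[OF j] h(3)[OF j] h(4)[OF j]]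
    have m1: "?S j \<in> borel_measurable (Fil (\<tau> (Suc j)))" "\<xi> j \<in> borel_measurable (Fil (\<tau> (Suc j)))"
      using measurable_Fil_mono[OF IH(2) \<tau>(2)[OF j]] measurable_Fil_mono[OF \<xi>(1)[OF j] \<tau>(2)[OF j]] .
    have m2: "(\<lambda>w. h j (B (\<tau> (Suc j)) w - B (\<tau> j) w)) \<in> borel_measurable (Fil (\<tau> (Suc j)))"
      by (rule measurable_compose[OF increment_Fil[OF IH(1) \<tau>(2)[OF j]] h(1)[OF j]])
    have "?S (Suc j) \<in> borel_measurable (Fil (\<tau> (Suc j)))"
      unfolding Sj by (rule borel_measurable_add[OF m1(1) borel_measurable_times[OF m1(2) m2]])
    moreover have "integrable W (\<lambda>w. (?S (Suc j) w)\<^sup>2)" using step(1) by (simp add: add.assoc)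
    moreover have "expectation (\<lambda>w. (?S (Suc j) w)\<^sup>2) = expectation (\<lambda>w. (\<eta> w)\<^sup>2) + (\<Sum>k<Suc j. expectation (\<lambda>w. (\<xi> k w)\<^sup>2) * v k)"
      using step(2) IH(4) h(5)[OF j] by (simp add: add.assoc)
    moreover have "0 \<le> \<tau> (Suc j)" using IH(1) \<tau>(2)[OF j] by linarith
    ultimately show ?case by blast
  qed
  from this[of n] show "?S n \<in> borel_measurable (Fil (\<tau> n))" "integrable W (\<lambda>w. (?S n w)\<^sup>2)"
    "expectation (\<lambda>w. (?S n w)\<^sup>2) = expectation (\<lambda>w. (\<eta> w)\<^sup>2) + (\<Sum>k<n. expectation (\<lambda>w. (\<xi> k w)\<^sup>2) * v k)" by auto
qed

lemma simple_integrandD: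
  assumes "simple_integrand W B a b n \<tau> \<xi>"
  shows "\<tau> 0 = a" "\<tau> n = b" "\<And>k. k < n \<Longrightarrow> \<tau> k \<le> \<tau> (Suc k)" "\<And>k. k < n \<Longrightarrow> \<xi> k \<in> borel_measurable (Fil (\<tau> k))"
    "\<exists>C. \<forall>k<n. \<forall>w\<in>space W. \<bar>\<xi> k w\<bar> \<le> C k"
proof -
  show "\<tau> 0 = a" "\<tau> n = b" "\<And>k. k < n \<Longrightarrow> \<tau> k \<le> \<tau> (Suc k)" "\<And>k. k < n \<Longrightarrow> \<xi> k \<in> borel_measurable (Fil (\<tau> k))"
    using assms by (auto simp: simple_integrand_def)
  have "\<forall>k. k < n \<longrightarrow> (\<exists>C. \<forall>w\<in>space W. \<bar>\<xi> k w\<bar> \<le> C)" using assms by (auto simp: simple_integrand_def bounded_iff)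
  then show "\<exists>C. \<forall>k<n. \<forall>w\<in>space W. \<bar>\<xi> k w\<bar> \<le> C k" by metis
qed

lemma partition_mono:
  assumes "\<And>k. k < n \<Longrightarrow> \<tau> k \<le> (\<tau> (Suc k) :: real)" "i \<le> j" "j \<le> n" shows "\<tau> i \<le> \<tau> j"
  using assms(2,3)
proof (induction rule: dec_induct)
  case (step m) then show ?case using assms(1)[of m] by simp
qed simp

text \<open>The summand \<open>\<eta>\<close> is known at the left end and orthogonal to the
  integral. Energy estimates for the backward equation use precisely this, with
  \<open>\<eta>\<close> the difference of two solutions at the left end of the interval.\<close>

lemma simple_square:
  assumes si: "simple_integrand W B a b n \<tau> \<xi>" and a: "0 \<le> a"
    and \<eta>: "\<eta> \<in> borel_measurable (Fil a)" "integrable W (\<lambda>w. (\<eta> w)\<^sup>2)"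
  shows "integrable W (\<lambda>w. (\<eta> w + simple_integral B n \<tau> \<xi> w)\<^sup>2)"
    and "expectation (\<lambda>w. (\<eta> w + simple_integral B n \<tau> \<xi> w)\<^sup>2) =
      expectation (\<lambda>w. (\<eta> w)\<^sup>2) + (\<Sum>k<n. expectation (\<lambda>w. (\<xi> k w)\<^sup>2) * (\<tau> (Suc k) - \<tau> k))"
    and "simple_integral B n \<tau> \<xi> \<in> borel_measurable W"
proof -
  note s = simple_integrandD[OF si]
  obtain C where C: "\<And>k w. k < n \<Longrightarrow> w \<in> space W \<Longrightarrow> \<bar>\<xi> k w\<bar> \<le> C k" using s(5) by blast
  have v: "(\<integral>z. (sqrt (\<tau> (Suc k) - \<tau> k) * z)\<^sup>2 \<partial>gauss) = \<tau> (Suc k) - \<tau> k"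
    "integrable gauss (\<lambda>z. (sqrt (\<tau> (Suc k) - \<tau> k) * z)\<^sup>2)" if "k < n" for k
    using s(3)[OF that] by (simp_all add: power_mult_distrib)
  have \<tau>0: "0 \<le> \<tau> 0" using s(1) a by simp
  have \<eta>0: "\<eta> \<in> borel_measurable (Fil (\<tau> 0))" using s(1) \<eta> by simp
  have P: "(\<lambda>w. f w + simple_integral B n \<tau> \<xi> w) \<in> borel_measurable (Fil (\<tau> n)) \<and>
    integrable W (\<lambda>w. (f w + simple_integral B n \<tau> \<xi> w)\<^sup>2) \<and>
    expectation (\<lambda>w. (f w + simple_integral B n \<tau> \<xi> w)\<^sup>2) =
      expectation (\<lambda>w. (f w)\<^sup>2) + (\<Sum>k<n. expectation (\<lambda>w. (\<xi> k w)\<^sup>2) * (\<tau> (Suc k) - \<tau> k))"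
    if "f \<in> borel_measurable (Fil (\<tau> 0))" "integrable W (\<lambda>w. (f w)\<^sup>2)" for f
    unfolding simple_integral_def
  proof (intro conjI)
    show "(\<lambda>w. f w + (\<Sum>k<n. \<xi> k w * (B (\<tau> (Suc k)) w - B (\<tau> k) w))) \<in> borel_measurable (Fil (\<tau> n))"
      by (rule partition_square(1)[of \<tau> n f \<xi> C "\<lambda>_ x. x" "\<lambda>k. \<tau> (Suc k) - \<tau> k"], rule \<tau>0, erule s(3), rule that(1), rule that(2), erule s(4), erule (1) C, simp, simp, simp, erule v(2), erule v(1))
    show "integrable W (\<lambda>w. (f w + (\<Sum>k<n. \<xi> k w * (B (\<tau> (Suc k)) w - B (\<tau> k) w)))\<^sup>2)"
      by (rule partition_square(2)[of \<tau> n f \<xi> C "\<lambda>_ x. x" "\<lambda>k. \<tau> (Suc k) - \<tau> k"], rule \<tau>0, erule s(3), rule that(1), rule that(2), erule s(4), erule (1) C, simp, simp, simp, erule v(2), erule v(1))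
    show "expectation (\<lambda>w. (f w + (\<Sum>k<n. \<xi> k w * (B (\<tau> (Suc k)) w - B (\<tau> k) w)))\<^sup>2) =
      expectation (\<lambda>w. (f w)\<^sup>2) + (\<Sum>k<n. expectation (\<lambda>w. (\<xi> k w)\<^sup>2) * (\<tau> (Suc k) - \<tau> k))"
      by (rule partition_square(3)[of \<tau> n f \<xi> C "\<lambda>_ x. x" "\<lambda>k. \<tau> (Suc k) - \<tau> k"], rule \<tau>0, erule s(3), rule that(1), rule that(2), erule s(4), erule (1) C, simp, simp, simp, erule v(2), erule v(1))
  qed
  show "integrable W (\<lambda>w. (\<eta> w + simple_integral B n \<tau> \<xi> w)\<^sup>2)"
    "expectation (\<lambda>w. (\<eta> w + simple_integral B n \<tau> \<xi> w)\<^sup>2) =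
      expectation (\<lambda>w. (\<eta> w)\<^sup>2) + (\<Sum>k<n. expectation (\<lambda>w. (\<xi> k w)\<^sup>2) * (\<tau> (Suc k) - \<tau> k))"
    using P[OF \<eta>0 \<eta>(2)] by blast+
  have "0 \<le> \<tau> n" by (rule order_trans[OF \<tau>0 partition_mono[of n \<tau> 0 n, OF s(3)]]) simp_all
  have m: "(\<lambda>w. 0 + simple_integral B n \<tau> \<xi> w) \<in> borel_measurable (Fil (\<tau> n))"
    by (rule P[THEN conjunct1]) simp_all
  have e: "(\<lambda>w. 0 + simple_integral B n \<tau> \<xi> w) = simple_integral B n \<tau> \<xi>" by (rule ext) (rule add_0)
  show "simple_integral B n \<tau> \<xi> \<in> borel_measurable W"
    by (rule measurable_Fil_W[OF m[unfolded e] \<open>0 \<le> \<tau> n\<close>])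
qed

lemma simple_process_late:
  assumes "\<And>k. k < n \<Longrightarrow> \<tau> k \<le> \<tau> (Suc k)" "\<tau> n < s"
  shows "simple_process n \<tau> \<xi> s w = 0"
  unfolding simple_process_def
proof (rule sum.neutral, rule ballI)
  fix k assume "k \<in> {..<n}"
  then have "\<tau> (Suc k) \<le> \<tau> n" by (intro partition_mono[of n \<tau>, OF assms(1)]) auto
  then show "\<xi> k w * indicator {\<tau> k<..\<tau> (Suc k)} s = 0" using assms(2) by simp
qed

lemma simple_process_square:
  assumes "\<And>k. k < n \<Longrightarrow> \<tau> k \<le> \<tau> (Suc k)"
  shows "(simple_process n \<tau> \<xi> s w)\<^sup>2 = (\<Sum>k<n. (\<xi> k w)\<^sup>2 * indicator {\<tau> k<..\<tau> (Suc k)} s)"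
  using assms
proof (induction n)
  case (Suc n)
  have S: "simple_process (Suc n) \<tau> \<xi> s w = simple_process n \<tau> \<xi> s w + \<xi> n w * indicator {\<tau> n<..\<tau> (Suc n)} s"
    by (simp add: simple_process_def)
  have IH: "(simple_process n \<tau> \<xi> s w)\<^sup>2 = (\<Sum>k<n. (\<xi> k w)\<^sup>2 * indicator {\<tau> k<..\<tau> (Suc k)} s)" using Suc by simp
  show ?case
  proof (cases "\<tau> n < s")
    case True
    have z: "simple_process n \<tau> \<xi> s w = 0" by (rule simple_process_late[of n \<tau>]) (use Suc.prems True in auto)
    show ?thesis unfolding S z using IH z by (simp add: indicator_def)
  next
    case False
    then show ?thesis unfolding S using IH by simp
  qed
qed (simp add: simple_process_def)

lemma simple_process_nn_integral:
  assumes si: "simple_integrand W B a b n \<tau> \<xi>"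
  shows "(\<integral>\<^sup>+s\<in>{a..b}. ennreal ((simple_process n \<tau> \<xi> s w)\<^sup>2) \<partial>lborel) = ennreal (\<Sum>k<n. (\<xi> k w)\<^sup>2 * (\<tau> (Suc k) - \<tau> k))"
proof -
  note s = simple_integrandD[OF si]
  have sq: "(simple_process n \<tau> \<xi> s w)\<^sup>2 = (\<Sum>k<n. (\<xi> k w)\<^sup>2 * indicator {\<tau> k<..\<tau> (Suc k)} s)" for s
    by (rule simple_process_square) (rule s(3))
  have "(\<integral>\<^sup>+s\<in>{a..b}. ennreal ((simple_process n \<tau> \<xi> s w)\<^sup>2) \<partial>lborel) =
    (\<integral>\<^sup>+s. (\<Sum>k<n. ennreal ((\<xi> k w)\<^sup>2) * indicator {\<tau> k<..\<tau> (Suc k)} s) \<partial>lborel)"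
  proof (rule nn_integral_cong)
    fix r :: real
    have "ennreal ((simple_process n \<tau> \<xi> r w)\<^sup>2) = (\<Sum>k<n. ennreal ((\<xi> k w)\<^sup>2) * indicator {\<tau> k<..\<tau> (Suc k)} r)"
      unfolding sq
      by (subst sum_ennreal[symmetric]) (auto simp: ennreal_mult' ennreal_indicator intro!: sum.cong)
    moreover have "(\<Sum>k<n. ennreal ((\<xi> k w)\<^sup>2) * indicator {\<tau> k<..\<tau> (Suc k)} r) = 0" if "r \<notin> {a..b}"
    proof (rule sum.neutral, rule ballI)
      fix k assume "k \<in> {..<n}"
      then have "a \<le> \<tau> k" "\<tau> (Suc k) \<le> b"
        using partition_mono[of n \<tau> 0 k, OF s(3)] partition_mono[of n \<tau> "Suc k" n, OF s(3)] s(1,2) by auto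
      then show "ennreal ((\<xi> k w)\<^sup>2) * indicator {\<tau> k<..\<tau> (Suc k)} r = 0" using that by (auto simp: indicator_def)
    qed
    ultimately show "ennreal ((simple_process n \<tau> \<xi> r w)\<^sup>2) * indicator {a..b} r =
      (\<Sum>k<n. ennreal ((\<xi> k w)\<^sup>2) * indicator {\<tau> k<..\<tau> (Suc k)} r)" by (cases "r \<in> {a..b}") auto
  qed
  also have "\<dots> = (\<Sum>k<n. ennreal ((\<xi> k w)\<^sup>2) * emeasure lborel {\<tau> k<..\<tau> (Suc k)})"
    by (subst nn_integral_sum) (auto simp: nn_integral_cmult_indicator)
  also have "\<dots> = (\<Sum>k<n. ennreal ((\<xi> k w)\<^sup>2 * (\<tau> (Suc k) - \<tau> k)))"
    using s(3) by (intro sum.cong) (auto simp: ennreal_mult)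
  also have "\<dots> = ennreal (\<Sum>k<n. (\<xi> k w)\<^sup>2 * (\<tau> (Suc k) - \<tau> k))"
    using s(3) by (intro sum_ennreal) auto
  finally show ?thesis .
qed

lemma bounded_square_integrable:
  assumes "f \<in> borel_measurable W" "\<And>w. w \<in> space W \<Longrightarrow> \<bar>f w\<bar> \<le> C"
  shows "integrable W (\<lambda>w. (f w :: real)\<^sup>2)"
proof (rule integrable_const_bound[of _ "C\<^sup>2"])
  show "AE w in W. norm ((f w)\<^sup>2) \<le> C\<^sup>2"
  proof (rule AE_I2)
    fix w assume "w \<in> space W"
    then have "\<bar>f w\<bar>\<^sup>2 \<le> C\<^sup>2" using assms(2) by (intro power_mono) auto
    then show "norm ((f w)\<^sup>2) \<le> C\<^sup>2" by simp
  qed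
qed (use assms in measurable)

lemma simple_isometry:
  assumes si: "simple_integrand W B a b n \<tau> \<xi>" and a: "0 \<le> a"
  shows "(\<integral>\<^sup>+w. (\<integral>\<^sup>+s\<in>{a..b}. ennreal ((simple_process n \<tau> \<xi> s w)\<^sup>2) \<partial>lborel) \<partial>W) =
    ennreal (\<Sum>k<n. expectation (\<lambda>w. (\<xi> k w)\<^sup>2) * (\<tau> (Suc k) - \<tau> k))"
proof -
  note s = simple_integrandD[OF si]
  obtain C where C: "\<And>k w. k < n \<Longrightarrow> w \<in> space W \<Longrightarrow> \<bar>\<xi> k w\<bar> \<le> C k" using s(5) by blast
  have \<tau>: "0 \<le> \<tau> k" if "k < n" for k using partition_mono[of n \<tau> 0 k, OF s(3)] s(1) a that by auto
  have i: "integrable W (\<lambda>w. (\<xi> k w)\<^sup>2)" if "k < n" for k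
    using C that by (intro bounded_square_integrable[of _ "C k"] measurable_Fil_W[OF s(4) \<tau>]) auto
  have "(\<integral>\<^sup>+w. ennreal (\<Sum>k<n. (\<xi> k w)\<^sup>2 * (\<tau> (Suc k) - \<tau> k)) \<partial>W) = ennreal (expectation (\<lambda>w. \<Sum>k<n. (\<xi> k w)\<^sup>2 * (\<tau> (Suc k) - \<tau> k)))"
    using i s(3) by (intro nn_integral_eq_integral Bochner_Integration.integrable_sum integrable_mult_left AE_I2 sum_nonneg) auto
  also have "expectation (\<lambda>w. \<Sum>k<n. (\<xi> k w)\<^sup>2 * (\<tau> (Suc k) - \<tau> k)) = (\<Sum>k<n. expectation (\<lambda>w. (\<xi> k w)\<^sup>2) * (\<tau> (Suc k) - \<tau> k))"
    using i by (subst Bochner_Integration.integral_sum) auto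
  finally show ?thesis unfolding simple_process_nn_integral[OF si] .
qed

section \<open>Refinement of partitions\<close>

text \<open>The refinement of a partition \<open>\<tau>\<close> along \<open>\<tau> k = p (c k)\<close>.\<close>

definition refine :: "nat \<Rightarrow> (nat \<Rightarrow> nat) \<Rightarrow> (nat \<Rightarrow> 'b \<Rightarrow> real) \<Rightarrow> nat \<Rightarrow> 'b \<Rightarrow> real" where
  "refine n c \<xi> j w = (\<Sum>k<n. if c k \<le> j \<and> j < c (Suc k) then \<xi> k w else 0)"

text \<open>Stated for an arbitrary integrator \<open>\<Phi>\<close> in order to serve twice: with
  the path of \<open>B\<close> it gives the integral, with a step function at \<open>s\<close> the
  value of the process at time \<open>s\<close>.\<close>

lemma refine_sum:
  fixes \<Phi> :: "real \<Rightarrow> real"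
  assumes c: "\<And>k. k < n \<Longrightarrow> c k \<le> c (Suc k)" "c n \<le> N" and p: "\<And>k. k \<le> n \<Longrightarrow> p (c k) = \<tau> k"
  shows "(\<Sum>j<N. refine n c \<xi> j w * (\<Phi> (p (Suc j)) - \<Phi> (p j))) = (\<Sum>k<n. \<xi> k w * (\<Phi> (\<tau> (Suc k)) - \<Phi> (\<tau> k)))"
proof -
  have cm: "c k \<le> N" if "k \<le> n" for k
  proof -
    have "real (c k) \<le> real (c n)"
      by (rule partition_mono[of n "\<lambda>k. real (c k)"]) (use c(1) that in auto)
    then show ?thesis using c(2) by simp
  qed
  have "(\<Sum>j<N. refine n c \<xi> j w * (\<Phi> (p (Suc j)) - \<Phi> (p j))) =
    (\<Sum>k<n. \<Sum>j<N. (if c k \<le> j \<and> j < c (Suc k) then \<xi> k w else 0) * (\<Phi> (p (Suc j)) - \<Phi> (p j)))"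
    unfolding refine_def sum_distrib_right by (rule sum.swap)
  also have "\<dots> = (\<Sum>k<n. \<xi> k w * (\<Phi> (\<tau> (Suc k)) - \<Phi> (\<tau> k)))"
  proof (rule sum.cong[OF refl])
    fix k assume "k \<in> {..<n}"
    then have k: "k < n" by simp
    have "(\<Sum>j<N. (if c k \<le> j \<and> j < c (Suc k) then \<xi> k w else 0) * (\<Phi> (p (Suc j)) - \<Phi> (p j))) =
      (\<Sum>j\<in>{c k..<c (Suc k)}. \<xi> k w * (\<Phi> (p (Suc j)) - \<Phi> (p j)))"
      using cm[of "Suc k"] k by (intro sum.mono_neutral_cong_right) auto
    also have "\<dots> = \<xi> k w * (\<Phi> (p (c (Suc k))) - \<Phi> (p (c k)))"
      unfolding sum_distrib_left[symmetric] by (subst sum_Suc_diff'[OF c(1)[OF k], of "\<lambda>j. \<Phi> (p j)"]) simp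
    finally show "(\<Sum>j<N. (if c k \<le> j \<and> j < c (Suc k) then \<xi> k w else 0) * (\<Phi> (p (Suc j)) - \<Phi> (p j))) =
      \<xi> k w * (\<Phi> (\<tau> (Suc k)) - \<Phi> (\<tau> k))" using p[of k] p[of "Suc k"] k by simp
  qed
  finally show ?thesis .
qed

text \<open>The half-open indicator is an increment of a step function at \<open>s\<close>, the form
  in which \<open>refine_sum\<close> applies to values of the process.\<close>

lemma simple_process_alt:
  assumes "\<And>k. k < n \<Longrightarrow> \<tau> k \<le> \<tau> (Suc k)"
  shows "simple_process n \<tau> \<xi> s w = (\<Sum>k<n. \<xi> k w * ((\<lambda>x. - indicator {..<s} x) (\<tau> (Suc k)) - (\<lambda>x. - indicator {..<s} x) (\<tau> k)))"
  unfolding simple_process_def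
proof (rule sum.cong[OF refl])
  fix k assume "k \<in> {..<n}"
  then have "\<tau> k \<le> \<tau> (Suc k)" using assms by simp
  then show "\<xi> k w * indicator {\<tau> k<..\<tau> (Suc k)} s =
    \<xi> k w * ((\<lambda>x. - indicator {..<s} x) (\<tau> (Suc k)) - (\<lambda>x. - indicator {..<s} x) (\<tau> k))"
    by (auto simp: indicator_def)
qed

lemma refine_simple:
  assumes si: "simple_integrand W B a b n \<tau> \<xi>" and p: "p 0 = a" "p N = b" "\<And>j. j < N \<Longrightarrow> p j \<le> p (Suc j)"
    and c: "\<And>k. k < n \<Longrightarrow> c k \<le> c (Suc k)" "c n \<le> N" "\<And>k. k \<le> n \<Longrightarrow> p (c k) = \<tau> k"
  shows "simple_integrand W B a b N p (refine n c \<xi>)"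
    "simple_integral B N p (refine n c \<xi>) w = simple_integral B n \<tau> \<xi> w"
    "simple_process N p (refine n c \<xi>) s w = simple_process n \<tau> \<xi> s w"
proof -
  note s = simple_integrandD[OF si]
  show "simple_integral B N p (refine n c \<xi>) w = simple_integral B n \<tau> \<xi> w"
    unfolding simple_integral_def using refine_sum[where \<Phi>="\<lambda>t. B t w", of n c N p \<tau>, OF c] .
  show "simple_process N p (refine n c \<xi>) s w = simple_process n \<tau> \<xi> s w"
  proof -
    have 1: "simple_process n \<tau> \<xi> s w = (\<Sum>k<n. \<xi> k w * ((\<lambda>x. - indicator {..<s} x) (\<tau> (Suc k)) - (\<lambda>x. - indicator {..<s} x) (\<tau> k)))"
      by (rule simple_process_alt) (rule s(3))
    have 2: "simple_process N p (refine n c \<xi>) s w = (\<Sum>k<N. refine n c \<xi> k w * ((\<lambda>x. - indicator {..<s} x) (p (Suc k)) - (\<lambda>x. - indicator {..<s} x) (p k)))"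
      by (rule simple_process_alt) (rule p(3))
    show ?thesis unfolding 1 2 by (rule refine_sum[of n c N p \<tau>, OF c])
  qed
  obtain C where C: "\<And>k w. k < n \<Longrightarrow> w \<in> space W \<Longrightarrow> \<bar>\<xi> k w\<bar> \<le> C k" using s(5) by blast
  show "simple_integrand W B a b N p (refine n c \<xi>)"
    unfolding simple_integrand_def
  proof (intro conjI allI impI)
    fix j assume j: "j < N"
    show "refine n c \<xi> j \<in> borel_measurable (Fil (p j))"
      unfolding refine_def[abs_def]
    proof (rule borel_measurable_sum)
      fix k assume "k \<in> {..<n}"
      then have k: "k < n" by simp
      show "(\<lambda>w. if c k \<le> j \<and> j < c (Suc k) then \<xi> k w else 0) \<in> borel_measurable (Fil (p j))"
      proof (cases "c k \<le> j \<and> j < c (Suc k)")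
        case True
        then have "\<tau> k \<le> p j" using partition_mono[of N p "c k" j, OF p(3)] j c(3)[of k] k by auto
        then show ?thesis using True measurable_Fil_mono[OF s(4)[OF k]] by simp
      next
        case False
        then have "(\<lambda>w. if c k \<le> j \<and> j < c (Suc k) then \<xi> k w else 0) = (\<lambda>_. 0)" by auto
        then show ?thesis by simp
      qed
    qed
    have "\<bar>refine n c \<xi> j w\<bar> \<le> (\<Sum>k<n. \<bar>C k\<bar>)" if "w \<in> space W" for w
      unfolding refine_def
    proof (rule order_trans[OF sum_abs], rule sum_mono)
      fix k assume "k \<in> {..<n}"
      then show "\<bar>if c k \<le> j \<and> j < c (Suc k) then \<xi> k w else 0\<bar> \<le> \<bar>C k\<bar>" using C[of k w] that by auto
    qed
    then show "bounded (refine n c \<xi> j ` space W)" by (auto simp: bounded_iff)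
  qed (use p in auto)
qed

text \<open>Partition points may repeat. Equal points get equal indices because the list is
  distinct, and this makes the index map monotone.\<close>

lemma partition_index:
  assumes \<tau>: "\<And>k. k < n \<Longrightarrow> \<tau> k \<le> (\<tau> (Suc k) :: real)" and xs: "sorted xs" "distinct xs" "\<tau> ` {..n} \<subseteq> set xs"
  shows "\<exists>c. (\<forall>k<n. c k \<le> c (Suc k)) \<and> (\<forall>k\<le>n. c k < length xs \<and> xs ! c k = \<tau> k)"
proof -
  have "\<forall>k\<in>{..n}. \<exists>i<length xs. xs ! i = \<tau> k" using xs(3) by (auto simp: in_set_conv_nth subset_eq)
  then obtain c where c: "\<And>k. k \<le> n \<Longrightarrow> c k < length xs" "\<And>k. k \<le> n \<Longrightarrow> xs ! c k = \<tau> k" by (metis atMost_iff)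
  have "c k \<le> c (Suc k)" if k: "k < n" for k
  proof (rule ccontr)
    assume "\<not> c k \<le> c (Suc k)"
    then have lt: "c (Suc k) < c k" by simp
    have "\<tau> (Suc k) \<le> \<tau> k" using sorted_nth_mono[OF xs(1), of "c (Suc k)" "c k"] lt c[of k] c[of "Suc k"] k by simp
    then have "xs ! c (Suc k) = xs ! c k" using \<tau>[OF k] c[of k] c[of "Suc k"] k by simp
    then show False using nth_eq_iff_index_eq[OF xs(2)] c(1)[of k] c(1)[of "Suc k"] k lt by simp
  qed
  then show ?thesis using c by (intro exI[of _ c]) auto
qed

lemma simple_integrand_diff:
  assumes si: "simple_integrand W B a b n \<tau> \<xi>" and si': "simple_integrand W B a b n \<tau> \<xi>'"
  shows "simple_integrand W B a b n \<tau> (\<lambda>k w. \<xi> k w - \<xi>' k w)"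
  unfolding simple_integrand_def
proof (intro conjI allI impI)
  note s = simple_integrandD[OF si] and s' = simple_integrandD[OF si']
  fix j assume j: "j < n"
  show "(\<lambda>w. \<xi> j w - \<xi>' j w) \<in> borel_measurable (Fil (\<tau> j))"
    by (intro borel_measurable_diff s(4)[OF j] s'(4)[OF j])
  obtain C where C: "\<And>w. w \<in> space W \<Longrightarrow> \<bar>\<xi> j w\<bar> \<le> C" using s(5) j by blast
  obtain C' where C': "\<And>w. w \<in> space W \<Longrightarrow> \<bar>\<xi>' j w\<bar> \<le> C'" using s'(5) j by blast
  have "\<bar>\<xi> j w - \<xi>' j w\<bar> \<le> C + C'" if "w \<in> space W" for w using C[OF that] C'[OF that] by simp
  then show "bounded ((\<lambda>w. \<xi> j w - \<xi>' j w) ` space W)" by (auto simp: bounded_iff)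
qed (use simple_integrandD[OF si] in auto)

text \<open>Makes the difference of two simple integrals over unrelated partitions a simple integral
  again; the linearity of the Ito integral rests on it.\<close>

lemma common_refinement:
  assumes si: "simple_integrand W B a b n \<tau> \<xi>" and si': "simple_integrand W B a b n' \<tau>' \<xi>'"
  shows "\<exists>N p \<zeta>. simple_integrand W B a b N p \<zeta> \<and>
    (\<forall>w. simple_integral B N p \<zeta> w = simple_integral B n \<tau> \<xi> w - simple_integral B n' \<tau>' \<xi>' w) \<and>
    (\<forall>s w. simple_process N p \<zeta> s w = simple_process n \<tau> \<xi> s w - simple_process n' \<tau>' \<xi>' s w)"
proof -
  note s = simple_integrandD[OF si] and s' = simple_integrandD[OF si']
  define T where "T = \<tau> ` {..n} \<union> \<tau>' ` {..n'}"
  define xs where "xs = sorted_list_of_set T"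
  have xs: "sorted xs" "distinct xs" "set xs = T" by (auto simp: xs_def T_def)
  have ab: "a \<in> T" "b \<in> T" "\<And>x. x \<in> T \<Longrightarrow> a \<le> x \<and> x \<le> b"
  proof -
    show "a \<in> T" "b \<in> T" using s(1,2) by (auto simp: T_def intro!: image_eqI)
    fix x assume "x \<in> T"
    then show "a \<le> x \<and> x \<le> b"
      unfolding T_def
    proof (elim UnE imageE)
      fix k assume "x = \<tau> k" "k \<in> {..n}"
      then show ?thesis using partition_mono[of n \<tau> 0 k, OF s(3)] partition_mono[of n \<tau> k n, OF s(3)] s(1,2) by auto
    next
      fix k assume "x = \<tau>' k" "k \<in> {..n'}"
      then show ?thesis using partition_mono[of n' \<tau>' 0 k, OF s'(3)] partition_mono[of n' \<tau>' k n', OF s'(3)] s'(1,2) by auto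
    qed
  qed
  define N where "N = length xs - 1"
  have len: "0 < length xs" using xs(3) ab(1) by (cases xs) auto
  then have lN: "length xs = Suc N" by (simp add: N_def)
  define p where "p j = xs ! j" for j
  obtain i where i: "i < length xs" "xs ! i = a" using ab(1) xs(3) by (auto simp: in_set_conv_nth)
  obtain j where j: "j < length xs" "xs ! j = b" using ab(2) xs(3) by (auto simp: in_set_conv_nth)
  have p0: "p 0 = a" using sorted_nth_mono[OF xs(1), of 0 i] i ab(3)[of "xs ! 0"] xs(3) len by (force simp: p_def)
  have pN: "p N = b" using sorted_nth_mono[OF xs(1), of j N] j ab(3)[of "xs ! N"] xs(3) lN by (force simp: p_def)
  have pm: "p k \<le> p (Suc k)" if "k < N" for k using sorted_nth_mono[OF xs(1), of k "Suc k"] that lN by (simp add: p_def)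
  have subs: "\<tau> ` {..n} \<subseteq> set xs" "\<tau>' ` {..n'} \<subseteq> set xs" by (auto simp: xs(3) T_def)
  obtain c where c: "\<And>k. k < n \<Longrightarrow> c k \<le> c (Suc k)" "\<And>k. k \<le> n \<Longrightarrow> c k < length xs \<and> xs ! c k = \<tau> k"
    using partition_index[of n \<tau> xs, OF s(3) xs(1,2) subs(1)] by blast
  obtain c' where c': "\<And>k. k < n' \<Longrightarrow> c' k \<le> c' (Suc k)" "\<And>k. k \<le> n' \<Longrightarrow> c' k < length xs \<and> xs ! c' k = \<tau>' k"
    using partition_index[of n' \<tau>' xs, OF s'(3) xs(1,2) subs(2)] by blast
  have cN: "c n \<le> N" "c' n' \<le> N" using c(2)[of n] c'(2)[of n'] lN by auto
  have pc: "\<And>k. k \<le> n \<Longrightarrow> p (c k) = \<tau> k" "\<And>k. k \<le> n' \<Longrightarrow> p (c' k) = \<tau>' k" using c(2) c'(2) by (auto simp: p_def)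
  have R: "simple_integrand W B a b N p (refine n c \<xi>)"
    "simple_integral B N p (refine n c \<xi>) w = simple_integral B n \<tau> \<xi> w"
    "simple_process N p (refine n c \<xi>) s w = simple_process n \<tau> \<xi> s w" for s w
    by (rule refine_simple[OF si p0 pN pm c(1) cN(1) pc(1)]; assumption)+
  have R': "simple_integrand W B a b N p (refine n' c' \<xi>')"
    "simple_integral B N p (refine n' c' \<xi>') w = simple_integral B n' \<tau>' \<xi>' w"
    "simple_process N p (refine n' c' \<xi>') s w = simple_process n' \<tau>' \<xi>' s w" for s w
    by (rule refine_simple[OF si' p0 pN pm c'(1) cN(2) pc(2)]; assumption)+
  define \<zeta> where "\<zeta> j w = refine n c \<xi> j w - refine n' c' \<xi>' j w" for j w
  have "simple_integrand W B a b N p \<zeta>" unfolding \<zeta>_def[abs_def] by (rule simple_integrand_diff[OF R(1) R'(1)])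
  moreover have "simple_integral B N p \<zeta> w = simple_integral B n \<tau> \<xi> w - simple_integral B n' \<tau>' \<xi>' w" for w
    unfolding R(2)[symmetric] R'(2)[symmetric] by (simp add: simple_integral_def \<zeta>_def left_diff_distrib sum_subtractf)
  moreover have "simple_process N p \<zeta> s w = simple_process n \<tau> \<xi> s w - simple_process n' \<tau>' \<xi>' s w" for s w
    unfolding R(3)[symmetric] R'(3)[symmetric] by (simp add: simple_process_def \<zeta>_def left_diff_distrib sum_subtractf)
  ultimately show ?thesis by blast
qed

end

section \<open>The Ito integral\<close>

lemma square_add_le: "(x + y)\<^sup>2 \<le> 2 * x\<^sup>2 + 2 * y\<^sup>2" for x y :: real
  using zero_le_power2[of "x - y"] by (simp add: power2_eq_square algebra_simps)

lemma ennreal_square_add_le: "ennreal ((x + y)\<^sup>2) \<le> 2 * ennreal (x\<^sup>2) + 2 * ennreal (y\<^sup>2)" for x y :: real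
proof -
  have "ennreal ((x + y)\<^sup>2) \<le> ennreal (2 * x\<^sup>2 + 2 * y\<^sup>2)" by (intro ennreal_leI square_add_le)
  also have "\<dots> = 2 * ennreal (x\<^sup>2) + 2 * ennreal (y\<^sup>2)"
    by (simp add: ennreal_plus ennreal_mult' flip: ennreal_numeral)
  finally show ?thesis .
qed

lemma nn_square_add_le:
  fixes f h :: "'a \<Rightarrow> real"
  assumes [measurable]: "f \<in> borel_measurable M" "h \<in> borel_measurable M"
  shows "(\<integral>\<^sup>+x. ennreal ((f x + h x)\<^sup>2) \<partial>M) \<le> 2 * (\<integral>\<^sup>+x. ennreal ((f x)\<^sup>2) \<partial>M) + 2 * (\<integral>\<^sup>+x. ennreal ((h x)\<^sup>2) \<partial>M)"
proof -
  have "(\<integral>\<^sup>+x. ennreal ((f x + h x)\<^sup>2) \<partial>M) \<le> (\<integral>\<^sup>+x. 2 * ennreal ((f x)\<^sup>2) + 2 * ennreal ((h x)\<^sup>2) \<partial>M)"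
    by (intro nn_integral_mono ennreal_square_add_le)
  also have "\<dots> = 2 * (\<integral>\<^sup>+x. ennreal ((f x)\<^sup>2) \<partial>M) + 2 * (\<integral>\<^sup>+x. ennreal ((h x)\<^sup>2) \<partial>M)"
    by (subst nn_integral_add) (auto simp: nn_integral_cmult)
  finally show ?thesis .
qed

context brownian begin

abbreviation "L01 \<equiv> restrict_space lborel {0..1::real}"

text \<open>The squared norm of L^2(dt x W) over [a, b], kept in \<open>ennreal\<close> so that
  inequalities can be chained before finiteness is known.\<close>

definition sq where "sq a b Z = (\<integral>\<^sup>+w. (\<integral>\<^sup>+s\<in>{a..b}. ennreal ((Z s w)\<^sup>2) \<partial>lborel) \<partial>W)" for Z :: "real \<Rightarrow> 'b \<Rightarrow> real"

definition jm where "jm Z \<longleftrightarrow> (\<lambda>(t, w). Z t w) \<in> borel_measurable (L01 \<Otimes>\<^sub>M W)" for Z :: "real \<Rightarrow> 'b \<Rightarrow> real"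

sublocale LW: pair_sigma_finite L01 W
  by (intro pair_sigma_finite.intro sigma_finite_measure_restrict_space sigma_finite_measure_axioms)
     (auto intro: sigma_finite_lborel)

lemma jm_iff: "jm Z \<longleftrightarrow> (\<lambda>(t, w). Z t w) \<in> borel_measurable (restrict_space borel {0..1} \<Otimes>\<^sub>M W)"
proof -
  have "sets (L01 \<Otimes>\<^sub>M W) = sets (restrict_space borel {0..1} \<Otimes>\<^sub>M W)"
    by (intro sets_pair_measure_cong) (simp_all cong: sets_restrict_space_cong)
  then show ?thesis unfolding jm_def by (simp cong: measurable_cong_sets)
qed

lemma jm_add: "jm Z \<Longrightarrow> jm Z' \<Longrightarrow> jm (\<lambda>t w. Z t w + Z' t w)"
  and jm_diff: "jm Z \<Longrightarrow> jm Z' \<Longrightarrow> jm (\<lambda>t w. Z t w - Z' t w)"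
  unfolding jm_def case_prod_unfold by (rule borel_measurable_add borel_measurable_diff; assumption)+

lemma double_integral_eq:
  fixes f :: "real \<Rightarrow> 'b \<Rightarrow> ennreal"
  assumes f: "(\<lambda>(t, w). f t w) \<in> borel_measurable (L01 \<Otimes>\<^sub>M W)" and ab: "0 \<le> a" "b \<le> 1"
  shows "(\<integral>\<^sup>+w. (\<integral>\<^sup>+s\<in>{a..b}. f s w \<partial>lborel) \<partial>W) = (\<integral>\<^sup>+p. f (fst p) (snd p) * indicator {a..b} (fst p) \<partial>(L01 \<Otimes>\<^sub>M W))"
    and "(\<lambda>w. \<integral>\<^sup>+s\<in>{a..b}. f s w \<partial>lborel) \<in> borel_measurable W"
proof -
  have e: "(\<integral>\<^sup>+s\<in>{a..b}. f s w \<partial>lborel) = (\<integral>\<^sup>+s. f s w * indicator {a..b} s \<partial>L01)" for w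
  proof -
    have "(\<integral>\<^sup>+s. f s w * indicator {a..b} s \<partial>L01) = (\<integral>\<^sup>+s. f s w * indicator {a..b} s * indicator {0..1} s \<partial>lborel)"
      by (rule nn_integral_restrict_space) simp
    also have "\<dots> = (\<integral>\<^sup>+s\<in>{a..b}. f s w \<partial>lborel)"
      using ab by (intro nn_integral_cong) (auto simp: indicator_def)
    finally show ?thesis by simp
  qed
  have id: "(\<lambda>s::real. s) \<in> borel_measurable L01" by (intro measurable_restrict_space1) simp
  have ind: "(\<lambda>s. indicator {a..b} s :: ennreal) \<in> borel_measurable L01"
    by (intro measurable_restrict_space1) simp
  have m: "(\<lambda>(s, w). f s w * indicator {a..b} s) \<in> borel_measurable (L01 \<Otimes>\<^sub>M W)"
    using f measurable_compose[OF measurable_fst[of L01 W] ind] unfolding case_prod_unfold by (rule borel_measurable_times_ennreal)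
  show "(\<integral>\<^sup>+w. (\<integral>\<^sup>+s\<in>{a..b}. f s w \<partial>lborel) \<partial>W) = (\<integral>\<^sup>+p. f (fst p) (snd p) * indicator {a..b} (fst p) \<partial>(L01 \<Otimes>\<^sub>M W))"
    unfolding e using LW.nn_integral_snd[OF m] by (simp add: case_prod_unfold)
  show "(\<lambda>w. \<integral>\<^sup>+s\<in>{a..b}. f s w \<partial>lborel) \<in> borel_measurable W"
    unfolding e by (rule sigma_finite_measure.borel_measurable_nn_integral)
      (use measurable_pair_swap[OF m] LW.M1.sigma_finite_measure_axioms in \<open>simp_all add: case_prod_unfold\<close>)
qed

lemma jm_square: "jm Z \<Longrightarrow> (\<lambda>(t, w). ennreal ((Z t w)\<^sup>2)) \<in> borel_measurable (L01 \<Otimes>\<^sub>M W)"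
  unfolding jm_def case_prod_unfold by (intro measurable_compose[OF _ measurable_ennreal] borel_measurable_power)

lemma sq_eq:
  assumes "jm Z" "0 \<le> a" "b \<le> 1"
  shows "sq a b Z = (\<integral>\<^sup>+p. ennreal ((Z (fst p) (snd p) * indicator {a..b} (fst p))\<^sup>2) \<partial>(L01 \<Otimes>\<^sub>M W))"
  unfolding sq_def double_integral_eq(1)[OF jm_square[OF assms(1)] assms(2,3)]
  by (intro nn_integral_cong) (auto simp: indicator_def)

lemma jm_indicator:
  assumes "jm Z" shows "(\<lambda>p. Z (fst p) (snd p) * indicator {a..b} (fst p)) \<in> borel_measurable (L01 \<Otimes>\<^sub>M W)"
proof -
  have ind: "(\<lambda>s. indicator {a..b} s :: real) \<in> borel_measurable L01"
    by (intro measurable_restrict_space1) simp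
  show ?thesis using assms measurable_compose[OF measurable_fst[of L01 W] ind] unfolding jm_def case_prod_unfold by (rule borel_measurable_times)
qed

lemma sq_add:
  assumes "jm Z" "jm Z'" "0 \<le> a" "b \<le> 1"
  shows "sq a b (\<lambda>t w. Z t w + Z' t w) \<le> 2 * sq a b Z + 2 * sq a b Z'"
  unfolding sq_eq[OF jm_add[OF assms(1,2)] assms(3,4)] sq_eq[OF assms(1,3,4)] sq_eq[OF assms(2,3,4)] distrib_right
  by (rule nn_square_add_le) (intro jm_indicator assms)+

lemma sq_mono_interval: "a' \<le> a \<Longrightarrow> b \<le> b' \<Longrightarrow> sq a b Z \<le> sq a' b' Z"
  unfolding sq_def by (intro nn_integral_mono) (auto simp: indicator_def)

lemma sq_uminus: "sq a b (\<lambda>t w. Z' t w - Z t w) = sq a b (\<lambda>t w. Z t w - Z' t w)"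
  by (simp add: sq_def power2_commute)

lemma jm_simple_process:
  assumes si: "simple_integrand W B a b n \<tau> \<xi>" and a: "0 \<le> a"
  shows "jm (simple_process n \<tau> \<xi>)"
  unfolding jm_def simple_process_def case_prod_unfold
proof (intro borel_measurable_sum borel_measurable_times)
  note s = simple_integrandD[OF si]
  fix k assume "k \<in> {..<n}"
  then have k: "k < n" by simp
  have "0 \<le> \<tau> k" using partition_mono[of n \<tau> 0 k, OF s(3)] s(1) a k by simp
  then show "(\<lambda>p. \<xi> k (snd p)) \<in> borel_measurable (L01 \<Otimes>\<^sub>M W)"
    by (intro measurable_compose[OF measurable_snd] measurable_Fil_W[OF s(4)[OF k]])
  have ind: "(\<lambda>s. indicator {\<tau> k<..\<tau> (Suc k)} s :: real) \<in> borel_measurable L01"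
    by (intro measurable_restrict_space1) simp
  show "(\<lambda>p. indicator {\<tau> k<..\<tau> (Suc k)} (fst p) :: real) \<in> borel_measurable (L01 \<Otimes>\<^sub>M W)"
    by (rule measurable_compose[OF measurable_fst[of L01 W] ind])
qed

lemma has_itoD:
  assumes "has_ito_integral W B Z a b I"
  obtains n :: "nat \<Rightarrow> nat" and \<tau> :: "nat \<Rightarrow> nat \<Rightarrow> real" and \<xi> :: "nat \<Rightarrow> nat \<Rightarrow> 'b \<Rightarrow> real" where "I \<in> borel_measurable W" "\<And>m::nat. simple_integrand W B a b (n m) (\<tau> m) (\<xi> m)"
    "(\<lambda>m. sq a b (\<lambda>s w. Z s w - simple_process (n m) (\<tau> m) (\<xi> m) s w)) \<longlonglongrightarrow> 0"
    "(\<lambda>m. \<integral>\<^sup>+w. ennreal ((I w - simple_integral B (n m) (\<tau> m) (\<xi> m) w)\<^sup>2) \<partial>W) \<longlonglongrightarrow> 0"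
  using assms unfolding has_ito_integral_def sq_def by blast

lemma has_itoI:
  assumes "I \<in> borel_measurable W" "\<And>m::nat. simple_integrand W B a b (n m) (\<tau> m) (\<xi> m)"
    "(\<lambda>m. sq a b (\<lambda>s w. Z s w - simple_process (n m) (\<tau> m) (\<xi> m) s w)) \<longlonglongrightarrow> 0"
    "(\<lambda>m. \<integral>\<^sup>+w. ennreal ((I w - simple_integral B (n m) (\<tau> m) (\<xi> m) w)\<^sup>2) \<partial>W) \<longlonglongrightarrow> 0"
  shows "has_ito_integral W B Z a b I"
  using assms unfolding has_ito_integral_def sq_def by blast

lemma tendsto_two_sum_0:
  fixes x y :: "nat \<Rightarrow> ennreal"
  assumes "x \<longlonglongrightarrow> 0" "y \<longlonglongrightarrow> 0" shows "(\<lambda>m. 2 * x m + 2 * y m) \<longlonglongrightarrow> 0"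
  using tendsto_add[OF ennreal_tendsto_cmult[OF _ assms(1), of 2] ennreal_tendsto_cmult[OF _ assms(2), of 2]] by simp

lemma has_ito_diff:
  assumes I: "has_ito_integral W B Z a b I" "has_ito_integral W B Z' a b I'"
    and j: "jm Z" "jm Z'" and ab: "0 \<le> a" "b \<le> 1"
  shows "has_ito_integral W B (\<lambda>s w. Z s w - Z' s w) a b (\<lambda>w. I w - I' w)"
proof -
  obtain n :: "nat \<Rightarrow> nat" and \<tau> :: "nat \<Rightarrow> nat \<Rightarrow> real" and \<xi> :: "nat \<Rightarrow> nat \<Rightarrow> 'b \<Rightarrow> real" where 1: "I \<in> borel_measurable W" "\<And>m::nat. simple_integrand W B a b (n m) (\<tau> m) (\<xi> m)"
    "(\<lambda>m. sq a b (\<lambda>s w. Z s w - simple_process (n m) (\<tau> m) (\<xi> m) s w)) \<longlonglongrightarrow> 0"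
    "(\<lambda>m. \<integral>\<^sup>+w. ennreal ((I w - simple_integral B (n m) (\<tau> m) (\<xi> m) w)\<^sup>2) \<partial>W) \<longlonglongrightarrow> 0"
    by (rule has_itoD[OF I(1)]) (rule that; (assumption | erule meta_spec))
  obtain n' :: "nat \<Rightarrow> nat" and \<tau>' :: "nat \<Rightarrow> nat \<Rightarrow> real" and \<xi>' :: "nat \<Rightarrow> nat \<Rightarrow> 'b \<Rightarrow> real" where 2: "I' \<in> borel_measurable W" "\<And>m::nat. simple_integrand W B a b (n' m) (\<tau>' m) (\<xi>' m)"
    "(\<lambda>m. sq a b (\<lambda>s w. Z' s w - simple_process (n' m) (\<tau>' m) (\<xi>' m) s w)) \<longlonglongrightarrow> 0"
    "(\<lambda>m. \<integral>\<^sup>+w. ennreal ((I' w - simple_integral B (n' m) (\<tau>' m) (\<xi>' m) w)\<^sup>2) \<partial>W) \<longlonglongrightarrow> 0"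
    by (rule has_itoD[OF I(2)]) (rule that; (assumption | erule meta_spec))
  define R where "R m N p \<zeta> \<longleftrightarrow> simple_integrand W B a b N p \<zeta> \<and>
    (\<forall>w. simple_integral B N p \<zeta> w = simple_integral B (n m) (\<tau> m) (\<xi> m) w - simple_integral B (n' m) (\<tau>' m) (\<xi>' m) w) \<and>
    (\<forall>s w. simple_process N p \<zeta> s w = simple_process (n m) (\<tau> m) (\<xi> m) s w - simple_process (n' m) (\<tau>' m) (\<xi>' m) s w)" for m N p \<zeta>
  have "\<forall>m. \<exists>N p \<zeta>. R m N p \<zeta>" unfolding R_def using common_refinement[OF 1(2) 2(2)] by blast
  then obtain N p \<zeta> where R: "\<And>m. R m (N m) (p m) (\<zeta> m)" by metis
  note R = R[unfolded R_def]
  show ?thesis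
  proof (rule has_itoI[of _ _ _ N p \<zeta>])
    show "(\<lambda>w. I w - I' w) \<in> borel_measurable W" using 1(1) 2(1) by simp
    show "simple_integrand W B a b (N m) (p m) (\<zeta> m)" for m using R[of m] by blast
    show "(\<lambda>m. sq a b (\<lambda>s w. Z s w - Z' s w - simple_process (N m) (p m) (\<zeta> m) s w)) \<longlonglongrightarrow> 0"
    proof (rule tendsto_sandwich[OF _ _ tendsto_const tendsto_two_sum_0[OF 1(3) 2(3)]])
      show "\<forall>\<^sub>F m in sequentially. sq a b (\<lambda>s w. Z s w - Z' s w - simple_process (N m) (p m) (\<zeta> m) s w) \<le>
        2 * sq a b (\<lambda>s w. Z s w - simple_process (n m) (\<tau> m) (\<xi> m) s w) + 2 * sq a b (\<lambda>s w. Z' s w - simple_process (n' m) (\<tau>' m) (\<xi>' m) s w)"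
      proof (rule always_eventually, rule allI)
        fix m
        let ?S = "simple_process (n m) (\<tau> m) (\<xi> m)" and ?S' = "simple_process (n' m) (\<tau>' m) (\<xi>' m)"
        have e: "(\<lambda>s w. Z s w - Z' s w - simple_process (N m) (p m) (\<zeta> m) s w) = (\<lambda>s w. (Z s w - ?S s w) + (?S' s w - Z' s w))"
          using R[of m] by (simp add: fun_eq_iff)
        show "sq a b (\<lambda>s w. Z s w - Z' s w - simple_process (N m) (p m) (\<zeta> m) s w) \<le>
          2 * sq a b (\<lambda>s w. Z s w - ?S s w) + 2 * sq a b (\<lambda>s w. Z' s w - ?S' s w)"
          unfolding e sq_uminus[of a b Z' ?S']
          by (intro sq_add jm_diff j ab jm_simple_process[OF 1(2)] jm_simple_process[OF 2(2)])
      qed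
    qed simp
    show "(\<lambda>m. \<integral>\<^sup>+w. ennreal ((I w - I' w - simple_integral B (N m) (p m) (\<zeta> m) w)\<^sup>2) \<partial>W) \<longlonglongrightarrow> 0"
    proof (rule tendsto_sandwich[OF _ _ tendsto_const tendsto_two_sum_0[OF 1(4) 2(4)]])
      show "\<forall>\<^sub>F m in sequentially. (\<integral>\<^sup>+w. ennreal ((I w - I' w - simple_integral B (N m) (p m) (\<zeta> m) w)\<^sup>2) \<partial>W) \<le>
        2 * (\<integral>\<^sup>+w. ennreal ((I w - simple_integral B (n m) (\<tau> m) (\<xi> m) w)\<^sup>2) \<partial>W) + 2 * (\<integral>\<^sup>+w. ennreal ((I' w - simple_integral B (n' m) (\<tau>' m) (\<xi>' m) w)\<^sup>2) \<partial>W)"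
      proof (rule always_eventually, rule allI)
        fix m
        let ?S = "simple_integral B (n m) (\<tau> m) (\<xi> m)" and ?S' = "simple_integral B (n' m) (\<tau>' m) (\<xi>' m)"
        note [measurable] = simple_square(3)[OF 1(2)[of m] ab(1), of "\<lambda>_. 0", simplified] simple_square(3)[OF 2(2)[of m] ab(1), of "\<lambda>_. 0", simplified] 1(1) 2(1)
        have e: "I w - I' w - simple_integral B (N m) (p m) (\<zeta> m) w = (I w - ?S w) + (?S' w - I' w)" for w
          using R[of m] by simp
        show "(\<integral>\<^sup>+w. ennreal ((I w - I' w - simple_integral B (N m) (p m) (\<zeta> m) w)\<^sup>2) \<partial>W) \<le>
          2 * (\<integral>\<^sup>+w. ennreal ((I w - ?S w)\<^sup>2) \<partial>W) + 2 * (\<integral>\<^sup>+w. ennreal ((I' w - ?S' w)\<^sup>2) \<partial>W)"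
          unfolding e power2_commute[of "I' _"] by (rule nn_square_add_le) measurable
      qed
    qed simp
  qed
qed

lemma simple_ito_isometry:
  assumes si: "simple_integrand W B a b n \<tau> \<xi>" and a: "0 \<le> a"
    and f: "f \<in> borel_measurable (Fil a)" "integrable W (\<lambda>w. (f w)\<^sup>2)"
  shows "(\<integral>\<^sup>+w. ennreal ((f w + simple_integral B n \<tau> \<xi> w)\<^sup>2) \<partial>W) =
    (\<integral>\<^sup>+w. ennreal ((f w)\<^sup>2) \<partial>W) + sq a b (simple_process n \<tau> \<xi>)"
proof -
  note s = simple_integrandD[OF si] and q = simple_square[OF si a f]
  have "(\<integral>\<^sup>+w. ennreal ((f w + simple_integral B n \<tau> \<xi> w)\<^sup>2) \<partial>W) = ennreal (expectation (\<lambda>w. (f w + simple_integral B n \<tau> \<xi> w)\<^sup>2))"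
    by (rule nn_integral_eq_integral[OF q(1)]) simp
  also have "\<dots> = ennreal (expectation (\<lambda>w. (f w)\<^sup>2)) + ennreal (\<Sum>k<n. expectation (\<lambda>w. (\<xi> k w)\<^sup>2) * (\<tau> (Suc k) - \<tau> k))"
    unfolding q(2) using s(3) by (intro ennreal_plus integral_nonneg_AE sum_nonneg mult_nonneg_nonneg) auto
  also have "ennreal (\<Sum>k<n. expectation (\<lambda>w. (\<xi> k w)\<^sup>2) * (\<tau> (Suc k) - \<tau> k)) = sq a b (simple_process n \<tau> \<xi>)"
    unfolding sq_def by (rule simple_isometry[OF si a, symmetric])
  also have "ennreal (expectation (\<lambda>w. (f w)\<^sup>2)) = (\<integral>\<^sup>+w. ennreal ((f w)\<^sup>2) \<partial>W)"
    by (rule nn_integral_eq_integral[OF f(2), symmetric]) simp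
  finally show ?thesis .
qed

text \<open>The Ito isometry, up to a factor that lets mean-square limits pass through without convergence of norms.\<close>

lemma has_ito_inequality:
  assumes I: "has_ito_integral W B Z a b I" and j: "jm Z" and ab: "0 \<le> a" "b \<le> 1"
    and \<eta>: "\<eta> \<in> borel_measurable (Fil a)" "integrable W (\<lambda>w. (\<eta> w)\<^sup>2)"
  shows "(\<integral>\<^sup>+w. ennreal ((\<eta> w)\<^sup>2) \<partial>W) + sq a b Z \<le> 4 * (\<integral>\<^sup>+w. ennreal ((\<eta> w + I w)\<^sup>2) \<partial>W)"
    and "(\<integral>\<^sup>+w. ennreal ((I w)\<^sup>2) \<partial>W) < \<infinity>"
proof -
  obtain n :: "nat \<Rightarrow> nat" and \<tau> :: "nat \<Rightarrow> nat \<Rightarrow> real" and \<xi> :: "nat \<Rightarrow> nat \<Rightarrow> 'b \<Rightarrow> real" where 1: "I \<in> borel_measurable W" "\<And>m::nat. simple_integrand W B a b (n m) (\<tau> m) (\<xi> m)"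
    "(\<lambda>m. sq a b (\<lambda>s w. Z s w - simple_process (n m) (\<tau> m) (\<xi> m) s w)) \<longlonglongrightarrow> 0"
    "(\<lambda>m. \<integral>\<^sup>+w. ennreal ((I w - simple_integral B (n m) (\<tau> m) (\<xi> m) w)\<^sup>2) \<partial>W) \<longlonglongrightarrow> 0"
    by (rule has_itoD[OF I(1)]) (rule that; (assumption | erule meta_spec))
  let ?P = "\<lambda>m. simple_process (n m) (\<tau> m) (\<xi> m)" and ?S = "\<lambda>m. simple_integral B (n m) (\<tau> m) (\<xi> m)"
  have [measurable]: "\<eta> \<in> borel_measurable W" by (rule measurable_Fil_W[OF \<eta>(1) ab(1)])
  have [measurable]: "?S m \<in> borel_measurable W" for m
    using simple_square(3)[OF 1(2) ab(1), of "\<lambda>_. 0"] by simp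
  note [measurable] = 1(1)
  define d where "d m = sq a b (\<lambda>s w. Z s w - ?P m s w)" for m
  define e where "e m = (\<integral>\<^sup>+w. ennreal ((I w - ?S m w)\<^sup>2) \<partial>W)" for m
  let ?A = "\<integral>\<^sup>+w. ennreal ((\<eta> w)\<^sup>2) \<partial>W" and ?T = "\<integral>\<^sup>+w. ennreal ((\<eta> w + I w)\<^sup>2) \<partial>W"
  have le: "?A + sq a b Z \<le> (2 * d m + 4 * e m) + 4 * ?T" for m
  proof -
    have "sq a b Z = sq a b (\<lambda>s w. (Z s w - ?P m s w) + ?P m s w)" by simp
    also have "\<dots> \<le> 2 * d m + 2 * sq a b (?P m)"
      unfolding d_def by (intro sq_add jm_diff j jm_simple_process[OF 1(2)] ab)
    finally have z: "sq a b Z \<le> 2 * d m + 2 * sq a b (?P m)" .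
    have "(\<integral>\<^sup>+w. ennreal ((\<eta> w + ?S m w)\<^sup>2) \<partial>W) = (\<integral>\<^sup>+w. ennreal (((\<eta> w + I w) + (?S m w - I w))\<^sup>2) \<partial>W)" by simp
    also have "\<dots> \<le> 2 * ?T + 2 * (\<integral>\<^sup>+w. ennreal ((?S m w - I w)\<^sup>2) \<partial>W)"
      by (rule nn_square_add_le) measurable
    also have "(\<integral>\<^sup>+w. ennreal ((?S m w - I w)\<^sup>2) \<partial>W) = e m" by (simp add: e_def power2_commute)
    finally have t: "?A + sq a b (?P m) \<le> 2 * ?T + 2 * e m" using simple_ito_isometry[OF 1(2) ab(1) \<eta>, of m] by simp
    \<comment> \<open>Doubling the first term as well makes both terms carry the same factor, so
      that the isometry applies to their sum.\<close>
    have "?A + sq a b Z \<le> 2 * ?A + (2 * d m + 2 * sq a b (?P m))"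
      using z by (intro add_mono) (simp add: mult_2)
    also have "\<dots> = 2 * d m + 2 * (?A + sq a b (?P m))" by (simp add: distrib_left ac_simps)
    also have "\<dots> \<le> 2 * d m + 2 * (2 * ?T + 2 * e m)" by (intro add_left_mono mult_left_mono t) simp
    also have "\<dots> = (2 * d m + 4 * e m) + 4 * ?T" by (simp add: distrib_left ac_simps)
    finally show ?thesis .
  qed
  have "(\<lambda>m. 2 * d m + 4 * e m) \<longlonglongrightarrow> 2 * 0 + 4 * 0"
    using 1(3,4) unfolding d_def e_def by (intro tendsto_add ennreal_tendsto_cmult) auto
  then have "(\<lambda>m. (2 * d m + 4 * e m) + 4 * ?T) \<longlonglongrightarrow> (2 * 0 + 4 * 0) + 4 * ?T"
    by (rule tendsto_add[OF _ tendsto_const])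
  then show "?A + sq a b Z \<le> 4 * ?T" using le by (intro LIMSEQ_le_const[of _ "4 * ?T"]) auto
  have "eventually (\<lambda>m. e m < 1) sequentially" using 1(4) unfolding e_def by (rule order_tendstoD(2)) simp
  then obtain m where m: "e m < 1" by (auto simp: eventually_sequentially)
  have "(\<integral>\<^sup>+w. ennreal ((I w)\<^sup>2) \<partial>W) = (\<integral>\<^sup>+w. ennreal (((I w - ?S m w) + ?S m w)\<^sup>2) \<partial>W)" by simp
  also have "\<dots> \<le> 2 * e m + 2 * (\<integral>\<^sup>+w. ennreal ((?S m w)\<^sup>2) \<partial>W)"
    unfolding e_def by (rule nn_square_add_le) measurable
  also have "\<dots> < \<infinity>"
  proof -
    have "(\<integral>\<^sup>+w. ennreal ((?S m w)\<^sup>2) \<partial>W) = ennreal (expectation (\<lambda>w. (?S m w)\<^sup>2))"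
      using simple_square(1)[OF 1(2) ab(1), of "\<lambda>_. 0" m] by (intro nn_integral_eq_integral) auto
    moreover have "e m < \<top>" using m by (rule less_trans) simp
    ultimately show ?thesis by (simp add: ennreal_add_less_top ennreal_mult_less_top flip: ennreal_numeral)
  qed
  finally show "(\<integral>\<^sup>+w. ennreal ((I w)\<^sup>2) \<partial>W) < \<infinity>" .
qed

end

section \<open>Uniqueness for the backward equation\<close>

context brownian begin

lemma integrable_L01_square:
  assumes "z \<in> borel_measurable L01" "(\<integral>\<^sup>+r. ennreal ((z r)\<^sup>2) \<partial>L01) < \<infinity>"
  shows "integrable L01 (\<lambda>r. (z r :: real)\<^sup>2)"
  by (rule integrableI_bounded) (use assms in simp_all)

lemma integrable_L01_const: "integrable L01 (\<lambda>r. c :: real)"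
  by (subst integrable_restrict_space) (simp_all add: integrable_mult_left)

lemma driver_integrable:
  assumes z: "z \<in> borel_measurable L01" "(\<integral>\<^sup>+r. ennreal ((z r)\<^sup>2) \<partial>L01) < \<infinity>" and g: "lip L g" "g \<in> borel_measurable borel"
  shows "integrable L01 (\<lambda>r. g (z r))"
proof (rule Bochner_Integration.integrable_bound)
  show "integrable L01 (\<lambda>r. \<bar>g 0\<bar> + \<bar>L\<bar> * (1 + (z r)\<^sup>2))"
    by (intro Bochner_Integration.integrable_add integrable_mult_right integrable_L01_const integrable_L01_square z)
  show "(\<lambda>r. g (z r)) \<in> borel_measurable L01" by (rule measurable_compose[OF z(1) g(2)])
  show "AE r in L01. norm (g (z r)) \<le> norm (\<bar>g 0\<bar> + \<bar>L\<bar> * (1 + (z r)\<^sup>2))"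
  proof (rule AE_I2)
    fix r
    have "\<bar>g (z r) - g 0\<bar> \<le> L * \<bar>z r - 0\<bar>" using g(1) unfolding lip_def by blast
    also have "\<dots> \<le> \<bar>L\<bar> * \<bar>z r\<bar>" by (simp add: mult_right_mono)
    also have "\<dots> \<le> \<bar>L\<bar> * (1 + (z r)\<^sup>2)"
    proof (rule mult_left_mono)
      show "\<bar>z r\<bar> \<le> 1 + (z r)\<^sup>2" using zero_le_power2[of "\<bar>z r\<bar> - 1"] zero_le_power2[of "z r"] by (simp add: power2_diff)
    qed simp
    finally have "\<bar>g (z r)\<bar> \<le> \<bar>g 0\<bar> + \<bar>L\<bar> * (1 + (z r)\<^sup>2)" by linarith
    then show "norm (g (z r)) \<le> norm (\<bar>g 0\<bar> + \<bar>L\<bar> * (1 + (z r)\<^sup>2))" by simp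
  qed
qed

lemma LINT_L01: "0 \<le> s \<Longrightarrow> t \<le> 1 \<Longrightarrow> (LINT r:{s..t}|lborel. f r) = (\<integral>r. indicator {s..t} r * f r \<partial>L01)" for f :: "real \<Rightarrow> real"
  unfolding set_lebesgue_integral_def
  by (subst integral_restrict_space) (auto intro!: Bochner_Integration.integral_cong simp: indicator_def)

lemma nn_L01: "0 \<le> s \<Longrightarrow> t \<le> 1 \<Longrightarrow> (\<integral>\<^sup>+r\<in>{s..t}. f r \<partial>lborel) = (\<integral>\<^sup>+r. f r * indicator {s..t} r \<partial>L01)"
  by (subst nn_integral_restrict_space) (auto intro!: nn_integral_cong simp: indicator_def)

lemma indicator_L01 [measurable]: "(\<lambda>s. indicator {a..b} s :: ennreal) \<in> borel_measurable L01"
  "(\<lambda>s. indicator {a..b} s :: real) \<in> borel_measurable L01"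
  by (intro measurable_restrict_space1; simp)+

text \<open>Cauchy-Schwarz in time. Since the integrands agree after \<open>t\<close>, only the
  length \<open>t - s\<close> appears, and its smallness is what makes the driver
  absorbable.\<close>

lemma driver_difference:
  assumes z: "z \<in> borel_measurable L01" "(\<integral>\<^sup>+r. ennreal ((z r)\<^sup>2) \<partial>L01) < \<infinity>"
    and z': "z' \<in> borel_measurable L01" "(\<integral>\<^sup>+r. ennreal ((z' r)\<^sup>2) \<partial>L01) < \<infinity>"
    and g: "lip L g" "g \<in> borel_measurable borel" and L: "0 \<le> L"
    and st: "0 \<le> s" "s \<le> t" "t \<le> 1" and late: "(\<integral>\<^sup>+r\<in>{t..1}. ennreal ((z r - z' r)\<^sup>2) \<partial>lborel) = 0"
  shows "ennreal (((LINT r:{s..1}|lborel. g (z r)) - (LINT r:{s..1}|lborel. g (z' r)))\<^sup>2)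
    \<le> ennreal (L\<^sup>2 * (t - s)) * (\<integral>\<^sup>+r\<in>{s..1}. ennreal ((z r - z' r)\<^sup>2) \<partial>lborel)"
proof -
  note [measurable] = z(1) z'(1)
  let ?i = "\<lambda>r. indicator {s..1} r :: real" and ?e = "\<lambda>r. g (z r) - g (z' r)"
  let ?f = "\<lambda>r. ennreal (L * \<bar>z r - z' r\<bar>) * indicator {s..1} r" and ?h = "\<lambda>r. indicator {s..t} r :: ennreal"
  have i: "integrable L01 (\<lambda>r. ?i r * f r)" if "integrable L01 f" for f :: "real \<Rightarrow> real"
  proof (rule Bochner_Integration.integrable_bound[OF that])
    show "(\<lambda>r. ?i r * f r) \<in> borel_measurable L01"
      by (intro borel_measurable_times indicator_L01 borel_measurable_integrable that)
  qed (auto simp: indicator_def)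
  note i1 = i[OF driver_integrable[OF z g]] and i2 = i[OF driver_integrable[OF z' g]]
  have eq: "(LINT r:{s..1}|lborel. g (z r)) - (LINT r:{s..1}|lborel. g (z' r)) = (\<integral>r. ?i r * ?e r \<partial>L01)"
    using st by (simp add: LINT_L01 Bochner_Integration.integral_diff[OF i1 i2, symmetric] right_diff_distrib)
  have "(\<integral>\<^sup>+r. ennreal ((z r - z' r)\<^sup>2) * indicator {t..1} r \<partial>L01) = 0"
    using late st by (subst (asm) nn_L01) auto
  then have AE0: "AE r in L01. ennreal ((z r - z' r)\<^sup>2) * indicator {t..1} r = 0"
    by (subst (asm) nn_integral_0_iff_AE) auto
  have "ennreal \<bar>\<integral>r. ?i r * ?e r \<partial>L01\<bar> \<le> (\<integral>\<^sup>+r. ennreal (norm (?i r * ?e r)) \<partial>L01)"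
    using integral_norm_bound_ennreal[of L01 "\<lambda>r. ?i r * ?e r"] Bochner_Integration.integrable_diff[OF i1 i2]
    by (simp add: right_diff_distrib)
  also have "\<dots> \<le> (\<integral>\<^sup>+r. ?f r * ?h r \<partial>L01)"
  proof (rule nn_integral_mono_AE)
    show "AE r in L01. ennreal (norm (?i r * ?e r)) \<le> ?f r * ?h r"
      using AE0
    proof eventually_elim
      case (elim r)
      have e: "\<bar>?e r\<bar> \<le> L * \<bar>z r - z' r\<bar>" using g(1) unfolding lip_def by blast
      show ?case
      proof (cases "r \<in> {s..1}")
        case True
        show ?thesis
        proof (cases "r \<le> t")
          case True
          then show ?thesis using e \<open>r \<in> {s..1}\<close> by (simp add: indicator_def ennreal_leI)
        next
          case False
          then have "z r = z' r" using elim True by (auto simp: indicator_def)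
          then show ?thesis by simp
        qed
      qed (simp add: indicator_def)
    qed
  qed
  finally have "(ennreal \<bar>\<integral>r. ?i r * ?e r \<partial>L01\<bar>)\<^sup>2 \<le> (\<integral>\<^sup>+r. ?f r * ?h r \<partial>L01)\<^sup>2" by (rule power_mono) simp
  also have "\<dots> \<le> (\<integral>\<^sup>+r. (?f r)\<^sup>2 \<partial>L01) * (\<integral>\<^sup>+r. (?h r)\<^sup>2 \<partial>L01)"
    by (rule Cauchy_Schwarz_nn_integral) auto
  also have "(\<integral>\<^sup>+r. (?f r)\<^sup>2 \<partial>L01) = (\<integral>\<^sup>+r. ennreal (L\<^sup>2) * (ennreal ((z r - z' r)\<^sup>2) * indicator {s..1} r) \<partial>L01)"
    using L by (intro nn_integral_cong) (auto simp: indicator_def power_mult_distrib ennreal_mult' simp: ennreal_power)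
  also have "\<dots> = ennreal (L\<^sup>2) * (\<integral>\<^sup>+r\<in>{s..1}. ennreal ((z r - z' r)\<^sup>2) \<partial>lborel)"
    using st by (subst nn_L01) (simp_all add: nn_integral_cmult)
  also have "(\<integral>\<^sup>+r. (?h r)\<^sup>2 \<partial>L01) = (\<integral>\<^sup>+r\<in>{s..t}. 1 \<partial>lborel)"
    using st by (subst nn_L01) (auto intro!: nn_integral_cong simp: indicator_def)
  also have "\<dots> = ennreal (t - s)" using st by simp
  also have "(ennreal \<bar>\<integral>r. ?i r * ?e r \<partial>L01\<bar>)\<^sup>2 = ennreal ((\<integral>r. ?i r * ?e r \<partial>L01)\<^sup>2)"
    by (simp add: ennreal_power)
  finally show ?thesis unfolding eq using st by (simp add: ennreal_mult ac_simps)
qed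

lemma sq_diff:
  assumes "jm Z" "jm Z'" "0 \<le> a" "b \<le> 1"
  shows "sq a b (\<lambda>t w. Z t w - Z' t w) \<le> 2 * sq a b Z + 2 * sq a b Z'"
proof -
  have "jm (\<lambda>t w. - Z' t w)" using assms(2) unfolding jm_def case_prod_unfold by (rule borel_measurable_uminus)
  from sq_add[OF assms(1) this assms(3,4)] show ?thesis by (simp add: sq_def)
qed

lemma jm_section: "jm Z \<Longrightarrow> w \<in> space W \<Longrightarrow> (\<lambda>t. Z t w) \<in> borel_measurable L01"
  unfolding jm_def using measurable_compose[OF measurable_Pair2'[of w W L01]] by fastforce

lemma sq_finite_AE:
  assumes "jm Z" "sq 0 1 Z < \<infinity>" shows "AE w in W. (\<integral>\<^sup>+r. ennreal ((Z r w)\<^sup>2) \<partial>L01) < \<infinity>"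
proof -
  have "AE w in W. (\<integral>\<^sup>+r\<in>{0..1}. ennreal ((Z r w)\<^sup>2) \<partial>lborel) \<noteq> \<infinity>"
    using assms double_integral_eq(2)[OF jm_square[OF assms(1)], of 0 1] unfolding sq_def by (intro nn_integral_PInf_AE) auto
  then show ?thesis
    by (rule AE_mp) (auto intro!: AE_I2 simp: nn_integral_restrict_space less_top)
qed

lemma driver_square:
  assumes Z: "jm Z" "sq 0 1 Z < \<infinity>" and Z': "jm Z'" "sq 0 1 Z' < \<infinity>"
    and g: "lip L g" "g \<in> borel_measurable borel" and L: "0 \<le> L"
    and st: "0 \<le> s" "s \<le> t" "t \<le> 1" and late: "sq t 1 (\<lambda>r w. Z r w - Z' r w) = 0"
  shows "(\<integral>\<^sup>+w. ennreal (((LINT r:{s..1}|lborel. g (Z r w)) - (LINT r:{s..1}|lborel. g (Z' r w)))\<^sup>2) \<partial>W)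
    \<le> ennreal (L\<^sup>2 * (t - s)) * sq s 1 (\<lambda>r w. Z r w - Z' r w)"
proof -
  note j = jm_square[OF jm_diff[OF Z(1) Z'(1)]]
  have m: "(\<lambda>w. \<integral>\<^sup>+r\<in>{s..1}. ennreal ((Z r w - Z' r w)\<^sup>2) \<partial>lborel) \<in> borel_measurable W" if "0 \<le> s" for s
    by (rule double_integral_eq(2)[OF j that order_refl])
  have "0 \<le> t" using st by simp
  have "AE w in W. (\<integral>\<^sup>+r\<in>{t..1}. ennreal ((Z r w - Z' r w)\<^sup>2) \<partial>lborel) = 0"
    using late m[OF \<open>0 \<le> t\<close>] unfolding sq_def by (subst (asm) nn_integral_0_iff_AE) auto
  then have "AE w in W. ennreal (((LINT r:{s..1}|lborel. g (Z r w)) - (LINT r:{s..1}|lborel. g (Z' r w)))\<^sup>2)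
    \<le> ennreal (L\<^sup>2 * (t - s)) * (\<integral>\<^sup>+r\<in>{s..1}. ennreal ((Z r w - Z' r w)\<^sup>2) \<partial>lborel)"
    using sq_finite_AE[OF Z] sq_finite_AE[OF Z'] AE_space
  proof eventually_elim
    case (elim w)
    show ?case by (rule driver_difference[OF jm_section[OF Z(1) elim(4)] elim(2) jm_section[OF Z'(1) elim(4)] elim(3) g L st elim(1)])
  qed
  from nn_integral_mono_AE[OF this] show ?thesis
    unfolding sq_def using m[OF st(1)] by (simp add: nn_integral_cmult)
qed

lemma asiD:
  assumes "adapted_square_integrable W B Z"
  shows "\<And>t. 0 \<le> t \<Longrightarrow> t \<le> 1 \<Longrightarrow> Z t \<in> borel_measurable (Fil t)" "jm Z" "sq 0 1 Z < \<infinity>"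
  using assms unfolding adapted_square_integrable_def jm_iff sq_def by auto

text \<open>Subtracting the equations gives (Y s - Y' s) + J = difference of the driver integrals,
  where J is the difference of the Ito integrals. By \<open>has_ito_inequality\<close> the left side
  controls both the solutions at \<open>s\<close> and the integrands on [s, 1]; the required square
  integrability of Y s - Y' s follows from the equation itself.\<close>

lemma solution_difference:
  assumes sol: "bsde_solution W B g \<xi> Y Z" "bsde_solution W B g \<xi> Y' Z'"
    and g: "lip L g" "g \<in> borel_measurable borel" and L: "0 \<le> L"
    and st: "0 \<le> s" "s \<le> t" "t \<le> 1" and late: "sq t 1 (\<lambda>r w. Z r w - Z' r w) = 0"
  shows "(\<integral>\<^sup>+w. ennreal ((Y s w - Y' s w)\<^sup>2) \<partial>W) + sq s 1 (\<lambda>r w. Z r w - Z' r w)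
    \<le> 4 * (ennreal (L\<^sup>2 * (t - s)) * sq s 1 (\<lambda>r w. Z r w - Z' r w))"
proof -
  have a: "adapted_square_integrable W B Y" "adapted_square_integrable W B Z"
    and a': "adapted_square_integrable W B Y'" "adapted_square_integrable W B Z'"
    using sol unfolding bsde_solution_def by blast+
  note Y = asiD[OF a(1)] and Z = asiD[OF a(2)] and Y' = asiD[OF a'(1)] and Z' = asiD[OF a'(2)]
  have s: "s \<in> {0..1}" using st by simp
  obtain I where I: "has_ito_integral W B Z s 1 I" "AE w in W. Y s w = \<xi> w + (LINT r:{s..1}|lborel. g (Z r w)) - I w"
    using sol(1) s unfolding bsde_solution_def by blast
  obtain I' where I': "has_ito_integral W B Z' s 1 I'" "AE w in W. Y' s w = \<xi> w + (LINT r:{s..1}|lborel. g (Z' r w)) - I' w"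
    using sol(2) s unfolding bsde_solution_def by blast
  let ?D = "\<lambda>r w. Z r w - Z' r w" and ?\<eta> = "\<lambda>w. Y s w - Y' s w" and ?J = "\<lambda>w. I w - I' w"
  let ?G = "\<lambda>w. (LINT r:{s..1}|lborel. g (Z r w)) - (LINT r:{s..1}|lborel. g (Z' r w))"
  have jD: "jm ?D" by (rule jm_diff[OF Z(2) Z'(2)])
  have ito: "has_ito_integral W B ?D s 1 ?J" by (rule has_ito_diff[OF I(1) I'(1) Z(2) Z'(2) st(1) order_refl])
  have \<eta>F: "?\<eta> \<in> borel_measurable (Fil s)" using Y(1)[of s] Y'(1)[of s] s by simp
  have [measurable]: "?\<eta> \<in> borel_measurable W" by (rule measurable_Fil_W[OF \<eta>F st(1)])
  have [measurable]: "?J \<in> borel_measurable W" using ito unfolding has_ito_integral_def by blast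
  have G: "(\<integral>\<^sup>+w. ennreal ((?\<eta> w + ?J w)\<^sup>2) \<partial>W) \<le> ennreal (L\<^sup>2 * (t - s)) * sq s 1 ?D"
  proof -
    have "(\<integral>\<^sup>+w. ennreal ((?\<eta> w + ?J w)\<^sup>2) \<partial>W) = (\<integral>\<^sup>+w. ennreal ((?G w)\<^sup>2) \<partial>W)"
      using I(2) I'(2) by (intro nn_integral_cong_AE) (auto elim!: eventually_elim2)
    also have "\<dots> \<le> ennreal (L\<^sup>2 * (t - s)) * sq s 1 ?D" by (rule driver_square[OF Z(2,3) Z'(2,3) g L st late])
    finally show ?thesis .
  qed
  have fin: "sq s 1 ?D < \<infinity>"
  proof -
    have "sq s 1 ?D \<le> sq 0 1 ?D" using st by (intro sq_mono_interval) auto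
    also have "\<dots> \<le> 2 * sq 0 1 Z + 2 * sq 0 1 Z'" by (rule sq_diff[OF Z(2) Z'(2)]) auto
    also have "\<dots> < \<infinity>" using Z(3) Z'(3) by (simp add: ennreal_mult_less_top)
    finally show ?thesis .
  qed
  have "(\<integral>\<^sup>+w. ennreal ((?\<eta> w)\<^sup>2) \<partial>W) = (\<integral>\<^sup>+w. ennreal (((?\<eta> w + ?J w) + (- ?J w))\<^sup>2) \<partial>W)" by simp
  also have "\<dots> \<le> 2 * (\<integral>\<^sup>+w. ennreal ((?\<eta> w + ?J w)\<^sup>2) \<partial>W) + 2 * (\<integral>\<^sup>+w. ennreal ((- ?J w)\<^sup>2) \<partial>W)"
    by (rule nn_square_add_le) measurable
  also have "\<dots> < \<infinity>"
  proof -
    have "(\<integral>\<^sup>+w. ennreal ((?J w)\<^sup>2) \<partial>W) < \<infinity>"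
      by (rule has_ito_inequality(2)[OF ito jD st(1) order_refl, of "\<lambda>_. 0"]) auto
    moreover have "(\<integral>\<^sup>+w. ennreal ((?\<eta> w + ?J w)\<^sup>2) \<partial>W) < \<infinity>"
      using fin by (intro le_less_trans[OF G]) (simp add: ennreal_mult_less_top)
    ultimately show ?thesis by (simp add: ennreal_mult_less_top power2_commute[of "I' _" "I _"])
  qed
  finally have "integrable W (\<lambda>w. (?\<eta> w)\<^sup>2)" by (intro integrableI_bounded) simp_all
  from has_ito_inequality(1)[OF ito jD st(1) order_refl \<eta>F this]
  have "(\<integral>\<^sup>+w. ennreal ((?\<eta> w)\<^sup>2) \<partial>W) + sq s 1 ?D \<le> 4 * (\<integral>\<^sup>+w. ennreal ((?\<eta> w + ?J w)\<^sup>2) \<partial>W)" .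
  also have "\<dots> \<le> 4 * (ennreal (L\<^sup>2 * (t - s)) * sq s 1 ?D)" by (rule mult_left_mono[OF G]) simp
  finally show ?thesis .
qed

lemma ennreal_le_half_imp_0: "x \<le> ennreal (1/2) * x \<Longrightarrow> x < \<infinity> \<Longrightarrow> x = 0" for x :: ennreal
proof (cases x)
  case (real r)
  assume "x \<le> ennreal (1/2) * x"
  then have "ennreal r \<le> ennreal (1/2 * r)" using real by (subst ennreal_mult') simp_all
  then show ?thesis using real by simp
qed simp

lemma sq_point: "sq a a Z = 0"
proof -
  have "(\<integral>\<^sup>+s\<in>{a..a}. ennreal ((Z s w)\<^sup>2) \<partial>lborel) = 0" for w
  proof -
    have "(\<integral>\<^sup>+s\<in>{a..a}. ennreal ((Z s w)\<^sup>2) \<partial>lborel) = (\<integral>\<^sup>+s. 0 \<partial>(lborel :: real measure))"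
    proof (rule nn_integral_cong_AE)
      show "AE s in lborel. ennreal ((Z s w)\<^sup>2) * indicator {a..a} s = 0"
        using AE_lborel_singleton[of a] by eventually_elim (simp add: indicator_def)
    qed
    then show ?thesis by simp
  qed
  then show ?thesis by (simp add: sq_def)
qed

text \<open>Backward induction over intervals of length \<open>c\<close>, along which agreement of
  the integrands spreads from time 1 to time 0.\<close>

lemma bsde_unique:
  assumes sol: "bsde_solution W B g \<xi> Y Z" "bsde_solution W B g \<xi> Y' Z'"
    and g: "lip L g" "g \<in> borel_measurable borel" and L: "0 < L"
  shows "AE w in W. Y 0 w = Y' 0 w"
proof -
  have a: "adapted_square_integrable W B Y" "adapted_square_integrable W B Z"
    and a': "adapted_square_integrable W B Y'" "adapted_square_integrable W B Z'"
    using sol unfolding bsde_solution_def by blast+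
  note Z = asiD[OF a(2)] and Z' = asiD[OF a'(2)]
  let ?D = "\<lambda>r w. Z r w - Z' r w"
  note step = solution_difference[OF sol g less_imp_le[OF L]]
  \<comment> \<open>Chosen so that 4 L^2 c = 1/2: the driver term in
    \<open>solution_difference\<close> is then at most half of the energy on the left.\<close>
  define c where "c = 1 / (8 * L\<^sup>2)"
  have c: "0 < c" using L by (simp add: c_def)
  have zero: "sq s 1 ?D = 0" if st: "0 \<le> s" "s \<le> t" "t \<le> 1" "t - s \<le> c" "sq t 1 ?D = 0" for s t
  proof (rule ennreal_le_half_imp_0)
    have "sq s 1 ?D \<le> 4 * (ennreal (L\<^sup>2 * (t - s)) * sq s 1 ?D)"
      using step[OF st(1,2,3,5)] by (rule order_trans[rotated]) simp
    also have "\<dots> = ennreal (4 * (L\<^sup>2 * (t - s))) * sq s 1 ?D"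
      using st by (simp add: ennreal_mult' mult.assoc flip: ennreal_numeral)
    also have "\<dots> \<le> ennreal (1/2) * sq s 1 ?D"
    proof (intro mult_right_mono ennreal_leI)
      have "L\<^sup>2 * (t - s) \<le> L\<^sup>2 * c" by (rule mult_left_mono[OF st(4)]) simp
      then show "4 * (L\<^sup>2 * (t - s)) \<le> 1/2" using L by (simp add: c_def)
    qed simp
    finally show "sq s 1 ?D \<le> ennreal (1/2) * sq s 1 ?D" .
    have "sq s 1 ?D \<le> sq 0 1 ?D" using st by (intro sq_mono_interval) auto
    also have "\<dots> \<le> 2 * sq 0 1 Z + 2 * sq 0 1 Z'" by (rule sq_diff[OF Z(2) Z'(2)]) auto
    also have "\<dots> < \<infinity>" using Z(3) Z'(3) by (simp add: ennreal_mult_less_top)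
    finally show "sq s 1 ?D < \<infinity>" .
  qed
  have "sq (max 0 (1 - real k * c)) 1 ?D = 0" for k
  proof (induction k)
    case 0
    show ?case by (simp add: sq_point)
  next
    case (Suc k)
    show ?case by (rule zero[OF _ _ _ _ Suc]) (use c in \<open>auto simp: algebra_simps max_def\<close>)
  qed
  moreover obtain k where "1 / c < real k" using reals_Archimedean2 by blast
  then have "max 0 (1 - real k * c) = 0" using c by (simp add: field_simps)
  ultimately have z: "sq 0 1 ?D = 0" by metis
  have "(\<integral>\<^sup>+w. ennreal ((Y 0 w - Y' 0 w)\<^sup>2) \<partial>W) = 0" using step[of 0 0] z by simp
  moreover have "(\<lambda>w. Y 0 w - Y' 0 w) \<in> borel_measurable W"
    by (intro borel_measurable_diff measurable_Fil_W[OF asiD(1)[OF a(1)]] measurable_Fil_W[OF asiD(1)[OF a'(1)]]) auto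
  ultimately have "AE w in W. ennreal ((Y 0 w - Y' 0 w)\<^sup>2) = 0"
    by (subst (asm) nn_integral_0_iff_AE) auto
  then show ?thesis by (auto elim!: eventually_mono)
qed

end

section \<open>Approximate solutions along Brownian paths\<close>

text \<open>At most one summand is active at time \<open>s\<close>; when none is, both sides vanish
  because \<open>g 0 = 0\<close>.\<close>

lemma simple_process_apply:
  assumes "\<And>k. k < n \<Longrightarrow> \<tau> k \<le> \<tau> (Suc k)" and g: "g 0 = (0::real)"
  shows "g (simple_process n \<tau> \<xi> s w) = simple_process n \<tau> (\<lambda>k w. g (\<xi> k w)) s w"
  using assms(1)
proof (induction n)
  case 0 then show ?case using g by (simp add: simple_process_def)
next
  case (Suc n)
  have S: "simple_process (Suc n) \<tau> \<xi> s w = simple_process n \<tau> \<xi> s w + \<xi> n w * indicator {\<tau> n<..\<tau> (Suc n)} s" for \<xi>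
    by (simp add: simple_process_def)
  show ?case
  proof (cases "\<tau> n < s")
    case True
    have z: "simple_process n \<tau> \<xi> s w = 0" for \<xi>
      unfolding simple_process_def
    proof (rule sum.neutral, rule ballI)
      fix k assume k: "k \<in> {..<n}"
      have "Suc k \<le> n \<Longrightarrow> n \<le> n \<Longrightarrow> \<tau> (Suc k) \<le> \<tau> n"
        by (rule lift_Suc_mono_le[of "\<lambda>j. \<tau> (min n j)", of "Suc k" n, simplified])
          (use Suc.prems in \<open>auto simp: min_def not_le less_Suc_eq_le dest: order_antisym\<close>)
      then show "\<xi> k w * indicator {\<tau> k<..\<tau> (Suc k)} s = 0" using True k by simp
    qed
    show ?thesis unfolding S z using g by (simp add: indicator_def)
  next
    case False
    then show ?thesis unfolding S using Suc by (simp add: indicator_def)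
  qed
qed

lemma LINT_simple_process:
  assumes "\<And>k. k < n \<Longrightarrow> \<tau> k \<le> \<tau> (Suc k)" "\<tau> 0 = a" "\<tau> n = b" "\<And>k. k \<le> n \<Longrightarrow> a \<le> \<tau> k \<and> \<tau> k \<le> b"
  shows "(LINT r:{a..b}|lborel. simple_process n \<tau> \<xi> r w) = (\<Sum>k<n. \<xi> k w * (\<tau> (Suc k) - \<tau> k))"
proof -
  have "(LINT r:{a..b}|lborel. simple_process n \<tau> \<xi> r w) = (\<integral>r. (\<Sum>k<n. \<xi> k w * indicator {\<tau> k<..\<tau> (Suc k)} r) \<partial>lborel)"
    unfolding set_lebesgue_integral_def
  proof (rule Bochner_Integration.integral_cong[OF refl])
    fix r :: real
    have "simple_process n \<tau> \<xi> r w = 0" if "r \<notin> {a..b}"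
      unfolding simple_process_def using that assms(4)
      by (intro sum.neutral) (auto simp: indicator_def, (meson Suc_leI less_imp_le order_trans not_le)+)
    then show "indicator {a..b} r *\<^sub>R simple_process n \<tau> \<xi> r w = (\<Sum>k<n. \<xi> k w * indicator {\<tau> k<..\<tau> (Suc k)} r)"
      by (cases "r \<in> {a..b}") (simp_all add: simple_process_def)
  qed
  also have "\<dots> = (\<Sum>k<n. \<xi> k w * (\<tau> (Suc k) - \<tau> k))"
    by (subst Bochner_Integration.integral_sum) (auto intro!: sum.cong integrable_mult_right simp: assms(1))
  finally show ?thesis .
qed

section \<open>Joint measurability, continuous paths and uniform grids\<close>

context brownian begin

text \<open>The left end is left out of the pointwise hypothesis because the cells of a simple
  process are half-open; a single time is negligible.\<close>

lemma sq_le: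
  assumes X: "jm X" and ab: "0 \<le> a" "a \<le> b" "b \<le> 1" and c: "\<And>r. a < r \<Longrightarrow> r \<le> b \<Longrightarrow> (\<integral>\<^sup>+w. ennreal ((X r w)\<^sup>2) \<partial>W) \<le> c"
  shows "sq a b X \<le> c * ennreal (b - a)"
proof -
  have m: "(\<lambda>p. ennreal ((X (fst p) (snd p) * indicator {a..b} (fst p))\<^sup>2)) \<in> borel_measurable (L01 \<Otimes>\<^sub>M W)"
    by (intro measurable_compose[OF _ measurable_ennreal] borel_measurable_power jm_indicator X)
  have "sq a b X = (\<integral>\<^sup>+r. (\<integral>\<^sup>+w. ennreal ((X r w * indicator {a..b} r)\<^sup>2) \<partial>W) \<partial>L01)"
    unfolding sq_eq[OF X ab(1,3)] using nn_integral_fst[OF m] by simp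
  also have "\<dots> \<le> (\<integral>\<^sup>+r. c * indicator {a..b} r \<partial>L01)"
  proof (rule nn_integral_mono_AE)
    have "AE r in L01. r \<noteq> a"
      using AE_lborel_singleton[of a] by (auto simp: AE_restrict_space_iff elim: eventually_mono)
    then show "AE r in L01. (\<integral>\<^sup>+w. ennreal ((X r w * indicator {a..b} r)\<^sup>2) \<partial>W) \<le> c * indicator {a..b} r"
    proof eventually_elim
      case (elim r)
      show ?case
      proof (cases "r \<in> {a..b}")
        case True then show ?thesis using c[of r] elim by simp
      qed simp
    qed
  qed
  also have "\<dots> = (\<integral>\<^sup>+r\<in>{a..b}. c \<partial>lborel)" using ab by (simp add: nn_L01)
  also have "\<dots> = c * ennreal (b - a)" using ab by (simp add: nn_integral_cmult)
  finally show ?thesis .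
qed

text \<open>Freezing the time at a grid point leaves countably many sections, hence joint
  measurability; path continuity passes it to the limit.\<close>

lemma jm_continuous:
  assumes f: "\<And>t. t \<in> {0..1} \<Longrightarrow> f t \<in> borel_measurable W" "\<And>w. w \<in> space W \<Longrightarrow> continuous_on {0..1} (\<lambda>t. f t w)"
  shows "jm f"
  unfolding jm_def
proof (rule borel_measurable_LIMSEQ_real)
  let ?q = "\<lambda>n t. nat \<lfloor>t * real (Suc n)\<rfloor>" and ?x = "\<lambda>n i. min 1 (real i / real (Suc n))"
  fix n
  have "(\<lambda>t. ?q n t) \<in> L01 \<rightarrow>\<^sub>M count_space UNIV" by (rule measurable_restrict_space1) measurable
  from measurable_compose[OF measurable_fst[of L01 W] this]
  show "(\<lambda>p. f (?x n (?q n (fst p))) (snd p)) \<in> borel_measurable (L01 \<Otimes>\<^sub>M W)"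
    by (rule measurable_compose_countable[rotated]) (intro measurable_compose[OF measurable_snd] f, simp)
next
  let ?q = "\<lambda>n t. nat \<lfloor>t * real (Suc n)\<rfloor>" and ?x = "\<lambda>n i. min 1 (real i / real (Suc n))"
  fix p assume "p \<in> space (L01 \<Otimes>\<^sub>M W)"
  then obtain t w where p: "p = (t, w)" "t \<in> {0..1}" "w \<in> space W" by (cases p) (auto simp: space_pair_measure space_restrict_space)
  have x: "\<bar>?x n (?q n t) - t\<bar> \<le> 1 / real (Suc n)" for n
  proof -
    have "real (?q n t) = of_int \<lfloor>t * real (Suc n)\<rfloor>" using p(2) by simp
    then have "real (?q n t) \<le> t * real (Suc n)" "t * real (Suc n) - 1 \<le> real (?q n t)" by linarith+
    moreover have "q / N \<le> t" "t - 1 / N \<le> q / N" if "q \<le> t * N" "t * N - 1 \<le> q" "0 < N" for q N :: real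
    proof -
      show "q / N \<le> t" using that by (simp add: pos_divide_le_eq)
      have "(t * N - 1) / N \<le> q / N" using that by (intro divide_right_mono) auto
      then show "t - 1 / N \<le> q / N" using that by (simp add: diff_divide_distrib)
    qed
    ultimately have "real (?q n t) / real (Suc n) \<le> t" "t - 1 / real (Suc n) \<le> real (?q n t) / real (Suc n)" by simp_all
    moreover have "\<bar>min 1 y - t\<bar> \<le> e" if "y \<le> t" "t - e \<le> y" "t \<le> 1" for y e :: real
      using that by (auto simp: min_def abs_le_iff)
    ultimately show ?thesis using p(2) by (metis atLeastAtMost_iff)
  qed
  have "(\<lambda>n. ?x n (?q n t) - t) \<longlonglongrightarrow> 0"
    by (rule Lim_null_comparison[OF _ LIMSEQ_inverse_real_of_nat]) (use x in \<open>auto simp: inverse_eq_divide\<close>)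
  then have "(\<lambda>n. ?x n (?q n t)) \<longlonglongrightarrow> t" by (simp add: LIM_zero_iff)
  then have "(\<lambda>n. f (?x n (?q n t)) w) \<longlonglongrightarrow> f t w"
    using p(2) by (intro continuous_on_tendsto_compose[OF f(2)[OF p(3)]]) auto
  then show "(\<lambda>n. f (?x n (?q n (fst p))) (snd p)) \<longlonglongrightarrow> (case p of (t, w) \<Rightarrow> f t w)" using p(1) by simp
qed

text \<open>\<open>Bc\<close> is a version of \<open>B\<close> with all paths continuous; compositions \<open>u t (Bc t w)\<close> are then jointly measurable.\<close>

definition exceptional where
  "exceptional = (SOME N. N \<in> null_sets W \<and> (\<forall>w\<in>space W - N. B 0 w = 0 \<and> continuous_on {0..} (\<lambda>t. B t w)))"

definition Bc where "Bc t w = (if w \<in> exceptional then 0 else B t w)"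

lemma exceptional: "exceptional \<in> null_sets W" "\<And>w. w \<in> space W \<Longrightarrow> w \<notin> exceptional \<Longrightarrow> B 0 w = 0 \<and> continuous_on {0..} (\<lambda>t. B t w)"
proof -
  have "AE w in W. B 0 w = 0 \<and> continuous_on {0..} (\<lambda>t. B t w)" using B_0 B_continuous by eventually_elim simp
  then obtain N where "N \<in> null_sets W" "{w \<in> space W. \<not> (B 0 w = 0 \<and> continuous_on {0..} (\<lambda>t. B t w))} \<subseteq> N"
    by (auto simp: eventually_ae_filter)
  then have "N \<in> null_sets W \<and> (\<forall>w\<in>space W - N. B 0 w = 0 \<and> continuous_on {0..} (\<lambda>t. B t w))" by blast
  then have "exceptional \<in> null_sets W \<and> (\<forall>w\<in>space W - exceptional. B 0 w = 0 \<and> continuous_on {0..} (\<lambda>t. B t w))"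
    unfolding exceptional_def by (rule someI)
  then show "exceptional \<in> null_sets W" "\<And>w. w \<in> space W \<Longrightarrow> w \<notin> exceptional \<Longrightarrow> B 0 w = 0 \<and> continuous_on {0..} (\<lambda>t. B t w)" by auto
qed

lemma Bc_0: "w \<in> space W \<Longrightarrow> Bc 0 w = 0" using exceptional(2) by (simp add: Bc_def)

lemma Bc_continuous: "w \<in> space W \<Longrightarrow> continuous_on {0..} (\<lambda>t. Bc t w)"
  using exceptional(2)[of w] by (cases "w \<in> exceptional") (simp_all add: Bc_def)

text \<open>Changing \<open>B\<close> on a null set keeps it adapted, since the augmented filtration
  contains every null set.\<close>

lemma Bc_Fil: "0 \<le> s \<Longrightarrow> s \<le> t \<Longrightarrow> Bc s \<in> borel_measurable (Fil t)"
  unfolding Bc_def[abs_def] by (intro measurable_If_set borel_measurable_const B_Fil) (simp_all add: null_Fil exceptional(1) sets.Int_space_eq2)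

lemma Bc_eq: "AE w in W. \<forall>t. Bc t w = B t w"
  using AE_not_in[OF exceptional(1)] by eventually_elim (simp add: Bc_def)

text \<open>The sixth moment is for squares of sums of cubed increments in
  \<open>remainder_square\<close>.\<close>

lemma increment_power:
  assumes "0 \<le> s" "s \<le> t"
  shows "(\<integral>\<^sup>+w. ennreal ((B t w - B s w)\<^sup>2) \<partial>W) = ennreal (t - s)"
    "(\<integral>\<^sup>+w. ennreal ((B t w - B s w)^6) \<partial>W) = ennreal (15 * (t - s)^3)"
proof -
  have 1: "integrable W (\<lambda>w. (B t w - B s w)^p)" "expectation (\<lambda>w. (B t w - B s w)^p) = (\<integral>z. (sqrt (t - s) * z)^p \<partial>gauss)" for p
  proof -
    have m: "(\<lambda>x::real. x^p) \<in> borel_measurable borel" by simp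
    have i: "integrable gauss (\<lambda>z. (sqrt (t - s) * z)^p)" unfolding power_mult_distrib by (intro integrable_mult_right integrable_gauss_power)
    have c: "(\<lambda>_. 1::real) \<in> borel_measurable (Fil s)" "integrable W (\<lambda>_. 1::real)" by simp_all
    have e1: "expectation (\<lambda>_. 1::real) = 1" by (simp add: prob_space)
    from increment_expectation[OF assms c m i]
    show "integrable W (\<lambda>w. (B t w - B s w)^p)" "expectation (\<lambda>w. (B t w - B s w)^p) = (\<integral>z. (sqrt (t - s) * z)^p \<partial>gauss)"
      by (simp_all only: e1 mult_1)
  qed
  have "(sqrt (t - s))^6 = ((sqrt (t - s))\<^sup>2)^3" by (simp flip: power_mult)
  then have s6: "(sqrt (t - s))^6 = (t - s)^3" using assms by simp
  show "(\<integral>\<^sup>+w. ennreal ((B t w - B s w)\<^sup>2) \<partial>W) = ennreal (t - s)"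
    using assms by (subst nn_integral_eq_integral[OF 1(1)]) (simp_all add: 1(2) power_mult_distrib gauss_second_moment)
  show "(\<integral>\<^sup>+w. ennreal ((B t w - B s w)^6) \<partial>W) = ennreal (15 * (t - s)^3)"
    by (subst nn_integral_eq_integral[OF 1(1)]) (simp_all add: 1(2) power_mult_distrib s6 gauss_sixth_moment mult.commute[of 15])
qed

definition grid where "grid s t n k = s + real k * ((t - s) / real n)" for s t :: real and n k :: nat

lemma grid:
  assumes "s \<le> t" "0 < n"
  shows "grid s t n 0 = s" "grid s t n n = t" "grid s t n k \<le> grid s t n (Suc k)" "grid s t n (Suc k) - grid s t n k = (t - s) / real n"
    "k \<le> n \<Longrightarrow> s \<le> grid s t n k \<and> grid s t n k \<le> t"
proof -
  have "real k * (t - s) / real n \<le> t - s" if "k \<le> n"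
  proof -
    have "real k * (t - s) \<le> (t - s) * real n" using that assms by (subst mult.commute) (intro mult_left_mono, auto)
    then show ?thesis using assms by (simp only: pos_divide_le_eq of_nat_0_less_iff)
  qed
  moreover have "0 \<le> real k * (t - s) / real n" using assms by simp
  ultimately show "k \<le> n \<Longrightarrow> s \<le> grid s t n k \<and> grid s t n k \<le> t" by (simp add: grid_def)
qed (use assms in \<open>auto simp: grid_def field_simps\<close>)

text \<open>Time is taken from the right end of the cell, where \<open>approx_step\<close> expands,
  and the path from the left end, which keeps the value known at the start of the cell.\<close>

definition slope where "slope u1 s t n k w = u1 (grid s t n (Suc k)) (Bc (grid s t n k) w)" for u1 :: "real \<Rightarrow> real \<Rightarrow> real"

lemma bounded_Fil:
  assumes "bfun C f" "0 \<le> s" "s \<le> t"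
  shows "(\<lambda>w. f (Bc s w)) \<in> borel_measurable (Fil t)" "\<And>w. \<bar>f (Bc s w)\<bar> \<le> C"
  using assms measurable_compose[OF Bc_Fil[OF assms(2,3)], of f borel] by (auto simp: bfun_def)

end

lemma approx_solD:
  assumes "approx_sol g \<epsilon> \<phi> C d u u1 u2"
  shows "0 < d" "\<And>t. 0 \<le> t \<Longrightarrow> t \<le> 1 \<Longrightarrow> smooth2 C (u t) (u1 t) (u2 t)" "\<And>x. \<bar>u 1 x - \<phi> x\<bar> \<le> \<epsilon>"
    "\<And>s t x. 0 \<le> s \<Longrightarrow> s \<le> t \<Longrightarrow> t \<le> 1 \<Longrightarrow> t - s \<le> d \<Longrightarrow>
      \<bar>u s x - u t x - (t - s) * (u2 t x / 2 + g (u1 t x))\<bar> \<le> \<epsilon> * (t - s)"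
    "\<And>s t x. 0 \<le> s \<Longrightarrow> s \<le> t \<Longrightarrow> t \<le> 1 \<Longrightarrow> t - s \<le> d \<Longrightarrow> \<bar>u1 s x - u1 t x\<bar> \<le> C * sqrt (t - s)"
  using assms unfolding approx_sol_def by auto

lemma smooth2_bfun: "smooth2 C f f1 f2 \<Longrightarrow> bfun C f" "smooth2 C f f1 f2 \<Longrightarrow> bfun C f1" "smooth2 C f f1 f2 \<Longrightarrow> bfun C f2"
  by (simp_all add: smooth2_def)

text \<open>Space is expanded at the later time, and the equation supplies the time increment at the
  old point. Half the second derivative enters both with h^2 and with -(t - s), so it multiplies the
  compensated square.\<close>

lemma approx_step:
  assumes a: "approx_sol g \<epsilon> \<phi> C d u u1 u2" and st: "0 \<le> s" "s \<le> t" "t \<le> 1" "t - s \<le> d"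
  shows "\<bar>(u t (x + h) - u s x) - (u1 t x * h - g (u1 t x) * (t - s)) - u2 t x / 2 * (h\<^sup>2 - (t - s))\<bar> \<le> C * \<bar>h\<bar>^3 + \<epsilon> * (t - s)"
proof -
  have 1: "\<bar>u t (x + h) - u t x - h * u1 t x - h\<^sup>2 / 2 * u2 t x\<bar> \<le> C * \<bar>h\<bar>^3"
    using approx_solD(2)[OF a, of t] st by (intro smooth2_taylor) auto
  have 2: "\<bar>u s x - u t x - (t - s) * (u2 t x / 2 + g (u1 t x))\<bar> \<le> \<epsilon> * (t - s)"
    by (rule approx_solD(4)[OF a st])
  have "(u t (x + h) - u s x) - (u1 t x * h - g (u1 t x) * (t - s)) - u2 t x / 2 * (h\<^sup>2 - (t - s)) =
    (u t (x + h) - u t x - h * u1 t x - h\<^sup>2 / 2 * u2 t x) - (u s x - u t x - (t - s) * (u2 t x / 2 + g (u1 t x)))"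
    by (simp add: field_simps)
  then show ?thesis using 1 2 by linarith
qed

lemma gauss_compensated_square:
  assumes "0 \<le> r"
  shows "(\<integral>z. (sqrt r * z)\<^sup>2 - r \<partial>gauss) = 0" "integrable gauss (\<lambda>z. (sqrt r * z)\<^sup>2 - r)"
    "integrable gauss (\<lambda>z. ((sqrt r * z)\<^sup>2 - r)\<^sup>2)" "(\<integral>z. ((sqrt r * z)\<^sup>2 - r)\<^sup>2 \<partial>gauss) = 2 * r\<^sup>2"
proof -
  have e: "(sqrt r * z)\<^sup>2 - r = r * z\<^sup>2 - r" and e2: "((sqrt r * z)\<^sup>2 - r)\<^sup>2 = r\<^sup>2 * z^4 - 2 * r\<^sup>2 * z\<^sup>2 + r\<^sup>2" for z
    using assms by (simp_all add: power_mult_distrib power2_eq_square power4_eq_xxxx algebra_simps)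
  have c: "integrable gauss (\<lambda>z. c :: real)" "(\<integral>z. c \<partial>gauss) = c" for c using gauss.prob_space by simp_all
  show "(\<integral>z. (sqrt r * z)\<^sup>2 - r \<partial>gauss) = 0" "integrable gauss (\<lambda>z. (sqrt r * z)\<^sup>2 - r)"
    unfolding e using c by simp_all
  show "integrable gauss (\<lambda>z. ((sqrt r * z)\<^sup>2 - r)\<^sup>2)"
    unfolding e2 by (intro Bochner_Integration.integrable_add Bochner_Integration.integrable_diff integrable_mult_right integrable_gauss_power c)
  have "(\<integral>z. ((sqrt r * z)\<^sup>2 - r)\<^sup>2 \<partial>gauss) = r\<^sup>2 * 3 - 2 * r\<^sup>2 * 1 + r\<^sup>2"
    unfolding e2 by (subst Bochner_Integration.integral_add, (intro Bochner_Integration.integrable_diff integrable_mult_right integrable_gauss_power c)+,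
      subst Bochner_Integration.integral_diff, (intro integrable_mult_right integrable_gauss_power)+)
      (use gauss.prob_space in \<open>simp add: gauss_fourth_moment\<close>)
  then show "(\<integral>z. ((sqrt r * z)\<^sup>2 - r)\<^sup>2 \<partial>gauss) = 2 * r\<^sup>2" by simp
qed

lemma sum_square_le: "(\<Sum>k<n. y k)\<^sup>2 \<le> real n * (\<Sum>k<n. (y k :: real)\<^sup>2)"
  using Cauchy_Schwarz_ineq_sum[of "\<lambda>_. 1" y "{..<n}"] by simp

context brownian begin

text \<open>The error of the BSDE for \<open>(u, u')\<close> along \<open>B\<close>, discretised on a grid. The Ito correction is the sum of
  \<open>u'' / 2\<close> times the centred squared increments, which is orthogonal and hence small.\<close>

definition remainder where
  "remainder g u u1 s t n w = (u t (Bc t w) - u s (Bc s w)) -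
    (simple_integral B n (grid s t n) (slope u1 s t n) w - (\<Sum>k<n. g (slope u1 s t n k w) * ((t - s) / real n)))"

context
  fixes g \<epsilon> \<phi> C d u u1 u2 s t and n :: nat
  assumes a: "approx_sol g \<epsilon> \<phi> C d u u1 u2" and st: "0 \<le> s" "s \<le> t" "t \<le> 1" and n: "0 < n" "(t - s) / real n \<le> d"
    and \<epsilon>: "0 \<le> \<epsilon>" and g: "g \<in> borel_measurable borel"
begin

lemma grid_range: "k \<le> n \<Longrightarrow> 0 \<le> grid s t n k \<and> grid s t n k \<le> 1"
  using grid(5)[OF st(2) n(1), of k] st by auto

lemma slope_simple: "simple_integrand W B s t n (grid s t n) (slope u1 s t n)"
  unfolding simple_integrand_def
proof (intro conjI allI impI)
  fix k assume k: "k < n"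
  have b: "bfun C (u1 (grid s t n (Suc k)))" using grid_range[of "Suc k"] k by (intro smooth2_bfun(2)[OF approx_solD(2)[OF a]]) auto
  have r: "0 \<le> grid s t n k" using grid_range[of k] k by simp
  show "slope u1 s t n k \<in> borel_measurable (Fil (grid s t n k))"
    unfolding slope_def[abs_def] by (rule bounded_Fil(1)[OF b r order_refl])
  show "bounded (slope u1 s t n k ` space W)"
    unfolding slope_def bounded_iff using bounded_Fil(2)[OF b r order_refl] by (auto intro!: exI[of _ C])
qed (use grid[OF st(2) n(1)] in auto)

lemma remainder_measurable: "remainder g u u1 s t n \<in> borel_measurable W"
proof -
  have u: "(\<lambda>w. u r (Bc r w)) \<in> borel_measurable W" if "0 \<le> r" "r \<le> 1" for r
    by (rule measurable_Fil_W[OF bounded_Fil(1)[OF smooth2_bfun(1)[OF approx_solD(2)[OF a that]] that(1) order_refl] that(1)])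
  have z: "slope u1 s t n k \<in> borel_measurable W" if "k < n" for k
    using simple_integrandD(4)[OF slope_simple that] grid_range[of k] that by (intro measurable_Fil_W) auto
  have S: "simple_integral B n (grid s t n) (slope u1 s t n) \<in> borel_measurable W"
    using simple_square(3)[OF slope_simple st(1), of "\<lambda>_. 0"] by simp
  show ?thesis
    unfolding remainder_def[abs_def] using st
    by (intro borel_measurable_diff u S borel_measurable_sum borel_measurable_times borel_measurable_const measurable_compose[OF z g]) auto
qed

lemma remainder_le:
  "AE w in W. \<bar>remainder g u u1 s t n w - (\<Sum>k<n. u2 (grid s t n (Suc k)) (Bc (grid s t n k) w) / 2 *
      ((B (grid s t n (Suc k)) w - B (grid s t n k) w)\<^sup>2 - (t - s) / real n))\<bar>
    \<le> C * (\<Sum>k<n. \<bar>B (grid s t n (Suc k)) w - B (grid s t n k) w\<bar>^3) + \<epsilon>"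
  using Bc_eq
proof eventually_elim
  case (elim w)
  let ?\<tau> = "grid s t n" and ?h = "\<lambda>k. B (grid s t n (Suc k)) w - B (grid s t n k) w" and ?\<Delta> = "(t - s) / real n"
  have e: "Bc r w = B r w" for r using elim by simp
  note gr = grid[OF st(2) n(1)]
  let ?D = "\<lambda>k. (u (?\<tau> (Suc k)) (B (?\<tau> (Suc k)) w) - u (?\<tau> k) (B (?\<tau> k) w)) - (slope u1 s t n k w * ?h k - g (slope u1 s t n k w) * ?\<Delta>)
    - u2 (?\<tau> (Suc k)) (B (?\<tau> k) w) / 2 * ((?h k)\<^sup>2 - ?\<Delta>)"
  have step: "\<bar>?D k\<bar> \<le> C * \<bar>?h k\<bar>^3 + \<epsilon> * ?\<Delta>" if k: "k < n" for k
  proof -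
    have r: "0 \<le> ?\<tau> k" "?\<tau> k \<le> ?\<tau> (Suc k)" "?\<tau> (Suc k) \<le> 1" "?\<tau> (Suc k) - ?\<tau> k \<le> d"
      using grid_range[of k] grid_range[of "Suc k"] k gr(3)[of k] n(2) by (auto simp: gr(4))
    show ?thesis
      using approx_step[OF a r, of "B (?\<tau> k) w" "?h k"] unfolding gr(4) slope_def e by simp
  qed
  have "u t (B t w) - u s (B s w) = (\<Sum>k<n. u (?\<tau> (Suc k)) (B (?\<tau> (Suc k)) w) - u (?\<tau> k) (B (?\<tau> k) w))"
    by (subst sum_lessThan_telescope[of "\<lambda>k. u (?\<tau> k) (B (?\<tau> k) w)" n]) (simp add: gr(1,2))
  then have "remainder g u u1 s t n w - (\<Sum>k<n. u2 (?\<tau> (Suc k)) (Bc (?\<tau> k) w) / 2 * ((?h k)\<^sup>2 - ?\<Delta>)) = (\<Sum>k<n. ?D k)"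
    unfolding remainder_def e simple_integral_def sum_subtractf by simp
  then have "\<bar>remainder g u u1 s t n w - (\<Sum>k<n. u2 (?\<tau> (Suc k)) (Bc (?\<tau> k) w) / 2 * ((?h k)\<^sup>2 - ?\<Delta>))\<bar> \<le> (\<Sum>k<n. \<bar>?D k\<bar>)"
    by (simp only: sum_abs)
  also have "(\<Sum>k<n. \<bar>?D k\<bar>) \<le> (\<Sum>k<n. C * \<bar>?h k\<bar>^3 + \<epsilon> * ?\<Delta>)" using step by (intro sum_mono) simp
  also have "\<dots> = C * (\<Sum>k<n. \<bar>?h k\<bar>^3) + \<epsilon> * (t - s)"
    using n(1) by (simp add: sum.distrib sum_distrib_left)
  also have "\<dots> \<le> C * (\<Sum>k<n. \<bar>?h k\<bar>^3) + \<epsilon>"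
    using st \<epsilon> mult_left_mono[of "t - s" 1 \<epsilon>] by simp
  finally show ?case .
qed

text \<open>The compensated squares are orthogonal: \<open>n\<close> terms of size at most C^2/4
  times 2 \<Delta>^2 give at most C^2 \<Delta>/2, where \<Delta> is the mesh. The cubes are handled
  by Cauchy-Schwarz over the cells and the sixth moment 15 \<Delta>^3. With the weights 2 and 4 from
  squaring sums this yields 61 = 1 + 60.\<close>

lemma remainder_square:
  "(\<integral>\<^sup>+w. ennreal ((remainder g u u1 s t n w)\<^sup>2) \<partial>W) \<le> ennreal (61 * C\<^sup>2 * (t - s) / real n + 4 * \<epsilon>\<^sup>2)"
proof -
  let ?\<tau> = "grid s t n" and ?h = "\<lambda>k w. B (grid s t n (Suc k)) w - B (grid s t n k) w" and ?\<Delta> = "(t - s) / real n"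
  note gr = grid[OF st(2) n(1)]
  have \<Delta>: "0 \<le> ?\<Delta>" "real n * ?\<Delta> = t - s" using st n by auto
  let ?\<xi> = "\<lambda>k w. u2 (?\<tau> (Suc k)) (Bc (?\<tau> k) w) / 2"
  let ?M = "\<lambda>w. \<Sum>k<n. ?\<xi> k w * ((?h k w)\<^sup>2 - ?\<Delta>)" and ?T = "\<lambda>w. \<Sum>k<n. \<bar>?h k w\<bar>^3"
  have b: "bfun C (u2 (?\<tau> (Suc k)))" and r: "0 \<le> ?\<tau> k" if "k < n" for k
    using grid_range[of "Suc k"] grid_range[of k] that by (auto intro!: smooth2_bfun(3)[OF approx_solD(2)[OF a]])
  have \<xi>F: "?\<xi> k \<in> borel_measurable (Fil (?\<tau> k))" if "k < n" for k
    by (intro borel_measurable_divide borel_measurable_const bounded_Fil(1)[OF b[OF that] r[OF that] order_refl])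
  have \<xi>C: "\<bar>?\<xi> k w\<bar> \<le> C / 2" if "k < n" for k w
    using bounded_Fil(2)[OF b[OF that] r[OF that] order_refl] by simp
  have hW: "?h k \<in> borel_measurable W" if "k < n" for k
    using r[OF that] gr(3)[of k] by (intro borel_measurable_diff B_measurable) auto
  have MW: "?M \<in> borel_measurable W"
    by (intro borel_measurable_sum borel_measurable_times[OF measurable_Fil_W[OF \<xi>F r] borel_measurable_diff[OF borel_measurable_power[OF hW] borel_measurable_const]]) auto
  have TW: "?T \<in> borel_measurable W"
    using hW by (intro borel_measurable_sum borel_measurable_power borel_measurable_abs) auto
  note gc = gauss_compensated_square[OF \<Delta>(1)]
  have \<tau>0: "0 \<le> ?\<tau> 0" using gr(1) st by simp
  have M: "integrable W (\<lambda>w. (?M w)\<^sup>2)" "expectation (\<lambda>w. (?M w)\<^sup>2) = (\<Sum>k<n. expectation (\<lambda>w. (?\<xi> k w)\<^sup>2) * (2 * ?\<Delta>\<^sup>2))"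
    using partition_square(2,3)[of ?\<tau> n "\<lambda>_. 0" ?\<xi> "\<lambda>_. C / 2" "\<lambda>_ x. x\<^sup>2 - ?\<Delta>" "\<lambda>_. 2 * ?\<Delta>\<^sup>2", OF \<tau>0 gr(3) _ _ \<xi>F \<xi>C] gc
    by (simp_all add: gr(4))
  have "expectation (\<lambda>w. (?M w)\<^sup>2) \<le> (\<Sum>k<n. C\<^sup>2 / 4 * (2 * ?\<Delta>\<^sup>2))"
    unfolding M(2)
  proof (intro sum_mono mult_right_mono)
    fix k assume "k \<in> {..<n}"
    then have k: "k < n" by simp
    have "(?\<xi> k w)\<^sup>2 \<le> C\<^sup>2 / 4" for w
    proof -
      have "\<bar>?\<xi> k w\<bar>\<^sup>2 \<le> (C / 2)\<^sup>2" by (intro power_mono \<xi>C k) simp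
      then show ?thesis by (simp add: power_divide)
    qed
    moreover have "integrable W (\<lambda>w. (?\<xi> k w)\<^sup>2)"
      using \<xi>C[OF k] by (intro bounded_square_integrable[of _ "C / 2"] measurable_Fil_W[OF \<xi>F[OF k] r[OF k]])
    ultimately have "expectation (\<lambda>w. (?\<xi> k w)\<^sup>2) \<le> expectation (\<lambda>w. C\<^sup>2 / 4)" by (intro integral_mono) simp_all
    then show "expectation (\<lambda>w. (?\<xi> k w)\<^sup>2) \<le> C\<^sup>2 / 4" by (simp add: prob_space)
  qed simp
  also have "(\<Sum>k<n. C\<^sup>2 / 4 * (2 * ?\<Delta>\<^sup>2)) = C\<^sup>2 / 2 * ?\<Delta> * (real n * ?\<Delta>)" by (simp add: power2_eq_square)
  also have "\<dots> \<le> C\<^sup>2 / 2 * ?\<Delta> * 1" unfolding \<Delta>(2) using \<Delta>(1) st by (intro mult_left_mono) auto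
  finally have EM: "expectation (\<lambda>w. (?M w)\<^sup>2) \<le> C\<^sup>2 / 2 * ?\<Delta>" by simp
  have nM: "(\<integral>\<^sup>+w. ennreal ((?M w)\<^sup>2) \<partial>W) \<le> ennreal (C\<^sup>2 / 2 * ?\<Delta>)"
    by (subst nn_integral_eq_integral[OF M(1)]) (simp_all only: ennreal_leI[OF EM] zero_le_power2 eventually_True)
  have nT: "(\<integral>\<^sup>+w. ennreal ((?T w)\<^sup>2) \<partial>W) \<le> ennreal (15 * ?\<Delta>)"
  proof -
    have "(\<integral>\<^sup>+w. ennreal ((?T w)\<^sup>2) \<partial>W) \<le> (\<integral>\<^sup>+w. (\<Sum>k<n. ennreal (real n) * ennreal ((?h k w)^6)) \<partial>W)"
    proof (rule nn_integral_mono)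
      fix w
      have "(?T w)\<^sup>2 \<le> real n * (\<Sum>k<n. (\<bar>?h k w\<bar>^3)\<^sup>2)" by (rule sum_square_le)
      also have "\<dots> = (\<Sum>k<n. real n * (?h k w)^6)"
        by (simp add: sum_distrib_left power_even_abs flip: power_mult)
      finally have "ennreal ((?T w)\<^sup>2) \<le> ennreal (\<Sum>k<n. real n * (?h k w)^6)" by (rule ennreal_leI)
      then show "ennreal ((?T w)\<^sup>2) \<le> (\<Sum>k<n. ennreal (real n) * ennreal ((?h k w)^6))"
        by (simp add: ennreal_mult' zero_le_even_power flip: sum_ennreal)
    qed
    also have "\<dots> = (\<Sum>k<n. ennreal (real n) * (\<integral>\<^sup>+w. ennreal ((?h k w)^6) \<partial>W))"
      using hW by (subst nn_integral_sum) (auto intro!: sum.cong nn_integral_cmult)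
    also have "\<dots> = (\<Sum>k<n. ennreal (real n) * ennreal (15 * ?\<Delta>^3))"
    proof (intro sum.cong refl arg_cong2[where f="(*)"])
      fix k assume "k \<in> {..<n}"
      then show "(\<integral>\<^sup>+w. ennreal ((?h k w)^6) \<partial>W) = ennreal (15 * ?\<Delta>^3)"
        using increment_power(2)[OF r gr(3), of k] by (simp add: gr(4))
    qed
    also have "\<dots> = ennreal (15 * ?\<Delta> * (real n * ?\<Delta>)\<^sup>2)"
    proof -
      have "(\<Sum>k<n. ennreal (real n) * ennreal (15 * ?\<Delta>^3)) = ennreal (real n * (real n * (15 * ?\<Delta>^3)))"
        by (simp only: sum_constant card_lessThan ennreal_of_nat_eq_real_of_nat ennreal_mult'[symmetric] of_nat_0_le_iff)
      also have "real n * (real n * (15 * ?\<Delta>^3)) = 15 * ?\<Delta> * (real n * ?\<Delta>)\<^sup>2"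
        by (simp only: power2_eq_square power3_eq_cube mult_ac)
      finally show ?thesis .
    qed
    also have "\<dots> \<le> ennreal (15 * ?\<Delta> * 1)"
      unfolding \<Delta>(2) using \<Delta>(1) st by (intro ennreal_leI mult_left_mono power_le_one) auto
    finally show ?thesis by simp
  qed
  have "(\<integral>\<^sup>+w. ennreal ((remainder g u u1 s t n w)\<^sup>2) \<partial>W) \<le>
    (\<integral>\<^sup>+w. 2 * ennreal ((?M w)\<^sup>2) + (ennreal (4 * C\<^sup>2) * ennreal ((?T w)\<^sup>2) + ennreal (4 * \<epsilon>\<^sup>2)) \<partial>W)"
  proof (rule nn_integral_mono_AE)
    show "AE w in W. ennreal ((remainder g u u1 s t n w)\<^sup>2) \<le>
      2 * ennreal ((?M w)\<^sup>2) + (ennreal (4 * C\<^sup>2) * ennreal ((?T w)\<^sup>2) + ennreal (4 * \<epsilon>\<^sup>2))"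
      using remainder_le
    proof eventually_elim
      case (elim w)
      let ?R = "remainder g u u1 s t n w"
      have "?R\<^sup>2 = (?M w + (?R - ?M w))\<^sup>2" by simp
      also have "\<dots> \<le> 2 * (?M w)\<^sup>2 + 2 * (?R - ?M w)\<^sup>2" by (rule square_add_le)
      also have "(?R - ?M w)\<^sup>2 \<le> (C * ?T w + \<epsilon>)\<^sup>2"
        using power_mono[OF elim abs_ge_zero, of 2] by simp
      also have "\<dots> \<le> 2 * (C * ?T w)\<^sup>2 + 2 * \<epsilon>\<^sup>2" by (rule square_add_le)
      finally have "?R\<^sup>2 \<le> 2 * (?M w)\<^sup>2 + (4 * C\<^sup>2 * (?T w)\<^sup>2 + 4 * \<epsilon>\<^sup>2)" by (simp add: power_mult_distrib)
      then have "ennreal (?R\<^sup>2) \<le> ennreal (2 * (?M w)\<^sup>2 + (4 * C\<^sup>2 * (?T w)\<^sup>2 + 4 * \<epsilon>\<^sup>2))" by (rule ennreal_leI)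
      also have "\<dots> = ennreal (2 * (?M w)\<^sup>2) + (ennreal (4 * C\<^sup>2 * (?T w)\<^sup>2) + ennreal (4 * \<epsilon>\<^sup>2))"
        by (simp only: ennreal_plus zero_le_power2 mult_nonneg_nonneg add_nonneg_nonneg zero_le_numeral)
      also have "\<dots> = 2 * ennreal ((?M w)\<^sup>2) + (ennreal (4 * C\<^sup>2) * ennreal ((?T w)\<^sup>2) + ennreal (4 * \<epsilon>\<^sup>2))"
        by (simp only: ennreal_mult' zero_le_numeral ennreal_numeral mult_nonneg_nonneg zero_le_power2)
      finally show ?case .
    qed
  qed
  also have "\<dots> = 2 * (\<integral>\<^sup>+w. ennreal ((?M w)\<^sup>2) \<partial>W) + (ennreal (4 * C\<^sup>2) * (\<integral>\<^sup>+w. ennreal ((?T w)\<^sup>2) \<partial>W) + ennreal (4 * \<epsilon>\<^sup>2))"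
    using MW TW by (simp add: nn_integral_add nn_integral_cmult emeasure_space_1)
  also have "\<dots> \<le> 2 * ennreal (C\<^sup>2 / 2 * ?\<Delta>) + (ennreal (4 * C\<^sup>2) * ennreal (15 * ?\<Delta>) + ennreal (4 * \<epsilon>\<^sup>2))"
    by (intro add_mono mult_left_mono nM nT) simp_all
  also have "\<dots> = ennreal (2 * (C\<^sup>2 / 2 * ?\<Delta>) + (4 * C\<^sup>2 * (15 * ?\<Delta>) + 4 * \<epsilon>\<^sup>2))"
  proof -
    have p: "0 \<le> C\<^sup>2 / 2 * ?\<Delta>" "0 \<le> 15 * ?\<Delta>" "0 \<le> 4 * C\<^sup>2" "0 \<le> 4 * \<epsilon>\<^sup>2"
      by (rule mult_nonneg_nonneg[OF _ \<Delta>(1)], simp)+ simp_all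
    show ?thesis using p by (simp only: ennreal_plus ennreal_mult mult_nonneg_nonneg add_nonneg_nonneg zero_le_numeral ennreal_numeral)
  qed
  also have "2 * (C\<^sup>2 / 2 * ?\<Delta>) + (4 * C\<^sup>2 * (15 * ?\<Delta>) + 4 * \<epsilon>\<^sup>2) = 61 * C\<^sup>2 * ?\<Delta> + 4 * \<epsilon>\<^sup>2"
  proof -
    have "2 * (c / 2 * D) + (4 * c * (15 * D) + e) = 61 * c * D + e" for c D e :: real by (simp add: algebra_simps)
    then show ?thesis .
  qed
  finally show ?thesis by simp
qed

end

end

section \<open>Stability\<close>

lemma partition_cell:
  assumes "\<tau> 0 < r" "r \<le> (\<tau> n :: real)" shows "\<exists>k<n. \<tau> k < r \<and> r \<le> \<tau> (Suc k)"
  using assms(2)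
proof (induction n)
  case 0 then show ?case using assms(1) by simp
next
  case (Suc n)
  show ?case
  proof (cases "r \<le> \<tau> n")
    case True then show ?thesis using Suc.IH less_SucI by blast
  next
    case False then show ?thesis using Suc.prems by (intro exI[of _ n]) auto
  qed
qed

context brownian begin

lemma simple_process_cell:
  assumes "\<And>j. j < n \<Longrightarrow> \<tau> j \<le> \<tau> (Suc j)" and k: "k < n" "\<tau> k < r" "r \<le> \<tau> (Suc k)"
  shows "simple_process n \<tau> \<xi> r w = \<xi> k w"
proof -
  have "(\<Sum>j<n. \<xi> j w * indicator {\<tau> j<..\<tau> (Suc j)} r) = (\<Sum>j\<in>{k}. \<xi> j w * indicator {\<tau> j<..\<tau> (Suc j)} r)"
  proof (rule sum.mono_neutral_right)
    show "\<forall>j\<in>{..<n} - {k}. \<xi> j w * indicator {\<tau> j<..\<tau> (Suc j)} r = 0"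
    proof
      fix j assume j: "j \<in> {..<n} - {k}"
      have "\<not> (\<tau> j < r \<and> r \<le> \<tau> (Suc j))"
      proof (cases "j < k")
        case True
        then have "\<tau> (Suc j) \<le> \<tau> k" using k by (intro partition_mono[of n \<tau>, OF assms(1)]) auto
        then show ?thesis using k by auto
      next
        case False
        then have "\<tau> (Suc k) \<le> \<tau> j" using k j by (intro partition_mono[of n \<tau>, OF assms(1)]) auto
        then show ?thesis using k by auto
      qed
      then show "\<xi> j w * indicator {\<tau> j<..\<tau> (Suc j)} r = 0" by (simp add: indicator_def)
    qed
  qed (use k in auto)
  then show ?thesis using k by (simp add: simple_process_def)
qed

lemma continuous_along_path:
  assumes f: "\<And>t. 0 \<le> t \<Longrightarrow> t \<le> 1 \<Longrightarrow> lip C (f t)"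
    "\<And>s t x. 0 \<le> s \<Longrightarrow> s \<le> t \<Longrightarrow> t \<le> 1 \<Longrightarrow> t - s \<le> d \<Longrightarrow> \<bar>f s x - f t x\<bar> \<le> M * sqrt (t - s)"
    and d: "0 < d" and w: "w \<in> space W"
  shows "continuous_on {0..1} (\<lambda>t. f t (Bc t w) :: real)"
  unfolding continuous_on_def
proof
  fix t :: real assume t: "t \<in> {0..1}"
  have b: "((\<lambda>r. Bc r w) \<longlongrightarrow> Bc t w) (at t within {0..1})"
    using continuous_on_subset[OF Bc_continuous[OF w], of "{0..1}"] t unfolding continuous_on_def by auto
  have "((\<lambda>r. M * sqrt \<bar>r - t\<bar> + C * \<bar>Bc r w - Bc t w\<bar>) \<longlongrightarrow> M * sqrt \<bar>t - t\<bar> + C * \<bar>Bc t w - Bc t w\<bar>) (at t within {0..1})"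
    by (intro tendsto_intros b)
  then have lim: "((\<lambda>r. M * sqrt \<bar>r - t\<bar> + C * \<bar>Bc r w - Bc t w\<bar>) \<longlongrightarrow> 0) (at t within {0..1})" by simp
  have "((\<lambda>r. f r (Bc r w) - f t (Bc t w)) \<longlongrightarrow> 0) (at t within {0..1})"
  proof (rule Lim_null_comparison[OF _ lim])
    have "eventually (\<lambda>r. dist r t < d) (at t within {0..1})"
      using d by (auto simp: eventually_at)
    moreover have "eventually (\<lambda>r. r \<in> {0..1}) (at t within {0..1})" by (simp add: eventually_at_filter)
    ultimately show "eventually (\<lambda>r. norm (f r (Bc r w) - f t (Bc t w)) \<le> M * sqrt \<bar>r - t\<bar> + C * \<bar>Bc r w - Bc t w\<bar>) (at t within {0..1})"
    proof eventually_elim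
      case (elim r)
      have 1: "\<bar>f r x - f t x\<bar> \<le> M * sqrt \<bar>r - t\<bar>" for x
        using f(2)[of r t x] f(2)[of t r x] elim t by (cases "r \<le> t") (auto simp: dist_real_def abs_minus_commute)
      have 2: "\<bar>f t (Bc r w) - f t (Bc t w)\<bar> \<le> C * \<bar>Bc r w - Bc t w\<bar>" using f(1)[of t] t unfolding lip_def by auto
      show ?case using 1[of "Bc r w"] 2 by simp
    qed
  qed
  then show "((\<lambda>r. f r (Bc r w)) \<longlongrightarrow> f t (Bc t w)) (at t within {0..1})" by (simp add: LIM_zero_iff)
qed

lemma approx_sol_u_holder:
  assumes a: "approx_sol g \<epsilon> \<phi> C d u u1 u2" and g: "lip L g" "g 0 = 0" and L: "0 \<le> L" and \<epsilon>: "0 \<le> \<epsilon>"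
    and st: "0 \<le> s" "s \<le> t" "t \<le> 1" "t - s \<le> d"
  shows "\<bar>u s x - u t x\<bar> \<le> (C / 2 + L * C + \<epsilon>) * sqrt (t - s)"
proof -
  have t: "0 \<le> t" using st by simp
  note sm = approx_solD(2)[OF a t st(3)]
  have b: "\<bar>u1 t x\<bar> \<le> C" "\<bar>u2 t x\<bar> \<le> C" using smooth2_bfun(2,3)[OF sm] by (auto simp: bfun_def)
  then have C: "0 \<le> C" by linarith
  have "\<bar>g (u1 t x) - g 0\<bar> \<le> L * \<bar>u1 t x - 0\<bar>" using g(1) unfolding lip_def by blast
  also have "\<dots> \<le> L * C" using b L by (intro mult_left_mono) auto
  finally have "\<bar>u2 t x / 2 + g (u1 t x)\<bar> \<le> C / 2 + L * C" using b g(2) by linarith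
  then have "\<bar>(t - s) * (u2 t x / 2 + g (u1 t x))\<bar> \<le> (t - s) * (C / 2 + L * C)"
    unfolding abs_mult using st by (intro mult_mono) auto
  then have "\<bar>u s x - u t x\<bar> \<le> (t - s) * (C / 2 + L * C) + \<epsilon> * (t - s)" using approx_solD(4)[OF a st, of x] by linarith
  also have "\<dots> = (C / 2 + L * C + \<epsilon>) * (t - s)" by (simp add: algebra_simps)
  also have "\<dots> \<le> (C / 2 + L * C + \<epsilon>) * sqrt (t - s)"
  proof (rule mult_left_mono)
    have "(t - s)\<^sup>2 \<le> t - s" using st power_decreasing[of 1 2 "t - s"] by simp
    then show "t - s \<le> sqrt (t - s)" by (rule real_le_rsqrt)
  qed (use C L \<epsilon> in auto)
  finally show ?thesis .
qed

lemma approx_sol_jm: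
  assumes a: "approx_sol g \<epsilon> \<phi> C d u u1 u2" and g: "lip L g" "g 0 = 0" and L: "0 \<le> L" and \<epsilon>: "0 \<le> \<epsilon>"
  shows "jm (\<lambda>t w. u t (Bc t w))" "jm (\<lambda>t w. u1 t (Bc t w))"
    "\<And>t. 0 \<le> t \<Longrightarrow> t \<le> 1 \<Longrightarrow> (\<lambda>w. u t (Bc t w)) \<in> borel_measurable (Fil t)"
    "\<And>t. 0 \<le> t \<Longrightarrow> t \<le> 1 \<Longrightarrow> (\<lambda>w. u1 t (Bc t w)) \<in> borel_measurable (Fil t)"
    "\<And>t w. 0 \<le> t \<Longrightarrow> t \<le> 1 \<Longrightarrow> \<bar>u t (Bc t w)\<bar> \<le> C"
    "\<And>t w. 0 \<le> t \<Longrightarrow> t \<le> 1 \<Longrightarrow> \<bar>u1 t (Bc t w)\<bar> \<le> C"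
proof -
  note sm = approx_solD(2)[OF a]
  show F: "(\<lambda>w. u t (Bc t w)) \<in> borel_measurable (Fil t)" "(\<lambda>w. u1 t (Bc t w)) \<in> borel_measurable (Fil t)"
    "\<bar>u t (Bc t w)\<bar> \<le> C" "\<bar>u1 t (Bc t w)\<bar> \<le> C" if "0 \<le> t" "t \<le> 1" for t w
    using bounded_Fil[OF smooth2_bfun(1)[OF sm[OF that]] that(1) order_refl]
      bounded_Fil[OF smooth2_bfun(2)[OF sm[OF that]] that(1) order_refl] by auto
  show "jm (\<lambda>t w. u t (Bc t w))"
    by (rule jm_continuous, rule measurable_Fil_W[OF F(1)], simp, simp, simp,
      rule continuous_along_path[OF smooth2_lip(1)[OF sm] approx_sol_u_holder[OF a g L \<epsilon>] approx_solD(1)[OF a]])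
  show "jm (\<lambda>t w. u1 t (Bc t w))"
    by (rule jm_continuous, rule measurable_Fil_W[OF F(2)], simp, simp, simp,
      rule continuous_along_path[OF smooth2_lip(2)[OF sm] approx_solD(5)[OF a] approx_solD(1)[OF a]])
qed

text \<open>Moving the path to the left end costs C^2 times the variance of an increment, moving the
  time to the right end costs C^2 times the mesh by the Hoelder bound; squaring the sum doubles
  both.\<close>

lemma slope_process_error:
  assumes a: "approx_sol g \<epsilon> \<phi> C d u u1 u2" and g: "lip L g" "g 0 = 0" and L: "0 \<le> L" and \<epsilon>: "0 \<le> \<epsilon>"
    and gm: "g \<in> borel_measurable borel"
    and st: "0 \<le> s" "s \<le> t" "t \<le> 1" and n: "0 < n" "(t - s) / real n \<le> d"
  shows "sq s t (\<lambda>r w. u1 r (Bc r w) - simple_process n (grid s t n) (slope u1 s t n) r w) \<le> ennreal (4 * C\<^sup>2 * (t - s) / real n)"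
proof -
  let ?\<tau> = "grid s t n" and ?\<Delta> = "(t - s) / real n"
  note gr = grid[OF st(2) n(1)] and aj = approx_sol_jm[OF a g L \<epsilon>]
  have C: "0 \<le> C" using aj(5)[of 1] by fastforce
  have \<Delta>: "0 \<le> ?\<Delta>" using st n by simp
  have "sq s t (\<lambda>r w. u1 r (Bc r w) - simple_process n ?\<tau> (slope u1 s t n) r w) \<le> ennreal (4 * C\<^sup>2 * ?\<Delta>) * ennreal (t - s)"
  proof (rule sq_le[OF jm_diff[OF aj(2) jm_simple_process[OF slope_simple[OF a st n \<epsilon> gm] st(1)]] st])
    fix r assume r: "s < r" "r \<le> t"
    then obtain k where k: "k < n" "?\<tau> k < r" "r \<le> ?\<tau> (Suc k)"
      using partition_cell[of ?\<tau> r n] gr(1,2) by auto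
    have rng: "0 \<le> ?\<tau> k" "?\<tau> (Suc k) \<le> 1" using grid_range[OF a st n \<epsilon> gm, of k] grid_range[OF a st n \<epsilon> gm, of "Suc k"] k by auto
    have \<Delta>k: "?\<tau> (Suc k) - ?\<tau> k = ?\<Delta>" by (rule gr(4))
    have "AE w in W. ennreal ((u1 r (Bc r w) - simple_process n ?\<tau> (slope u1 s t n) r w)\<^sup>2) \<le>
      ennreal (2 * C\<^sup>2) * ennreal ((B r w - B (?\<tau> k) w)\<^sup>2) + ennreal (2 * C\<^sup>2 * ?\<Delta>)"
      using Bc_eq
    proof eventually_elim
      case (elim w)
      have e: "Bc x w = B x w" for x using elim by simp
      have P: "simple_process n ?\<tau> (slope u1 s t n) r w = u1 (?\<tau> (Suc k)) (B (?\<tau> k) w)"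
        using simple_process_cell[of n ?\<tau> k r "slope u1 s t n" w, OF gr(3) k] by (simp add: slope_def e)
      have 1: "\<bar>u1 r (B r w) - u1 r (B (?\<tau> k) w)\<bar> \<le> C * \<bar>B r w - B (?\<tau> k) w\<bar>"
        using smooth2_lip(2)[OF approx_solD(2)[OF a, of r]] r st unfolding lip_def by auto
      have "\<bar>u1 r (B (?\<tau> k) w) - u1 (?\<tau> (Suc k)) (B (?\<tau> k) w)\<bar> \<le> C * sqrt (?\<tau> (Suc k) - r)"
        using k rng n(2) \<Delta>k by (intro approx_solD(5)[OF a]) linarith+
      also have "\<dots> \<le> C * sqrt ?\<Delta>" using k \<Delta>k C by (intro mult_left_mono real_sqrt_le_mono) linarith+
      finally have 2: "\<bar>u1 r (B (?\<tau> k) w) - u1 (?\<tau> (Suc k)) (B (?\<tau> k) w)\<bar> \<le> C * sqrt ?\<Delta>" .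
      have "(u1 r (B r w) - u1 (?\<tau> (Suc k)) (B (?\<tau> k) w))\<^sup>2 =
        ((u1 r (B r w) - u1 r (B (?\<tau> k) w)) + (u1 r (B (?\<tau> k) w) - u1 (?\<tau> (Suc k)) (B (?\<tau> k) w)))\<^sup>2" by simp
      also have "\<dots> \<le> 2 * (u1 r (B r w) - u1 r (B (?\<tau> k) w))\<^sup>2 + 2 * (u1 r (B (?\<tau> k) w) - u1 (?\<tau> (Suc k)) (B (?\<tau> k) w))\<^sup>2"
        by (rule square_add_le)
      also have "\<dots> \<le> 2 * (C * \<bar>B r w - B (?\<tau> k) w\<bar>)\<^sup>2 + 2 * (C * sqrt ?\<Delta>)\<^sup>2"
        using power_mono[OF 1 abs_ge_zero, of 2] power_mono[OF 2 abs_ge_zero, of 2] by (simp only: power2_abs)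
      also have "\<dots> = 2 * C\<^sup>2 * (B r w - B (?\<tau> k) w)\<^sup>2 + 2 * C\<^sup>2 * ?\<Delta>"
        using \<Delta> by (simp only: power_mult_distrib power2_abs real_sqrt_pow2 mult.assoc)
      finally have le: "(u1 r (B r w) - u1 (?\<tau> (Suc k)) (B (?\<tau> k) w))\<^sup>2 \<le> 2 * C\<^sup>2 * (B r w - B (?\<tau> k) w)\<^sup>2 + 2 * C\<^sup>2 * ?\<Delta>" .
      have nn: "0 \<le> 2 * C\<^sup>2" "0 \<le> 2 * C\<^sup>2 * (B r w - B (?\<tau> k) w)\<^sup>2" by simp_all
      have nn': "0 \<le> 2 * C\<^sup>2 * ?\<Delta>" by (rule mult_nonneg_nonneg[OF nn(1) \<Delta>])
      show ?case unfolding P e using ennreal_leI[OF le] by (simp only: ennreal_plus[OF nn(2) nn'] ennreal_mult'[OF nn(1)])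
    qed
    then have "(\<integral>\<^sup>+w. ennreal ((u1 r (Bc r w) - simple_process n ?\<tau> (slope u1 s t n) r w)\<^sup>2) \<partial>W) \<le>
      (\<integral>\<^sup>+w. ennreal (2 * C\<^sup>2) * ennreal ((B r w - B (?\<tau> k) w)\<^sup>2) + ennreal (2 * C\<^sup>2 * ?\<Delta>) \<partial>W)" by (rule nn_integral_mono_AE)
    also have "\<dots> = ennreal (2 * C\<^sup>2) * ennreal (r - ?\<tau> k) + ennreal (2 * C\<^sup>2 * ?\<Delta>)"
    proof -
      have "(\<lambda>w. ennreal ((B r w - B (?\<tau> k) w)\<^sup>2)) \<in> borel_measurable W"
        using r k rng by (intro measurable_compose[OF _ measurable_ennreal] borel_measurable_power borel_measurable_diff B_measurable) auto
      then show ?thesis using increment_power(1)[of "?\<tau> k" r] k rng by (simp add: nn_integral_add nn_integral_cmult emeasure_space_1)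
    qed
    also have "\<dots> \<le> ennreal (2 * C\<^sup>2) * ennreal ?\<Delta> + ennreal (2 * C\<^sup>2 * ?\<Delta>)"
      using k \<Delta>k by (intro add_right_mono mult_left_mono ennreal_leI) auto
    also have "\<dots> = ennreal (4 * C\<^sup>2 * ?\<Delta>)"
    proof -
      have nn: "0 \<le> 2 * C\<^sup>2" by simp
      have "ennreal (2 * C\<^sup>2) * ennreal ?\<Delta> + ennreal (2 * C\<^sup>2 * ?\<Delta>) = ennreal (2 * C\<^sup>2 * ?\<Delta> + 2 * C\<^sup>2 * ?\<Delta>)"
        by (simp only: ennreal_plus[OF mult_nonneg_nonneg[OF nn \<Delta>] mult_nonneg_nonneg[OF nn \<Delta>]] ennreal_mult'[OF nn])
      moreover have "2 * c * D + 2 * c * D = 4 * c * D" for c D :: real by simp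
      ultimately show ?thesis by (simp only:)
    qed
    finally show "(\<integral>\<^sup>+w. ennreal ((u1 r (Bc r w) - simple_process n ?\<tau> (slope u1 s t n) r w)\<^sup>2) \<partial>W) \<le> ennreal (4 * C\<^sup>2 * ?\<Delta>)" .
  qed
  also have "\<dots> \<le> ennreal (4 * C\<^sup>2 * ?\<Delta>) * ennreal 1" using st by (intro mult_left_mono ennreal_leI) auto
  finally show ?thesis by simp
qed

text \<open>Cancellation in \<open>ennreal\<close> is legitimate for finite terms only, hence the
  assumption on \<open>y\<close>.\<close>

lemma ennreal_absorb_half: "x + y \<le> z + ennreal (1/2) * y \<Longrightarrow> y < \<infinity> \<Longrightarrow> x + ennreal (1/2) * y \<le> z" for x y z :: ennreal
proof -
  assume 1: "x + y \<le> z + ennreal (1/2) * y" and y: "y < \<infinity>"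
  have h: "ennreal (1/2) + ennreal (1/2) = ennreal 1" by (subst ennreal_plus[symmetric]) simp_all
  have "y = ennreal (1/2) * y + ennreal (1/2) * y"
    by (simp only: h distrib_right[symmetric] ennreal_1 mult_1)
  then have "ennreal (1/2) * y + (x + ennreal (1/2) * y) \<le> ennreal (1/2) * y + z" using 1 by (simp add: ac_simps)
  moreover have "ennreal (1/2) * y < \<top>" using y ennreal_less_top[of "1/2"] unfolding ennreal_mult_less_top infinity_ennreal_def by blast
  ultimately show ?thesis by (auto simp add: ennreal_add_left_cancel_le)
qed

text \<open>Not the \<open>gap\<close> of the normalised sums, which lives in another context; this
  one plays the part of E|Y - Y'|^2.\<close>

definition gap where "gap u u' t = (\<integral>\<^sup>+w. ennreal ((u t (Bc t w) - u' t (Bc t w))\<^sup>2) \<partial>W)" for u u' :: "real \<Rightarrow> real \<Rightarrow> real"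

text \<open>The discrete counterpart of \<open>solution_difference\<close>, with sums for the
  integrals and one additional remainder for each solution. The condition on \<open>t - s\<close>
  lets half of the slope energy absorb the driver. Squaring sums produces the numbers: 8 times 61
  plus 4 is below 500, and 8 times 4 is 32.\<close>

lemma stability_grid:
  assumes a: "approx_sol g \<epsilon> \<phi> C d u u1 u2" and a': "approx_sol g \<epsilon>' \<phi> C' d' u' u1' u2'"
    and g: "lip L g" "g 0 = 0" and L: "0 \<le> L" and \<epsilon>: "0 \<le> \<epsilon>" "0 \<le> \<epsilon>'" and gm: "g \<in> borel_measurable borel"
    and st: "0 \<le> s" "s \<le> t" "t \<le> 1" "8 * L\<^sup>2 * (t - s) \<le> 1"
    and n: "0 < n" "(t - s) / real n \<le> d" "(t - s) / real n \<le> d'"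
  shows "gap u u' s + ennreal (1/4) * sq s t (\<lambda>r w. u1 r (Bc r w) - u1' r (Bc r w))
    \<le> 2 * gap u u' t + ennreal (500 * (C\<^sup>2 + C'\<^sup>2) / real n + 32 * (\<epsilon>\<^sup>2 + \<epsilon>'\<^sup>2))"
proof -
  let ?\<tau> = "grid s t n" and ?\<Delta> = "(t - s) / real n" and ?z = "slope u1 s t n" and ?z' = "slope u1' s t n"
  let ?R = "remainder g u u1 s t n" and ?R' = "remainder g u' u1' s t n"
  let ?P = "simple_process n ?\<tau> ?z" and ?P' = "simple_process n ?\<tau> ?z'"
  let ?v = "\<lambda>r w. u1 r (Bc r w)" and ?v' = "\<lambda>r w. u1' r (Bc r w)"
  note gr = grid[OF st(2) n(1)]
  note aj = approx_sol_jm[OF a g L \<epsilon>(1)] and aj' = approx_sol_jm[OF a' g L \<epsilon>(2)]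
  note S = slope_simple[OF a st(1-3) n(1,2) \<epsilon>(1) gm] and S' = slope_simple[OF a' st(1-3) n(1,3) \<epsilon>(2) gm]
  let ?\<zeta> = "\<lambda>k w. ?z k w - ?z' k w"
  have D: "simple_integrand W B s t n ?\<tau> ?\<zeta>" by (rule simple_integrand_diff[OF S S'])
  let ?\<eta> = "\<lambda>w. u s (Bc s w) - u' s (Bc s w)" and ?\<theta> = "\<lambda>w. u t (Bc t w) - u' t (Bc t w)"
  let ?G = "\<lambda>w. \<Sum>k<n. (g (?z k w) - g (?z' k w)) * ?\<Delta>"
  define A where "A = sq s t (simple_process n ?\<tau> ?\<zeta>)"
  have s1: "s \<le> 1" and t0: "0 \<le> t" using st by simp_all
  have \<eta>F: "?\<eta> \<in> borel_measurable (Fil s)" by (intro borel_measurable_diff aj(3) aj'(3) st s1)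
  have \<theta>W[measurable]: "?\<theta> \<in> borel_measurable W"
    by (rule measurable_Fil_W[OF _ t0]) (intro borel_measurable_diff aj(3) aj'(3) st t0)
  have \<eta>2: "integrable W (\<lambda>w. (?\<eta> w)\<^sup>2)"
  proof (rule bounded_square_integrable[OF measurable_Fil_W[OF \<eta>F st(1)]])
    fix w show "\<bar>?\<eta> w\<bar> \<le> C + C'" using aj(5)[OF st(1) s1, of w] aj'(5)[OF st(1) s1, of w] by linarith
  qed
  note [measurable] = remainder_measurable[OF a st(1-3) n(1,2) \<epsilon>(1) gm] remainder_measurable[OF a' st(1-3) n(1,3) \<epsilon>(2) gm]
  have zW: "?z k \<in> borel_measurable W" "?z' k \<in> borel_measurable W" if "k < n" for k
    using simple_integrandD(4)[OF S that] simple_integrandD(4)[OF S' that] gr(5)[of k] that st(1) by (auto intro!: measurable_Fil_W)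
  have GW[measurable]: "?G \<in> borel_measurable W"
    by (intro borel_measurable_sum borel_measurable_times borel_measurable_diff borel_measurable_const measurable_compose[OF zW(1) gm] measurable_compose[OF zW(2) gm]) auto
  \<comment> \<open>The energy identity comes from this: the left side splits orthogonally, the
    right side consists of the later difference, the driver and the two remainders.\<close>
  have ident: "?\<eta> w + simple_integral B n ?\<tau> ?\<zeta> w = ?\<theta> w + (?G w + (?R' w - ?R w))" for w
    unfolding remainder_def simple_integral_def left_diff_distrib sum_subtractf by simp
  have A_eq: "A = (\<integral>\<^sup>+w. ennreal (\<Sum>k<n. (?\<zeta> k w)\<^sup>2 * ?\<Delta>) \<partial>W)"
    unfolding A_def sq_def simple_process_nn_integral[OF D] by (simp add: gr(4))
  have \<Delta>0: "0 \<le> ?\<Delta>" using st n by simp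
  have G2: "(\<integral>\<^sup>+w. ennreal ((?G w)\<^sup>2) \<partial>W) \<le> ennreal (L\<^sup>2 * (t - s)) * A"
  proof -
    have "(\<integral>\<^sup>+w. ennreal ((?G w)\<^sup>2) \<partial>W) \<le> (\<integral>\<^sup>+w. ennreal (L\<^sup>2 * (t - s)) * ennreal (\<Sum>k<n. (?\<zeta> k w)\<^sup>2 * ?\<Delta>) \<partial>W)"
    proof (rule nn_integral_mono)
      fix w
      have "(?G w)\<^sup>2 \<le> real n * (\<Sum>k<n. ((g (?z k w) - g (?z' k w)) * ?\<Delta>)\<^sup>2)" by (rule sum_square_le)
      also have "\<dots> \<le> real n * (\<Sum>k<n. (L\<^sup>2 * ?\<Delta>) * ((?\<zeta> k w)\<^sup>2 * ?\<Delta>))"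
      proof (intro mult_left_mono sum_mono)
        fix k
        have "\<bar>g (?z k w) - g (?z' k w)\<bar> \<le> L * \<bar>?\<zeta> k w\<bar>" using g(1) unfolding lip_def by blast
        from power_mono[OF this abs_ge_zero, of 2]
        have "(g (?z k w) - g (?z' k w))\<^sup>2 \<le> L\<^sup>2 * (?\<zeta> k w)\<^sup>2" by (simp add: power_mult_distrib)
        then have "(g (?z k w) - g (?z' k w))\<^sup>2 * ?\<Delta>\<^sup>2 \<le> L\<^sup>2 * (?\<zeta> k w)\<^sup>2 * ?\<Delta>\<^sup>2" by (rule mult_right_mono) simp
        then show "((g (?z k w) - g (?z' k w)) * ?\<Delta>)\<^sup>2 \<le> (L\<^sup>2 * ?\<Delta>) * ((?\<zeta> k w)\<^sup>2 * ?\<Delta>)"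
          by (simp only: power_mult_distrib) (simp only: power2_eq_square mult_ac)
      qed simp
      also have "\<dots> = L\<^sup>2 * (real n * ?\<Delta>) * (\<Sum>k<n. (?\<zeta> k w)\<^sup>2 * ?\<Delta>)" by (simp only: sum_distrib_left[symmetric] mult_ac)
      also have "real n * ?\<Delta> = t - s" using n by simp
      finally have "ennreal ((?G w)\<^sup>2) \<le> ennreal (L\<^sup>2 * (t - s) * (\<Sum>k<n. (?\<zeta> k w)\<^sup>2 * ?\<Delta>))" by (rule ennreal_leI)
      also have "\<dots> = ennreal (L\<^sup>2 * (t - s)) * ennreal (\<Sum>k<n. (?\<zeta> k w)\<^sup>2 * ?\<Delta>)" using st by (intro ennreal_mult') simp
      finally show "ennreal ((?G w)\<^sup>2) \<le> ennreal (L\<^sup>2 * (t - s)) * ennreal (\<Sum>k<n. (?\<zeta> k w)\<^sup>2 * ?\<Delta>)" .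
    qed
    also have "\<dots> = ennreal (L\<^sup>2 * (t - s)) * A"
      unfolding A_eq by (intro nn_integral_cmult measurable_compose[OF _ measurable_ennreal] borel_measurable_sum borel_measurable_times
        borel_measurable_power borel_measurable_diff borel_measurable_const zW) auto
    finally show ?thesis .
  qed
  let ?r = "\<lambda>C \<epsilon>. 61 * C\<^sup>2 * (t - s) / real n + 4 * \<epsilon>\<^sup>2 :: real" and ?e = "\<lambda>C. 4 * C\<^sup>2 * (t - s) / real n :: real"
  have R2: "(\<integral>\<^sup>+w. ennreal ((?R' w - ?R w)\<^sup>2) \<partial>W) \<le> 2 * ennreal (?r C' \<epsilon>') + 2 * ennreal (?r C \<epsilon>)"
  proof -
    have "(\<integral>\<^sup>+w. ennreal ((?R' w - ?R w)\<^sup>2) \<partial>W) = (\<integral>\<^sup>+w. ennreal ((?R' w + - ?R w)\<^sup>2) \<partial>W)" by simp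
    also have "\<dots> \<le> 2 * (\<integral>\<^sup>+w. ennreal ((?R' w)\<^sup>2) \<partial>W) + 2 * (\<integral>\<^sup>+w. ennreal ((- ?R w)\<^sup>2) \<partial>W)"
      by (rule nn_square_add_le) measurable
    also have "\<dots> \<le> 2 * ennreal (?r C' \<epsilon>') + 2 * ennreal (?r C \<epsilon>)"
      unfolding power2_minus by (intro add_mono mult_left_mono remainder_square[OF a' st(1-3) n(1,3) \<epsilon>(2) gm] remainder_square[OF a st(1-3) n(1,2) \<epsilon>(1) gm]) simp_all
    finally show ?thesis .
  qed
  have "gap u u' s + A = (\<integral>\<^sup>+w. ennreal ((?\<theta> w + (?G w + (?R' w - ?R w)))\<^sup>2) \<partial>W)"
    unfolding gap_def A_def ident[symmetric] by (rule simple_ito_isometry[OF D st(1) \<eta>F \<eta>2, symmetric])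
  also have "\<dots> \<le> 2 * gap u u' t + 2 * (\<integral>\<^sup>+w. ennreal ((?G w + (?R' w - ?R w))\<^sup>2) \<partial>W)"
    unfolding gap_def by (rule nn_square_add_le) measurable
  also have "\<dots> \<le> 2 * gap u u' t + 2 * (2 * (\<integral>\<^sup>+w. ennreal ((?G w)\<^sup>2) \<partial>W) + 2 * (\<integral>\<^sup>+w. ennreal ((?R' w - ?R w)\<^sup>2) \<partial>W))"
    by (intro add_left_mono mult_left_mono nn_square_add_le) measurable
  also have "\<dots> \<le> 2 * gap u u' t + 2 * (2 * (ennreal (L\<^sup>2 * (t - s)) * A) + 2 * (2 * ennreal (?r C' \<epsilon>') + 2 * ennreal (?r C \<epsilon>)))"
    by (intro add_mono mult_left_mono order_refl G2 R2) simp_all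
  also have "\<dots> = (2 * gap u u' t + (8 * ennreal (?r C' \<epsilon>') + 8 * ennreal (?r C \<epsilon>))) + 4 * ennreal (L\<^sup>2 * (t - s)) * A"
    by (simp add: distrib_left ac_simps)
  also have "\<dots> \<le> (2 * gap u u' t + (8 * ennreal (?r C' \<epsilon>') + 8 * ennreal (?r C \<epsilon>))) + ennreal (1/2) * A"
  proof (intro add_left_mono mult_right_mono)
    have "4 * ennreal (L\<^sup>2 * (t - s)) = ennreal (4 * (L\<^sup>2 * (t - s)))" by (simp add: ennreal_mult')
    also have "\<dots> \<le> ennreal (1/2)" using st(4) by (intro ennreal_leI) simp
    finally show "4 * ennreal (L\<^sup>2 * (t - s)) \<le> ennreal (1/2)" .
  qed simp
  finally have le: "gap u u' s + A \<le> (2 * gap u u' t + (8 * ennreal (?r C' \<epsilon>') + 8 * ennreal (?r C \<epsilon>))) + ennreal (1/2) * A" .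
  have "A < \<infinity>" unfolding A_def sq_def simple_isometry[OF D st(1)] by simp
  note half = ennreal_absorb_half[OF le this]
  have e: "sq s t (\<lambda>r w. ?v r w - ?P r w) \<le> ennreal (?e C)" "sq s t (\<lambda>r w. ?v' r w - ?P' r w) \<le> ennreal (?e C')"
    by (rule slope_process_error[OF a g L \<epsilon>(1) gm st(1-3) n(1,2)] slope_process_error[OF a' g L \<epsilon>(2) gm st(1-3) n(1,3)])+
  have jP: "jm ?P" "jm ?P'" "jm (simple_process n ?\<tau> ?\<zeta>)"
    by (rule jm_simple_process[OF S st(1)] jm_simple_process[OF S' st(1)] jm_simple_process[OF D st(1)])+
  have P: "simple_process n ?\<tau> ?\<zeta> r w = ?P r w - ?P' r w" for r w
    by (simp add: simple_process_def left_diff_distrib sum_subtractf)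
  \<comment> \<open>Back from the grid to the slopes along the path. The step costs a factor 2 on
    the energy \<open>A\<close>, of which only one half is left; hence the weight 1/4 in the
    claim.\<close>
  have "sq s t (\<lambda>r w. ?v r w - ?v' r w) = sq s t (\<lambda>r w. ((?v r w - ?P r w) - (?v' r w - ?P' r w)) + simple_process n ?\<tau> ?\<zeta> r w)"
    by (simp add: P)
  also have "\<dots> \<le> 2 * sq s t (\<lambda>r w. (?v r w - ?P r w) - (?v' r w - ?P' r w)) + 2 * A"
    unfolding A_def by (intro sq_add jm_diff aj aj' jP st)
  also have "\<dots> \<le> 2 * (2 * sq s t (\<lambda>r w. ?v r w - ?P r w) + 2 * sq s t (\<lambda>r w. ?v' r w - ?P' r w)) + 2 * A"
    by (intro add_right_mono mult_left_mono sq_diff jm_diff aj aj' jP st) simp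
  also have "\<dots> \<le> 2 * (2 * ennreal (?e C) + 2 * ennreal (?e C')) + 2 * A"
    by (intro add_right_mono mult_left_mono add_mono e) simp_all
  also have "\<dots> = 4 * (ennreal (?e C) + ennreal (?e C')) + 2 * A" by (simp add: distrib_left ac_simps)
  finally have "ennreal (1/4) * sq s t (\<lambda>r w. ?v r w - ?v' r w) \<le> ennreal (1/4) * (4 * (ennreal (?e C) + ennreal (?e C')) + 2 * A)"
    by (rule mult_left_mono) simp
  also have "\<dots> = (ennreal (?e C) + ennreal (?e C')) + ennreal (1/2) * A"
  proof -
    have "ennreal (1/4) * 4 = 1" "ennreal (1/4) * 2 = ennreal (1/2)" by (simp_all flip: ennreal_numeral ennreal_mult')
    then show ?thesis by (simp only: distrib_left mult.assoc[symmetric] mult_1)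
  qed
  finally have "gap u u' s + ennreal (1/4) * sq s t (\<lambda>r w. ?v r w - ?v' r w) \<le> (gap u u' s + ennreal (1/2) * A) + (ennreal (?e C) + ennreal (?e C'))"
    by (simp add: add_left_mono add.assoc add.commute add.left_commute)
  also have "\<dots> \<le> (2 * gap u u' t + (8 * ennreal (?r C' \<epsilon>') + 8 * ennreal (?r C \<epsilon>))) + (ennreal (?e C) + ennreal (?e C'))"
    by (rule add_right_mono[OF half])
  also have "\<dots> = 2 * gap u u' t + ((8 * ennreal (?r C' \<epsilon>') + 8 * ennreal (?r C \<epsilon>)) + (ennreal (?e C) + ennreal (?e C')))"
    by (simp only: add.assoc)
  also have "(8 * ennreal (?r C' \<epsilon>') + 8 * ennreal (?r C \<epsilon>)) + (ennreal (?e C) + ennreal (?e C')) =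
    ennreal ((8 * ?r C' \<epsilon>' + 8 * ?r C \<epsilon>) + (?e C + ?e C'))"
  proof -
    have nn: "0 \<le> ?r C \<epsilon>" "0 \<le> ?e C" for C \<epsilon> using st by (auto intro!: add_nonneg_nonneg divide_nonneg_nonneg mult_nonneg_nonneg)
    show ?thesis by (simp only: ennreal_plus nn mult_nonneg_nonneg add_nonneg_nonneg ennreal_mult' zero_le_numeral ennreal_numeral)
  qed
  also have "\<dots> \<le> ennreal (500 * (C\<^sup>2 + C'\<^sup>2) / real n + 32 * (\<epsilon>\<^sup>2 + \<epsilon>'\<^sup>2))"
  proof (rule ennreal_leI)
    have c: "c * (t - s) / real n \<le> c / real n" if "0 \<le> c" for c
      using that st by (intro divide_right_mono mult_left_le) auto
    show "(8 * ?r C' \<epsilon>' + 8 * ?r C \<epsilon>) + (?e C + ?e C') \<le> 500 * (C\<^sup>2 + C'\<^sup>2) / real n + 32 * (\<epsilon>\<^sup>2 + \<epsilon>'\<^sup>2)"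
    proof -
      have arith: "(8 * (61 * p' + 4 * e') + 8 * (61 * p + 4 * e)) + (4 * p + 4 * p') \<le> 500 * (q + q') + 32 * (e + e')"
        if "p \<le> q" "p' \<le> q'" "0 \<le> q" "0 \<le> q'" for p p' q q' e e' :: real using that by simp
      have scale: "61 * x * (t - s) / real n = 61 * (x * (t - s) / real n)" "4 * x * (t - s) / real n = 4 * (x * (t - s) / real n)"
        "500 * (x + y) / real n = 500 * (x / real n + y / real n)" for x y
        by (simp_all add: add_divide_distrib mult.assoc)
      show ?thesis unfolding scale by (rule arith) (simp_all only: c zero_le_power2 divide_nonneg_nonneg of_nat_0_le_iff)
    qed
  qed
  finally show ?thesis by (simp add: add_left_mono)
qed

text \<open>The grid was only needed for the energy identity; refining it removes the discretisation error.\<close>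

lemma stability_step:
  assumes a: "approx_sol g \<epsilon> \<phi> C d u u1 u2" and a': "approx_sol g \<epsilon>' \<phi> C' d' u' u1' u2'"
    and g: "lip L g" "g 0 = 0" and L: "0 \<le> L" and \<epsilon>: "0 \<le> \<epsilon>" "0 \<le> \<epsilon>'" and gm: "g \<in> borel_measurable borel"
    and st: "0 \<le> s" "s \<le> t" "t \<le> 1" "8 * L\<^sup>2 * (t - s) \<le> 1"
  shows "gap u u' s + ennreal (1/4) * sq s t (\<lambda>r w. u1 r (Bc r w) - u1' r (Bc r w))
    \<le> 2 * gap u u' t + ennreal (32 * (\<epsilon>\<^sup>2 + \<epsilon>'\<^sup>2))"
proof (rule LIMSEQ_le_const)
  have "(\<lambda>n. 500 * (C\<^sup>2 + C'\<^sup>2) / real n + 32 * (\<epsilon>\<^sup>2 + \<epsilon>'\<^sup>2)) \<longlonglongrightarrow> 0 + 32 * (\<epsilon>\<^sup>2 + \<epsilon>'\<^sup>2)"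
    by (intro tendsto_add tendsto_const lim_const_over_n)
  then have "(\<lambda>n. ennreal (500 * (C\<^sup>2 + C'\<^sup>2) / real n + 32 * (\<epsilon>\<^sup>2 + \<epsilon>'\<^sup>2))) \<longlonglongrightarrow> ennreal (32 * (\<epsilon>\<^sup>2 + \<epsilon>'\<^sup>2))"
    by (intro tendsto_ennrealI) simp
  then show "(\<lambda>n. 2 * gap u u' t + ennreal (500 * (C\<^sup>2 + C'\<^sup>2) / real n + 32 * (\<epsilon>\<^sup>2 + \<epsilon>'\<^sup>2))) \<longlonglongrightarrow>
    2 * gap u u' t + ennreal (32 * (\<epsilon>\<^sup>2 + \<epsilon>'\<^sup>2))"
    by (rule tendsto_add[OF tendsto_const])
  obtain N where N: "(t - s) / d < real N" "(t - s) / d' < real N"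
    by (meson less_trans max_less_iff_conj reals_Archimedean2)
  have d: "0 < d" "0 < d'" using approx_solD(1)[OF a] approx_solD(1)[OF a'] .
  have "(t - s) / real n \<le> d" "(t - s) / real n \<le> d'" if "Suc N \<le> n" for n
  proof -
    have "(t - s) / d < real n" "(t - s) / d' < real n" "0 < real n" using N that by auto
    then show "(t - s) / real n \<le> d" "(t - s) / real n \<le> d'" using d by (simp_all add: field_simps)
  qed
  then show "\<exists>N. \<forall>n\<ge>N. gap u u' s + ennreal (1/4) * sq s t (\<lambda>r w. u1 r (Bc r w) - u1' r (Bc r w)) \<le>
    2 * gap u u' t + ennreal (500 * (C\<^sup>2 + C'\<^sup>2) / real n + 32 * (\<epsilon>\<^sup>2 + \<epsilon>'\<^sup>2))"
    by (intro exI[of _ "Suc N"] allI impI stability_grid[OF a a' g L \<epsilon> gm st]) auto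
qed

end

section \<open>Existence for the backward equation\<close>

text \<open>Geometric rates make the whole sequence, and not just a subsequence, converge almost
  everywhere; Fatou's lemma then transfers the rate to the limit.\<close>

lemma L2_limit:
  fixes f :: "nat \<Rightarrow> 'a \<Rightarrow> real"
  assumes f[measurable]: "\<And>m. f m \<in> borel_measurable M"
    and K: "\<And>m m'. (\<integral>\<^sup>+x. ennreal ((f m x - f m' x)\<^sup>2) \<partial>M) \<le> ennreal (K * ((1/4)^m + (1/4)^m'))" "0 \<le> K"
  shows "AE x in M. (\<lambda>m. f m x) \<longlonglongrightarrow> lim (\<lambda>m. f m x)"
    and "(\<integral>\<^sup>+x. ennreal ((lim (\<lambda>m. f m x) - f m x)\<^sup>2) \<partial>M) \<le> ennreal (2 * K * (1/4)^m)"
proof -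
  \<comment> \<open>The weight 2^m leaves the integrals summable, and by |y| \<le> 2^-m + 2^m y^2
    the weighted squares control the increments themselves.\<close>
  define D where "D m x = 2^m * (f m x - f (Suc m) x)\<^sup>2" for m x
  have D0: "0 \<le> D m x" for m x by (simp add: D_def)
  have [measurable]: "D m \<in> borel_measurable M" for m unfolding D_def[abs_def] by measurable
  have "(\<integral>\<^sup>+x. (\<Sum>m. ennreal (D m x)) \<partial>M) = (\<Sum>m. \<integral>\<^sup>+x. ennreal (D m x) \<partial>M)"
    by (rule nn_integral_suminf) measurable
  also have "\<dots> \<le> (\<Sum>m. ennreal (2 * K * (1/2)^m))"
  proof (intro suminf_le)
    fix m
    have "(\<integral>\<^sup>+x. ennreal (D m x) \<partial>M) = ennreal (2^m) * (\<integral>\<^sup>+x. ennreal ((f m x - f (Suc m) x)\<^sup>2) \<partial>M)"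
      unfolding D_def by (subst nn_integral_cmult[symmetric]) (auto intro!: nn_integral_cong simp: ennreal_mult')
    also have "\<dots> \<le> ennreal (2^m) * ennreal (K * ((1/4)^m + (1/4)^Suc m))" by (intro mult_left_mono K) simp
    also have "\<dots> = ennreal (2^m * (K * ((1/4)^m + (1/4)^Suc m)))" by (rule ennreal_mult'[symmetric]) simp
    also have "\<dots> \<le> ennreal (2 * K * (1/2)^m)"
    proof (rule ennreal_leI)
      have p: "2^m * (1/4)^m = (1/2::real)^m" by (simp flip: power_mult_distrib)
      have "2^m * (K * ((1/4)^m + (1/4)^Suc m)) = 5/4 * K * (2^m * (1/4)^m)" by (simp add: algebra_simps)
      also have "\<dots> \<le> 2 * K * (1/2)^m" unfolding p using K(2) by (intro mult_right_mono) auto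
      finally show "2^m * (K * ((1/4)^m + (1/4)^Suc m)) \<le> 2 * K * (1/2)^m" .
    qed
    finally show "(\<integral>\<^sup>+x. ennreal (D m x) \<partial>M) \<le> ennreal (2 * K * (1/2)^m)" .
  qed auto
  also have "\<dots> = ennreal (\<Sum>m. 2 * K * (1/2)^m)"
    using K(2) by (intro suminf_ennreal2) (auto intro!: summable_mult summable_geometric)
  finally have "(\<integral>\<^sup>+x. (\<Sum>m. ennreal (D m x)) \<partial>M) \<noteq> \<infinity>" by (auto simp: top_unique)
  then have "AE x in M. (\<Sum>m. ennreal (D m x)) \<noteq> \<infinity>" by (intro nn_integral_PInf_AE) auto
  then show conv: "AE x in M. (\<lambda>m. f m x) \<longlonglongrightarrow> lim (\<lambda>m. f m x)"
  proof eventually_elim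
    case (elim x)
    have "summable (\<lambda>m. D m x)" using elim D0 by (intro summable_suminf_not_top) auto
    then have s: "summable (\<lambda>m. (1/2)^m + D m x)" by (intro summable_add summable_geometric) auto
    have le: "\<bar>f m x - f (Suc m) x\<bar> \<le> (1/2)^m + D m x" for m
    proof -
      define y where "y = 2^m * \<bar>f m x - f (Suc m) x\<bar>"
      have "2 * y \<le> 1 + y\<^sup>2" using zero_le_power2[of "y - 1"] by (simp add: power2_diff)
      then have "y \<le> 1 + y\<^sup>2" using zero_le_power2[of y] by linarith
      then have "(1/2)^m * y \<le> (1/2)^m * (1 + y\<^sup>2)" by (rule mult_left_mono) simp
      moreover have "(1/2)^m * y = \<bar>f m x - f (Suc m) x\<bar>" by (simp add: y_def power_one_over)
      moreover have "(1/2)^m * (1 + y\<^sup>2) = (1/2)^m + D m x"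
        by (simp add: y_def D_def power_one_over distrib_left power_mult_distrib power2_eq_square)
      ultimately show ?thesis by simp
    qed
    have "summable (\<lambda>m. f m x - f (Suc m) x)"
      by (rule summable_comparison_test[OF _ s]) (use le in auto)
    then have "(\<lambda>n. \<Sum>m<n. f m x - f (Suc m) x) \<longlonglongrightarrow> (\<Sum>m. f m x - f (Suc m) x)" by (rule summable_LIMSEQ)
    then have "(\<lambda>n. f 0 x - f n x) \<longlonglongrightarrow> (\<Sum>m. f m x - f (Suc m) x)" by (simp only: sum_lessThan_telescope'[of "\<lambda>m. f m x"])
    then have "(\<lambda>n. f 0 x - (f 0 x - f n x)) \<longlonglongrightarrow> f 0 x - (\<Sum>m. f m x - f (Suc m) x)" by (intro tendsto_diff tendsto_const)
    then have "convergent (\<lambda>n. f n x)" by (auto intro: convergentI)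
    then show ?case by (simp add: convergent_LIMSEQ_iff)
  qed
  show "(\<integral>\<^sup>+x. ennreal ((lim (\<lambda>m. f m x) - f m x)\<^sup>2) \<partial>M) \<le> ennreal (2 * K * (1/4)^m)"
  proof -
    have "(\<integral>\<^sup>+x. ennreal ((lim (\<lambda>m. f m x) - f m x)\<^sup>2) \<partial>M) = (\<integral>\<^sup>+x. liminf (\<lambda>j. ennreal ((f j x - f m x)\<^sup>2)) \<partial>M)"
    proof (rule nn_integral_cong_AE)
      show "AE x in M. ennreal ((lim (\<lambda>m. f m x) - f m x)\<^sup>2) = liminf (\<lambda>j. ennreal ((f j x - f m x)\<^sup>2))"
        using conv
      proof eventually_elim
        case (elim x)
        have "(\<lambda>j. ennreal ((f j x - f m x)\<^sup>2)) \<longlonglongrightarrow> ennreal ((lim (\<lambda>m. f m x) - f m x)\<^sup>2)"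
          by (intro tendsto_ennrealI tendsto_power tendsto_diff elim tendsto_const)
        then show ?case by (rule lim_imp_Liminf[symmetric, rotated]) simp
      qed
    qed
    also have "\<dots> \<le> liminf (\<lambda>j. \<integral>\<^sup>+x. ennreal ((f j x - f m x)\<^sup>2) \<partial>M)" by (rule nn_integral_liminf) measurable
    also have "\<dots> \<le> limsup (\<lambda>j. \<integral>\<^sup>+x. ennreal ((f j x - f m x)\<^sup>2) \<partial>M)" by (rule Liminf_le_Limsup) simp
    also have "\<dots> \<le> ennreal (2 * K * (1/4)^m)"
    proof (rule Limsup_bounded, rule eventually_sequentiallyI[of m])
      fix j assume "m \<le> j"
      then have "(1/4::real)^j \<le> (1/4)^m" by (intro power_decreasing) auto
      then have "K * ((1/4)^j + (1/4)^m) \<le> K * (2 * (1/4)^m)" using K(2) by (intro mult_left_mono) auto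
      then have "ennreal (K * ((1/4)^j + (1/4)^m)) \<le> ennreal (2 * K * (1/4)^m)" by (intro ennreal_leI) simp
      then show "(\<integral>\<^sup>+x. ennreal ((f j x - f m x)\<^sup>2) \<partial>M) \<le> ennreal (2 * K * (1/4)^m)" by (rule order_trans[OF K(1)])
    qed
    finally show ?thesis .
  qed
qed

lemma (in brownian) sq_split:
  assumes "jm X" "0 \<le> s" "s \<le> t" "t \<le> 1"
  shows "sq s 1 X \<le> sq s t X + sq t 1 X"
proof -
  have t: "0 \<le> t" using assms by simp
  let ?f = "\<lambda>a b p. ennreal ((X (fst p) (snd p) * indicator {a..b} (fst p))\<^sup>2)"
  have m: "?f a b \<in> borel_measurable (L01 \<Otimes>\<^sub>M W)" for a b
    by (intro measurable_compose[OF _ measurable_ennreal] borel_measurable_power jm_indicator assms)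
  have "(\<integral>\<^sup>+p. ?f s 1 p \<partial>(L01 \<Otimes>\<^sub>M W)) \<le> (\<integral>\<^sup>+p. ?f s t p + ?f t 1 p \<partial>(L01 \<Otimes>\<^sub>M W))"
    by (intro nn_integral_mono) (auto simp: indicator_def)
  also have "\<dots> = (\<integral>\<^sup>+p. ?f s t p \<partial>(L01 \<Otimes>\<^sub>M W)) + (\<integral>\<^sup>+p. ?f t 1 p \<partial>(L01 \<Otimes>\<^sub>M W))" by (rule nn_integral_add[OF m m])
  finally show ?thesis
    unfolding sq_eq[OF assms(1,2) order_refl] sq_eq[OF assms(1,2,4)] sq_eq[OF assms(1) t order_refl] .
qed

lemma (in brownian) LINT_measurable:
  fixes g :: "real \<Rightarrow> real"
  assumes "jm Z" "g \<in> borel_measurable borel" "0 \<le> s"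
  shows "(\<lambda>w. LINT r:{s..1}|lborel. g (Z r w)) \<in> borel_measurable W"
proof -
  have "(\<lambda>p. indicator {s..1} (fst p) * g (Z (fst p) (snd p))) \<in> borel_measurable (L01 \<Otimes>\<^sub>M W)"
    using assms(1) unfolding jm_def case_prod_unfold
    by (intro borel_measurable_times measurable_compose[OF measurable_fst[of L01 W] indicator_L01(2)] measurable_compose[OF _ assms(2)])
  from measurable_compose[OF measurable_pair_swap'[of W L01] this]
  have "(\<lambda>(w, r). indicator {s..1} r * g (Z r w)) \<in> borel_measurable (W \<Otimes>\<^sub>M L01)" by (simp add: case_prod_unfold)
  from sigma_finite_measure.borel_measurable_lebesgue_integral[OF LW.M1.sigma_finite_measure_axioms this]
  show ?thesis using assms(3) by (simp add: LINT_L01)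
qed

text \<open>The accuracies (1/2)^m make squared errors of order (1/4)^m, the rate assumed in
  \<open>L2_limit\<close>.\<close>

locale bsde_approximation = brownian W B for W :: "'b measure" and B +
  fixes g \<phi> :: "real \<Rightarrow> real" and L :: real and C d :: "nat \<Rightarrow> real" and u u1 u2 :: "nat \<Rightarrow> real \<Rightarrow> real \<Rightarrow> real"
  assumes approx: "\<And>m. approx_sol g ((1/2)^m) \<phi> (C m) (d m) (u m) (u1 m) (u2 m)"
    and g: "lip L g" "g 0 = 0" and gm: "g \<in> borel_measurable borel" and L: "0 < L"
    and \<phi>m: "\<phi> \<in> borel_measurable borel"
begin

lemma L0: "0 \<le> L" using L by simp

lemma \<epsilon>0: "0 \<le> (1/2::real)^m" by simp

lemmas jm_v = approx_sol_jm[OF approx g L0 \<epsilon>0]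

lemma \<epsilon>2: "((1/2::real)^m)\<^sup>2 = (1/4)^m"
proof -
  have "((1/2::real)^m)\<^sup>2 = ((1/2)\<^sup>2)^m" by (simp only: power_mult[symmetric] mult.commute)
  then show ?thesis by (simp add: power2_eq_square)
qed

abbreviation "v m t w \<equiv> u m t (Bc t w)"
abbreviation "v1 m t w \<equiv> u1 m t (Bc t w)"

text \<open>The interval is covered by pieces short enough for \<open>stability_step\<close>; the constants solve \<open>D 0 = 2\<close>, \<open>D (k + 1) = 2 D k + 32\<close>.\<close>

lemma energy_bound:
  assumes "0 \<le> s" "s \<le> 1" "1 - real k * (1 / (8 * L\<^sup>2)) \<le> s"
  shows "gap (u m) (u m') s + ennreal (1/4) * sq s 1 (\<lambda>r w. v1 m r w - v1 m' r w) \<le> ennreal ((34 * 2^k - 32) * ((1/4)^m + (1/4)^m'))"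
  using assms
proof (induction k arbitrary: s)
  case 0
  then have s: "s = 1" by simp
  let ?\<rho> = "(1/4::real)^m + (1/4)^m'"
  have "gap (u m) (u m') 1 \<le> (\<integral>\<^sup>+w. ennreal (2 * ?\<rho>) \<partial>W)"
    unfolding gap_def
  proof (intro nn_integral_mono ennreal_leI)
    fix w
    let ?x = "Bc 1 w"
    have 1: "\<bar>u m 1 ?x - \<phi> ?x\<bar> \<le> (1/2)^m" "\<bar>u m' 1 ?x - \<phi> ?x\<bar> \<le> (1/2)^m'"
      using approx_solD(3)[OF approx] by blast+
    have "(u m 1 ?x - u m' 1 ?x)\<^sup>2 = ((u m 1 ?x - \<phi> ?x) + (\<phi> ?x - u m' 1 ?x))\<^sup>2" by simp
    also have "\<dots> \<le> 2 * (u m 1 ?x - \<phi> ?x)\<^sup>2 + 2 * (\<phi> ?x - u m' 1 ?x)\<^sup>2" by (rule square_add_le)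
    also have "\<dots> \<le> 2 * (1/4)^m + 2 * (1/4)^m'"
      using power_mono[OF 1(1) abs_ge_zero, of 2] power_mono[OF 1(2) abs_ge_zero, of 2]
      by (simp add: \<epsilon>2 power2_commute[of "\<phi> _"])
    finally show "(u m 1 ?x - u m' 1 ?x)\<^sup>2 \<le> 2 * ?\<rho>" by simp
  qed
  also have "\<dots> = ennreal (2 * ?\<rho>)" by (simp add: emeasure_space_1)
  finally show ?case by (simp add: s sq_point)
next
  case (Suc k)
  let ?c = "1 / (8 * L\<^sup>2)" and ?\<rho> = "(1/4::real)^m + (1/4)^m'" and ?D = "\<lambda>r w. v1 m r w - v1 m' r w"
  \<comment> \<open>The start of the region covered by the induction hypothesis, at most one piece
    after \<open>s\<close>; if \<open>s\<close> lies there already, \<open>t = s\<close>.\<close>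
  define t where "t = max s (1 - real k * ?c)"
  have c: "0 \<le> ?c" by simp
  have "real (Suc k) * ?c = real k * ?c + ?c" by (simp add: add_divide_distrib)
  then have t: "s \<le> t" "t \<le> 1" "0 \<le> t" "1 - real k * ?c \<le> t" "t - s \<le> ?c"
    using Suc.prems c mult_nonneg_nonneg[of "real k" ?c] unfolding t_def max_def by auto
  have "8 * L\<^sup>2 * (t - s) \<le> 8 * L\<^sup>2 * ?c" by (rule mult_left_mono[OF t(5)]) simp
  then have small: "8 * L\<^sup>2 * (t - s) \<le> 1" using L by simp
  have jD: "jm ?D" by (rule jm_diff[OF jm_v(2) jm_v(2)])
  have "gap (u m) (u m') s + ennreal (1/4) * sq s 1 ?D \<le> gap (u m) (u m') s + ennreal (1/4) * (sq s t ?D + sq t 1 ?D)"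
    by (intro add_left_mono mult_left_mono sq_split jD Suc.prems t) simp
  also have "\<dots> = (gap (u m) (u m') s + ennreal (1/4) * sq s t ?D) + ennreal (1/4) * sq t 1 ?D" by (simp add: distrib_left add.assoc)
  also have "\<dots> \<le> (2 * gap (u m) (u m') t + ennreal (32 * ?\<rho>)) + ennreal (1/4) * sq t 1 ?D"
    using stability_step[OF approx approx g L0 \<epsilon>0 \<epsilon>0 gm Suc.prems(1) t(1,2) small, of m m'] by (intro add_right_mono) (simp add: \<epsilon>2)
  also have "\<dots> \<le> (2 * gap (u m) (u m') t + ennreal (32 * ?\<rho>)) + 2 * (ennreal (1/4) * sq t 1 ?D)"
    by (intro add_left_mono) (simp add: mult_2)
  also have "\<dots> = 2 * (gap (u m) (u m') t + ennreal (1/4) * sq t 1 ?D) + ennreal (32 * ?\<rho>)" by (simp only: distrib_left ac_simps)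
  also have "\<dots> \<le> 2 * ennreal ((34 * 2^k - 32) * ?\<rho>) + ennreal (32 * ?\<rho>)"
    by (intro add_right_mono mult_left_mono Suc.IH t) simp
  also have "\<dots> = ennreal (2 * ((34 * 2^k - 32) * ?\<rho>) + 32 * ?\<rho>)"
  proof -
    have "1 \<le> (2::real)^k" by simp
    then have "0 \<le> 34 * 2^k - (32::real)" by linarith
    then have nn: "0 \<le> (34 * 2^k - 32) * ?\<rho>" by (rule mult_nonneg_nonneg) simp
    show ?thesis by (simp only: ennreal_plus nn mult_nonneg_nonneg ennreal_mult' zero_le_numeral ennreal_numeral add_nonneg_nonneg zero_le_power zero_le_divide_1_iff)
  qed
  also have "2 * ((34 * 2^k - 32) * ?\<rho>) + 32 * ?\<rho> = (34 * 2^Suc k - 32) * ?\<rho>"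
  proof -
    have "2 * ((34 * x - 32) * r) + 32 * r = (34 * (2 * x) - 32) * r" for x r :: real by (simp add: algebra_simps)
    then show ?thesis by (simp only: power_Suc)
  qed
  finally show ?case .
qed

text \<open>More than 8 L^2 pieces reach back to time 0. The factor 4 removes the weight 1/4 of the
  slope energy.\<close>

lemma cauchy_bound:
  obtains K where "0 \<le> K" "\<And>m m' t. 0 \<le> t \<Longrightarrow> t \<le> 1 \<Longrightarrow> gap (u m) (u m') t \<le> ennreal (K * ((1/4)^m + (1/4)^m'))"
    "\<And>m m'. sq 0 1 (\<lambda>r w. v1 m r w - v1 m' r w) \<le> ennreal (K * ((1/4)^m + (1/4)^m'))"
proof -
  obtain k where k: "8 * L\<^sup>2 < real k" using reals_Archimedean2 by blast
  then have k': "1 - real k * (1 / (8 * L\<^sup>2)) \<le> t" if "0 \<le> t" for t using L that by (simp add: field_simps) (smt (verit) mult_nonneg_nonneg zero_le_power2)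
  define E where "E = 34 * 2^k - (32::real)"
  have "1 \<le> (2::real)^k" by simp
  then have E: "0 \<le> E" unfolding E_def by linarith
  note b = energy_bound[OF _ _ k', folded E_def]
  show ?thesis
  proof (rule that[of "4 * E"])
    fix m m' and t :: real assume t: "0 \<le> t" "t \<le> 1"
    have "gap (u m) (u m') t \<le> ennreal (E * ((1/4)^m + (1/4)^m'))"
      by (rule order_trans[OF _ b[OF t t(1)]]) simp
    also have "\<dots> \<le> ennreal (4 * E * ((1/4)^m + (1/4)^m'))" using E by (intro ennreal_leI mult_right_mono) auto
    finally show "gap (u m) (u m') t \<le> ennreal (4 * E * ((1/4)^m + (1/4)^m'))" .
  next
    fix m m'
    let ?D = "\<lambda>r w. v1 m r w - v1 m' r w"
    have "sq 0 1 ?D = 4 * (ennreal (1/4) * sq 0 1 ?D)"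
    proof -
      have "4 * ennreal (1/4) = 1" by (simp flip: ennreal_numeral ennreal_mult')
      then show ?thesis by (simp only: mult.assoc[symmetric] mult_1)
    qed
    also have "\<dots> \<le> 4 * ennreal (E * ((1/4)^m + (1/4)^m'))"
      by (intro mult_left_mono order_trans[OF _ b[of 0 m m']]) simp_all
    also have "\<dots> = ennreal (4 * E * ((1/4)^m + (1/4)^m'))" by (simp add: ennreal_mult' mult.assoc)
    finally show "sq 0 1 ?D \<le> ennreal (4 * E * ((1/4)^m + (1/4)^m'))" .
  qed (use E in simp)
qed

end

section \<open>The limit solves the backward equation\<close>

context bsde_approximation begin

text \<open>A pointwise \<open>lim\<close> keeps adaptedness at every time and joint measurability,
  also where the sequence fails to converge. Of \<open>Z\<close> only the mean-square distance to
  the slopes is used afterwards.\<close>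

definition "Y t w = lim (\<lambda>m. v m t w)"
definition "Z t w = lim (\<lambda>m. v1 m t w)"

lemma sq01: "jm X \<Longrightarrow> sq 0 1 X = (\<integral>\<^sup>+p. ennreal ((X (fst p) (snd p))\<^sup>2) \<partial>(L01 \<Otimes>\<^sub>M W))"
  by (subst sq_eq) (auto intro!: nn_integral_cong simp: space_pair_measure)

lemma limit_facts:
  shows Y_Fil: "\<And>t. 0 \<le> t \<Longrightarrow> t \<le> 1 \<Longrightarrow> Y t \<in> borel_measurable (Fil t)"
    and Z_Fil: "\<And>t. 0 \<le> t \<Longrightarrow> t \<le> 1 \<Longrightarrow> Z t \<in> borel_measurable (Fil t)"
    and jm_Y: "jm Y" and jm_Z: "jm Z"
proof -
  show "Y t \<in> borel_measurable (Fil t)" "Z t \<in> borel_measurable (Fil t)" if "0 \<le> t" "t \<le> 1" for t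
    unfolding Y_def[abs_def] Z_def[abs_def] by (intro borel_measurable_lim_metric jm_v(3,4) that)+
  show "jm Y" "jm Z"
    unfolding jm_def Y_def Z_def case_prod_unfold
    by (rule borel_measurable_lim_metric, rule jm_v(1,2)[unfolded jm_def case_prod_unfold])+
qed

lemma limit_bounds:
  obtains K where "0 \<le> K"
    "\<And>m t. 0 \<le> t \<Longrightarrow> t \<le> 1 \<Longrightarrow> (\<integral>\<^sup>+w. ennreal ((Y t w - v m t w)\<^sup>2) \<partial>W) \<le> ennreal (K * (1/4)^m)"
    "\<And>m. sq 0 1 (\<lambda>t w. Z t w - v1 m t w) \<le> ennreal (K * (1/4)^m)"
    "\<And>t. 0 \<le> t \<Longrightarrow> t \<le> 1 \<Longrightarrow> AE w in W. (\<lambda>m. v m t w) \<longlonglongrightarrow> Y t w"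
proof -
  obtain K where K: "0 \<le> K" "\<And>m m' t. 0 \<le> t \<Longrightarrow> t \<le> 1 \<Longrightarrow> gap (u m) (u m') t \<le> ennreal (K * ((1/4)^m + (1/4)^m'))"
    "\<And>m m'. sq 0 1 (\<lambda>r w. v1 m r w - v1 m' r w) \<le> ennreal (K * ((1/4)^m + (1/4)^m'))"
    by (rule cauchy_bound) (rule that; assumption)
  have vW: "v m t \<in> borel_measurable W" if "0 \<le> t" "t \<le> 1" for m t by (rule measurable_Fil_W[OF jm_v(3)[OF that] that(1)])
  note lY = L2_limit[of "\<lambda>m. v m t" W K for t, OF vW K(2)[unfolded gap_def] K(1), folded Y_def]
  have mZ: "(\<lambda>p. v1 m (fst p) (snd p)) \<in> borel_measurable (L01 \<Otimes>\<^sub>M W)" for m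
    using jm_v(2) unfolding jm_def case_prod_unfold .
  have "sq 0 1 (\<lambda>t w. Z t w - v1 m t w) \<le> ennreal (2 * K * (1/4)^m)" for m
    unfolding sq01[OF jm_diff[OF jm_Z jm_v(2)]] unfolding Z_def
    by (rule L2_limit(2)[OF mZ K(3)[unfolded sq01[OF jm_diff[OF jm_v(2) jm_v(2)]]] K(1)])
  then show ?thesis using K(1) lY by (intro that[of "2 * K"]) auto
qed

lemma sq_bounded:
  assumes "jm X" "\<And>t w. 0 < t \<Longrightarrow> t \<le> 1 \<Longrightarrow> \<bar>X t w\<bar> \<le> c"
  shows "sq 0 1 X < \<infinity>"
proof -
  have "sq 0 1 X \<le> ennreal (c\<^sup>2) * ennreal (1 - 0)"
  proof (rule sq_le[OF assms(1)])
    fix r :: real assume r: "0 < r" "r \<le> 1"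
    have "(\<integral>\<^sup>+w. ennreal ((X r w)\<^sup>2) \<partial>W) \<le> (\<integral>\<^sup>+w. ennreal (c\<^sup>2) \<partial>W)"
      using power_mono[OF assms(2)[OF r] abs_ge_zero, of _ 2] by (intro nn_integral_mono ennreal_leI) simp
    then show "(\<integral>\<^sup>+w. ennreal ((X r w)\<^sup>2) \<partial>W) \<le> ennreal (c\<^sup>2)" by (simp add: emeasure_space_1)
  qed simp_all
  also have "\<dots> < \<infinity>" by simp
  finally show ?thesis .
qed

lemma sq_perturbation:
  assumes "jm X" "jm X'" "sq 0 1 X' < \<infinity>" "sq 0 1 (\<lambda>t w. X t w - X' t w) < \<infinity>"
  shows "sq 0 1 X < \<infinity>"
proof -
  have "sq 0 1 X = sq 0 1 (\<lambda>t w. (X t w - X' t w) + X' t w)" by simp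
  also have "\<dots> \<le> 2 * sq 0 1 (\<lambda>t w. X t w - X' t w) + 2 * sq 0 1 X'" by (intro sq_add jm_diff assms) simp_all
  also have "\<dots> < \<infinity>" using assms(3,4) by (simp add: ennreal_mult_less_top)
  finally show ?thesis .
qed

lemma limit_square_integrable: "adapted_square_integrable W B Y" "adapted_square_integrable W B Z"
proof -
  obtain K where K: "0 \<le> K" "\<And>m t. 0 \<le> t \<Longrightarrow> t \<le> 1 \<Longrightarrow> (\<integral>\<^sup>+w. ennreal ((Y t w - v m t w)\<^sup>2) \<partial>W) \<le> ennreal (K * (1/4)^m)"
    "\<And>m. sq 0 1 (\<lambda>t w. Z t w - v1 m t w) \<le> ennreal (K * (1/4)^m)"
    by (rule limit_bounds) (rule that; assumption)
  have "sq 0 1 (\<lambda>t w. Y t w - v 0 t w) \<le> ennreal (K * (1/4)^0) * ennreal (1 - 0)"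
    by (rule sq_le[OF jm_diff[OF jm_Y jm_v(1)]], simp, simp, simp, rule K(2), simp, simp)
  also have "\<dots> < \<infinity>" by (simp add: ennreal_mult_less_top)
  finally have dY: "sq 0 1 (\<lambda>t w. Y t w - v 0 t w) < \<infinity>" .
  have dZ: "sq 0 1 (\<lambda>t w. Z t w - v1 0 t w) < \<infinity>" by (rule le_less_trans[OF K(3)]) simp
  have "sq 0 1 (v 0) < \<infinity>" by (rule sq_bounded[OF jm_v(1), of _ "C 0"]) (rule jm_v(5), simp_all)
  from sq_perturbation[OF jm_Y jm_v(1) this dY] have "sq 0 1 Y < \<infinity>" .
  moreover have "sq 0 1 (v1 0) < \<infinity>" by (rule sq_bounded[OF jm_v(2), of _ "C 0"]) (rule jm_v(6), simp_all)
  from sq_perturbation[OF jm_Z jm_v(2) this dZ] have "sq 0 1 Z < \<infinity>" .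
  ultimately show "adapted_square_integrable W B Y" "adapted_square_integrable W B Z"
    using Y_Fil Z_Fil jm_Y jm_Z unfolding adapted_square_integrable_def jm_iff sq_def by auto
qed

text \<open>The equation itself dictates the candidate for the Ito integral. Its simple
  approximations are the slopes of the \<open>m\<close>-th approximate solution on a grid so fine
  that the discretisation error is of the order of the accuracy already lost.\<close>

lemma limit_equation:
  assumes t: "0 \<le> t" "t \<le> 1"
  shows "has_ito_integral W B Z t 1 (\<lambda>w. \<phi> (B 1 w) + (LINT r:{t..1}|lborel. g (Z r w)) - Y t w)"
proof -
  obtain K where K: "0 \<le> K" "\<And>m t. 0 \<le> t \<Longrightarrow> t \<le> 1 \<Longrightarrow> (\<integral>\<^sup>+w. ennreal ((Y t w - v m t w)\<^sup>2) \<partial>W) \<le> ennreal (K * (1/4)^m)"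
    "\<And>m. sq 0 1 (\<lambda>t w. Z t w - v1 m t w) \<le> ennreal (K * (1/4)^m)"
    by (rule limit_bounds) (rule that; assumption)
  \<comment> \<open>A diagonal choice: the mesh is admissible for the \<open>m\<close>-th solution,
    and the constant \<open>C m\<close>, however large, is outweighed so that the remainder stays of
    order (1/4)^m.\<close>
  define n where "n m = Suc (nat \<lceil>max ((1 - t) / d m) (61 * (C m)\<^sup>2 * 4^m)\<rceil>)" for m
  have n: "0 < n m" "(1 - t) / d m \<le> real (n m)" "61 * (C m)\<^sup>2 * 4^m \<le> real (n m)" for m
    unfolding n_def by (simp, linarith, linarith)
  have nd: "(1 - t) / real (n m) \<le> d m" for m
    using n(2)[of m] n(1)[of m] approx_solD(1)[OF approx, of m] by (simp add: field_simps)
  have small: "61 * (C m)\<^sup>2 * (1 - t) / real (n m) \<le> (1/4)^m" for m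
  proof -
    have "61 * (C m)\<^sup>2 * (1 - t) \<le> 61 * (C m)\<^sup>2" using t by (intro mult_left_le) auto
    also have "\<dots> = 61 * (C m)\<^sup>2 * 4^m * (1/4)^m" by (simp add: power_one_over)
    also have "\<dots> \<le> real (n m) * (1/4)^m" using n(3) by (rule mult_right_mono) simp
    finally show ?thesis using n(1)[of m] by (simp add: divide_le_eq mult.commute)
  qed
  note am = approx g L0 \<epsilon>0
  define \<tau> where "\<tau> m = grid t 1 (n m)" for m
  define \<xi> where "\<xi> m = slope (u1 m) t 1 (n m)" for m
  have S: "simple_integrand W B t 1 (n m) (\<tau> m) (\<xi> m)" for m
    unfolding \<tau>_def \<xi>_def by (rule slope_simple[OF approx t order_refl n(1) nd \<epsilon>0 gm])
  let ?P = "\<lambda>m. simple_process (n m) (\<tau> m) (\<xi> m)" and ?S = "\<lambda>m. simple_integral B (n m) (\<tau> m) (\<xi> m)"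
  let ?I = "\<lambda>w. \<phi> (B 1 w) + (LINT r:{t..1}|lborel. g (Z r w)) - Y t w"
  have jP: "jm (?P m)" for m by (rule jm_simple_process[OF S t(1)])
  have IW: "?I \<in> borel_measurable W"
    by (intro borel_measurable_add borel_measurable_diff LINT_measurable jm_Z gm t measurable_Fil_W[OF Y_Fil[OF t]]
      measurable_compose[OF B_measurable \<phi>m]) simp
  have P: "sq t 1 (\<lambda>r w. Z r w - ?P m r w) \<le> ennreal ((2 * K + 2) * (1/4)^m)" for m
  proof -
    have e: "sq t 1 (\<lambda>r w. v1 m r w - ?P m r w) \<le> ennreal ((1/4)^m)"
    proof -
      have "sq t 1 (\<lambda>r w. v1 m r w - ?P m r w) \<le> ennreal (4 * (C m)\<^sup>2 * (1 - t) / real (n m))"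
        unfolding \<tau>_def \<xi>_def by (rule slope_process_error[OF am gm t order_refl n(1) nd])
      also have "\<dots> \<le> ennreal (61 * (C m)\<^sup>2 * (1 - t) / real (n m))"
        using t by (intro ennreal_leI divide_right_mono mult_right_mono) auto
      also have "\<dots> \<le> ennreal ((1/4)^m)" by (rule ennreal_leI[OF small])
      finally show ?thesis .
    qed
    have "sq t 1 (\<lambda>r w. Z r w - ?P m r w) = sq t 1 (\<lambda>r w. (Z r w - v1 m r w) + (v1 m r w - ?P m r w))" by simp
    also have "\<dots> \<le> 2 * sq t 1 (\<lambda>r w. Z r w - v1 m r w) + 2 * sq t 1 (\<lambda>r w. v1 m r w - ?P m r w)"
      by (intro sq_add jm_diff jm_Z jm_v(2) jP t order_refl)
    also have "\<dots> \<le> 2 * ennreal (K * (1/4)^m) + 2 * ennreal ((1/4)^m)"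
      by (intro add_mono mult_left_mono e order_trans[OF sq_mono_interval K(3)] t order_refl) simp_all
    also have "\<dots> = ennreal ((2 * K + 2) * (1/4)^m)"
    proof -
      have nn: "0 \<le> K * (1/4)^m" "0 \<le> (1/4::real)^m" using K(1) by simp_all
      have "2 * ennreal (K * (1/4)^m) + 2 * ennreal ((1/4)^m) = ennreal (2 * (K * (1/4)^m) + 2 * (1/4)^m)"
        by (simp only: ennreal_plus nn mult_nonneg_nonneg ennreal_mult' zero_le_numeral ennreal_numeral)
      then show ?thesis by (simp add: algebra_simps)
    qed
    finally show ?thesis .
  qed
  have geo: "(\<lambda>m. ennreal (c * (1/4)^m)) \<longlonglongrightarrow> 0" for c
  proof -
    have "(\<lambda>m. c * (1/4::real)^m) \<longlonglongrightarrow> c * 0" by (intro tendsto_mult tendsto_const LIMSEQ_realpow_zero) auto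
    then show ?thesis using tendsto_ennrealI by fastforce
  qed
  let ?R = "\<lambda>m. remainder g (u m) (u1 m) t 1 (n m)"
  let ?G = "\<lambda>m w. LINT r:{t..1}|lborel. g (?P m r w)"
  have R: "(\<integral>\<^sup>+w. ennreal ((?R m w)\<^sup>2) \<partial>W) \<le> ennreal (5 * (1/4)^m)" for m
  proof -
    have "(\<integral>\<^sup>+w. ennreal ((?R m w)\<^sup>2) \<partial>W) \<le> ennreal (61 * (C m)\<^sup>2 * (1 - t) / real (n m) + 4 * ((1/2)^m)\<^sup>2)"
      by (rule remainder_square[OF approx t order_refl n(1) nd \<epsilon>0 gm])
    also have "\<dots> \<le> ennreal (5 * (1/4)^m)" using small[of m] by (intro ennreal_leI) (simp add: \<epsilon>2)
    finally show ?thesis .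
  qed
  have G: "(\<integral>\<^sup>+w. ennreal (((LINT r:{t..1}|lborel. g (Z r w)) - ?G m w)\<^sup>2) \<partial>W) \<le> ennreal (L\<^sup>2 * ((2 * K + 2) * (1/4)^m))" for m
  proof -
    obtain c where c: "\<And>k w. k < n m \<Longrightarrow> \<bar>\<xi> m k w\<bar> \<le> c"
    proof
      fix k w assume k: "k < n m"
      have r: "0 \<le> \<tau> m k" "0 \<le> \<tau> m (Suc k)" "\<tau> m (Suc k) \<le> 1"
        using grid(5)[OF t(2) n(1)[of m], of k] grid(5)[OF t(2) n(1)[of m], of "Suc k"] k t(1) unfolding \<tau>_def by auto
      show "\<bar>\<xi> m k w\<bar> \<le> C m"
        unfolding \<xi>_def slope_def \<tau>_def[symmetric]
        by (rule bounded_Fil(2)[OF smooth2_bfun(2)[OF approx_solD(2)[OF approx r(2,3)]] r(1) order_refl])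
    qed
    have fin: "sq 0 1 (?P m) < \<infinity>"
    proof (rule sq_bounded[OF jP])
      fix r :: real and w
      have "\<bar>?P m r w\<bar> \<le> (\<Sum>k<n m. \<bar>\<xi> m k w * indicator {\<tau> m k<..\<tau> m (Suc k)} r\<bar>)" unfolding simple_process_def by (rule sum_abs)
      also have "\<dots> \<le> (\<Sum>k<n m. \<bar>c\<bar>)"
      proof (rule sum_mono)
        fix k assume "k \<in> {..<n m}"
        then show "\<bar>\<xi> m k w * indicator {\<tau> m k<..\<tau> m (Suc k)} r\<bar> \<le> \<bar>c\<bar>" using c[of k w] by (auto simp: indicator_def)
      qed
      finally show "\<bar>?P m r w\<bar> \<le> (\<Sum>k<n m. \<bar>c\<bar>)" .
    qed
    have "sq 0 1 Z < \<infinity>" using asiD(3)[OF limit_square_integrable(2)] .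
    from driver_square[OF jm_Z this jP fin g(1) gm L0 t order_refl sq_point]
    have "(\<integral>\<^sup>+w. ennreal (((LINT r:{t..1}|lborel. g (Z r w)) - ?G m w)\<^sup>2) \<partial>W) \<le> ennreal (L\<^sup>2 * (1 - t)) * sq t 1 (\<lambda>r w. Z r w - ?P m r w)" .
    also have "\<dots> \<le> ennreal (L\<^sup>2) * ennreal ((2 * K + 2) * (1/4)^m)"
      using t by (intro mult_mono ennreal_leI P mult_left_le) auto
    also have "\<dots> = ennreal (L\<^sup>2 * ((2 * K + 2) * (1/4)^m))" by (rule ennreal_mult'[symmetric]) simp
    finally show ?thesis .
  qed
  have F: "(\<integral>\<^sup>+w. ennreal ((\<phi> (Bc 1 w) - v m 1 w)\<^sup>2) \<partial>W) \<le> ennreal ((1/4)^m)" for m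
  proof -
    have "(\<integral>\<^sup>+w. ennreal ((\<phi> (Bc 1 w) - v m 1 w)\<^sup>2) \<partial>W) \<le> (\<integral>\<^sup>+w. ennreal ((1/4)^m) \<partial>W)"
    proof (intro nn_integral_mono ennreal_leI)
      fix w
      show "(\<phi> (Bc 1 w) - v m 1 w)\<^sup>2 \<le> (1/4)^m"
        using power_mono[OF approx_solD(3)[OF approx] abs_ge_zero, of m "Bc 1 w" 2] by (simp add: \<epsilon>2 power2_commute)
    qed
    then show ?thesis by (simp add: emeasure_space_1)
  qed
  have bd: "(\<integral>\<^sup>+w. ennreal ((?I w - ?S m w)\<^sup>2) \<partial>W) \<le> ennreal (4 * (1 + L\<^sup>2 * (2 * K + 2) + K + 5) * (1/4)^m)" for m
  proof -
    let ?a = "\<lambda>w. \<phi> (Bc 1 w) - v m 1 w" and ?b = "\<lambda>w. (LINT r:{t..1}|lborel. g (Z r w)) - ?G m w" and ?c = "\<lambda>w. Y t w - v m t w"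
    have m1: "?a \<in> borel_measurable W"
      using measurable_Fil_W[OF Bc_Fil[of 1 1]] measurable_Fil_W[OF jm_v(3)[of 1 m]]
      by (intro borel_measurable_diff measurable_compose[OF _ \<phi>m]) auto
    have m2: "?b \<in> borel_measurable W" by (intro borel_measurable_diff LINT_measurable jm_Z jP gm t)
    have m3: "(\<lambda>w. - ?c w) \<in> borel_measurable W"
      by (intro borel_measurable_uminus borel_measurable_diff measurable_Fil_W[OF Y_Fil[OF t]] measurable_Fil_W[OF jm_v(3)[OF t]] t)
    have m4: "?R m \<in> borel_measurable W" by (rule remainder_measurable[OF approx t order_refl n(1) nd \<epsilon>0 gm])
    \<comment> \<open>Four errors are separated: terminal value, driver, solution at
      \<open>t\<close>, and Ito remainder.\<close>
    have "(\<integral>\<^sup>+w. ennreal ((?I w - ?S m w)\<^sup>2) \<partial>W) = (\<integral>\<^sup>+w. ennreal (((?a w + ?b w) + (- ?c w + ?R m w))\<^sup>2) \<partial>W)"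
    proof (rule nn_integral_cong_AE)
      show "AE w in W. ennreal ((?I w - ?S m w)\<^sup>2) = ennreal (((?a w + ?b w) + (- ?c w + ?R m w))\<^sup>2)"
        using Bc_eq
      proof eventually_elim
        case (elim w)
        note gr = grid[OF t(2) n(1)[of m]]
        have "?G m w = (LINT r:{t..1}|lborel. simple_process (n m) (\<tau> m) (\<lambda>k w. g (\<xi> m k w)) r w)"
          using simple_process_apply[of "n m" "\<tau> m" g "\<xi> m", OF _ g(2)] simple_integrandD(3)[OF S[of m]] by simp
        also have "\<dots> = (\<Sum>k<n m. g (\<xi> m k w) * (\<tau> m (Suc k) - \<tau> m k))"
          unfolding \<tau>_def by (rule LINT_simple_process[OF gr(3,1,2,5)])
        finally have G: "?G m w = (\<Sum>k<n m. g (\<xi> m k w) * ((1 - t) / real (n m)))" unfolding \<tau>_def gr(4) .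
        have "?S m w = v m 1 w - v m t w + ?G m w - ?R m w"
          unfolding G unfolding remainder_def \<tau>_def \<xi>_def by simp
        then have "?I w - ?S m w = (?a w + ?b w) + (- ?c w + ?R m w)" using elim by simp
        then show ?case by (simp only:)
      qed
    qed
    also have "\<dots> \<le> 2 * (\<integral>\<^sup>+w. ennreal ((?a w + ?b w)\<^sup>2) \<partial>W) + 2 * (\<integral>\<^sup>+w. ennreal ((- ?c w + ?R m w)\<^sup>2) \<partial>W)"
      by (intro nn_square_add_le borel_measurable_add m1 m2 m3 m4)
    also have "\<dots> \<le> 2 * (2 * (\<integral>\<^sup>+w. ennreal ((?a w)\<^sup>2) \<partial>W) + 2 * (\<integral>\<^sup>+w. ennreal ((?b w)\<^sup>2) \<partial>W)) +
      2 * (2 * (\<integral>\<^sup>+w. ennreal ((- ?c w)\<^sup>2) \<partial>W) + 2 * (\<integral>\<^sup>+w. ennreal ((?R m w)\<^sup>2) \<partial>W))"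
      by (intro add_mono mult_left_mono nn_square_add_le m1 m2 m3 m4) simp_all
    also have "\<dots> \<le> 2 * (2 * ennreal ((1/4)^m) + 2 * ennreal (L\<^sup>2 * ((2 * K + 2) * (1/4)^m))) + 2 * (2 * ennreal (K * (1/4)^m) + 2 * ennreal (5 * (1/4)^m))"
      unfolding power2_minus by (intro add_mono mult_left_mono F G K(2) R t) simp_all
    also have "\<dots> = ennreal (2 * (2 * (1/4)^m + 2 * (L\<^sup>2 * ((2 * K + 2) * (1/4)^m))) + 2 * (2 * (K * (1/4)^m) + 2 * (5 * (1/4)^m)))"
    proof -
      have nn: "0 \<le> (1/4::real)^m" "0 \<le> L\<^sup>2" "0 \<le> 2 * K + 2" using K(1) by simp_all
      show ?thesis by (simp only: ennreal_plus nn K(1) mult_nonneg_nonneg add_nonneg_nonneg ennreal_mult' zero_le_numeral ennreal_numeral)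
    qed
    also have "2 * (2 * (1/4)^m + 2 * (L\<^sup>2 * ((2 * K + 2) * (1/4)^m))) + 2 * (2 * (K * (1/4)^m) + 2 * (5 * (1/4)^m)) =
      4 * (1 + L\<^sup>2 * (2 * K + 2) + K + 5) * (1/4)^m"
    proof -
      have "2 * (2 * q + 2 * (l * ((2 * K + 2) * q))) + 2 * (2 * (K * q) + 2 * (5 * q)) = 4 * (1 + l * (2 * K + 2) + K + 5) * q" for l q :: real
        by (simp add: algebra_simps)
      then show ?thesis .
    qed
    finally show ?thesis .
  qed
  show ?thesis
  proof (rule has_itoI[OF IW S])
    show "(\<lambda>m. sq t 1 (\<lambda>r w. Z r w - ?P m r w)) \<longlonglongrightarrow> 0"
      by (rule tendsto_sandwich[OF _ _ tendsto_const geo]) (auto intro!: always_eventually P)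
    show "(\<lambda>m. \<integral>\<^sup>+w. ennreal ((?I w - ?S m w)\<^sup>2) \<partial>W) \<longlonglongrightarrow> 0"
      by (rule tendsto_sandwich[OF _ _ tendsto_const geo]) (auto intro!: always_eventually bd)
  qed
qed

lemma bsde_exists: "bsde_solution W B g (\<lambda>w. \<phi> (B 1 w)) Y Z"
  unfolding bsde_solution_def
proof (intro conjI ballI limit_square_integrable)
  fix t :: real assume "t \<in> {0..1}"
  then show "\<exists>I. has_ito_integral W B Z t 1 I \<and> (AE w in W. Y t w = \<phi> (B 1 w) + (LINT s:{t..1}|lborel. g (Z s w)) - I w)"
    by (intro exI[of _ "\<lambda>w. \<phi> (B 1 w) + (LINT r:{t..1}|lborel. g (Z r w)) - Y t w"] conjI limit_equation) auto
qed

text \<open>At time 0 the path sits at 0, so the approximating sequence is deterministic: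
  convergence at a single point of the space suffices, and the limit is a constant.\<close>

lemma initial_value:
  obtains y where "(\<lambda>m. u m 0 0) \<longlonglongrightarrow> y" "AE w in W. Y 0 w = y"
proof -
  obtain K where K: "AE w in W. (\<lambda>m. v m 0 w) \<longlonglongrightarrow> Y 0 w"
    by (rule limit_bounds) (rule that, auto)
  then have ae: "AE w in W. (\<lambda>m. u m 0 0) \<longlonglongrightarrow> Y 0 w"
    using AE_space by eventually_elim (simp add: Bc_0)
  have "\<exists>w. (\<lambda>m. u m 0 0) \<longlonglongrightarrow> Y 0 w"
  proof (rule ccontr)
    assume "\<not> ?thesis"
    then have "AE w in W. False" using ae by simp
    then show False by simp
  qed
  then obtain y where y: "(\<lambda>m. u m 0 0) \<longlonglongrightarrow> y" by blast
  moreover have "AE w in W. Y 0 w = y" using ae by eventually_elim (rule LIMSEQ_unique[OF _ y])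
  ultimately show ?thesis by (rule that)
qed

end

section \<open>The limit theorem\<close>

text \<open>The summand 1 keeps the constant positive, as \<open>bsde_unique\<close> and
  \<open>bsde_approximation\<close> require.\<close>

lemma lip_max_driver: "lip (1 + \<bar>\<mu>l\<bar> + \<bar>\<mu>u\<bar>) (\<lambda>z. max (\<mu>l * z) (\<mu>u * z))"
  unfolding lip_def
proof (intro allI)
  fix x y :: real
  have mx: "\<bar>max a b - max c d\<bar> \<le> \<bar>a - c\<bar> + \<bar>b - d\<bar>" for a b c d :: real by (auto simp: max_def)
  have "\<bar>max (\<mu>l * x) (\<mu>u * x) - max (\<mu>l * y) (\<mu>u * y)\<bar> \<le> \<bar>\<mu>l * x - \<mu>l * y\<bar> + \<bar>\<mu>u * x - \<mu>u * y\<bar>" by (rule mx)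
  also have "\<dots> = (\<bar>\<mu>l\<bar> + \<bar>\<mu>u\<bar>) * \<bar>x - y\<bar>" by (simp only: right_diff_distrib[symmetric] abs_mult distrib_right)
  also have "\<dots> \<le> (1 + \<bar>\<mu>l\<bar> + \<bar>\<mu>u\<bar>) * \<bar>x - y\<bar>" by (rule mult_right_mono) simp_all
  finally show "\<bar>max (\<mu>l * x) (\<mu>u * x) - max (\<mu>l * y) (\<mu>u * y)\<bar> \<le> (1 + \<bar>\<mu>l\<bar> + \<bar>\<mu>u\<bar>) * \<bar>x - y\<bar>" .
qed

lemma SUP_linear: "\<mu>l \<le> \<mu>u \<Longrightarrow> (SUP \<mu>\<in>{\<mu>l..\<mu>u}. \<mu> * z) = max (\<mu>l * z) (\<mu>u * z)" for z :: real
  by (intro cSup_eq_maximum) (cases "0 \<le> z"; auto simp: max_def mult_right_mono mult_right_mono_neg le_max_iff_disj)+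

text \<open>Written in the reflected form that \<open>bsde_solution_uminus\<close> produces.\<close>

lemma INF_linear: "\<mu>l \<le> \<mu>u \<Longrightarrow> (INF \<mu>\<in>{\<mu>l..\<mu>u}. \<mu> * z) = - max (\<mu>l * - z) (\<mu>u * - z)" for z :: real
proof -
  assume "\<mu>l \<le> \<mu>u"
  have "(INF \<mu>\<in>{\<mu>l..\<mu>u}. \<mu> * z) = - (SUP \<mu>\<in>{\<mu>l..\<mu>u}. \<mu> * - z)" by (simp add: Inf_real_def image_image)
  then show ?thesis using SUP_linear[OF \<open>\<mu>l \<le> \<mu>u\<close>, of "- z"] by simp
qed

lemma C_extended_uminus: "\<phi> \<in> C_extended \<Longrightarrow> (\<lambda>x. - \<phi> x) \<in> C_extended"
proof -
  assume \<phi>: "\<phi> \<in> C_extended"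
  then obtain l l' where l: "(\<phi> \<longlongrightarrow> l) at_top" "(\<phi> \<longlongrightarrow> l') at_bot" by (auto simp: C_extended_def)
  have "bounded (uminus ` range \<phi>)" using \<phi> by (simp add: C_extended_def bounded_uminus)
  then have "bounded (range (\<lambda>x. - \<phi> x))" by (simp add: image_image)
  moreover have "continuous_on UNIV (\<lambda>x. - \<phi> x)" using \<phi> by (intro continuous_on_minus) (simp add: C_extended_def)
  moreover have "((\<lambda>x. - \<phi> x) \<longlongrightarrow> - l) at_top" "((\<lambda>x. - \<phi> x) \<longlongrightarrow> - l') at_bot" using l by (auto intro: tendsto_minus)
  ultimately show ?thesis unfolding C_extended_def by blast
qed

section \<open>Reading off the value, and reflection of solutions\<close>

context brownian begin

text \<open>The definite description is resolved by existence and by uniqueness of the initial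
  value; on a probability space two constants that agree almost surely are equal.\<close>

lemma bsde_value_eq:
  assumes sol: "bsde_solution W B g \<xi> Y Z" "AE w in W. Y 0 w = y"
    and unique: "\<And>Y' Z'. bsde_solution W B g \<xi> Y' Z' \<Longrightarrow> AE w in W. Y 0 w = Y' 0 w"
  shows "bsde_value W B g \<xi> = y"
  unfolding bsde_value_def
proof (rule the_equality)
  show "\<exists>Y Z. bsde_solution W B g \<xi> Y Z \<and> (AE w in W. Y 0 w = y)" using sol by blast
  fix y' assume "\<exists>Y Z. bsde_solution W B g \<xi> Y Z \<and> (AE w in W. Y 0 w = y')"
  then obtain Y' Z' where s: "bsde_solution W B g \<xi> Y' Z'" "AE w in W. Y' 0 w = y'" by blast
  have "AE w in W. y' = y" using unique[OF s(1)] s(2) sol(2) by eventually_elim simp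
  then show "y' = y" by simp
qed

lemma has_ito_uminus:
  assumes I: "has_ito_integral W B Z a b I"
  shows "has_ito_integral W B (\<lambda>t w. - Z t w) a b (\<lambda>w. - I w)"
proof -
  obtain n :: "nat \<Rightarrow> nat" and \<tau> :: "nat \<Rightarrow> nat \<Rightarrow> real" and \<xi> :: "nat \<Rightarrow> nat \<Rightarrow> 'b \<Rightarrow> real" where 1: "I \<in> borel_measurable W"
    "\<And>m::nat. simple_integrand W B a b (n m) (\<tau> m) (\<xi> m)"
    "(\<lambda>m. sq a b (\<lambda>s w. Z s w - simple_process (n m) (\<tau> m) (\<xi> m) s w)) \<longlonglongrightarrow> 0"
    "(\<lambda>m. \<integral>\<^sup>+w. ennreal ((I w - simple_integral B (n m) (\<tau> m) (\<xi> m) w)\<^sup>2) \<partial>W) \<longlonglongrightarrow> 0"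
    by (rule has_itoD[OF I(1)]) (rule that; (assumption | erule meta_spec))
  show ?thesis
  proof (rule has_itoI)
    show "(\<lambda>w. - I w) \<in> borel_measurable W" using 1(1) by simp
    \<comment> \<open>Writing the negative as a difference from 0 makes
      \<open>simple_integrand_diff\<close> applicable.\<close>
    show "simple_integrand W B a b (n m) (\<tau> m) (\<lambda>k w. 0 - \<xi> m k w)" for m
    proof (rule simple_integrand_diff[OF _ 1(2)])
      show "simple_integrand W B a b (n m) (\<tau> m) (\<lambda>k w. 0)"
        using 1(2)[of m] by (auto simp: simple_integrand_def bounded_iff)
    qed
    have p: "simple_process (n m) (\<tau> m) (\<lambda>k w. 0 - \<xi> m k w) s w = - simple_process (n m) (\<tau> m) (\<xi> m) s w"
      "simple_integral B (n m) (\<tau> m) (\<lambda>k w. 0 - \<xi> m k w) w = - simple_integral B (n m) (\<tau> m) (\<xi> m) w" for m s w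
      unfolding simple_process_def simple_integral_def by (simp_all add: sum_negf)
    have e: "(- x - - y)\<^sup>2 = (x - y)\<^sup>2" for x y :: real by (simp add: power2_eq_square algebra_simps)
    show "(\<lambda>m. sq a b (\<lambda>s w. - Z s w - simple_process (n m) (\<tau> m) (\<lambda>k w. 0 - \<xi> m k w) s w)) \<longlonglongrightarrow> 0"
      using 1(3) unfolding p sq_def e .
    show "(\<lambda>m. \<integral>\<^sup>+w. ennreal ((- I w - simple_integral B (n m) (\<tau> m) (\<lambda>k w. 0 - \<xi> m k w) w)\<^sup>2) \<partial>W) \<longlonglongrightarrow> 0"
      using 1(4) unfolding p e .
  qed
qed

lemma adapted_square_integrable_uminus:
  assumes "adapted_square_integrable W B Z" shows "adapted_square_integrable W B (\<lambda>t w. - Z t w)"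
  using assms borel_measurable_uminus[of "\<lambda>(t, w). Z t w"]
  unfolding adapted_square_integrable_def power2_minus by (auto simp: case_prod_unfold)

lemma bsde_solution_uminus:
  assumes "bsde_solution W B g \<xi> Y Z"
  shows "bsde_solution W B (\<lambda>z. - g (- z)) (\<lambda>w. - \<xi> w) (\<lambda>t w. - Y t w) (\<lambda>t w. - Z t w)"
  unfolding bsde_solution_def
proof (intro conjI ballI)
  show "adapted_square_integrable W B (\<lambda>t w. - Y t w)" "adapted_square_integrable W B (\<lambda>t w. - Z t w)"
    using assms by (auto simp: bsde_solution_def intro: adapted_square_integrable_uminus)
  fix t :: real assume "t \<in> {0..1}"
  then obtain I where I: "has_ito_integral W B Z t 1 I" "AE w in W. Y t w = \<xi> w + (LINT s:{t..1}|lborel. g (Z s w)) - I w"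
    using assms unfolding bsde_solution_def by blast
  show "\<exists>I. has_ito_integral W B (\<lambda>t w. - Z t w) t 1 I \<and>
    (AE w in W. - Y t w = - \<xi> w + (LINT s:{t..1}|lborel. - g (- (- Z s w))) - I w)"
  proof (intro exI conjI, rule has_ito_uminus[OF I(1)])
    show "AE w in W. - Y t w = - \<xi> w + (LINT s:{t..1}|lborel. - g (- (- Z s w))) - - I w"
      using I(2) by eventually_elim (simp add: set_lebesgue_integral_def)
  qed
qed

end

text \<open>The limit is delivered with a solution attached instead of as
  \<open>upper_bsde_expectation\<close>, because it is also applied to \<open>- \<phi>\<close>,
  where the solution is reflected before its value is read off.\<close>

lemma upper_limit:
  assumes clt: "rectangular_clt S G \<P> K X \<mu>l \<mu>u \<sigma>" and brownian: "brownian W B" and \<phi>: "\<phi> \<in> C_extended"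
  defines "g \<equiv> \<lambda>z. max (\<mu>l * z) (\<mu>u * z)"
  shows "\<exists>y Y Z. bsde_solution W B g (\<lambda>w. \<phi> (B 1 w)) Y Z \<and> (AE w in W. Y 0 w = y) \<and>
    (\<lambda>n. SUP Q\<in>\<P>. \<integral>w. \<phi> (clt_statistic (filt S G) X \<sigma> Q n w) \<partial>Q) \<longlonglongrightarrow> y"
proof -
  interpret R: rectangular_clt S G \<P> K X \<mu>l \<mu>u \<sigma> by (rule clt)
  have "\<forall>m. \<exists>C d u u1 u2. approx_sol g ((1/2)^m) \<phi> C d u u1 u2"
    unfolding g_def by (intro allI approx_sol_exists[OF \<phi> lip_max_driver]) simp
  then obtain C d u u1 u2 where ap: "\<And>m. approx_sol g ((1/2)^m) \<phi> (C m) (d m) (u m) (u1 m) (u2 m)" by metis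
  obtain C\<phi> where C\<phi>: "bfun C\<phi> \<phi>" using C_extended_bfun[OF \<phi>] by blast
  interpret A: bsde_approximation W B g \<phi> "1 + \<bar>\<mu>l\<bar> + \<bar>\<mu>u\<bar>" C d u u1 u2
  proof (intro bsde_approximation.intro brownian bsde_approximation_axioms.intro ap)
    show "lip (1 + \<bar>\<mu>l\<bar> + \<bar>\<mu>u\<bar>) g" unfolding g_def by (rule lip_max_driver)
    show "\<phi> \<in> borel_measurable borel" using C\<phi> by (simp add: bfun_def)
  qed (simp_all add: g_def)
  obtain y where y: "(\<lambda>m. u m 0 0) \<longlonglongrightarrow> y" "AE w in W. A.Y 0 w = y" by (rule A.initial_value)
  let ?s = "\<lambda>n. SUP Q\<in>\<P>. \<integral>w. \<phi> (clt_statistic (filt S G) X \<sigma> Q n w) \<partial>Q"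
  have "?s \<longlonglongrightarrow> y"
  proof (rule tendstoI)
    fix e :: real assume e: "0 < e"
    have lim7: "(\<lambda>m. 7 * (1/2::real)^m) \<longlonglongrightarrow> 7 * 0" by (intro tendsto_mult tendsto_const LIMSEQ_realpow_zero) auto
    have "eventually (\<lambda>m. 7 * (1/2::real)^m < e / 2) sequentially" by (rule order_tendstoD(2)[OF lim7]) (use e in simp)
    moreover have "eventually (\<lambda>m. dist (u m 0 0) y < e / 2) sequentially" using y(1) e by (intro tendstoD) auto
    ultimately have "eventually (\<lambda>m. 7 * (1/2::real)^m < e / 2 \<and> dist (u m 0 0) y < e / 2) sequentially" by (rule eventually_conj)
    then obtain m where m: "7 * (1/2::real)^m < e / 2" "dist (u m 0 0) y < e / 2" by (auto simp: eventually_sequentially)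
    \<comment> \<open>The accuracy index \<open>m\<close> is fixed at this point, before
      \<open>n\<close> goes to infinity.\<close>
    have "eventually (\<lambda>n. \<bar>?s n - u m 0 0\<bar> \<le> 7 * (1/2)^m) sequentially"
      by (rule R.sup_near_approximate_solution[OF ap[unfolded g_def] _ C\<phi>]) simp
    then show "eventually (\<lambda>n. dist (?s n) y < e) sequentially"
    proof eventually_elim
      case (elim n)
      then show ?case using m unfolding dist_real_def by linarith
    qed
  qed
  then show ?thesis using A.bsde_exists y(2) by blast
qed

theorem theorem4p1:
  fixes S :: "nat \<Rightarrow> 'a set"
    and G :: "nat \<Rightarrow> (nat \<Rightarrow> 'a) measure"
    and \<P> :: "(nat \<Rightarrow> 'a) measure set"
    and K :: "(nat \<Rightarrow> 'a) measure \<Rightarrow> nat \<Rightarrow> (nat \<Rightarrow> 'a) \<Rightarrow> (nat \<Rightarrow> 'a) measure"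
    and X :: "nat \<Rightarrow> (nat \<Rightarrow> 'a) \<Rightarrow> real"
    and \<mu>l \<mu>u \<sigma> :: real
    and W :: "'b measure"
    and B :: "real \<Rightarrow> 'b \<Rightarrow> real"
  assumes space: "filtered_product_space S G"
    and family: "measure_family S G \<P> K"
    and rect: "rectangular S G \<P> K"
    and adapted: "\<And>i. i \<ge> 1 \<Longrightarrow> X i \<in> borel_measurable (filt S G i)"
    and in_H: "\<And>i. i \<ge> 1 \<Longrightarrow> X i \<in> class_H (filt_top S G) \<P>"
    and bounds: "\<mu>l \<le> \<mu>u" "\<sigma> > 0"
    and upper_mean: "\<And>i P. i \<ge> 1 \<Longrightarrow> P \<in> \<P> \<Longrightarrow>
      is_ess_sup (restr_to_subalg P (filt S G (i - 1))) \<P>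
        (\<lambda>Q \<omega>. ereal (real_cond_exp Q (filt S G (i - 1)) (X i) \<omega>)) (\<lambda>_. ereal \<mu>u)"
    and lower_mean: "\<And>i P. i \<ge> 1 \<Longrightarrow> P \<in> \<P> \<Longrightarrow>
      is_ess_inf (restr_to_subalg P (filt S G (i - 1))) \<P>
        (\<lambda>Q \<omega>. ereal (real_cond_exp Q (filt S G (i - 1)) (X i) \<omega>)) (\<lambda>_. ereal \<mu>l)"
    and cond_var: "\<And>i Q. i \<ge> 1 \<Longrightarrow> Q \<in> \<P> \<Longrightarrow>
      AE \<omega> in Q. real_cond_exp Q (filt S G (i - 1))
        (\<lambda>\<omega>'. (X i \<omega>' - real_cond_exp Q (filt S G (i - 1)) (X i) \<omega>')\<^sup>2) \<omega> = \<sigma>\<^sup>2"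
    and lindeberg: "\<And>\<epsilon>::real. \<epsilon> > 0 \<Longrightarrow>
      (\<lambda>n. (\<Sum>i=1..n. SUP Q\<in>\<P>. \<integral>\<^sup>+\<omega>\<in>{\<omega>. \<bar>X i \<omega>\<bar> > sqrt (real n) * \<epsilon>}. ennreal (\<bar>X i \<omega>\<bar>\<^sup>2) \<partial>Q)
        / of_nat n) \<longlonglongrightarrow> 0"
    and brownian: "brownian_motion W B"
  shows
    "(\<forall>\<phi>\<in>C_extended.
        (\<lambda>n. SUP Q\<in>\<P>. \<integral>\<omega>. \<phi> (clt_statistic (filt S G) X \<sigma> Q n \<omega>) \<partial>Q)
          \<longlonglongrightarrow> upper_bsde_expectation W B \<mu>l \<mu>u \<phi>) \<and>
     (\<forall>\<phi>\<in>C_extended.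
        (\<lambda>n. INF Q\<in>\<P>. \<integral>\<omega>. \<phi> (clt_statistic (filt S G) X \<sigma> Q n \<omega>) \<partial>Q)
          \<longlonglongrightarrow> lower_bsde_expectation W B \<mu>l \<mu>u \<phi>)"
proof -
  have clt: "rectangular_clt S G \<P> K X \<mu>l \<mu>u \<sigma>"
    by (intro rectangular_clt.intro rectangular_family.intro rectangular_clt_axioms.intro space family rect adapted in_H
      bounds upper_mean lower_mean cond_var lindeberg)
  have bW: "brownian W B" by (rule brownian.intro[OF brownian])
  interpret brownian W B by (rule bW)
  let ?g = "\<lambda>z. max (\<mu>l * z) (\<mu>u * z)" and ?L = "1 + \<bar>\<mu>l\<bar> + \<bar>\<mu>u\<bar>"
  have gm: "?g \<in> borel_measurable borel" and L: "0 < ?L" by simp_all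
  note unique = bsde_unique[OF _ _ lip_max_driver gm L]
  show ?thesis
  proof (intro conjI ballI)
    fix \<phi> assume \<phi>: "\<phi> \<in> C_extended"
    obtain y Y Z where 1: "bsde_solution W B ?g (\<lambda>w. \<phi> (B 1 w)) Y Z" "AE w in W. Y 0 w = y"
      "(\<lambda>n. SUP Q\<in>\<P>. \<integral>w. \<phi> (clt_statistic (filt S G) X \<sigma> Q n w) \<partial>Q) \<longlonglongrightarrow> y"
      using upper_limit[OF clt bW \<phi>] by (elim exE conjE)
    have "upper_bsde_expectation W B \<mu>l \<mu>u \<phi> = y"
      unfolding upper_bsde_expectation_def SUP_linear[OF bounds(1)] by (rule bsde_value_eq[OF 1(1,2)]) (rule unique[OF 1(1)])
    then show "(\<lambda>n. SUP Q\<in>\<P>. \<integral>w. \<phi> (clt_statistic (filt S G) X \<sigma> Q n w) \<partial>Q) \<longlonglongrightarrow> upper_bsde_expectation W B \<mu>l \<mu>u \<phi>"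
      using 1(3) by simp
    obtain y' Y' Z' where 2: "bsde_solution W B ?g (\<lambda>w. - \<phi> (B 1 w)) Y' Z'" "AE w in W. Y' 0 w = y'"
      "(\<lambda>n. SUP Q\<in>\<P>. \<integral>w. - \<phi> (clt_statistic (filt S G) X \<sigma> Q n w) \<partial>Q) \<longlonglongrightarrow> y'"
      using upper_limit[OF clt bW C_extended_uminus[OF \<phi>]] by (elim exE conjE)
    have "lower_bsde_expectation W B \<mu>l \<mu>u \<phi> = - y'"
      unfolding lower_bsde_expectation_def INF_linear[OF bounds(1)]
    proof (rule bsde_value_eq)
      show "bsde_solution W B (\<lambda>z. - ?g (- z)) (\<lambda>w. \<phi> (B 1 w)) (\<lambda>t w. - Y' t w) (\<lambda>t w. - Z' t w)"
        using bsde_solution_uminus[OF 2(1)] by simp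
      show "AE w in W. - Y' 0 w = - y'" using 2(2) by simp
      \<comment> \<open>Uniqueness for the reflected driver is uniqueness for the original one after
        a second reflection.\<close>
      fix Y2 Z2 assume "bsde_solution W B (\<lambda>z. - ?g (- z)) (\<lambda>w. \<phi> (B 1 w)) Y2 Z2"
      from bsde_solution_uminus[OF this] have "bsde_solution W B ?g (\<lambda>w. - \<phi> (B 1 w)) (\<lambda>t w. - Y2 t w) (\<lambda>t w. - Z2 t w)" by simp
      from unique[OF 2(1) this] show "AE w in W. - Y' 0 w = Y2 0 w" by eventually_elim simp
    qed
    moreover have "(INF Q\<in>\<P>. \<integral>w. \<phi> (clt_statistic (filt S G) X \<sigma> Q n w) \<partial>Q) =
      - (SUP Q\<in>\<P>. \<integral>w. - \<phi> (clt_statistic (filt S G) X \<sigma> Q n w) \<partial>Q)" for n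
      by (simp add: Inf_real_def image_image)
    ultimately show "(\<lambda>n. INF Q\<in>\<P>. \<integral>w. \<phi> (clt_statistic (filt S G) X \<sigma> Q n w) \<partial>Q) \<longlonglongrightarrow> lower_bsde_expectation W B \<mu>l \<mu>u \<phi>"
      using tendsto_minus[OF 2(3)] by (simp only:)
  qed
qed

end
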